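(* Let $d\ge2$ and let $p,q\in[1,\infty]$ satisfy $\frac1p+\frac1q<\frac2d$. There exists a constant $C=C(d,p,q)<\infty$ such that the following holds. Let $\mathbf a$ be a coefficient field on $\square_0=(-\frac12,\frac12)^d$ with $\mathbf a\in L^p(\square_0)$ and $\mathbf a^{-1}\in L^q(\square_0)$. Then every nonnegative weak solution $u\in H^1_{\mathbf a}(\square_0)$ of $-\nabla\cdot\mathbf a\nabla u=0$ in $\square_0$ satisfies $$\sup_{\frac18\square_0}u\;\le\;\exp\Bigl(C\,\|\mathbf a\|_{L^p(\square_0)}^{1/2}\,\|\mathbf a^{-1}\|_{L^q(\square_0)}^{1/2}\Bigr)\inf_{\frac18\square_0}u .$$
   Context: A coefficient field on $\square_0$ is a measurable map $\mathbf a$ from $\square_0$ to symmetric positive semi-definite $d\times d$ matrices, invertible a.e., with $\mathbf a,\mathbf a^{-1}\in L^1(\square_0)$. $L^p$ norms of matrix fields are those of the spectral norm. $H^1_{\mathbf a}(\square_0)$ is the completion of $C^\infty(\overline{\square_0})$ in the norm $(\|u\|_{L^2(\square_0)}^2+\int_{\square_0}\nabla u\cdot\mathbf a\nabla u)^{1/2}$. A weak solution is $u\in H^1_{\mathbf a}(\square_0)$ with $\int_{\square_0}\nabla\psi\cdot\mathbf a\nabla u=0$ for all $\psi\in C_c^\infty(\square_0)$. $\rho\square_0=(-\frac\rho2,\frac\rho2)^d$; $\sup,\inf$ are essential. *)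

theory Defs
  imports "HOL-Analysis.Analysis" "HOL-Probability.Essential_Supremum"
begin

definition cube :: "real \<Rightarrow> (real ^ 'n) set"
  where "cube \<rho> = box (\<chi> i. - \<rho> / 2) (\<chi> i. \<rho> / 2)"

abbreviation cube_measure :: "real \<Rightarrow> (real ^ 'n) measure"
  where "cube_measure \<rho> \<equiv> lebesgue_on (cube \<rho>)"

definition essinf :: "'a measure \<Rightarrow> ('a \<Rightarrow> ereal) \<Rightarrow> ereal"
  where "essinf M f = - esssup M (\<lambda>x. - f x)"

definition spectral_norm :: "real ^ 'n ^ 'm \<Rightarrow> real"
  where "spectral_norm A = onorm (\<lambda>v. A *v v)"

definition Lp_norm :: "ennreal \<Rightarrow> 'a measure \<Rightarrow> ('a \<Rightarrow> real) \<Rightarrow> ennreal"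
  where "Lp_norm p M f =
    (if p = \<infinity> then esssup M (\<lambda>x. ennreal \<bar>f x\<bar>)
     else let I = \<integral>\<^sup>+ x. ennreal (\<bar>f x\<bar> powr enn2real p) \<partial>M
          in if I = \<infinity> then \<infinity> else ennreal (enn2real I powr (1 / enn2real p)))"

definition matrix_Lp_norm :: "ennreal \<Rightarrow> 'a measure \<Rightarrow> ('a \<Rightarrow> real ^ 'n ^ 'm) \<Rightarrow> ennreal"
  where "matrix_Lp_norm p M A = Lp_norm p M (\<lambda>x. spectral_norm (A x))"

definition matrix_in_Lp :: "ennreal \<Rightarrow> 'a measure \<Rightarrow> ('a \<Rightarrow> real ^ 'n ^ 'm) \<Rightarrow> bool"
  where "matrix_in_Lp p M A \<longleftrightarrow> A \<in> borel_measurable M \<and> matrix_Lp_norm p M A < \<infinity>"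

definition coefficient_field :: "(real ^ 'n \<Rightarrow> real ^ 'n ^ 'n) \<Rightarrow> bool"
  where "coefficient_field a \<longleftrightarrow>
    a \<in> borel_measurable (cube_measure 1) \<and>
    (\<forall>x \<in> cube 1. transpose (a x) = a x \<and> (\<forall>v. 0 \<le> v \<bullet> (a x *v v))) \<and>
    (AE x in cube_measure 1. invertible (a x)) \<and>
    matrix_in_Lp 1 (cube_measure 1) a \<and>
    matrix_in_Lp 1 (cube_measure 1) (\<lambda>x. matrix_inv (a x))"

text \<open>
  For an open set \<open>S\<close>, \<open>Ck_closure k S f\<close> says that \<open>f\<close> is \<open>k\<close> times continuously
  differentiable in \<open>S\<close> and that all its derivatives of order at most \<open>k\<close> extend continuously
  to the closure of \<open>S\<close>. For \<open>S = UNIV\<close> this is the usual class of \<open>k\<close> times continuously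
  differentiable functions.
\<close>

fun Ck_closure :: "nat \<Rightarrow> 'a::euclidean_space set \<Rightarrow> ('a \<Rightarrow> real) \<Rightarrow> bool"
  where
    "Ck_closure 0 S f \<longleftrightarrow> (\<exists>g. continuous_on (closure S) g \<and> (\<forall>x \<in> S. g x = f x))"
  | "Ck_closure (Suc k) S f \<longleftrightarrow>
       (\<exists>g. continuous_on (closure S) g \<and> (\<forall>x \<in> S. g x = f x)) \<and>
       (\<forall>x \<in> S. f differentiable (at x)) \<and>
       (\<forall>v. Ck_closure k S (\<lambda>x. frechet_derivative f (at x) v))"

definition smooth_closure :: "'a::euclidean_space set \<Rightarrow> ('a \<Rightarrow> real) \<Rightarrow> bool"
  where "smooth_closure S f \<longleftrightarrow> (\<forall>k. Ck_closure k S f)"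

definition test_function :: "'a::euclidean_space set \<Rightarrow> ('a \<Rightarrow> real) \<Rightarrow> bool"
  where "test_function S \<psi> \<longleftrightarrow>
    smooth_closure UNIV \<psi> \<and> compact (closure {x. \<psi> x \<noteq> 0}) \<and> closure {x. \<psi> x \<noteq> 0} \<subseteq> S"

definition grad :: "(real ^ 'n \<Rightarrow> real) \<Rightarrow> real ^ 'n \<Rightarrow> real ^ 'n"
  where "grad f x = (\<chi> i. frechet_derivative f (at x) (axis i 1))"

text \<open>
  The square of the norm of \<open>H\<^sup>1\<^sub>a\<close>, for a pair of a function and a vector field playing the
  role of its gradient.
\<close>

definition H1a_norm_sq ::
    "(real ^ 'n \<Rightarrow> real ^ 'n ^ 'n) \<Rightarrow> (real ^ 'n \<Rightarrow> real) \<Rightarrow> (real ^ 'n \<Rightarrow> real ^ 'n) \<Rightarrow> ennreal"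
  where "H1a_norm_sq a w F =
    (\<integral>\<^sup>+ x. ennreal ((w x)\<^sup>2) \<partial>cube_measure 1) +
    (\<integral>\<^sup>+ x. ennreal (F x \<bullet> (a x *v F x)) \<partial>cube_measure 1)"

text \<open>
  The map sending a smooth function \<open>\<phi>\<close> to the pair \<open>(\<phi>, grad \<phi>)\<close> is an isometry from the smooth
  functions, with the norm of \<open>H\<^sup>1\<^sub>a\<close>, into the complete space of pairs \<open>(w, F)\<close> with
  \<open>H1a_norm_sq a w F < \<infinity>\<close>, modulo equality a.e. The completion is therefore the closure of its
  image: \<open>in_H1a a u G\<close> says that \<open>(u, G)\<close> lies in that closure, that is, that \<open>u\<close> belongs to
  \<open>H\<^sup>1\<^sub>a\<close> and has gradient \<open>G\<close>. As the inverse of \<open>a\<close> is integrable, convergence in the norm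
  implies convergence of the gradients in \<open>L\<^sup>1\<close>, so that \<open>G\<close> is determined a.e. by \<open>u\<close>.
\<close>

definition in_H1a ::
    "(real ^ 'n \<Rightarrow> real ^ 'n ^ 'n) \<Rightarrow> (real ^ 'n \<Rightarrow> real) \<Rightarrow> (real ^ 'n \<Rightarrow> real ^ 'n) \<Rightarrow> bool"
  where "in_H1a a u G \<longleftrightarrow>
    u \<in> borel_measurable (cube_measure 1) \<and> G \<in> borel_measurable (cube_measure 1) \<and>
    (\<exists>\<phi> :: nat \<Rightarrow> real ^ 'n \<Rightarrow> real.
      (\<forall>k. smooth_closure (cube 1) (\<phi> k)) \<and>
      (\<lambda>k. H1a_norm_sq a (\<lambda>x. \<phi> k x - u x) (\<lambda>x. grad (\<phi> k) x - G x)) \<longlonglongrightarrow> 0)"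

text \<open>
  The integrand below is integrable for every coefficient field: by Cauchy-Schwarz, it is
  dominated by the product of two square roots of integrable energy densities.
\<close>

definition weak_solution ::
    "(real ^ 'n \<Rightarrow> real ^ 'n ^ 'n) \<Rightarrow> (real ^ 'n \<Rightarrow> real) \<Rightarrow> bool"
  where "weak_solution a u \<longleftrightarrow>
    (\<exists>G. in_H1a a u G \<and>
      (\<forall>\<psi>. test_function (cube 1) \<psi> \<longrightarrow>
        (LINT x|cube_measure 1. grad \<psi> x \<bullet> (a x *v G x)) = 0))"

end

theory Submission
  imports Defs "HOL-Computational_Algebra.Polynomial"
begin

text \<open>
  Write \<open>\<Lambda>\<close> for the product of the two norms in the exponent. Moser's iteration for powers of \<open>u\<close>
  loses a power of \<open>\<Lambda>\<close>, which would destroy the square root. The remedy is that the Caccioppoli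
  inequality for \<open>u powr \<beta>\<close> carries the factor \<open>\<beta>\<^sup>2\<close> when it is used without differentiating the
  cutoff, that is, together with the Poincare-Sobolev inequality on a cube. The constant of a step is then
  \<open>1 + \<bar>\<beta>\<bar> * sqrt \<Lambda>\<close>, so for \<open>u powr (1 / sqrt \<Lambda>)\<close> the iteration does not see \<open>\<Lambda>\<close> any more. The logarithm
  of this function oscillates by a bounded amount in \<open>L\<^sup>1\<close>, by the Caccioppoli inequality for the
  logarithm, and the argument of Bombieri and Giusti combines both facts to a bound, from both sides,
  for \<open>ln u / sqrt \<Lambda>\<close> that does not depend on \<open>\<Lambda>\<close>.

  As the condition on the exponents is strict, a subcritical Poincare-Sobolev inequality suffices.
  It follows from averaging the fundamental theorem of calculus over segments.
\<close>

subsection \<open>Poincare-Sobolev inequality on convex sets\<close>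

text \<open>Two applications of Hoelder fix the exponents. Against \<open>a\<close>, it turns the
  right-hand side of Caccioppoli into an L^m norm with m = 2 p / (p - 1). Against the inverse of
  \<open>a\<close>, it puts the gradient in L^s with s = 2 q / (q + 1), and Poincare-Sobolev then
  reaches every r with d (1/s - 1/r) < 1. A gain r > m is available exactly when 1/p + 1/q < 2/d;
  the quotient r / m is the ratio of the iteration. A solution may vanish, so all estimates are made
  for u + \<delta>, with constants free of \<delta>, and \<delta> tends to 0 at the very end.
  Caccioppoli for the power \<beta> of u + \<delta> tests with the power 2 \<beta> - 1 and
  degenerates at \<beta> = 1/2. The exponents are therefore confined to a geometric sequence that
  misses this value by a fixed factor. A weak solution is a limit of smooth functions in the energy
  norm only, whereas test functions are smooth. Every nonlinear test function is thus approximated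
  by bounded smooth functions of the approximants, and the two limits are taken one after the
  other.\<close>

lemma nn_integral_Holder_bound:
  fixes f g :: "'a \<Rightarrow> real"
  assumes [measurable]: "f \<in> borel_measurable M" "g \<in> borel_measurable M"
    and f0: "\<And>x. 0 \<le> f x" and g0: "\<And>x. 0 \<le> g x"
    and p: "1 < p" and pq: "1 / p + 1 / q = 1"
    and a: "0 \<le> a" "(\<integral>\<^sup>+ x. ennreal (f x powr p) \<partial>M) \<le> ennreal a"
    and b: "0 \<le> b" "(\<integral>\<^sup>+ x. ennreal (g x powr q) \<partial>M) \<le> ennreal b"
  shows "(\<integral>\<^sup>+ x. ennreal (f x * g x) \<partial>M) \<le> ennreal (a powr (1 / p) * b powr (1 / q))"
proof -
  have q: "1 < q"
  proof -
    have "1 / q = 1 - 1 / p" using pq by simp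
    moreover have "0 < 1 - 1 / p" "1 - 1/p < 1" using p by (auto simp: field_simps)
    ultimately have "0 < 1 / q" "1 / q < 1" by auto
    then show ?thesis by (simp add: field_simps split: if_splits)
  qed
  have zero: "(\<integral>\<^sup>+ x. ennreal (f x * g x) \<partial>M) = 0"
    if "(\<integral>\<^sup>+ x. ennreal (f x powr p) \<partial>M) = 0 \<or> (\<integral>\<^sup>+ x. ennreal (g x powr q) \<partial>M) = 0"
    using that
  proof
    assume "(\<integral>\<^sup>+ x. ennreal (f x powr p) \<partial>M) = 0"
    then have "AE x in M. ennreal (f x powr p) = 0" by (subst (asm) nn_integral_0_iff_AE) auto
    then have "AE x in M. ennreal (f x * g x) = 0" by eventually_elim (auto simp: ennreal_eq_0_iff)
    then show ?thesis by (subst nn_integral_0_iff_AE) auto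
  next
    assume "(\<integral>\<^sup>+ x. ennreal (g x powr q) \<partial>M) = 0"
    then have "AE x in M. ennreal (g x powr q) = 0" by (subst (asm) nn_integral_0_iff_AE) auto
    then have "AE x in M. ennreal (f x * g x) = 0" by eventually_elim (auto simp: ennreal_eq_0_iff)
    then show ?thesis by (subst nn_integral_0_iff_AE) auto
  qed
  show ?thesis
  proof (cases "a = 0 \<or> b = 0")
    case True
    then show ?thesis using zero a b by auto
  next
    case False
    then have a0: "0 < a" and b0: "0 < b" using a b by auto
    \<comment> \<open>Young's inequality is applied after dividing by the bounds
      \<open>a powr (1 / p)\<close> and \<open>b powr (1 / q)\<close> rather than by the norms
      themselves; vanishing bounds have been split off for this reason.\<close>
    define c where "c = a powr (1 / p) * b powr (1 / q)"
    have c0: "0 < c" using a0 b0 by (simp add: c_def)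
    have pt: "f x * g x \<le> c / (a * p) * f x powr p + c / (b * q) * g x powr q" for x
    proof -
      have "(f x / a powr (1/p)) * (g x / b powr (1/q))
          \<le> (f x / a powr (1/p)) powr p / p + (g x / b powr (1/q)) powr q / q"
        by (rule Youngs_inequality) (use p q pq f0 g0 in auto)
      also have "\<dots> = f x powr p / (a * p) + g x powr q / (b * q)"
        using p q a0 b0 f0 g0 by (simp add: powr_divide powr_powr)
      finally have "c * ((f x / a powr (1/p)) * (g x / b powr (1/q))) \<le> c * (f x powr p / (a * p) + g x powr q / (b * q))"
        using c0 by (intro mult_left_mono) auto
      moreover have "c * ((f x / a powr (1/p)) * (g x / b powr (1/q))) = f x * g x"
        using a0 b0 by (simp add: c_def)
      ultimately show ?thesis by (simp add: distrib_left)
    qed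
    have "(\<integral>\<^sup>+ x. ennreal (f x * g x) \<partial>M) \<le>
        (\<integral>\<^sup>+ x. ennreal (c / (a * p)) * ennreal (f x powr p) + ennreal (c / (b * q)) * ennreal (g x powr q) \<partial>M)"
      using a0 b0 c0 p q pt
      by (intro nn_integral_mono) (auto simp: ennreal_mult[symmetric] ennreal_plus[symmetric] simp del: ennreal_plus intro!: ennreal_leI)
    also have "\<dots> = ennreal (c / (a * p)) * (\<integral>\<^sup>+ x. ennreal (f x powr p) \<partial>M) + ennreal (c / (b * q)) * (\<integral>\<^sup>+ x. ennreal (g x powr q) \<partial>M)"
      by (simp add: nn_integral_add nn_integral_cmult)
    also have "\<dots> \<le> ennreal (c / (a * p)) * ennreal a + ennreal (c / (b * q)) * ennreal b"
      by (intro add_mono mult_left_mono a b) auto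
    also have "\<dots> = ennreal (c / (a * p) * a + c / (b * q) * b)"
      using a0 b0 c0 p q by (simp add: ennreal_mult[symmetric] ennreal_plus[symmetric] del: ennreal_plus)
    also have "c / (a * p) * a + c / (b * q) * b = c * (1 / p + 1 / q)"
      using a0 b0 by (simp add: field_simps)
    also have "\<dots> = c" using pq by simp
    finally show ?thesis by (simp add: c_def)
  qed
qed

lemma nn_integral_affine_euclidean:
  fixes F :: "'a::euclidean_space \<Rightarrow> ennreal"
  assumes [measurable]: "F \<in> borel_measurable borel" and c: "c \<noteq> 0"
  shows "(\<integral>\<^sup>+ y. F (b + c *\<^sub>R y) \<partial>lborel) = ennreal (1 / \<bar>c\<bar> ^ DIM('a)) * (\<integral>\<^sup>+ y. F y \<partial>lborel)"
proof -
  have "(\<integral>\<^sup>+ y. F y \<partial>lborel) = (\<integral>\<^sup>+ y. ennreal (\<bar>c\<bar> ^ DIM('a)) * F (b + c *\<^sub>R y) \<partial>lborel)"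
    by (subst lborel_affine[OF c, of b]) (simp add: nn_integral_density nn_integral_distr)
  also have "\<dots> = ennreal (\<bar>c\<bar> ^ DIM('a)) * (\<integral>\<^sup>+ y. F (b + c *\<^sub>R y) \<partial>lborel)"
    by (simp add: nn_integral_cmult)
  finally show ?thesis
    using c by (simp add: mult.assoc[symmetric] ennreal_mult[symmetric] divide_simps)
qed

text \<open>The fundamental theorem of calculus along the segment, which convexity keeps inside
  \<open>Q\<close>. The line integral is written as an \<open>ennreal\<close> integral over the real
  line so that it can be interchanged with the average over \<open>y\<close>.\<close>

lemma segment_integral_bound:
  fixes w :: "'a::euclidean_space \<Rightarrow> real"
  assumes Q: "convex Q" "x \<in> Q" "y \<in> Q"
    and w: "\<And>z. z \<in> Q \<Longrightarrow> (w has_derivative D z) (at z)"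
    and D: "\<And>z v. z \<in> Q \<Longrightarrow> \<bar>D z v\<bar> \<le> g z * norm v"
    and g: "continuous_on Q g" "\<And>z. z \<in> Q \<Longrightarrow> 0 \<le> g z"
    and \<Delta>: "norm (y - x) \<le> \<Delta>"
  shows "ennreal \<bar>w x - w y\<bar> \<le> ennreal \<Delta> * (\<integral>\<^sup>+ t. ennreal (g ((1 - t) *\<^sub>R x + t *\<^sub>R y)) * indicator {0..1} t \<partial>lborel)"
proof -
  define \<gamma> where "\<gamma> t = (1 - t) *\<^sub>R x + t *\<^sub>R y" for t :: real
  have \<gamma>Q: "\<gamma> t \<in> Q" if "t \<in> {0..1}" for t
    unfolding \<gamma>_def using Q that by (intro convexD) auto
  have \<Delta>0: "0 \<le> \<Delta>" using \<Delta> norm_ge_zero order_trans by blast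
  have gam: "(\<gamma> has_vector_derivative (y - x)) (at t within {0..1})" for t
    unfolding \<gamma>_def by (auto intro!: derivative_eq_intros)
  have dw: "((\<lambda>t. w (\<gamma> t)) has_vector_derivative (D (\<gamma> t) (y - x))) (at t within {0..1})" if "t \<in> {0..1}" for t
  proof -
    have "((w \<circ> \<gamma>) has_derivative (D (\<gamma> t) \<circ> (\<lambda>h. h *\<^sub>R (y - x)))) (at t within {0..1})"
      using gam[of t] w[OF \<gamma>Q[OF that]] unfolding has_vector_derivative_def
      by (intro diff_chain_within) (auto intro: has_derivative_at_withinI)
    moreover have "linear (D (\<gamma> t))" using w[OF \<gamma>Q[OF that]] has_derivative_linear by blast
    ultimately show ?thesis
      unfolding has_vector_derivative_def o_def by (simp add: linear_cmul)
  qed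
  have I: "((\<lambda>t. D (\<gamma> t) (y - x)) has_integral (w (\<gamma> 1) - w (\<gamma> 0))) {0..1}"
    by (rule fundamental_theorem_of_calculus) (use dw in auto)
  have cg: "continuous_on {0..1} (\<lambda>t. g (\<gamma> t))"
    by (rule continuous_on_compose2[OF g(1)]) (use \<gamma>Q in \<open>auto simp: \<gamma>_def intro!: continuous_intros\<close>)
  then have gi: "(\<lambda>t. g (\<gamma> t)) integrable_on {0..1}" by (rule integrable_continuous_interval)
  have "norm (integral {0..1} (\<lambda>t. D (\<gamma> t) (y - x))) \<le> integral {0..1} (\<lambda>t. \<Delta> * g (\<gamma> t))"
  proof (rule integral_norm_bound_integral)
    show "(\<lambda>t. D (\<gamma> t) (y - x)) integrable_on {0..1}" using I by blast
    show "(\<lambda>t. \<Delta> * g (\<gamma> t)) integrable_on {0..1}" using gi by (rule integrable_on_cmult_left[where 'b=real, simplified])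
    fix t :: real assume t: "t \<in> {0..1}"
    have "\<bar>D (\<gamma> t) (y - x)\<bar> \<le> g (\<gamma> t) * norm (y - x)" by (rule D[OF \<gamma>Q[OF t]])
    also have "\<dots> \<le> g (\<gamma> t) * \<Delta>" using g(2)[OF \<gamma>Q[OF t]] \<Delta> by (intro mult_left_mono)
    finally show "norm (D (\<gamma> t) (y - x)) \<le> \<Delta> * g (\<gamma> t)" by (simp add: mult.commute)
  qed
  then have "\<bar>w x - w y\<bar> \<le> \<Delta> * integral {0..1} (\<lambda>t. g (\<gamma> t))"
    using integral_unique[OF I] by (simp add: \<gamma>_def)
  moreover have "(\<integral>\<^sup>+ t. ennreal (g (\<gamma> t)) * indicator {0..1} t \<partial>lborel) = ennreal (integral {0..1} (\<lambda>t. g (\<gamma> t)))"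
  proof -
    have "((\<lambda>t. indicat_real {0..1} t * g (\<gamma> t)) has_integral integral {0..1} (\<lambda>t. g (\<gamma> t))) UNIV"
    proof -
      have "(\<lambda>t. indicat_real {0..1} t * g (\<gamma> t)) = (\<lambda>t. if t \<in> {0..1} then g (\<gamma> t) else 0)" by auto
      then show ?thesis
        using integrable_integral[OF gi] by (simp add: has_integral_restrict_UNIV del: atLeastAtMost_iff)
    qed
    moreover have "(\<lambda>t. indicat_real {0..1} t * g (\<gamma> t)) \<in> borel_measurable borel"
      using borel_measurable_continuous_on_indicator[OF _ cg] by simp
    moreover have "0 \<le> indicat_real {0..1} t * g (\<gamma> t)" for t
      using g(2)[OF \<gamma>Q[of t]] by (simp add: indicator_def)
    ultimately have "(\<integral>\<^sup>+ t. ennreal (indicat_real {0..1} t * g (\<gamma> t)) \<partial>lborel) = ennreal (integral {0..1} (\<lambda>t. g (\<gamma> t)))"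
      by (intro nn_integral_has_integral_lborel) auto
    moreover have "ennreal (g (\<gamma> t)) * indicator {0..1} t = ennreal (indicat_real {0..1} t * g (\<gamma> t))" for t
      by (simp add: indicator_def)
    ultimately show ?thesis by presburger
  qed
  ultimately show ?thesis
    using \<Delta>0 by (simp add: \<gamma>_def ennreal_mult'[symmetric] ennreal_leI)
qed


lemma nn_integral_powr_01:
  fixes \<sigma> :: real
  assumes "\<sigma> < 1"
  shows "(\<integral>\<^sup>+ t. ennreal (t powr - \<sigma>) * indicator {0<..<1} t \<partial>lborel) = ennreal (1 / (1 - \<sigma>))"
proof -
  have "((\<lambda>t::real. t powr - \<sigma>) has_integral (1 powr (- \<sigma> + 1) / (- \<sigma> + 1))) {0..1}"
    by (rule has_integral_powr_from_0) (use assms in auto)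
  then have "((\<lambda>t::real. if t \<in> {0..1} then t powr - \<sigma> else 0) has_integral (1 / (1 - \<sigma>))) UNIV"
    by (simp add: has_integral_restrict_UNIV add.commute del: atLeastAtMost_iff)
  then have "(\<integral>\<^sup>+ t. ennreal (if t \<in> {0..1} then t powr - \<sigma> else 0) \<partial>lborel) = ennreal (1 / (1 - \<sigma>))"
    by (intro nn_integral_has_integral_lborel) auto
  moreover have "(\<integral>\<^sup>+ t. ennreal (t powr - \<sigma>) * indicator {0<..<1} t \<partial>lborel) =
      (\<integral>\<^sup>+ t. ennreal (if t \<in> {0..1} then t powr - \<sigma> else 0) \<partial>lborel)"
    by (rule nn_integral_cong_AE)
      (use AE_lborel_singleton[of "0::real"] AE_lborel_singleton[of "1::real"] in eventually_elim, auto)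
  ultimately show ?thesis by simp
qed

text \<open>The substitution in \<open>y\<close> has Jacobian \<open>t ^ d\<close>, which
  degenerates as \<open>t\<close> tends to 0. After a further integration in \<open>x\<close> one
  may choose the variable to substitute: \<open>y\<close> for t >= 1/2 and \<open>x\<close> for t <
  1/2. The Jacobian is then at least 2^(-d), so the second bound is uniform in
  \<open>t\<close>.\<close>

lemma interpolated_average_bound:
  fixes F :: "'a::euclidean_space \<Rightarrow> ennreal"
  assumes [measurable]: "F \<in> borel_measurable borel" "Q \<in> sets borel"
    and t: "0 < t" "t < 1"
  shows "(\<integral>\<^sup>+ y. F ((1 - t) *\<^sub>R x + t *\<^sub>R y) * indicator Q y \<partial>lborel)
      \<le> ennreal (t powr - DIM('a)) * (\<integral>\<^sup>+ z. F z \<partial>lborel)"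
    and "emeasure lborel Q \<le> 1 \<Longrightarrow>
      (\<integral>\<^sup>+ x. (\<integral>\<^sup>+ y. F ((1 - t) *\<^sub>R x + t *\<^sub>R y) * indicator Q y \<partial>lborel) * indicator Q x \<partial>lborel)
      \<le> 2 ^ DIM('a) * (\<integral>\<^sup>+ z. F z \<partial>lborel)"
proof -
  have A: "(\<integral>\<^sup>+ y. F (b + c *\<^sub>R y) * indicator Q y \<partial>lborel) \<le> ennreal (1 / \<bar>c\<bar> ^ DIM('a)) * (\<integral>\<^sup>+ z. F z \<partial>lborel)"
    if "c \<noteq> 0" for b c
  proof -
    have "(\<integral>\<^sup>+ y. F (b + c *\<^sub>R y) * indicator Q y \<partial>lborel) \<le> (\<integral>\<^sup>+ y. F (b + c *\<^sub>R y) \<partial>lborel)"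
      by (intro nn_integral_mono) (auto simp: indicator_def)
    then show ?thesis using nn_integral_affine_euclidean[OF assms(1) that] by simp
  qed
  show "(\<integral>\<^sup>+ y. F ((1 - t) *\<^sub>R x + t *\<^sub>R y) * indicator Q y \<partial>lborel)
      \<le> ennreal (t powr - DIM('a)) * (\<integral>\<^sup>+ z. F z \<partial>lborel)"
    using A[of t "(1 - t) *\<^sub>R x"] t by (simp add: powr_minus_divide powr_realpow)
  assume Q1: "emeasure lborel Q \<le> 1"
  have B: "(\<integral>\<^sup>+ x. (\<integral>\<^sup>+ y. F ((1 - t) *\<^sub>R x + t *\<^sub>R y) * indicator Q y \<partial>lborel) * indicator Q x \<partial>lborel)
      \<le> 2 ^ DIM('a) * (\<integral>\<^sup>+ z. F z \<partial>lborel)" if t: "1/2 \<le> t" for t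
  proof -
    have "1 / t ^ DIM('a) \<le> 2 ^ DIM('a)"
    proof -
      have "(1 / t) ^ DIM('a) \<le> 2 ^ DIM('a)" by (rule power_mono) (use t in \<open>auto simp: field_simps\<close>)
      then show ?thesis by (simp add: power_one_over)
    qed
    then have "ennreal (1 / \<bar>t\<bar> ^ DIM('a)) \<le> 2 ^ DIM('a)"
      using t by (metis abs_of_nonneg ennreal_leI ennreal_numeral ennreal_power order_trans zero_le_numeral divide_nonneg_nonneg zero_le_one)
    then have C: "(\<integral>\<^sup>+ y. F ((1 - t) *\<^sub>R x + t *\<^sub>R y) * indicator Q y \<partial>lborel) \<le> 2 ^ DIM('a) * (\<integral>\<^sup>+ z. F z \<partial>lborel)" for x
      using order_trans[OF A[of t "(1 - t) *\<^sub>R x"] mult_right_mono] t by simp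
    have "(\<integral>\<^sup>+ x. (\<integral>\<^sup>+ y. F ((1 - t) *\<^sub>R x + t *\<^sub>R y) * indicator Q y \<partial>lborel) * indicator Q x \<partial>lborel)
      \<le> (\<integral>\<^sup>+ x. 2 ^ DIM('a) * (\<integral>\<^sup>+ z. F z \<partial>lborel) * indicator Q x \<partial>lborel)"
      by (intro nn_integral_mono mult_right_mono C) auto
    also have "\<dots> = 2 ^ DIM('a) * (\<integral>\<^sup>+ z. F z \<partial>lborel) * emeasure lborel Q"
      by (subst nn_integral_cmult_indicator) auto
    also have "\<dots> \<le> 2 ^ DIM('a) * (\<integral>\<^sup>+ z. F z \<partial>lborel) * 1" by (intro mult_left_mono Q1) auto
    finally show ?thesis by simp
  qed
  show "(\<integral>\<^sup>+ x. (\<integral>\<^sup>+ y. F ((1 - t) *\<^sub>R x + t *\<^sub>R y) * indicator Q y \<partial>lborel) * indicator Q x \<partial>lborel)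
      \<le> 2 ^ DIM('a) * (\<integral>\<^sup>+ z. F z \<partial>lborel)"
  proof (cases "1/2 \<le> t")
    case True then show ?thesis by (rule B)
  next
    case False
    have "(\<integral>\<^sup>+ x. (\<integral>\<^sup>+ y. F ((1 - t) *\<^sub>R x + t *\<^sub>R y) * indicator Q y \<partial>lborel) * indicator Q x \<partial>lborel)
        = (\<integral>\<^sup>+ x. (\<integral>\<^sup>+ y. F ((1 - t) *\<^sub>R x + t *\<^sub>R y) * indicator Q y * indicator Q x \<partial>lborel) \<partial>lborel)"
      by (simp add: nn_integral_multc)
    also have "\<dots> = (\<integral>\<^sup>+ y. (\<integral>\<^sup>+ x. F ((1 - t) *\<^sub>R x + t *\<^sub>R y) * indicator Q y * indicator Q x \<partial>lborel) \<partial>lborel)"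
      by (rule lborel_pair.Fubini'[of "\<lambda>x y. F ((1 - t) *\<^sub>R x + t *\<^sub>R y) * indicator Q y * indicator Q x", symmetric]) measurable
    also have "\<dots> = (\<integral>\<^sup>+ y. (\<integral>\<^sup>+ x. F ((1 - (1 - t)) *\<^sub>R y + (1 - t) *\<^sub>R x) * indicator Q x \<partial>lborel) * indicator Q y \<partial>lborel)"
      by (subst nn_integral_multc[symmetric]) (auto intro!: nn_integral_cong simp: ac_simps)
    also have "\<dots> \<le> 2 ^ DIM('a) * (\<integral>\<^sup>+ z. F z \<partial>lborel)" by (rule B) (use False in auto)
    finally show ?thesis .
  qed
qed


text \<open>Averaging the segment bound over \<open>y\<close> leaves, for each \<open>t\<close>, the
  mean \<open>R t x\<close> of \<open>g powr s\<close> over interpolated points. Pointwise it may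
  grow like t^(-d), but its integral in \<open>x\<close> is bounded uniformly in \<open>t\<close>.
  Interpolating between the two facts costs a weight t^(-\<sigma>), and \<sigma> < 1 makes this
  weight integrable.\<close>

proposition poincare_sobolev:
  fixes w :: "'a::euclidean_space \<Rightarrow> real"
  assumes Q: "open Q" "convex Q" and vol: "emeasure lborel Q = ennreal vol" "0 < vol" "vol \<le> 1"
    and \<Delta>: "\<And>x y. x \<in> Q \<Longrightarrow> y \<in> Q \<Longrightarrow> norm (y - x) \<le> \<Delta>"
    and w: "\<And>z. z \<in> Q \<Longrightarrow> (w has_derivative D z) (at z)" "set_integrable lborel Q w"
    and D: "\<And>z v. z \<in> Q \<Longrightarrow> \<bar>D z v\<bar> \<le> g z * norm v"
    and g: "continuous_on Q g" "\<And>z. z \<in> Q \<Longrightarrow> 0 \<le> g z"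
    and s: "1 < s" "s < r" and \<sigma>: "\<sigma> = DIM('a) * (1 / s - 1 / r)" "\<sigma> < 1"
    and S: "(\<integral>\<^sup>+ z. ennreal (g z powr s) * indicator Q z \<partial>lborel) \<le> ennreal S" "0 \<le> S"
  shows "(\<integral>\<^sup>+ x. ennreal (\<bar>w x - (LINT y:Q|lborel. w y) / vol\<bar> powr r) * indicator Q x \<partial>lborel)
    \<le> ennreal (2 ^ DIM('a) * (\<Delta> / vol) powr r * (1 / (1 - \<sigma>)) powr r * S powr (r / s))"
proof -
  have [measurable]: "Q \<in> sets borel" using Q by auto
  obtain x0 where "x0 \<in> Q" using vol by (cases "Q = {}") auto
  then have \<Delta>0: "0 \<le> \<Delta>" using \<Delta>[of x0 x0] by simp
  define G where "G z = (if z \<in> Q then g z else 0)" for z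
  have G_eq: "G z = g z" if "z \<in> Q" for z using that by (simp add: G_def)
  have [measurable]: "G \<in> borel_measurable borel"
    using borel_measurable_continuous_on_indicator[OF _ g(1)]
    by (rule back_subst[where P="\<lambda>f. f \<in> borel_measurable borel"]) (auto simp: G_def fun_eq_iff)
  have G0: "0 \<le> G z" for z using g by (simp add: G_def)
  define F where "F z = ennreal (G z powr s)" for z
  have [measurable]: "F \<in> borel_measurable borel" unfolding F_def[abs_def] by measurable
  have F_S: "(\<integral>\<^sup>+ z. F z \<partial>lborel) \<le> ennreal S"
  proof -
    have "F z = ennreal (g z powr s) * indicator Q z" for z by (simp add: F_def G_def)
    then show ?thesis using S(1) by presburger
  qed
  define R where "R t x = (\<integral>\<^sup>+ y. F ((1 - t) *\<^sub>R x + t *\<^sub>R y) * indicator Q y \<partial>lborel)" for t x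
  have R_le: "R t x \<le> ennreal (t powr - DIM('a) * S)" if "0 < t" "t < 1" for t x
  proof -
    have "R t x \<le> ennreal (t powr - DIM('a)) * (\<integral>\<^sup>+ z. F z \<partial>lborel)"
      unfolding R_def by (rule interpolated_average_bound) (use that in auto)
    also have "\<dots> \<le> ennreal (t powr - DIM('a)) * ennreal S" by (intro mult_left_mono F_S) auto
    finally show ?thesis using S(2) by (simp add: ennreal_mult[symmetric])
  qed
  have R_int: "(\<integral>\<^sup>+ x. R t x * indicator Q x \<partial>lborel) \<le> ennreal (2 ^ DIM('a) * S)" if "0 < t" "t < 1" for t
  proof -
    have "(\<integral>\<^sup>+ x. R t x * indicator Q x \<partial>lborel) \<le> 2 ^ DIM('a) * (\<integral>\<^sup>+ z. F z \<partial>lborel)"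
      unfolding R_def by (rule interpolated_average_bound) (use that vol in \<open>auto simp: ennreal_le_1\<close>)
    also have "\<dots> \<le> 2 ^ DIM('a) * ennreal S" by (intro mult_left_mono F_S) auto
    also have "\<dots> = ennreal (2 ^ DIM('a) * S)" using S(2) by (simp add: ennreal_mult ennreal_power[symmetric])
    finally show ?thesis .
  qed
  define R' where "R' t x = enn2real (R t x)" for t x
  have R'0: "0 \<le> R' t x" for t x by (simp add: R'_def)
  have R'_eq: "ennreal (R' t x) = R t x" if "0 < t" "t < 1" for t x
  proof -
    have "R t x < top" using R_le[OF that, of x] by (rule le_less_trans) simp
    then show ?thesis unfolding R'_def by (rule ennreal_enn2real)
  qed
  have [measurable]: "(\<lambda>(t, x). R t x) \<in> borel_measurable (borel \<Otimes>\<^sub>M borel)"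
    unfolding R_def[abs_def] by measurable
  have [measurable]: "(\<lambda>(t, x). R' t x) \<in> borel_measurable (borel \<Otimes>\<^sub>M borel)"
    unfolding R'_def[abs_def] by measurable
  define e where "e = 1 / s - 1 / r"
  have e: "0 < e" unfolding e_def using s by (simp add: field_simps)
  have r: "1 < r" using s by simp
  \<comment> \<open>Hoelder in \<open>y\<close> gives the power 1/s of \<open>R\<close>. It is split
    as e + 1/r: the power e is spent on the pointwise bound and produces t^(-\<sigma>), the power
    1/r is kept for the integration in \<open>x\<close>.\<close>
  have P_le: "(\<integral>\<^sup>+ y. ennreal (G ((1 - t) *\<^sub>R x + t *\<^sub>R y)) * indicator Q y \<partial>lborel)
      \<le> ennreal (t powr - \<sigma> * S powr e * R' t x powr (1 / r))" if t: "0 < t" "t < 1" for t x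
  proof -
    have "(\<integral>\<^sup>+ y. ennreal (G ((1 - t) *\<^sub>R x + t *\<^sub>R y) * indicat_real Q y * indicat_real Q y) \<partial>lborel)
      \<le> ennreal (R' t x powr (1 / s) * 1 powr (1 / (s / (s - 1))))"
    proof (rule nn_integral_Holder_bound)
      show "1 / s + 1 / (s / (s - 1)) = 1" using s by (simp add: field_simps)
      have "(\<integral>\<^sup>+ y. ennreal ((G ((1 - t) *\<^sub>R x + t *\<^sub>R y) * indicat_real Q y) powr s) \<partial>lborel) = R t x"
        unfolding R_def F_def by (intro nn_integral_cong) (simp add: indicator_def)
      then show "(\<integral>\<^sup>+ y. ennreal ((G ((1 - t) *\<^sub>R x + t *\<^sub>R y) * indicat_real Q y) powr s) \<partial>lborel) \<le> ennreal (R' t x)"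
        using R'_eq[OF t] by simp
      have "(\<integral>\<^sup>+ y. ennreal (indicat_real Q y powr (s / (s - 1))) \<partial>lborel) = (\<integral>\<^sup>+ y. indicator Q y \<partial>lborel)"
        by (intro nn_integral_cong) (simp add: indicator_def)
      also have "\<dots> = ennreal vol" using vol by simp
      finally show "(\<integral>\<^sup>+ y. ennreal (indicat_real Q y powr (s / (s - 1))) \<partial>lborel) \<le> ennreal 1"
        using vol by (simp add: ennreal_leI)
    qed (use s G0 R'0 in auto)
    also have "(\<integral>\<^sup>+ y. ennreal (G ((1 - t) *\<^sub>R x + t *\<^sub>R y) * indicat_real Q y * indicat_real Q y) \<partial>lborel)
        = (\<integral>\<^sup>+ y. ennreal (G ((1 - t) *\<^sub>R x + t *\<^sub>R y)) * indicator Q y \<partial>lborel)"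
      by (intro nn_integral_cong) (simp add: indicator_def)
    finally have 1: "(\<integral>\<^sup>+ y. ennreal (G ((1 - t) *\<^sub>R x + t *\<^sub>R y)) * indicator Q y \<partial>lborel) \<le> ennreal (R' t x powr (1 / s))"
      by simp
    have "R' t x \<le> t powr - DIM('a) * S"
      using R_le[OF t, of x] S(2) by (simp add: R'_eq[OF t, symmetric] ennreal_le_iff)
    then have "R' t x powr e \<le> (t powr - DIM('a) * S) powr e" using R'0 e by (intro powr_mono2) auto
    also have "\<dots> = t powr - \<sigma> * S powr e"
      using t S(2) by (simp add: powr_mult powr_powr \<sigma> e_def)
    finally have "R' t x powr e * R' t x powr (1 / r) \<le> t powr - \<sigma> * S powr e * R' t x powr (1 / r)"
      by (intro mult_right_mono) auto
    moreover have "R' t x powr e * R' t x powr (1 / r) = R' t x powr (1 / s)"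
      by (simp add: powr_add[symmetric] e_def)
    ultimately show ?thesis using 1 by (auto intro: order_trans ennreal_leI)
  qed
  \<comment> \<open>What remains after Hoelder in \<open>t\<close> with respect to the weight
    t^(-\<sigma>): the r-th power of the oscillation is at most a constant times \<open>Y\<close>,
    which is linear in \<open>R\<close>.\<close>
  define Y where "Y x = (\<integral>\<^sup>+ t. ennreal (t powr - \<sigma>) * R t x * indicator {0<..<1} t \<partial>lborel)" for x
  have [measurable]: "Y \<in> borel_measurable borel" unfolding Y_def[abs_def] by measurable
  define m where "m = (LINT y:Q|lborel. w y) / vol"
  have Qfin: "emeasure lborel Q < \<infinity>" using vol by simp
  have osc: "ennreal (vol * \<bar>w x - m\<bar>) \<le> ennreal \<Delta> * (\<integral>\<^sup>+ t. (\<integral>\<^sup>+ y. ennreal (G ((1 - t) *\<^sub>R x + t *\<^sub>R y)) * indicator Q y \<partial>lborel) * indicator {0<..<1} t \<partial>lborel)"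
    if x: "x \<in> Q" for x
  proof -
    have intc: "set_integrable lborel Q (\<lambda>y. w x)"
      unfolding set_integrable_def using Qfin by (intro integrable_scaleR_left) (auto simp: integrable_indicator_iff)
    have "vol * (w x - m) = (LINT y:Q|lborel. w x) - (LINT y:Q|lborel. w y)"
      using vol by (simp add: m_def right_diff_distrib set_lebesgue_integral_def measure_def)
    also have "\<dots> = (LINT y:Q|lborel. w x - w y)" using set_integral_diff(2)[OF intc w(2)] by simp
    finally have "\<bar>vol * (w x - m)\<bar> = norm (LINT y:Q|lborel. w x - w y)" by simp
    then have "ennreal (vol * \<bar>w x - m\<bar>) = ennreal (norm (LINT y:Q|lborel. w x - w y))"
      using vol by (simp add: abs_mult)
    also have "\<dots> \<le> (\<integral>\<^sup>+ y. ennreal (norm (indicat_real Q y *\<^sub>R (w x - w y))) \<partial>lborel)"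
      unfolding set_lebesgue_integral_def
      by (rule integral_norm_bound_ennreal) (use set_integral_diff(1)[OF intc w(2)] in \<open>simp add: set_integrable_def\<close>)
    also have "\<dots> = (\<integral>\<^sup>+ y. ennreal \<bar>w x - w y\<bar> * indicator Q y \<partial>lborel)"
      by (intro nn_integral_cong) (simp add: indicator_def)
    also have "\<dots> \<le> (\<integral>\<^sup>+ y. ennreal \<Delta> * ((\<integral>\<^sup>+ t. ennreal (G ((1 - t) *\<^sub>R x + t *\<^sub>R y)) * indicator {0<..<1} t \<partial>lborel) * indicator Q y) \<partial>lborel)"
    proof (rule nn_integral_mono)
      fix y :: 'a
      show "ennreal \<bar>w x - w y\<bar> * indicator Q y \<le> ennreal \<Delta> * ((\<integral>\<^sup>+ t. ennreal (G ((1 - t) *\<^sub>R x + t *\<^sub>R y)) * indicator {0<..<1} t \<partial>lborel) * indicator Q y)"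
      proof (cases "y \<in> Q")
        case True
        have "ennreal \<bar>w x - w y\<bar> \<le> ennreal \<Delta> * (\<integral>\<^sup>+ t. ennreal (g ((1 - t) *\<^sub>R x + t *\<^sub>R y)) * indicator {0..1} t \<partial>lborel)"
          by (rule segment_integral_bound[OF Q(2) x True w(1) D g \<Delta>[OF x True]])
        also have "(\<integral>\<^sup>+ t. ennreal (g ((1 - t) *\<^sub>R x + t *\<^sub>R y)) * indicator {0..1} t \<partial>lborel)
           = (\<integral>\<^sup>+ t. ennreal (G ((1 - t) *\<^sub>R x + t *\<^sub>R y)) * indicator {0<..<1} t \<partial>lborel)"
        proof (rule nn_integral_cong_AE)
          have inQ: "(1 - t) *\<^sub>R x + t *\<^sub>R y \<in> Q" if "0 < t" "t < 1" for t
            using convexD[OF Q(2) x True, of "1 - t" t] that by simp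
          show "AE t in lborel. ennreal (g ((1 - t) *\<^sub>R x + t *\<^sub>R y)) * indicator {0..1} t =
             ennreal (G ((1 - t) *\<^sub>R x + t *\<^sub>R y)) * indicator {0<..<1} t"
            using AE_lborel_singleton[of "0::real"] AE_lborel_singleton[of "1::real"]
            by eventually_elim (auto simp: indicator_def G_eq inQ)
        qed
        finally show ?thesis using True by simp
      qed simp
    qed
    also have "\<dots> = ennreal \<Delta> * (\<integral>\<^sup>+ y. (\<integral>\<^sup>+ t. ennreal (G ((1 - t) *\<^sub>R x + t *\<^sub>R y)) * indicator {0<..<1} t * indicator Q y \<partial>lborel) \<partial>lborel)"
      by (simp add: nn_integral_cmult nn_integral_multc)
    also have "(\<integral>\<^sup>+ y. (\<integral>\<^sup>+ t. ennreal (G ((1 - t) *\<^sub>R x + t *\<^sub>R y)) * indicator {0<..<1} t * indicator Q y \<partial>lborel) \<partial>lborel)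
       = (\<integral>\<^sup>+ t. (\<integral>\<^sup>+ y. ennreal (G ((1 - t) *\<^sub>R x + t *\<^sub>R y)) * indicator {0<..<1} t * indicator Q y \<partial>lborel) \<partial>lborel)"
      by (rule lborel_pair.Fubini'[of "\<lambda>y t. ennreal (G ((1 - t) *\<^sub>R x + t *\<^sub>R y)) * indicator {0<..<1} t * indicator Q y", symmetric]) measurable
    also have "\<dots> = (\<integral>\<^sup>+ t. (\<integral>\<^sup>+ y. ennreal (G ((1 - t) *\<^sub>R x + t *\<^sub>R y)) * indicator Q y \<partial>lborel) * indicator {0<..<1} t \<partial>lborel)"
      by (subst nn_integral_multc[symmetric]) (auto simp: ac_simps)
    finally show ?thesis .
  qed
  have osc2: "ennreal (vol * \<bar>w x - m\<bar>) \<le> ennreal \<Delta> * (\<integral>\<^sup>+ t. ennreal (t powr - \<sigma> * S powr e * R' t x powr (1 / r)) * indicator {0<..<1} t \<partial>lborel)"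
    if "x \<in> Q" for x
  proof (rule order_trans[OF osc[OF that]], intro mult_left_mono nn_integral_mono)
    fix t :: real
    show "(\<integral>\<^sup>+ y. ennreal (G ((1 - t) *\<^sub>R x + t *\<^sub>R y)) * indicator Q y \<partial>lborel) * indicator {0<..<1} t
      \<le> ennreal (t powr - \<sigma> * S powr e * R' t x powr (1 / r)) * indicator {0<..<1} t"
      by (cases "t \<in> {0<..<1}") (use P_le[of t x] in simp_all)
  qed simp
  define B where "B = (1 / (1 - \<sigma>)) powr (1 - 1 / r)"
  have B0: "0 \<le> B" by (simp add: B_def)
  have pw: "ennreal (\<bar>w x - m\<bar> powr r) \<le> ennreal ((\<Delta> / vol * S powr e * B) powr r) * Y x" if x: "x \<in> Q" for x
  proof (cases "Y x = \<infinity>")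
    case inf: True
    show ?thesis
    proof (cases "(\<Delta> / vol * S powr e * B) powr r = 0")
      case False
      then show ?thesis using inf by (simp add: ennreal_mult_top)
    next
      \<comment> \<open>In \<open>ennreal\<close> the product of 0 and infinity is 0, so here the
        claim is that the oscillation vanishes. It does, because the vanishing factor already occurs
        in \<open>osc2\<close>.\<close>
      case True
      then have z: "\<Delta> * S powr e = 0" using vol \<sigma> by (auto simp: B_def)
      have "ennreal (vol * \<bar>w x - m\<bar>) \<le> ennreal \<Delta> * (\<integral>\<^sup>+ t. ennreal (t powr - \<sigma> * S powr e * R' t x powr (1 / r)) * indicator {0<..<1} t \<partial>lborel)"
        by (rule osc2[OF x])
      also have "\<dots> = 0" using z by auto
      finally show ?thesis using vol by (simp add: mult_le_0_iff ennreal_eq_0_iff)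
    qed
  next
    case False
    then obtain y where y: "Y x = ennreal y" "0 \<le> y" by (cases "Y x") auto
    have H: "(\<integral>\<^sup>+ t. ennreal (((t powr - \<sigma>) powr (1 / r) * R' t x powr (1 / r) * indicat_real {0<..<1} t) *
         ((t powr - \<sigma>) powr (1 - 1 / r) * indicat_real {0<..<1} t)) \<partial>lborel)
      \<le> ennreal (y powr (1 / r) * (1 / (1 - \<sigma>)) powr (1 / (1 / (1 - 1 / r))))"
    proof (rule nn_integral_Holder_bound)
      show "1 / r + 1 / (1 / (1 - 1 / r)) = 1" by simp
      have "(\<integral>\<^sup>+ t. ennreal (((t powr - \<sigma>) powr (1 / r) * R' t x powr (1 / r) * indicat_real {0<..<1} t) powr r) \<partial>lborel) = Y x"
        unfolding Y_def
      proof (rule nn_integral_cong)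
        fix t :: real
        show "ennreal (((t powr - \<sigma>) powr (1 / r) * R' t x powr (1 / r) * indicat_real {0<..<1} t) powr r) =
          ennreal (t powr - \<sigma>) * R t x * indicator {0<..<1} t"
          using R'_eq[of t x] r R'0[of t x] by (auto simp: indicator_def powr_mult powr_powr ennreal_mult)
      qed
      then show "(\<integral>\<^sup>+ t. ennreal (((t powr - \<sigma>) powr (1 / r) * R' t x powr (1 / r) * indicat_real {0<..<1} t) powr r) \<partial>lborel) \<le> ennreal y"
        using y by simp
      have "(\<integral>\<^sup>+ t. ennreal (((t powr - \<sigma>) powr (1 - 1 / r) * indicat_real {0<..<1} t) powr (1 / (1 - 1 / r))) \<partial>lborel)
         = (\<integral>\<^sup>+ t. ennreal (t powr - \<sigma>) * indicator {0<..<1} t \<partial>lborel)"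
      proof (rule nn_integral_cong)
        fix t :: real
        have "(1 - 1 / r) * (1 / (1 - 1 / r)) = 1" using r by simp
        then show "ennreal (((t powr - \<sigma>) powr (1 - 1 / r) * indicat_real {0<..<1} t) powr (1 / (1 - 1 / r)))
           = ennreal (t powr - \<sigma>) * indicator {0<..<1} t"
          by (auto simp: indicator_def powr_powr mult.assoc)
      qed
      then show "(\<integral>\<^sup>+ t. ennreal (((t powr - \<sigma>) powr (1 - 1 / r) * indicat_real {0<..<1} t) powr (1 / (1 - 1 / r))) \<partial>lborel) \<le> ennreal (1 / (1 - \<sigma>))"
        using nn_integral_powr_01[OF \<sigma>(2)] by simp
    qed (use r y \<sigma> R'0 in auto)
    have "ennreal (vol * \<bar>w x - m\<bar>) \<le> ennreal \<Delta> * (\<integral>\<^sup>+ t. ennreal (t powr - \<sigma> * S powr e * R' t x powr (1 / r)) * indicator {0<..<1} t \<partial>lborel)"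
      by (rule osc2[OF x])
    also have "\<dots> = ennreal \<Delta> * (\<integral>\<^sup>+ t. ennreal (S powr e) * ennreal (((t powr - \<sigma>) powr (1 / r) * R' t x powr (1 / r) * indicat_real {0<..<1} t) *
         ((t powr - \<sigma>) powr (1 - 1 / r) * indicat_real {0<..<1} t)) \<partial>lborel)"
    proof (intro arg_cong[where f="\<lambda>z. ennreal \<Delta> * z"] nn_integral_cong)
      fix t :: real
      have "(t powr - \<sigma>) powr (1 / r) * (t powr - \<sigma>) powr (1 - 1 / r) = t powr - \<sigma>"
        by (subst powr_add[symmetric]) simp
      then have E: "t powr - \<sigma> * S powr e * R' t x powr (1 / r) = S powr e * ((t powr - \<sigma>) powr (1 / r) * R' t x powr (1 / r) * (t powr - \<sigma>) powr (1 - 1 / r))"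
        by (metis mult.assoc mult.commute)
      show "ennreal (t powr - \<sigma> * S powr e * R' t x powr (1 / r)) * indicator {0<..<1} t =
         ennreal (S powr e) * ennreal (((t powr - \<sigma>) powr (1 / r) * R' t x powr (1 / r) * indicat_real {0<..<1} t) *
         ((t powr - \<sigma>) powr (1 - 1 / r) * indicat_real {0<..<1} t))"
        unfolding E by (cases "t \<in> {0<..<1}") (simp_all add: ennreal_mult[symmetric] mult_ac)
    qed
    also have "\<dots> = ennreal \<Delta> * (ennreal (S powr e) * (\<integral>\<^sup>+ t. ennreal (((t powr - \<sigma>) powr (1 / r) * R' t x powr (1 / r) * indicat_real {0<..<1} t) *
         ((t powr - \<sigma>) powr (1 - 1 / r) * indicat_real {0<..<1} t)) \<partial>lborel))"
      by (subst nn_integral_cmult) auto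
    also have "\<dots> \<le> ennreal \<Delta> * (ennreal (S powr e) * ennreal (y powr (1 / r) * (1 / (1 - \<sigma>)) powr (1 / (1 / (1 - 1 / r)))))"
      by (intro mult_left_mono H) auto
    also have "\<dots> = ennreal (\<Delta> * S powr e * B * y powr (1 / r))"
      using \<Delta>0 by (simp add: ennreal_mult[symmetric] B_def mult_ac)
    finally have "vol * \<bar>w x - m\<bar> \<le> \<Delta> * S powr e * B * y powr (1 / r)"
      using \<Delta>0 B0 by (subst (asm) ennreal_le_iff) auto
    then have "\<bar>w x - m\<bar> \<le> (\<Delta> / vol * S powr e * B) * y powr (1 / r)" using vol by (simp add: field_simps)
    then have "\<bar>w x - m\<bar> powr r \<le> ((\<Delta> / vol * S powr e * B) * y powr (1 / r)) powr r"
      using r by (intro powr_mono2) auto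
    also have "\<dots> = (\<Delta> / vol * S powr e * B) powr r * y"
      using \<Delta>0 B0 vol y r by (subst powr_mult) (auto simp: powr_powr)
    finally show ?thesis using y by (simp add: ennreal_mult[symmetric])
  qed
  have "(\<integral>\<^sup>+ x. Y x * indicator Q x \<partial>lborel)
      = (\<integral>\<^sup>+ x. (\<integral>\<^sup>+ t. ennreal (t powr - \<sigma>) * R t x * indicator {0<..<1} t * indicator Q x \<partial>lborel) \<partial>lborel)"
    unfolding Y_def by (simp add: nn_integral_multc)
  also have "\<dots> = (\<integral>\<^sup>+ t. (\<integral>\<^sup>+ x. ennreal (t powr - \<sigma>) * R t x * indicator {0<..<1} t * indicator Q x \<partial>lborel) \<partial>lborel)"
    by (rule lborel_pair.Fubini'[of "\<lambda>x t. ennreal (t powr - \<sigma>) * R t x * indicator {0<..<1} t * indicator Q x", symmetric]) measurable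
  also have "\<dots> = (\<integral>\<^sup>+ t. (ennreal (t powr - \<sigma>) * indicator {0<..<1} t) * (\<integral>\<^sup>+ x. R t x * indicator Q x \<partial>lborel) \<partial>lborel)"
    by (subst nn_integral_cmult[symmetric]) (auto simp: ac_simps)
  also have "\<dots> \<le> (\<integral>\<^sup>+ t. (ennreal (t powr - \<sigma>) * indicator {0<..<1} t) * ennreal (2 ^ DIM('a) * S) \<partial>lborel)"
  proof (rule nn_integral_mono)
    fix t :: real
    show "(ennreal (t powr - \<sigma>) * indicator {0<..<1} t) * (\<integral>\<^sup>+ x. R t x * indicator Q x \<partial>lborel)
      \<le> (ennreal (t powr - \<sigma>) * indicator {0<..<1} t) * ennreal (2 ^ DIM('a) * S)"
      by (cases "t \<in> {0<..<1}") (use R_int[of t] in \<open>simp_all add: mult_left_mono\<close>)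
  qed
  also have "\<dots> = ennreal (1 / (1 - \<sigma>)) * ennreal (2 ^ DIM('a) * S)"
    by (subst nn_integral_multc) (auto simp: nn_integral_powr_01[OF \<sigma>(2)])
  also have "\<dots> = ennreal (1 / (1 - \<sigma>) * (2 ^ DIM('a) * S))" by (rule ennreal_mult[symmetric]) (use \<sigma> S in auto)
  finally have YB: "(\<integral>\<^sup>+ x. Y x * indicator Q x \<partial>lborel) \<le> ennreal (1 / (1 - \<sigma>) * (2 ^ DIM('a) * S))" .
  have "(\<integral>\<^sup>+ x. ennreal (\<bar>w x - m\<bar> powr r) * indicator Q x \<partial>lborel)
      \<le> (\<integral>\<^sup>+ x. ennreal ((\<Delta> / vol * S powr e * B) powr r) * (Y x * indicator Q x) \<partial>lborel)"
  proof (rule nn_integral_mono)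
    fix x
    show "ennreal (\<bar>w x - m\<bar> powr r) * indicator Q x \<le> ennreal ((\<Delta> / vol * S powr e * B) powr r) * (Y x * indicator Q x)"
      by (cases "x \<in> Q") (use pw[of x] in simp_all)
  qed
  also have "\<dots> = ennreal ((\<Delta> / vol * S powr e * B) powr r) * (\<integral>\<^sup>+ x. Y x * indicator Q x \<partial>lborel)"
    by (simp add: nn_integral_cmult)
  also have "\<dots> \<le> ennreal ((\<Delta> / vol * S powr e * B) powr r) * ennreal (1 / (1 - \<sigma>) * (2 ^ DIM('a) * S))"
    by (intro mult_left_mono YB) simp
  also have "\<dots> = ennreal ((\<Delta> / vol * S powr e * B) powr r * (1 / (1 - \<sigma>) * (2 ^ DIM('a) * S)))"
    by (rule ennreal_mult[symmetric]) (use \<sigma> S in auto)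
  also have "(\<Delta> / vol * S powr e * B) powr r * (1 / (1 - \<sigma>) * (2 ^ DIM('a) * S))
     = 2 ^ DIM('a) * (\<Delta> / vol) powr r * (B powr r * (1 / (1 - \<sigma>))) * (S powr (e * r) * S)"
  proof -
    have "(k * S powr e * B) powr r = k powr r * B powr r * S powr (e * r)" if "0 \<le> k" for k
      using that B0 by (simp add: powr_mult powr_powr)
    from this[of "\<Delta> / vol"] show ?thesis using \<Delta>0 vol by simp
  qed
  also have "B powr r * (1 / (1 - \<sigma>)) = (1 / (1 - \<sigma>)) powr r"
  proof -
    have "B powr r * (1 / (1 - \<sigma>)) = (1 / (1 - \<sigma>)) powr ((1 - 1 / r) * r) * (1 / (1 - \<sigma>)) powr 1"
      using \<sigma> by (simp add: B_def powr_powr)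
    also have "\<dots> = (1 / (1 - \<sigma>)) powr r" using r by (subst powr_add[symmetric]) (simp add: left_diff_distrib)
    finally show ?thesis .
  qed
  also have "S powr (e * r) * S = S powr (r / s)"
  proof -
    have "S powr (e * r) * S = S powr (e * r) * S powr 1" using S(2) by simp
    also have "\<dots> = S powr (r / s)" using r s by (subst powr_add[symmetric]) (simp add: e_def left_diff_distrib)
    finally show ?thesis .
  qed
  finally show ?thesis by (simp add: m_def)
qed

subsection \<open>Moser iteration and the crossover of Bombieri and Giusti\<close>

text \<open>The logarithm of the product of all constants of the iteration. Step i costs the factor
  \<open>4 * K / \<delta> * (2 * \<gamma>) ^ i\<close> to the power \<open>m\<close>, weighted by
  \<open>(1 / \<gamma>) ^ i\<close> when the exponents are normalised.\<close>

definition moser_error :: "real \<Rightarrow> real \<Rightarrow> real \<Rightarrow> real \<Rightarrow> real" where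
  "moser_error m \<gamma> K \<delta> = m * ((\<Sum>i. (1 / \<gamma>) ^ i) * ln (4 * K / \<delta>) + (\<Sum>i. real i * (1 / \<gamma>) ^ i) * ln (2 * \<gamma>))"

text \<open>The height above which an upper bound for \<open>V\<close> on one set improves by the
  factor 3/4 on the set whose radius is smaller by \<open>\<delta>\<close>.\<close>

definition crossover_bound :: "real \<Rightarrow> real \<Rightarrow> real \<Rightarrow> real \<Rightarrow> real \<Rightarrow> real" where
  "crossover_bound m \<gamma> K D \<delta> = 2 * D * exp (2 * \<gamma> * (moser_error m \<gamma> K \<delta> + ln 2))"

text \<open>\<open>crossover_bound\<close> is a constant times a negative power of
  \<open>\<delta>\<close>. This is the ratio by which \<open>\<delta>\<close> has to shrink for the
  height to grow by exactly 4/3, the inverse of the improvement per step.\<close>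

definition contraction_ratio :: "real \<Rightarrow> real \<Rightarrow> real" where
  "contraction_ratio m \<gamma> = (3 / 4) powr (1 / (2 * \<gamma> * m * (\<Sum>i. (1 / \<gamma>) ^ i)))"

text \<open>The abstract setting of the crossover. \<open>V\<close> will be plus or minus the
  centred and scaled logarithm of the solution, so \<open>exp (t * V x)\<close> is a multiple of a
  positive or negative power of it. Only exponents in \<open>T\<close> are admissible, which leaves
  room to avoid the degenerate one; \<open>T_dense\<close> says that every target is met up to the
  factor \<open>\<gamma>\<close>.\<close>

locale reverse_Holder_family =
  fixes M :: "'a measure" and S :: "real \<Rightarrow> 'a set" and V :: "'a \<Rightarrow> real" and T :: "real set"
    and \<gamma> m K \<rho>0 \<rho>1 :: real
  assumes V_meas [measurable]: "V \<in> borel_measurable M"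
    and S_meas [measurable]: "\<And>\<rho>. S \<rho> \<in> sets M"
    and S_mono: "\<And>\<rho> \<rho>'. \<rho> \<le> \<rho>' \<Longrightarrow> S \<rho> \<subseteq> S \<rho>'"
    and S_le_1: "emeasure M (S \<rho>1) \<le> 1"
    and \<gamma>: "1 < \<gamma>" and m: "0 < m" and K: "1 \<le> K"
    and \<rho>: "\<rho>0 < \<rho>1" "\<rho>1 - \<rho>0 \<le> 1"
    and T_pos: "\<And>t. t \<in> T \<Longrightarrow> 0 < t" and T_mult: "\<And>t. t \<in> T \<Longrightarrow> \<gamma> * t \<in> T"
    and T_dense: "\<And>y. 0 < y \<Longrightarrow> \<exists>t\<in>T. y \<le> t \<and> t \<le> \<gamma> * y"
    and reverse_Holder: "\<And>t r r' J. t \<in> T \<Longrightarrow> \<rho>0 \<le> r \<Longrightarrow> r < r' \<Longrightarrow> r' \<le> \<rho>1 \<Longrightarrow> 0 \<le> J \<Longrightarrow>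
        (\<integral>\<^sup>+ x. ennreal (exp (t * V x)) * indicator (S r') x \<partial>M) \<le> ennreal J \<Longrightarrow>
        (\<integral>\<^sup>+ x. ennreal (exp (\<gamma> * t * V x)) * indicator (S r) x \<partial>M)
          \<le> ennreal (((K * (1 + t) / (r' - r)) powr m * J) powr \<gamma>)"
begin

lemma geometric_sums: "summable (\<lambda>i. (1 / \<gamma>) ^ i)" "summable (\<lambda>i. real i * (1 / \<gamma>) ^ i)"
proof -
  show "summable (\<lambda>i. (1 / \<gamma>) ^ i)" using \<gamma> by (intro summable_geometric) auto
  have "summable (\<lambda>i. real (Suc i) * (1 / \<gamma>) ^ i)"
    using geometric_deriv_sums[of "1 / \<gamma>"] \<gamma> by (auto simp: sums_iff)
  then show "summable (\<lambda>i. real i * (1 / \<gamma>) ^ i)"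
    by (rule summable_comparison_test') (use \<gamma> in \<open>auto intro!: mult_right_mono simp: abs_mult\<close>)
qed

text \<open>\<open>reverse_Holder\<close> is applied with exponents \<open>t * \<gamma> ^ k\<close>
  and radii whose gaps halve. The logarithm of the k-th bound, divided by
  \<open>\<gamma> ^ k\<close>, increases by a convergent series. A pointwise bound follows from
  Chebyshev's inequality for each exponent, without identifying the limit of the norms.\<close>

lemma moser_iteration:
  assumes t: "t \<in> T" "t \<le> 1" and r: "\<rho>0 \<le> r" "r < r'" "r' \<le> \<rho>1"
    and J: "0 < J" "(\<integral>\<^sup>+ x. ennreal (exp (t * V x)) * indicator (S r') x \<partial>M) \<le> ennreal J"
  shows "AE x in M. x \<in> S r \<longrightarrow> t * V x \<le> ln J + moser_error m \<gamma> K (r' - r)"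
proof -
  define \<delta> where "\<delta> = r' - r"
  have \<delta>: "0 < \<delta>" "\<delta> \<le> 1" using r \<rho> by (auto simp: \<delta>_def)
  define R where "R k = r + \<delta> / 2 ^ k" for k :: nat
  \<comment> \<open>An upper bound for the k-th factor
    \<open>K * (1 + t * \<gamma> ^ k) / (R k - R (Suc k))\<close>. One 2 comes from
    \<open>1 + t * \<gamma> ^ k \<le> 2 * \<gamma> ^ k\<close>, where \<open>t \<le> 1\<close>
    enters, the other from the gap \<open>\<delta> / 2 ^ Suc k\<close>.\<close>
  define Y where "Y k = 4 * K / \<delta> * (2 * \<gamma>) ^ k" for k :: nat
  have Y0: "0 < Y k" for k using K \<delta> \<gamma> by (simp add: Y_def)
  define L where "L k = ln J + (\<Sum>i<k. m * (1 / \<gamma>) ^ i * ln (Y i))" for k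
  have lnY: "ln (Y i) = ln (4 * K / \<delta>) + real i * ln (2 * \<gamma>)" for i
  proof -
    have "ln ((2 * \<gamma>) ^ i) = real i * ln (2 * \<gamma>)" by (rule ln_realpow)
    moreover have "ln (Y i) = ln (4 * K / \<delta>) + ln ((2 * \<gamma>) ^ i)"
      unfolding Y_def by (rule ln_mult_pos) (use K \<delta> \<gamma> in simp_all)
    ultimately show ?thesis by simp
  qed
  have K\<delta>: "1 \<le> 4 * K / \<delta>" using K \<delta> by (simp add: field_simps)
  have L_le: "L k \<le> ln J + moser_error m \<gamma> K \<delta>" for k
  proof -
    have "(\<Sum>i<k. m * (1 / \<gamma>) ^ i * ln (Y i))
       = m * ((\<Sum>i<k. (1 / \<gamma>) ^ i) * ln (4 * K / \<delta>) + (\<Sum>i<k. real i * (1 / \<gamma>) ^ i) * ln (2 * \<gamma>))"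
      by (simp add: lnY sum_distrib_left sum_distrib_right sum.distrib[symmetric] algebra_simps)
    also have "\<dots> \<le> moser_error m \<gamma> K \<delta>"
      unfolding moser_error_def using m K\<delta> \<gamma> geometric_sums
      by (intro mult_left_mono add_mono mult_right_mono sum_le_suminf) auto
    finally show ?thesis by (simp add: L_def)
  qed
  have iter: "(\<integral>\<^sup>+ x. ennreal (exp (t * \<gamma> ^ k * V x)) * indicator (S (R k)) x \<partial>M) \<le> ennreal (exp (\<gamma> ^ k * L k)) \<and> t * \<gamma> ^ k \<in> T" for k
  proof (induction k)
    case 0
    then show ?case using J t by (simp add: R_def L_def \<delta>_def)
  next
    case (Suc k)
    have T: "t * \<gamma> ^ k \<in> T" using Suc by simp
    have Rk: "\<rho>0 \<le> R (Suc k)" "R (Suc k) < R k" "R k \<le> \<rho>1"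
    proof -
      have "\<delta> / 2 ^ k \<le> \<delta>" using \<delta> by (simp add: field_simps)
      then show "R k \<le> \<rho>1" using r by (simp add: R_def \<delta>_def)
      show "\<rho>0 \<le> R (Suc k)" using \<delta> r unfolding R_def by (intro add_increasing2) auto
    qed (use \<delta> in \<open>auto simp: R_def field_simps\<close>)
    have X: "K * (1 + t * \<gamma> ^ k) / (R k - R (Suc k)) \<le> Y k"
    proof -
      have "t * \<gamma> ^ k \<le> \<gamma> ^ k" "1 \<le> \<gamma> ^ k" using t \<gamma> by (simp_all add: mult_left_le_one_le T_pos less_imp_le)
      then have "1 + t * \<gamma> ^ k \<le> 2 * \<gamma> ^ k" by linarith
      then have "K * (1 + t * \<gamma> ^ k) \<le> K * (2 * \<gamma> ^ k)" using K by (intro mult_left_mono) auto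
      then have "K * (1 + t * \<gamma> ^ k) * (2 * 2 ^ k / \<delta>) \<le> K * (2 * \<gamma> ^ k) * (2 * 2 ^ k / \<delta>)"
        using \<delta> by (intro mult_right_mono) auto
      moreover have "R k - R (Suc k) = \<delta> / (2 * 2 ^ k)" by (simp add: R_def field_simps)
      ultimately show ?thesis by (simp add: Y_def power_mult_distrib mult_ac)
    qed
    have "(\<integral>\<^sup>+ x. ennreal (exp (\<gamma> * (t * \<gamma> ^ k) * V x)) * indicator (S (R (Suc k))) x \<partial>M)
        \<le> ennreal (((K * (1 + t * \<gamma> ^ k) / (R k - R (Suc k))) powr m * exp (\<gamma> ^ k * L k)) powr \<gamma>)"
      by (rule reverse_Holder[OF T Rk]) (use Suc in auto)
    also have "\<dots> \<le> ennreal ((Y k powr m * exp (\<gamma> ^ k * L k)) powr \<gamma>)"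
      using X m \<gamma> K T_pos[OF T] Rk by (intro ennreal_leI powr_mono2 mult_right_mono) auto
    also have "(Y k powr m * exp (\<gamma> ^ k * L k)) powr \<gamma> = exp (\<gamma> ^ Suc k * L (Suc k))"
    proof -
      have "Y k powr m * exp (\<gamma> ^ k * L k) = exp (m * ln (Y k) + \<gamma> ^ k * L k)"
        using Y0 by (simp add: powr_def exp_add less_imp_neq[symmetric])
      moreover have "\<gamma> * (m * ln (Y k) + \<gamma> ^ k * L k) = \<gamma> ^ Suc k * L (Suc k)"
        using \<gamma> by (simp add: L_def algebra_simps power_one_over)
      ultimately show ?thesis by (simp add: powr_def)
    qed
    finally show ?case using T_mult[OF T] by (simp add: mult_ac)
  qed
  define Linf where "Linf = ln J + moser_error m \<gamma> K \<delta>"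
  have null: "AE x in M. x \<in> S r \<longrightarrow> t * V x \<le> Linf + \<epsilon>" if \<epsilon>: "0 < \<epsilon>" for \<epsilon>
  proof -
    define A where "A = {x \<in> S r. Linf + \<epsilon> < t * V x}"
    have A_eq: "A = {x \<in> space M. x \<in> S r \<and> Linf + \<epsilon> < t * V x}"
      using sets.sets_into_space[OF S_meas] by (auto simp: A_def)
    have [measurable]: "A \<in> sets M" unfolding A_eq by measurable
    \<comment> \<open>Chebyshev with the exponent \<open>t * \<gamma> ^ k\<close>. The set does not
      depend on \<open>k\<close>, whereas the bound tends to 0.\<close>
    have bound: "emeasure M A \<le> ennreal (exp (- (\<gamma> ^ k * \<epsilon>)))" for k
    proof -
      have "ennreal (exp (\<gamma> ^ k * (Linf + \<epsilon>))) * emeasure M A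
          = (\<integral>\<^sup>+ x. ennreal (exp (\<gamma> ^ k * (Linf + \<epsilon>))) * indicator A x \<partial>M)"
        by (simp add: nn_integral_cmult)
      also have "\<dots> \<le> (\<integral>\<^sup>+ x. ennreal (exp (t * \<gamma> ^ k * V x)) * indicator (S (R k)) x \<partial>M)"
      proof (rule nn_integral_mono)
        fix x
        have sub: "S r \<subseteq> S (R k)" using \<delta> by (intro S_mono) (simp add: R_def)
        show "ennreal (exp (\<gamma> ^ k * (Linf + \<epsilon>))) * indicator A x \<le> ennreal (exp (t * \<gamma> ^ k * V x)) * indicator (S (R k)) x"
        proof (cases "x \<in> A")
          case True
          then have "\<gamma> ^ k * (Linf + \<epsilon>) \<le> \<gamma> ^ k * (t * V x)" using \<gamma> by (intro mult_left_mono) (auto simp: A_def)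
          then show ?thesis using True sub by (auto simp: A_def mult_ac intro!: ennreal_leI)
        qed simp
      qed
      also have "\<dots> \<le> ennreal (exp (\<gamma> ^ k * L k))" using iter by simp
      also have "\<dots> \<le> ennreal (exp (\<gamma> ^ k * Linf))"
        using L_le[of k] \<gamma> by (intro ennreal_leI) (simp add: Linf_def mult_left_mono)
      finally have le: "ennreal (exp (\<gamma> ^ k * (Linf + \<epsilon>))) * emeasure M A \<le> ennreal (exp (\<gamma> ^ k * Linf))" .
      define u where "u = \<gamma> ^ k * (Linf + \<epsilon>)"
      have "emeasure M A = ennreal (exp (- u)) * ennreal (exp u) * emeasure M A"
        by (simp add: ennreal_mult[symmetric] exp_add[symmetric])
      also have "\<dots> \<le> ennreal (exp (- u)) * ennreal (exp (\<gamma> ^ k * Linf))"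
        unfolding mult.assoc by (rule mult_left_mono) (use le in \<open>simp_all add: u_def\<close>)
      also have "\<dots> = ennreal (exp (- u + \<gamma> ^ k * Linf))" by (simp add: ennreal_mult[symmetric] exp_add[symmetric])
      also have "- u + \<gamma> ^ k * Linf = - (\<gamma> ^ k * \<epsilon>)" by (simp add: u_def algebra_simps)
      finally show ?thesis .
    qed
    have "(\<lambda>k. ennreal (exp (- (\<gamma> ^ k * \<epsilon>)))) \<longlonglongrightarrow> ennreal 0"
    proof (rule tendsto_ennrealI)
      have "filterlim (\<lambda>k. \<gamma> ^ k * \<epsilon>) at_top sequentially"
      proof (rule filterlim_at_top_mult_tendsto_pos[OF tendsto_const \<epsilon>])
        have "filterlim (\<lambda>k. \<gamma> ^ k) at_infinity sequentially"
          by (rule filterlim_realpow_sequentially_gt1) (use \<gamma> in simp)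
        then show "filterlim (\<lambda>k. \<gamma> ^ k) at_top sequentially"
          by (rule filterlim_at_infinity_imp_filterlim_at_top) (use \<gamma> in simp)
      qed
      then have "filterlim (\<lambda>k. - (\<gamma> ^ k * \<epsilon>)) at_bot sequentially"
        by (simp add: filterlim_uminus_at_top)
      then show "(\<lambda>k. exp (- (\<gamma> ^ k * \<epsilon>))) \<longlonglongrightarrow> 0"
        by (rule filterlim_compose[OF exp_at_bot])
    qed
    then have "emeasure M A \<le> 0" using bound by (intro LIMSEQ_le_const) auto
    then have "A \<in> null_sets M" by (simp add: null_sets_def)
    then show ?thesis using AE_not_in[of A M] by (auto simp: A_def elim!: eventually_mono)
  qed
  have "AE x in M. \<forall>n::nat. x \<in> S r \<longrightarrow> t * V x \<le> Linf + 1 / real (Suc n)"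
    using null by (subst AE_all_countable) auto
  then show ?thesis
  proof eventually_elim
    case (elim x)
    show ?case
    proof
      assume "x \<in> S r"
      then have "t * V x \<le> Linf + 1 / real (Suc n)" for n using elim by blast
      moreover have "(\<lambda>n. Linf + 1 / real (Suc n)) \<longlonglongrightarrow> Linf + 0"
        using LIMSEQ_inverse_real_of_nat by (intro tendsto_intros) (simp add: inverse_eq_divide)
      ultimately have "t * V x \<le> Linf + 0" by (intro LIMSEQ_le_const) auto
      then show "t * V x \<le> ln J + moser_error m \<gamma> K (r' - r)" by (simp add: Linf_def \<delta>_def)
    qed
  qed
qed

lemma moser_error_nonneg: "0 < \<delta> \<Longrightarrow> \<delta> \<le> 1 \<Longrightarrow> 0 \<le> moser_error m \<gamma> K \<delta>"
  unfolding moser_error_def using m K \<gamma> geometric_sums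
  by (intro mult_nonneg_nonneg add_nonneg_nonneg suminf_nonneg) (auto simp: field_simps intro!: ln_ge_zero)

text \<open>The exponent is chosen with \<open>t * \<psi>\<close> between \<open>X\<close> and
  \<open>\<gamma> * X\<close>. The exponential integral is split at the level
  \<open>\<psi> / 2\<close>: below it the integrand is at most \<open>exp (t * \<psi> / 2)\<close>,
  and above it the weak L^1 bound makes the set so small that its share is no larger. One Moser
  iteration then adds only \<open>X / 4\<close> to \<open>t * \<psi> / 2\<close>.\<close>

lemma crossover_step:
  assumes r: "\<rho>0 \<le> r" "r < r'" "r' \<le> \<rho>1"
    and D: "1 \<le> D" "\<And>s. 0 < s \<Longrightarrow> emeasure M {x \<in> S \<rho>1. s < V x} \<le> ennreal (D / s)"
    and \<psi>: "crossover_bound m \<gamma> K D (r' - r) \<le> \<psi>" "AE x in M. x \<in> S r' \<longrightarrow> V x \<le> \<psi>"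
  shows "AE x in M. x \<in> S r \<longrightarrow> V x \<le> 3 / 4 * \<psi>"
proof -
  define E where "E = moser_error m \<gamma> K (r' - r)"
  \<comment> \<open>Chosen so that \<open>E + ln 2\<close>, the loss of the Moser iteration and of
    the factor 2, is a quarter of \<open>X\<close> and hence at most a quarter of
    \<open>t * \<psi>\<close>.\<close>
  define X where "X = 4 * (E + ln 2)"
  have E: "0 \<le> E" unfolding E_def by (rule moser_error_nonneg) (use r \<rho> in auto)
  have X: "0 < X" using E by (simp add: X_def add_nonneg_pos)
  have \<psi>X: "2 * D * exp (\<gamma> * X / 2) \<le> \<psi>" 
  proof -
    have "\<gamma> * X / 2 = 2 * \<gamma> * (E + ln 2)" by (simp add: X_def)
    then show ?thesis using \<psi>(1) by (simp only: crossover_bound_def E_def)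
  qed
  \<comment> \<open>The exponent found below is at most \<open>\<gamma> * X / \<psi>\<close>; this
    inequality brings it under 1, as \<open>moser_iteration\<close> requires.\<close>
  have "\<gamma> * X \<le> 2 * exp (\<gamma> * X / 2)" using exp_ge_add_one_self[of "\<gamma> * X / 2"] by linarith
  also have "\<dots> \<le> 2 * D * exp (\<gamma> * X / 2)" using D by simp
  finally have \<gamma>X: "\<gamma> * X \<le> \<psi>" using \<psi>X by simp
  have \<psi>0: "0 < \<psi>" using \<gamma>X X \<gamma> by (meson less_le_trans mult_pos_pos less_trans zero_less_one)
  obtain t where t: "t \<in> T" "X / \<psi> \<le> t" "t \<le> \<gamma> * (X / \<psi>)" using T_dense[of "X / \<psi>"] X \<psi>0 by auto
  have t1: "t \<le> 1"
  proof -
    have "\<gamma> * (X / \<psi>) \<le> 1" using \<gamma>X \<psi>0 by (simp add: field_simps)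
    then show ?thesis using t by simp
  qed
  have t0: "0 < t" using T_pos t by blast
  have t\<psi>: "X \<le> t * \<psi>" "t * \<psi> \<le> \<gamma> * X" using t \<psi>0 by (simp_all add: field_simps)
  define B where "B = {x \<in> S \<rho>1. \<psi> / 2 < V x}"
  have B_eq: "B = {x \<in> space M. x \<in> S \<rho>1 \<and> \<psi> / 2 < V x}"
    using sets.sets_into_space[OF S_meas] by (auto simp: B_def)
  have [measurable]: "B \<in> sets M" unfolding B_eq by measurable
  have "(\<integral>\<^sup>+ x. ennreal (exp (t * V x)) * indicator (S r') x \<partial>M)
     \<le> (\<integral>\<^sup>+ x. ennreal (exp (t * \<psi>)) * indicator B x + ennreal (exp (t * \<psi> / 2)) * indicator (S \<rho>1) x \<partial>M)"
  proof (rule nn_integral_mono_AE)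
    have sub: "S r' \<subseteq> S \<rho>1" by (rule S_mono) (rule r)
    show "AE x in M. ennreal (exp (t * V x)) * indicator (S r') x \<le> ennreal (exp (t * \<psi>)) * indicator B x + ennreal (exp (t * \<psi> / 2)) * indicator (S \<rho>1) x"
      using \<psi>(2)
    proof eventually_elim
      case (elim x)
      show ?case
      proof (cases "x \<in> S r'")
        case True
        then have le: "V x \<le> \<psi>" and inS: "x \<in> S \<rho>1" using elim sub by auto
        show ?thesis
        proof (cases "\<psi> / 2 < V x")
          case True
          then have "x \<in> B" using inS by (simp add: B_def)
          moreover have "ennreal (exp (t * V x)) \<le> ennreal (exp (t * \<psi>))" using le t0 by (intro ennreal_leI) simp
          ultimately show ?thesis using \<open>x \<in> S r'\<close> by (simp add: add_increasing2)
        next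
          case False
          then have "t * V x \<le> t * (\<psi> / 2)" using t0 by (intro mult_left_mono) auto
          then have "ennreal (exp (t * V x)) \<le> ennreal (exp (t * \<psi> / 2))" by (intro ennreal_leI) simp
          then show ?thesis using \<open>x \<in> S r'\<close> inS by (simp add: add_increasing)
        qed
      qed simp
    qed
  qed
  also have "\<dots> = ennreal (exp (t * \<psi>)) * emeasure M B + ennreal (exp (t * \<psi> / 2)) * emeasure M (S \<rho>1)"
    by (simp add: nn_integral_add nn_integral_cmult)
  also have "\<dots> \<le> ennreal (exp (t * \<psi>)) * ennreal (D / (\<psi> / 2)) + ennreal (exp (t * \<psi> / 2)) * 1"
    by (intro add_mono mult_left_mono S_le_1) (use D(2)[of "\<psi> / 2"] \<psi>0 in \<open>auto simp: B_def\<close>)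
  also have "\<dots> = ennreal (exp (t * \<psi>) * (2 * D / \<psi>) + exp (t * \<psi> / 2))"
    using \<psi>0 D(1) by (simp add: ennreal_mult[symmetric] ennreal_plus[symmetric] mult.commute del: ennreal_plus)
  also have "\<dots> \<le> ennreal (2 * exp (t * \<psi> / 2))"
  proof (rule ennreal_leI)
    have "2 * D * exp (t * \<psi> / 2) \<le> 2 * D * exp (\<gamma> * X / 2)" using t\<psi> D(1) by (intro mult_left_mono) auto
    also have "\<dots> \<le> \<psi>" by (rule \<psi>X)
    finally have "exp (t * \<psi> / 2) * (2 * D / \<psi>) \<le> 1" using \<psi>0 by (simp add: field_simps)
    then have "exp (t * \<psi> / 2) * (exp (t * \<psi> / 2) * (2 * D / \<psi>)) \<le> exp (t * \<psi> / 2) * 1"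
      by (intro mult_left_mono) auto
    moreover have "exp (t * \<psi>) = exp (t * \<psi> / 2) * exp (t * \<psi> / 2)" by (simp add: exp_add[symmetric])
    ultimately show "exp (t * \<psi>) * (2 * D / \<psi>) + exp (t * \<psi> / 2) \<le> 2 * exp (t * \<psi> / 2)"
      by (simp add: mult.assoc)
  qed
  finally have "AE x in M. x \<in> S r \<longrightarrow> t * V x \<le> ln (2 * exp (t * \<psi> / 2)) + moser_error m \<gamma> K (r' - r)"
    by (intro moser_iteration[OF t(1) t1 r]) auto
  then show ?thesis
  proof eventually_elim
    case (elim x)
    show ?case
    proof
      assume "x \<in> S r"
      then have "t * V x \<le> ln 2 + t * \<psi> / 2 + E" using elim by (simp add: ln_mult E_def)
      also have "\<dots> \<le> t * (3 / 4 * \<psi>)" 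
      proof -
        have "a + z / 2 + b \<le> 3 / 4 * z" if "4 * (b + a) \<le> z" for a b z :: real using that by (simp add: field_simps)
        from this[of E "ln 2" "t * \<psi>"] show ?thesis using t\<psi>(1) by (simp add: X_def mult.left_commute)
      qed
      finally show "V x \<le> 3 / 4 * \<psi>" using t0 by simp
    qed
  qed
qed

text \<open>Both the finiteness of the integral and the bound it yields are only qualitative. They
  give some level, reached by the thresholds at some radius \<open>r n\<close>; descending from
  there, every crossover step lowers the bound from one threshold to the next, and the final level
  depends on the constants alone.\<close>

theorem bombieri_giusti:
  assumes D: "1 \<le> D" "\<And>s. 0 < s \<Longrightarrow> emeasure M {x \<in> S \<rho>1. s < V x} \<le> ennreal (D / s)"
    and fin: "t \<in> T" "t \<le> 1" "(\<integral>\<^sup>+ x. ennreal (exp (t * V x)) * indicator (S \<rho>1) x \<partial>M) < \<infinity>"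
  shows "AE x in M. x \<in> S \<rho>0 \<longrightarrow> V x \<le> crossover_bound m \<gamma> K D ((\<rho>1 - \<rho>0) / 2 * (1 - contraction_ratio m \<gamma>))"
proof -
  \<comment> \<open>The outer half of the gap is spent on the qualitative bound, the inner half on
    the crossover steps.\<close>
  define R where "R = (\<rho>1 - \<rho>0) / 2"
  define lam where "lam = contraction_ratio m \<gamma>"
  define F where "F = crossover_bound m \<gamma> K D (R * (1 - lam))"
  define G where "G = (\<Sum>i. (1 / \<gamma>) ^ i)"
  have R: "0 < R" "R \<le> 1" using \<rho> by (auto simp: R_def)
  have G: "0 < G" unfolding G_def using \<gamma> geometric_sums(1) by (intro suminf_pos) auto
  define \<kappa> where "\<kappa> = 2 * \<gamma> * m * G"
  have \<kappa>: "0 < \<kappa>" using \<gamma> m G by (simp add: \<kappa>_def)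
  have lam_def': "lam = (3 / 4) powr (1 / \<kappa>)" by (simp add: lam_def contraction_ratio_def \<kappa>_def G_def)
  have lam: "0 < lam" "lam < 1"
  proof -
    have "(3 / 4) powr (1 / \<kappa>) < (1::real) powr (1 / \<kappa>)" using \<kappa> by (intro powr_less_mono2) auto
    then show "lam < 1" by (simp add: lam_def')
  qed (simp add: lam_def')
  define \<delta> where "\<delta> k = R * (1 - lam) * lam ^ k" for k :: nat
  \<comment> \<open>The radii are spaced so that the thresholds form an exact geometric sequence
    with ratio 4/3.\<close>
  have cross: "crossover_bound m \<gamma> K D (\<delta> k) = F * (4 / 3) ^ k" for k
  proof -
    have "ln (4 * K / \<delta> k) = ln (4 * K / (R * (1 - lam))) - real k * ln lam"
      unfolding \<delta>_def using R lam K by (simp add: ln_div ln_mult ln_realpow)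
    moreover have "ln lam = - (ln (4 / 3) / \<kappa>)" using \<kappa> by (simp add: lam_def' ln_powr ln_div field_simps)
    ultimately have "moser_error m \<gamma> K (\<delta> k) = moser_error m \<gamma> K (R * (1 - lam)) + m * G * (real k * ln (4 / 3) / \<kappa>)"
      by (simp add: moser_error_def G_def[symmetric] algebra_simps)
    then have "2 * \<gamma> * (moser_error m \<gamma> K (\<delta> k) + ln 2)
       = 2 * \<gamma> * (moser_error m \<gamma> K (R * (1 - lam)) + ln 2) + \<kappa> * (real k * ln (4 / 3) / \<kappa>)"
      by (simp add: \<kappa>_def algebra_simps)
    also have "\<dots> = 2 * \<gamma> * (moser_error m \<gamma> K (R * (1 - lam)) + ln 2) + real k * ln (4 / 3)"
      using \<kappa> by simp
    finally show ?thesis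
      by (simp add: crossover_bound_def F_def exp_add exp_of_nat_mult)
  qed
  have F0: "0 < F" using D(1) by (simp add: F_def crossover_bound_def)
  define r where "r k = \<rho>0 + R * (1 - lam ^ k)" for k :: nat
  obtain \<Psi> where \<Psi>: "AE x in M. x \<in> S (\<rho>0 + R) \<longrightarrow> V x \<le> \<Psi>"
  proof -
    define J where "J = enn2real (\<integral>\<^sup>+ x. ennreal (exp (t * V x)) * indicator (S \<rho>1) x \<partial>M) + 1"
    have "AE x in M. x \<in> S (\<rho>0 + R) \<longrightarrow> t * V x \<le> ln J + moser_error m \<gamma> K (\<rho>1 - (\<rho>0 + R))"
    proof (rule moser_iteration[OF fin(1,2)])
      show "(\<integral>\<^sup>+ x. ennreal (exp (t * V x)) * indicator (S \<rho>1) x \<partial>M) \<le> ennreal J"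
        unfolding J_def using fin(3) by (cases "\<integral>\<^sup>+ x. ennreal (exp (t * V x)) * indicator (S \<rho>1) x \<partial>M") (auto intro: ennreal_leI)
      show "0 < J" by (simp add: J_def add_nonneg_pos)
    qed (use \<rho> R in \<open>auto simp: R_def field_simps\<close>)
    then have "AE x in M. x \<in> S (\<rho>0 + R) \<longrightarrow> V x \<le> (ln J + moser_error m \<gamma> K (\<rho>1 - (\<rho>0 + R))) / t"
      by eventually_elim (use T_pos[OF fin(1)] in \<open>auto simp: field_simps\<close>)
    then show ?thesis by (rule that)
  qed
  obtain n where n: "\<Psi> \<le> F * (4 / 3) ^ n"
  proof -
    obtain n where "\<Psi> / F < (4 / 3) ^ n" using real_arch_pow[of "4/3" "\<Psi> / F"] by auto
    then show ?thesis using F0 that[of n] by (simp add: field_simps)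
  qed
  \<comment> \<open>The induction goes inwards from \<open>r n\<close> to \<open>r 0\<close>, the
    radius \<open>\<rho>0\<close>, at which the bound is the lowest threshold
    \<open>F\<close>.\<close>
  have "k \<le> n \<Longrightarrow> AE x in M. x \<in> S (r (n - k)) \<longrightarrow> V x \<le> F * (4 / 3) ^ (n - k)" for k
  proof (induction k)
    case 0
    have "r n \<le> \<rho>0 + R" using R lam by (simp add: r_def field_simps)
    then have "S (r n) \<subseteq> S (\<rho>0 + R)" by (rule S_mono)
    then show ?case using \<Psi> n by (auto elim!: eventually_mono)
  next
    case (Suc k)
    define j where "j = n - Suc k"
    have j: "n - k = Suc j" using Suc by (simp add: j_def)
    have diff: "r (Suc j) - r j = \<delta> j" by (simp add: r_def \<delta>_def algebra_simps)
    have "AE x in M. x \<in> S (r j) \<longrightarrow> V x \<le> 3 / 4 * (F * (4 / 3) ^ Suc j)"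
    proof (rule crossover_step[OF _ _ _ D])
      show "crossover_bound m \<gamma> K D (r (Suc j) - r j) \<le> F * (4 / 3) ^ Suc j"
        unfolding diff cross using F0 by simp
      show "AE x in M. x \<in> S (r (Suc j)) \<longrightarrow> V x \<le> F * (4 / 3) ^ Suc j" using Suc j by simp
      have "0 < \<delta> j" using R lam by (simp add: \<delta>_def)
      then show "r j < r (Suc j)" using diff by linarith
      show "\<rho>0 \<le> r j" using R lam by (simp add: r_def power_le_one)
      have "R * (1 - lam ^ Suc j) \<le> R * 1" using R lam by (intro mult_left_mono) auto
      then have "r (Suc j) \<le> \<rho>0 + R" by (simp only: r_def)
      then show "r (Suc j) \<le> \<rho>1" using \<rho> by (simp add: R_def field_simps)
    qed
    then show ?case by (simp add: j_def[symmetric])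
  qed
  from this[of n] show ?thesis by (simp add: r_def F_def R_def lam_def)
qed

end

subsection \<open>Smooth functions and cutoffs\<close>

text \<open>\<open>Ck_closure\<close> without continuous extension to the boundary. In this form the
  class passes to open subsets and unions, products and compositions. On the whole space it implies
  the original class, which is what test functions need.\<close>

fun Ck :: "nat \<Rightarrow> 'a::euclidean_space set \<Rightarrow> ('a \<Rightarrow> real) \<Rightarrow> bool" where
  "Ck 0 S f \<longleftrightarrow> continuous_on S f"
| "Ck (Suc k) S f \<longleftrightarrow> continuous_on S f \<and> (\<forall>x\<in>S. f differentiable at x) \<and>
     (\<forall>v. Ck k S (\<lambda>x. frechet_derivative f (at x) v))"

lemma Ck_imp_continuous: "Ck k S f \<Longrightarrow> continuous_on S f"
  by (cases k) auto

lemma Ck_Suc_imp_Ck: "Ck (Suc k) S f \<Longrightarrow> Ck k S f"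
proof (induction k arbitrary: f)
  case (Suc k)
  then have "Ck k S (\<lambda>x. frechet_derivative f (at x) v)" for v by simp
  then show ?case using Suc.prems by simp
qed simp

lemma Ck_closure_imp_Ck: "Ck_closure k S f \<Longrightarrow> Ck k S f"
proof -
  have ext: "continuous_on S h" if ex: "\<exists>g. continuous_on (closure S) g \<and> (\<forall>x\<in>S. g x = h x)" for h :: "'a \<Rightarrow> real"
  proof -
    obtain g where g: "continuous_on (closure S) g" "\<forall>x\<in>S. g x = h x" using ex by (elim exE conjE)
    have "continuous_on S g" by (rule continuous_on_subset[OF g(1) closure_subset])
    then show ?thesis by (rule continuous_on_eq) (use g(2) in blast)
  qed
  show "Ck_closure k S f \<Longrightarrow> Ck k S f"
  proof (induction k arbitrary: f)
    case 0
    then show ?case unfolding Ck_closure.simps Ck.simps by (rule ext)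
  next
    case (Suc k)
    note S = Suc.prems[unfolded Ck_closure.simps]
    show ?case unfolding Ck.simps using ext[OF conjunct1[OF S]] conjunct2[OF S] Suc.IH by blast
  qed
qed

lemma Ck_UNIV_imp_Ck_closure: "Ck k UNIV f \<Longrightarrow> Ck_closure k UNIV f"
proof (induction k arbitrary: f)
  case 0
  then have "continuous_on (closure UNIV) f" by (simp only: Ck.simps closure_UNIV)
  then show ?case unfolding Ck_closure.simps by blast
next
  case (Suc k)
  note S = Suc.prems[unfolded Ck.simps]
  have "continuous_on (closure UNIV) f" using S by (simp only: closure_UNIV)
  then show ?case unfolding Ck_closure.simps using S Suc.IH by blast
qed

lemma frechet_derivative_eq: "(f has_derivative f') (at x) \<Longrightarrow> frechet_derivative f (at x) = f'"
  by (rule frechet_derivative_at[symmetric])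

lemma Ck_cong:
  assumes "open S" "\<And>x. x \<in> S \<Longrightarrow> f x = g x" "Ck k S f"
  shows "Ck k S g"
  using assms(2,3)
proof (induction k arbitrary: f g)
  case 0
  then show ?case by (auto cong: continuous_on_cong)
next
  case (Suc k)
  have d: "(g has_derivative frechet_derivative f (at x)) (at x)" if "x \<in> S" for x
    using Suc.prems that
    by (intro has_derivative_transform_within_open[of f _ x UNIV S g]) (auto simp: assms(1) frechet_derivative_works[symmetric])
  have "Ck k S (\<lambda>x. frechet_derivative g (at x) v)" for v
    by (rule Suc.IH[of "\<lambda>x. frechet_derivative f (at x) v"]) (use Suc.prems frechet_derivative_eq[OF d] in auto)
  then show ?case using Suc.prems d by (auto simp: differentiable_def cong: continuous_on_cong)
qed

lemma Ck_subset: "Ck k S f \<Longrightarrow> T \<subseteq> S \<Longrightarrow> Ck k T f"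
  by (induction k arbitrary: f) (auto intro: continuous_on_subset)

lemma Ck_Un: "open S \<Longrightarrow> open T \<Longrightarrow> Ck k S f \<Longrightarrow> Ck k T f \<Longrightarrow> Ck k (S \<union> T) f"
  by (induction k arbitrary: f) (auto intro: continuous_on_open_Un)

lemma Ck_const: "Ck k S (\<lambda>x. c)"
  by (induction k arbitrary: c) auto

lemma Ck_SucI:
  assumes "open S" "\<And>x. x \<in> S \<Longrightarrow> (f has_derivative D x) (at x)" "\<And>v. Ck k S (\<lambda>x. D x v)"
  shows "Ck (Suc k) S f"
proof -
  have "f differentiable at x" if "x \<in> S" for x using assms(2)[OF that] differentiable_def by blast
  moreover have "continuous_on S f"
    using assms(2) by (intro has_derivative_continuous_on) (auto intro: has_derivative_at_withinI)
  moreover have "Ck k S (\<lambda>x. frechet_derivative f (at x) v)" for v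
    by (rule Ck_cong[OF assms(1) _ assms(3)[of v]]) (simp add: frechet_derivative_eq[OF assms(2)])
  ultimately show ?thesis by simp
qed

lemma Ck_SucD: "Ck (Suc k) S f \<Longrightarrow> x \<in> S \<Longrightarrow> (f has_derivative frechet_derivative f (at x)) (at x)"
  by (simp add: frechet_derivative_works[symmetric])

lemma Ck_add: "open S \<Longrightarrow> Ck k S f \<Longrightarrow> Ck k S g \<Longrightarrow> Ck k S (\<lambda>x. f x + g x)"
proof (induction k arbitrary: f g)
  case (Suc k)
  show ?case
  proof (rule Ck_SucI[OF Suc.prems(1)])
    show "((\<lambda>x. f x + g x) has_derivative (\<lambda>v. frechet_derivative f (at x) v + frechet_derivative g (at x) v)) (at x)"
      if "x \<in> S" for x
      by (rule has_derivative_add[OF Ck_SucD[OF Suc.prems(2) that] Ck_SucD[OF Suc.prems(3) that]])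
    show "Ck k S (\<lambda>x. frechet_derivative f (at x) v + frechet_derivative g (at x) v)" for v
      by (rule Suc.IH[OF Suc.prems(1)]) (use Suc.prems in simp_all)
  qed
qed (simp add: continuous_on_add)

lemma Ck_mult: "open S \<Longrightarrow> Ck k S f \<Longrightarrow> Ck k S g \<Longrightarrow> Ck k S (\<lambda>x. f x * g x)"
proof (induction k arbitrary: f g)
  case (Suc k)
  show ?case
  proof (rule Ck_SucI[OF Suc.prems(1)])
    show "((\<lambda>x. f x * g x) has_derivative (\<lambda>v. f x * frechet_derivative g (at x) v + frechet_derivative f (at x) v * g x)) (at x)"
      if "x \<in> S" for x
      by (rule has_derivative_mult[OF Ck_SucD[OF Suc.prems(2) that] Ck_SucD[OF Suc.prems(3) that]])
    show "Ck k S (\<lambda>x. f x * frechet_derivative g (at x) v + frechet_derivative f (at x) v * g x)" for v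
      by (intro Ck_add Suc.IH Suc.prems(1) Ck_Suc_imp_Ck[OF Suc.prems(2)] Ck_Suc_imp_Ck[OF Suc.prems(3)])
        (use Suc.prems in simp_all)
  qed
qed (simp add: continuous_on_mult)

lemma Ck_prod: "open S \<Longrightarrow> (\<And>i. i \<in> I \<Longrightarrow> Ck k S (f i)) \<Longrightarrow> Ck k S (\<lambda>x. \<Prod>i\<in>I. f i x)"
  by (induction I rule: infinite_finite_induct) (auto intro: Ck_const Ck_mult)

lemma Ck_linear: "open S \<Longrightarrow> bounded_linear f \<Longrightarrow> Ck k S f"
proof (cases k)
  case 0
  assume "bounded_linear f"
  then show ?thesis using 0 by (simp add: linear_continuous_on)
next
  case (Suc j)
  assume "open S" "bounded_linear f"
  then show ?thesis unfolding Suc by (intro Ck_SucI[where D="\<lambda>_. f"]) (auto intro: bounded_linear_imp_has_derivative Ck_const)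
qed

text \<open>The outer function depends on one real variable, so its derivative is multiplication by
  a number. The chain rule then stays inside scalar products and compositions of the same kind, and
  the induction closes.\<close>

lemma Ck_compose: "open S \<Longrightarrow> Ck k UNIV h \<Longrightarrow> Ck k S f \<Longrightarrow> Ck k S (\<lambda>x. h (f x))"
  for h :: "real \<Rightarrow> real"
proof (induction k arbitrary: h f)
  case 0
  then show ?case using continuous_on_compose2[of UNIV h S f] by simp
next
  case (Suc k)
  have dh: "frechet_derivative h (at y) u = frechet_derivative h (at y) 1 * u" for y u
  proof -
    have "linear (frechet_derivative h (at y))" using Suc.prems by (simp add: linear_frechet_derivative)
    from linear_cmul[OF this, of u 1] show ?thesis by (simp add: mult.commute)
  qed
  show ?case
  proof (rule Ck_SucI[OF Suc.prems(1), where D="\<lambda>x v. frechet_derivative h (at (f x)) 1 * frechet_derivative f (at x) v"])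
    fix x assume x: "x \<in> S"
    have "(h \<circ> f has_derivative frechet_derivative h (at (f x)) \<circ> frechet_derivative f (at x)) (at x)"
      by (rule diff_chain_at[OF Ck_SucD[OF Suc.prems(3) x] Ck_SucD[OF Suc.prems(2) UNIV_I]])
    moreover have "frechet_derivative h (at (f x)) \<circ> frechet_derivative f (at x)
        = (\<lambda>v. frechet_derivative h (at (f x)) 1 * frechet_derivative f (at x) v)"
      by (rule ext) (unfold o_def, rule dh)
    ultimately show "((\<lambda>x. h (f x)) has_derivative (\<lambda>v. frechet_derivative h (at (f x)) 1 * frechet_derivative f (at x) v)) (at x)"
      by (simp add: o_def)
  next
    fix v
    show "Ck k S (\<lambda>x. frechet_derivative h (at (f x)) 1 * frechet_derivative f (at x) v)"
    proof (rule Ck_mult[OF Suc.prems(1)])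
      show "Ck k S (\<lambda>x. frechet_derivative h (at (f x)) 1)"
        by (rule Suc.IH[OF Suc.prems(1) _ Ck_Suc_imp_Ck[OF Suc.prems(3)]]) (use Suc.prems(2) in simp)
      show "Ck k S (\<lambda>x. frechet_derivative f (at x) v)" using Suc.prems(3) by simp
    qed
  qed
qed

lemma Ck_real_SucI:
  fixes h :: "real \<Rightarrow> real"
  assumes h: "\<And>t. (h has_real_derivative h' t) (at t)" and "Ck k UNIV h'"
  shows "Ck (Suc k) UNIV h"
proof (rule Ck_SucI[OF open_UNIV])
  show "(h has_derivative (\<lambda>v. h' x * v)) (at x)" for x
    using h[of x] by (simp add: has_field_derivative_def)
  show "Ck k UNIV (\<lambda>x. h' x * v)" for v
    by (rule Ck_mult[OF open_UNIV assms(2) Ck_const])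
qed

text \<open>
  Polynomials in \<open>tanh\<close> are bounded, smooth and closed under differentiation. By Weierstrass they
  approximate the nonlinear functions needed in the test functions, so no mollifier is required.
\<close>

lemma poly_tanh_deriv:
  "((\<lambda>t::real. poly P (tanh t)) has_real_derivative poly (pderiv P * [:1, 0, -1:]) (tanh t)) (at t)"
proof -
  have "cosh t \<noteq> 0" by (simp add: less_imp_neq[OF cosh_real_pos, symmetric])
  then have "(tanh has_real_derivative 1 - (tanh t)\<^sup>2) (at t)"
    using has_field_derivative_tanh[of "\<lambda>x. x" t 1 UNIV] by simp
  from DERIV_chain2[OF poly_DERIV this]
  show ?thesis by (simp add: power2_eq_square right_diff_distrib mult_ac)
qed

lemma Ck_poly_tanh: "Ck k UNIV (\<lambda>t::real. poly P (tanh t))"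
proof (induction k arbitrary: P)
  case 0
  have "isCont (\<lambda>t::real. poly P (tanh t)) t" for t by (rule DERIV_isCont[OF poly_tanh_deriv])
  then show ?case by (simp add: continuous_at_imp_continuous_on)
next
  case (Suc k)
  show ?case by (rule Ck_real_SucI[OF poly_tanh_deriv Suc])
qed

section \<open>A smooth step function from the function exp (-1/x)\<close>

definition flat_exp :: "real poly \<Rightarrow> real \<Rightarrow> real" where
  "flat_exp P x = (if 0 < x then poly P (1 / x) * exp (- (1 / x)) else 0)"

lemma poly_exp_limit: "((\<lambda>y. poly P y * exp (- y)) \<longlongrightarrow> 0) at_top" for P :: "real poly"
proof -
  have "((\<lambda>y. \<Sum>i\<le>degree P. coeff P i * (y ^ i / exp y)) \<longlongrightarrow> (\<Sum>i\<le>degree P. coeff P i * 0)) at_top"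
    by (intro tendsto_intros tendsto_power_div_exp_0)
  then show ?thesis by (simp add: poly_altdef sum_distrib_right exp_minus divide_inverse mult.assoc)
qed

text \<open>With y = 1/x, differentiation turns P(y) exp(-y) into y^2 (P(y) - P'(y)) exp(-y).
  Allowing an arbitrary polynomial therefore makes the family closed under differentiation, and
  smoothness is a plain induction.\<close>

lemma flat_exp_deriv:
  "(flat_exp P has_real_derivative flat_exp ([:0, 0, 1:] * (P - pderiv P)) x) (at x)"
proof -
  consider "0 < x" | "x < 0" | "x = 0" by linarith
  then show ?thesis
  proof cases
    case 1
    have "((\<lambda>x. poly P (1 / x) * exp (- (1 / x))) has_real_derivative flat_exp ([:0, 0, 1:] * (P - pderiv P)) x) (at x)"
      using 1 by (auto intro!: derivative_eq_intros poly_DERIV[THEN DERIV_chain2]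
          simp: flat_exp_def power2_eq_square field_simps)
    then show ?thesis
      by (rule has_field_derivative_transform_within_open[where S="{0<..}"]) (use 1 in \<open>auto simp: flat_exp_def\<close>)
  next
    case 2
    have "((\<lambda>x. 0) has_real_derivative flat_exp ([:0, 0, 1:] * (P - pderiv P)) x) (at x)"
      using 2 by (simp add: flat_exp_def)
    then show ?thesis
      by (rule has_field_derivative_transform_within_open[where S="{..<0}"]) (use 2 in \<open>auto simp: flat_exp_def\<close>)
  next
    case 3
    have right: "((\<lambda>h. flat_exp P h / h) \<longlongrightarrow> 0) (at_right 0)"
    proof -
      \<comment> \<open>The difference quotient at 0 is again of the form polynomial in 1/h times
        exp(-1/h), with one more factor 1/h.\<close>
      have "((\<lambda>h. poly (P * [:0, 1:]) (inverse h) * exp (- inverse h)) \<longlongrightarrow> 0) (at_right 0)"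
        by (rule filterlim_compose[OF poly_exp_limit filterlim_inverse_at_top_right])
      moreover have "eventually (\<lambda>h. poly (P * [:0, 1:]) (inverse h) * exp (- inverse h) = flat_exp P h / h) (at_right 0)"
        using eventually_at_right_less[of "0::real"] by eventually_elim (simp add: flat_exp_def field_simps)
      ultimately show ?thesis by (rule Lim_transform_eventually)
    qed
    have left: "((\<lambda>h. flat_exp P h / h) \<longlongrightarrow> 0) (at_left 0)"
    proof (rule Lim_transform_eventually[OF tendsto_const])
      show "eventually (\<lambda>h. 0 = flat_exp P h / h) (at_left 0)"
        unfolding eventually_at_filter by (auto simp: flat_exp_def)
    qed
    have "((\<lambda>h. flat_exp P h / h) \<longlongrightarrow> 0) (at 0)"
      using left right by (simp add: filterlim_split_at)
    then show ?thesis using 3 by (simp add: DERIV_def flat_exp_def)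
  qed
qed

lemma Ck_flat_exp: "Ck k UNIV (flat_exp P)"
proof (induction k arbitrary: P)
  case 0
  have "isCont (flat_exp P) x" for x using flat_exp_deriv by (rule DERIV_isCont)
  then show ?case by (simp add: continuous_at_imp_continuous_on)
next
  case (Suc k)
  show ?case by (rule Ck_real_SucI[OF flat_exp_deriv Suc])
qed

lemma continuous_antiderivative:
  fixes g :: "real \<Rightarrow> real"
  assumes "continuous_on UNIV g"
  obtains F where "\<And>t. (F has_real_derivative g t) (at t)" "F 0 = 0"
proof -
  obtain F where F: "\<And>x::real. (F has_vector_derivative g x) (at x)"
    using einterval_antiderivative[of "-\<infinity>" "\<infinity>" g] assms by (auto simp: continuous_on_eq_continuous_at)
  show ?thesis
  proof (rule that[of "\<lambda>t. F t - F 0"])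
    fix t show "((\<lambda>t. F t - F 0) has_real_derivative g t) (at t)"
      using F[of t] by (auto intro!: derivative_eq_intros simp: has_real_derivative_iff_has_vector_derivative)
  qed simp
qed

text \<open>The step is the normalised antiderivative of a bump supported in the unit interval.
  Smoothness of the antiderivative is inherited from that of the bump.\<close>

lemma smooth_step_exists:
  obtains \<sigma> \<sigma>' :: "real \<Rightarrow> real" and L
  where "\<And>k. Ck k UNIV \<sigma>" "\<And>t. t \<le> 0 \<Longrightarrow> \<sigma> t = 0" "\<And>t. 1 \<le> t \<Longrightarrow> \<sigma> t = 1"
    "\<And>t. 0 \<le> \<sigma> t" "\<And>t. \<sigma> t \<le> 1" "\<And>t. (\<sigma> has_real_derivative \<sigma>' t) (at t)" "\<And>t. \<bar>\<sigma>' t\<bar> \<le> L" "0 < L"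
proof -
  define g where "g t = flat_exp 1 t * flat_exp 1 (1 - t)" for t
  have Ckg: "Ck k UNIV g" for k
    unfolding g_def
  proof (intro Ck_mult Ck_flat_exp open_UNIV)
    have "Ck k UNIV (\<lambda>t::real. 1 + (-1) * t)"
      by (intro Ck_add Ck_mult Ck_const Ck_linear bounded_linear_ident open_UNIV)
    then have "Ck k UNIV (\<lambda>t::real. 1 - t)" by simp
    then show "Ck k UNIV (\<lambda>t. flat_exp 1 (1 - t))" by (rule Ck_compose[OF open_UNIV Ck_flat_exp])
  qed
  have cont: "continuous_on UNIV g" using Ckg[of 0] by simp
  have g0: "0 \<le> g t" for t by (simp add: g_def flat_exp_def)
  have gpos: "0 < g t" if "0 < t" "t < 1" for t using that by (simp add: g_def flat_exp_def)
  have gz: "g t = 0" if "t \<le> 0 \<or> 1 \<le> t" for t using that by (auto simp: g_def flat_exp_def)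
  obtain F where F: "\<And>t. (F has_real_derivative g t) (at t)" "F 0 = 0"
    using continuous_antiderivative[OF cont] by blast
  have F_mono: "F s \<le> F t" if "s \<le> t" for s t
    by (rule DERIV_nonneg_imp_nondecreasing[OF that]) (rule exI, rule conjI[OF F(1) g0])
  have F1: "0 < F 1"
  proof -
    have "F 0 < F 1"
    proof (rule DERIV_pos_imp_increasing_open[of 0 1 F])
      show "continuous_on {0..1} F" by (rule DERIV_continuous_on) (rule has_field_derivative_at_within[OF F(1)])
      show "\<exists>y. (F has_real_derivative y) (at x) \<and> 0 < y" if "0 < x" "x < 1" for x
        using F(1)[of x] gpos[OF that] by blast
    qed simp
    then show ?thesis using F(2) by simp
  qed
  have F_left: "F t = 0" if "t \<le> 0" for t
  proof -
    have "F 0 \<le> F t"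
    proof (rule DERIV_nonpos_imp_nonincreasing[OF that])
      fix x assume "t \<le> x" "x \<le> 0"
      then show "\<exists>y. (F has_real_derivative y) (at x) \<and> y \<le> 0" using F(1)[of x] gz[of x] by auto
    qed
    then show ?thesis using F_mono[OF that] F(2) by simp
  qed
  have F_right: "F t = F 1" if "1 \<le> t" for t
  proof -
    have "F t \<le> F 1"
    proof (rule DERIV_nonpos_imp_nonincreasing[OF that])
      fix x assume "1 \<le> x" "x \<le> t"
      then show "\<exists>y. (F has_real_derivative y) (at x) \<and> y \<le> 0" using F(1)[of x] gz[of x] by auto
    qed
    then show ?thesis using F_mono[OF that] by simp
  qed
  have F_bd: "0 \<le> F t" "F t \<le> F 1" for t
  proof -
    show "0 \<le> F t" using F_mono[of 0 t] F_left[of t] F(2) by (cases "t \<le> 0") auto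
    show "F t \<le> F 1" using F_mono[of t 1] F_right[of t] by (cases "1 \<le> t") auto
  qed
  have "bounded (g ` {0..1})"
    by (intro compact_imp_bounded compact_continuous_image continuous_on_subset[OF cont]) auto
  then obtain B where B: "\<forall>t\<in>{0..1}. \<bar>g t\<bar> \<le> B" unfolding bounded_iff by auto
  have B': "\<bar>g t\<bar> \<le> \<bar>B\<bar>" for t
  proof (cases "t \<in> {0..1}")
    case True
    then have "\<bar>g t\<bar> \<le> B" using B by (rule bspec[rotated])
    then show ?thesis by linarith
  next
    case False
    then have "g t = 0" by (intro gz) auto
    then show ?thesis by simp
  qed
  have CkF: "Ck k UNIV F" for k
    by (rule Ck_Suc_imp_Ck[OF Ck_real_SucI[OF F(1) Ckg]])
  show ?thesis
  \<comment> \<open>The summand 1 makes the bound of the derivative strictly positive regardless of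
    which bound \<open>B\<close> was obtained.\<close>
  proof (rule that[of "\<lambda>t. inverse (F 1) * F t" "\<lambda>t. inverse (F 1) * g t" "\<bar>B\<bar> / F 1 + 1"])
    show "Ck k UNIV (\<lambda>t. inverse (F 1) * F t)" for k by (intro Ck_mult Ck_const CkF open_UNIV)
    show "((\<lambda>t. inverse (F 1) * F t) has_real_derivative inverse (F 1) * g t) (at t)" for t by (rule DERIV_cmult[OF F(1)])
    show "\<bar>inverse (F 1) * g t\<bar> \<le> \<bar>B\<bar> / F 1 + 1" for t
      using B'[of t] F1 by (simp add: abs_mult field_simps)
    show "0 < \<bar>B\<bar> / F 1 + 1" using F1 by (simp add: add_nonneg_pos)
    show "inverse (F 1) * F t = 0" if "t \<le> 0" for t using F_left[OF that] by simp
    show "inverse (F 1) * F t = 1" if "1 \<le> t" for t using F_right[OF that] F1 by simp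
    show "0 \<le> inverse (F 1) * F t" for t using F_bd(1)[of t] F1 by simp
    show "inverse (F 1) * F t \<le> 1" for t using F_bd(2)[of t] F1 by (simp add: field_simps)
  qed
qed

section \<open>Gradients, cutoffs of cubes and test functions\<close>

lemma grad_eqI: "(f has_derivative (\<lambda>v. g \<bullet> v)) (at x) \<Longrightarrow> grad f x = g"
  unfolding grad_def by (simp add: frechet_derivative_eq inner_axis vec_eq_iff)

lemma grad_works:
  assumes "f differentiable at x"
  shows "(f has_derivative (\<lambda>v. grad f x \<bullet> v)) (at x)"
proof -
  have lin: "linear (frechet_derivative f (at x))" using assms by (rule linear_frechet_derivative)
  have "frechet_derivative f (at x) v = grad f x \<bullet> v" for v
  proof -
    have "frechet_derivative f (at x) v = frechet_derivative f (at x) (\<Sum>i\<in>UNIV. v $ i *\<^sub>R axis i 1)"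
      by (simp add: basis_expansion[of v, unfolded scalar_mult_eq_scaleR])
    also have "\<dots> = grad f x \<bullet> v"
      by (simp add: linear_sum[OF lin] linear_cmul[OF lin] grad_def inner_vec_def mult.commute)
    finally show ?thesis .
  qed
  then have "frechet_derivative f (at x) = (\<lambda>v. grad f x \<bullet> v)" by auto
  then show ?thesis using assms by (metis frechet_derivative_works)
qed

text \<open>The derivative is evaluated in the direction of the gradient itself.\<close>

lemma norm_grad_le:
  assumes "(f has_derivative D) (at x)" "\<And>v. \<bar>D v\<bar> \<le> C * norm v"
  shows "norm (grad f x) \<le> C"
proof -
  have "f differentiable at x" using assms(1) differentiable_def by blast
  then have "D = (\<lambda>v. grad f x \<bullet> v)" using grad_works assms(1) has_derivative_unique by blast
  then have "norm (grad f x) * norm (grad f x) \<le> C * norm (grad f x)"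
    using assms(2)[of "grad f x"] by (simp add: dot_square_norm power2_eq_square)
  moreover have "0 \<le> C" using order_trans[OF abs_ge_zero assms(2)[of "axis undefined 1"]] by simp
  ultimately show ?thesis by (cases "norm (grad f x) = 0") auto
qed

lemma in_cube_iff: "x \<in> cube \<rho> \<longleftrightarrow> (\<forall>i. - \<rho> / 2 < x $ i \<and> x $ i < \<rho> / 2)"
  by (simp add: cube_def mem_box_cart)

lemma open_cube: "open (cube \<rho>)" by (simp add: cube_def open_box)

text \<open>A product of two steps per coordinate, one for each of the opposite faces. The constant
  precedes the radii in the quantifiers because the final constant may depend on it but not on the
  radii of the iteration.\<close>

lemma cutoff_exists:
  "\<exists>L>0. \<forall>\<rho> \<rho>'. \<rho> < \<rho>' \<longrightarrow> (\<exists>\<eta> :: real ^ 'n \<Rightarrow> real.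
     (\<forall>k. Ck k UNIV \<eta>) \<and> (\<forall>x. 0 \<le> \<eta> x \<and> \<eta> x \<le> 1) \<and> (\<forall>x\<in>cube \<rho>. \<eta> x = 1) \<and> (\<forall>x. x \<notin> cube \<rho>' \<longrightarrow> \<eta> x = 0) \<and>
     (\<forall>x. norm (grad \<eta> x) \<le> L / (\<rho>' - \<rho>)))"
proof (rule smooth_step_exists)
  fix \<sigma> \<sigma>' :: "real \<Rightarrow> real" and L assume \<sigma>: "\<And>k. Ck k UNIV \<sigma>" "\<And>t. t \<le> 0 \<Longrightarrow> \<sigma> t = 0" "\<And>t. 1 \<le> t \<Longrightarrow> \<sigma> t = 1"
    "\<And>t. 0 \<le> \<sigma> t" "\<And>t. \<sigma> t \<le> 1" "\<And>t. (\<sigma> has_real_derivative \<sigma>' t) (at t)" "\<And>t. \<bar>\<sigma>' t\<bar> \<le> L" "0 < L"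
  show ?thesis
  \<comment> \<open>Each step is rescaled by \<open>2 / (\<rho>' - \<rho>)\<close>, so its
    derivative is at most \<open>2 * L / (\<rho>' - \<rho>)\<close>; there are two steps in each of
    the \<open>CARD('n)\<close> coordinates, and all other factors are at most 1.\<close>
  proof (intro exI[of _ "real CARD('n) * (4 * L)"] conjI allI impI)
    show "0 < real CARD('n) * (4 * L)" using \<sigma>(8) by simp
    fix \<rho> \<rho>' :: real assume \<rho>: "\<rho> < \<rho>'"
    define c where "c = 2 / (\<rho>' - \<rho>)"
    have c: "0 < c" using \<rho> by (simp add: c_def)
    define z where "z s x i = \<sigma> (c * (\<rho>' / 2) + (c * s) * (x $ i))" for s and x :: "real^'n" and i
    define \<eta> where "\<eta> x = (\<Prod>i\<in>UNIV. z 1 x i * z (-1) x i)" for x :: "real^'n"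
    have z01: "0 \<le> z s x i" "z s x i \<le> 1" for s x i using \<sigma> by (simp_all add: z_def)
    have zd: "((\<lambda>x. z s x i) has_derivative (\<lambda>v. \<sigma>' (c * (\<rho>' / 2) + (c * s) * (x $ i)) * ((c * s) * v $ i))) (at x)" for s x i
      unfolding z_def
    proof -
      have "((\<lambda>x. c * (\<rho>' / 2) + (c * s) * (x $ i)) has_derivative (\<lambda>v. (c * s) * v $ i)) (at x)"
        by (auto intro!: derivative_eq_intros bounded_linear_imp_has_derivative bounded_linear_vec_nth)
      from DERIV_compose_FDERIV[OF \<sigma>(6) this]
      show "((\<lambda>x. \<sigma> (c * (\<rho>' / 2) + (c * s) * (x $ i))) has_derivative (\<lambda>v. \<sigma>' (c * (\<rho>' / 2) + (c * s) * (x $ i)) * ((c * s) * v $ i))) (at x)"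
        by (rule has_derivative_eq_rhs) (rule ext, rule mult.commute)
    qed
    have zCk: "Ck k UNIV (\<lambda>x. z s x i)" for k s i
      unfolding z_def
      by (rule Ck_compose[OF open_UNIV \<sigma>(1)], rule Ck_add[OF open_UNIV Ck_const],
          rule Ck_mult[OF open_UNIV Ck_const], rule Ck_linear[OF open_UNIV bounded_linear_vec_nth])
    show "\<exists>\<eta> :: real ^ 'n \<Rightarrow> real. (\<forall>k. Ck k UNIV \<eta>) \<and> (\<forall>x. 0 \<le> \<eta> x \<and> \<eta> x \<le> 1) \<and> (\<forall>x\<in>cube \<rho>. \<eta> x = 1) \<and>
       (\<forall>x. x \<notin> cube \<rho>' \<longrightarrow> \<eta> x = 0) \<and> (\<forall>x. norm (grad \<eta> x) \<le> real CARD('n) * (4 * L) / (\<rho>' - \<rho>))"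
    proof (intro exI[of _ \<eta>] conjI allI ballI impI)
      show "Ck k UNIV \<eta>" for k unfolding \<eta>_def by (intro Ck_prod Ck_mult zCk open_UNIV)
      fix x :: "real^'n"
      show "0 \<le> \<eta> x" unfolding \<eta>_def using z01 by (intro prod_nonneg) auto
      show "\<eta> x \<le> 1" unfolding \<eta>_def using z01 by (intro prod_le_1) (auto intro: mult_le_one)
      {
        assume "x \<in> cube \<rho>"
        then have inx: "- \<rho> / 2 < x $ i \<and> x $ i < \<rho> / 2" for i by (simp add: in_cube_iff)
        have "z 1 x i = 1 \<and> z (-1) x i = 1" for i
        proof -
          have "1 \<le> c * (\<rho>' / 2 + x $ i)" "1 \<le> c * (\<rho>' / 2 - x $ i)"
            using inx[of i] \<rho> by (simp_all add: c_def field_simps)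
          then show ?thesis unfolding z_def by (intro conjI \<sigma>(3)) (simp_all add: algebra_simps)
        qed
        then show "\<eta> x = 1" by (simp add: \<eta>_def)
      }
      {
        assume "x \<notin> cube \<rho>'"
        then obtain i where "x $ i \<le> - \<rho>' / 2 \<or> \<rho>' / 2 \<le> x $ i" by (auto simp: in_cube_iff not_less)
        then have "c * (\<rho>' / 2 + x $ i) \<le> 0 \<or> c * (\<rho>' / 2 - x $ i) \<le> 0" using c by (simp add: mult_le_0_iff) linarith
        then have "z 1 x i = 0 \<or> z (-1) x i = 0"
        proof
          assume "c * (\<rho>' / 2 + x $ i) \<le> 0"
          then have "z 1 x i = 0" unfolding z_def by (intro \<sigma>(2)) (simp add: algebra_simps)
          then show ?thesis ..
        next
          assume "c * (\<rho>' / 2 - x $ i) \<le> 0"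
          then have "z (-1) x i = 0" unfolding z_def by (intro \<sigma>(2)) (simp add: algebra_simps)
          then show ?thesis ..
        qed
        then have "\<exists>i. z 1 x i * z (-1) x i = 0" by auto
        then show "\<eta> x = 0" unfolding \<eta>_def by (intro prod_zero) auto
      }
      define d where "d i v = z 1 x i * (\<sigma>' (c * (\<rho>' / 2) + (c * (-1)) * (x $ i)) * ((c * (-1)) * v $ i))
        + (\<sigma>' (c * (\<rho>' / 2) + (c * 1) * (x $ i)) * ((c * 1) * v $ i)) * z (-1) x i" for i and v :: "real^'n"
      have "(\<eta> has_derivative (\<lambda>v. \<Sum>i\<in>UNIV. d i v * (\<Prod>j\<in>UNIV - {i}. z 1 x j * z (-1) x j))) (at x)"
        unfolding \<eta>_def[abs_def] d_def by (rule has_derivative_prod) (rule has_derivative_mult[OF zd zd])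
      then show "norm (grad \<eta> x) \<le> real CARD('n) * (4 * L) / (\<rho>' - \<rho>)"
      proof (rule norm_grad_le)
        fix v :: "real^'n"
        have summand: "\<bar>a * (s * (k * y)) + (s' * (k' * y)) * b\<bar> \<le> (L * c + L * c) * norm v"
          if "0 \<le> a" "a \<le> 1" "0 \<le> b" "b \<le> 1" "\<bar>s\<bar> \<le> L" "\<bar>s'\<bar> \<le> L" "\<bar>y\<bar> \<le> norm v" "\<bar>k\<bar> = c" "\<bar>k'\<bar> = c" for a b s s' y k k'
        proof -
          have "\<bar>a * (s * (k * y))\<bar> \<le> 1 * (L * (c * norm v))"
            unfolding abs_mult using that \<sigma>(8) c by (intro mult_mono) auto
          moreover have "\<bar>(s' * (k' * y)) * b\<bar> \<le> (L * (c * norm v)) * 1"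
            unfolding abs_mult using that \<sigma>(8) c by (intro mult_mono) auto
          ultimately show ?thesis by (simp add: algebra_simps)
        qed
        have d: "\<bar>d i v\<bar> \<le> (L * c + L * c) * norm v" for i
          unfolding d_def by (rule summand) (use z01 \<sigma>(7) c component_le_norm_cart[of v i] in auto)
        have P: "0 \<le> (\<Prod>j\<in>UNIV - {i}. z 1 x j * z (-1) x j)" "(\<Prod>j\<in>UNIV - {i}. z 1 x j * z (-1) x j) \<le> 1" for i
          using z01 by (auto intro!: prod_nonneg prod_le_1 mult_le_one)
        have "\<bar>\<Sum>i\<in>UNIV. d i v * (\<Prod>j\<in>UNIV - {i}. z 1 x j * z (-1) x j)\<bar>
            \<le> (\<Sum>i\<in>(UNIV::'n set). (L * c + L * c) * norm v)"
        proof (rule order_trans[OF sum_abs], rule sum_mono)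
          fix i :: 'n
          have "\<bar>d i v\<bar> * \<bar>\<Prod>j\<in>UNIV - {i}. z 1 x j * z (-1) x j\<bar> \<le> ((L * c + L * c) * norm v) * 1"
            using d[of i] P[of i] \<sigma>(8) c by (intro mult_mono) auto
          then show "\<bar>d i v * (\<Prod>j\<in>UNIV - {i}. z 1 x j * z (-1) x j)\<bar> \<le> (L * c + L * c) * norm v"
            by (simp add: abs_mult)
        qed
        also have "\<dots> = real CARD('n) * (4 * L) / (\<rho>' - \<rho>) * norm v" by (simp add: c_def)
        finally show "\<bar>\<Sum>i\<in>UNIV. d i v * (\<Prod>j\<in>UNIV - {i}. z 1 x j * z (-1) x j)\<bar> \<le> real CARD('n) * (4 * L) / (\<rho>' - \<rho>) * norm v" .
      qed
    qed
  qed
qed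

text \<open>The approximants are smooth only inside the cube, so a product with a cutoff has to be
  extended by zero. The two open sets \<open>S\<close> and the complement of \<open>K\<close> cover
  the space, and the extension is smooth on each of them.\<close>

lemma test_functionI:
  assumes S: "open S" and K: "compact K" "K \<subseteq> S"
    and Ck: "\<And>k. Ck k S f" and zero: "\<And>x. x \<in> S - K \<Longrightarrow> f x = 0"
  shows "test_function S (\<lambda>x. if x \<in> S then f x else 0)" (is "test_function S ?g")
proof -
  have g_nz: "{x. ?g x \<noteq> 0} \<subseteq> K" using zero by auto
  have cl: "closure {x. ?g x \<noteq> 0} \<subseteq> K" using g_nz K(1) by (simp add: closure_minimal compact_imp_closed)
  have "Ck k UNIV ?g" for k
  proof -
    have "Ck k S ?g" by (rule Ck_cong[OF S _ Ck]) simp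
    moreover have "Ck k (- K) ?g"
      by (rule Ck_cong[OF _ _ Ck_const[of k _ 0]]) (use zero K in \<open>auto simp: compact_imp_closed open_Compl\<close>)
    ultimately have "Ck k (S \<union> - K) ?g" using S K by (intro Ck_Un) (auto simp: compact_imp_closed open_Compl)
    moreover have "S \<union> - K = UNIV" using K by auto
    ultimately show ?thesis by simp
  qed
  then have "smooth_closure UNIV ?g" by (simp add: smooth_closure_def Ck_UNIV_imp_Ck_closure)
  moreover have "compact (closure {x. ?g x \<noteq> 0})"
    using cl K(1) by (metis closed_closure compact_Int_closed inf.absorb_iff2)
  ultimately show ?thesis using cl K by (auto simp: test_function_def)
qed

subsection \<open>Positive semi-definite matrices and polynomials in tanh\<close>

lemma psd_Cauchy_Schwarz:
  fixes A :: "real ^ 'n ^ 'n"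
  assumes sym: "transpose A = A" and psd: "\<And>v. 0 \<le> v \<bullet> (A *v v)"
  shows "(x \<bullet> (A *v y))\<^sup>2 \<le> (x \<bullet> (A *v x)) * (y \<bullet> (A *v y))"
proof -
  have s: "y \<bullet> (A *v x) = x \<bullet> (A *v y)"
    using sym by (metis dot_lmul_matrix inner_commute vector_transpose_matrix)
  define a b c where "a = x \<bullet> (A *v x)" and "b = x \<bullet> (A *v y)" and "c = y \<bullet> (A *v y)"
  have q: "0 \<le> a * t\<^sup>2 + 2 * b * t * r + c * r\<^sup>2" for t r
  proof -
    have "(t *\<^sub>R x + r *\<^sub>R y) \<bullet> (A *v (t *\<^sub>R x + r *\<^sub>R y)) = a * t\<^sup>2 + 2 * b * t * r + c * r\<^sup>2"
      using s by (simp add: a_def b_def c_def matrix_vector_right_distrib matrix_vector_mult_scaleR inner_simps power2_eq_square algebra_simps)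
    then show ?thesis using psd by metis
  qed
  have "b\<^sup>2 \<le> a * c"
  proof (cases "c = 0")
    case True
    show ?thesis
    proof (cases "b = 0")
      case False
      \<comment> \<open>For c = 0 the form is affine in the second coefficient; this choice gives it
        the value -1.\<close>
      have "0 \<le> a * 1\<^sup>2 + 2 * b * 1 * (- (a + 1) / (2 * b)) + c * (- (a + 1) / (2 * b))\<^sup>2" by (rule q)
      then show ?thesis using True False by simp
    qed (simp add: True)
  next
    case False
    then have c: "0 < c" using psd[of y] by (simp add: c_def)
    have "0 \<le> a * c\<^sup>2 + 2 * b * c * (- b) + c * (- b)\<^sup>2" by (rule q)
    also have "\<dots> = c * (a * c - b\<^sup>2)" by (simp add: power2_eq_square algebra_simps)
    finally show ?thesis using c by (simp add: zero_le_mult_iff)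
  qed
  then show ?thesis by (simp add: a_def b_def c_def)
qed

lemma psd_Young:
  fixes A :: "real ^ 'n ^ 'n"
  assumes "transpose A = A" "\<And>v. 0 \<le> v \<bullet> (A *v v)"
  shows "2 * \<bar>x \<bullet> (A *v y)\<bar> \<le> x \<bullet> (A *v x) + y \<bullet> (A *v y)"
proof -
  define a b c where "a = x \<bullet> (A *v x)" and "b = \<bar>x \<bullet> (A *v y)\<bar>" and "c = y \<bullet> (A *v y)"
  have "b\<^sup>2 \<le> a * c" using psd_Cauchy_Schwarz[OF assms, of x y] by (simp add: a_def b_def c_def)
  moreover have "4 * (a * c) \<le> (a + c)\<^sup>2"
    using sum_squares_ge_zero[of "a - c" 0] by (simp add: power2_eq_square algebra_simps)
  ultimately have "(2 * b)\<^sup>2 \<le> (a + c)\<^sup>2" by (simp add: power_mult_distrib)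
  moreover have "0 \<le> a + c" using assms(2)[of x] assms(2)[of y] by (simp add: a_def c_def)
  ultimately have "2 * b \<le> a + c" by (rule power2_le_imp_le)
  then show ?thesis by (simp add: a_def b_def c_def)
qed

section \<open>The spectral norm and its measurability\<close>

lemma bounded_linear_matrix_vector: "bounded_linear (\<lambda>v. (A :: real ^ 'n ^ 'm) *v v)"
  by (simp add: linear_conv_bounded_linear[symmetric])

lemma spectral_norm_nonneg: "0 \<le> spectral_norm A"
  unfolding spectral_norm_def by (rule onorm_pos_le[OF bounded_linear_matrix_vector])

lemma norm_matrix_vector_le: "norm (A *v v) \<le> spectral_norm A * norm v"
  unfolding spectral_norm_def by (rule onorm[OF bounded_linear_matrix_vector])

lemma quadratic_form_le: "v \<bullet> (A *v v) \<le> spectral_norm A * (norm v)\<^sup>2"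
proof -
  have "v \<bullet> (A *v v) \<le> norm v * norm (A *v v)" by (rule norm_cauchy_schwarz)
  also have "\<dots> \<le> norm v * (spectral_norm A * norm v)" by (intro mult_left_mono norm_matrix_vector_le) simp
  finally show ?thesis by (simp add: power2_eq_square mult_ac)
qed

text \<open>With w the image of v under the inverse, (v, v) = (v, A w), and Cauchy-Schwarz in the
  form of A bounds its square by (v, A v) (w, A w), where (w, A w) = (v, w). This is how the norm of
  the inverse controls a gradient by its energy density.\<close>

lemma quadratic_form_inverse_ge:
  fixes A :: "real ^ 'n ^ 'n"
  assumes sym: "transpose A = A" and psd: "\<And>v. 0 \<le> v \<bullet> (A *v v)" and inv: "invertible A"
  shows "(norm v)\<^sup>2 \<le> spectral_norm (matrix_inv A) * (v \<bullet> (A *v v))"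
proof (cases "v = 0")
  case False
  define w where "w = matrix_inv A *v v"
  have Aw: "A *v w = v"
    using someI_ex[OF inv[unfolded invertible_def], folded matrix_inv_def]
    by (simp add: w_def matrix_vector_mul_assoc)
  have "((norm v)\<^sup>2)\<^sup>2 = (v \<bullet> (A *v w))\<^sup>2" by (simp add: Aw dot_square_norm)
  also have "\<dots> \<le> (v \<bullet> (A *v v)) * (w \<bullet> (A *v w))" by (rule psd_Cauchy_Schwarz[OF sym psd])
  also have "\<dots> \<le> (v \<bullet> (A *v v)) * (spectral_norm (matrix_inv A) * (norm v)\<^sup>2)"
  proof (rule mult_left_mono[OF _ psd])
    have "w \<bullet> (A *v w) = v \<bullet> (matrix_inv A *v v)" by (simp add: Aw) (simp add: w_def inner_commute)
    then show "w \<bullet> (A *v w) \<le> spectral_norm (matrix_inv A) * (norm v)\<^sup>2" using quadratic_form_le by metis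
  qed
  finally have "(norm v)\<^sup>2 * (norm v)\<^sup>2 \<le> (spectral_norm (matrix_inv A) * (v \<bullet> (A *v v))) * (norm v)\<^sup>2"
    by (simp add: power2_eq_square mult_ac)
  moreover have "0 < (norm v)\<^sup>2" using False by simp
  ultimately show ?thesis by (rule mult_right_le_imp_le)
qed (simp)

lemma spectral_norm_triangle: "spectral_norm (A + B) \<le> spectral_norm A + spectral_norm B"
  unfolding spectral_norm_def using onorm_triangle[OF bounded_linear_matrix_vector[of A] bounded_linear_matrix_vector[of B]]
  unfolding matrix_vector_mult_add_rdistrib[symmetric] .

lemma spectral_norm_le_norm: "spectral_norm (A :: real ^ 'n ^ 'm) \<le> norm A"
  unfolding spectral_norm_def
proof (rule onorm_le)
  fix v :: "real ^ 'n"
  have "(norm (A *v v))\<^sup>2 = (\<Sum>i\<in>UNIV. (row i A \<bullet> v)\<^sup>2)"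
    by (simp add: norm_vec_def L2_set_def sum_nonneg matrix_mult_dot row_def vec_lambda_eta)
  also have "\<dots> \<le> (\<Sum>i\<in>UNIV. (norm (A $ i))\<^sup>2 * (norm v)\<^sup>2)"
  proof (rule sum_mono)
    fix i
    have "\<bar>A $ i \<bullet> v\<bar>\<^sup>2 \<le> (norm (A $ i) * norm v)\<^sup>2" by (intro power_mono Cauchy_Schwarz_ineq2) simp
    then show "(row i A \<bullet> v)\<^sup>2 \<le> (norm (A $ i))\<^sup>2 * (norm v)\<^sup>2"
      by (simp add: row_def vec_lambda_eta power_mult_distrib)
  qed
  also have "\<dots> = (norm A * norm v)\<^sup>2"
    by (simp add: norm_vec_def[of A] L2_set_def sum_nonneg sum_distrib_right[symmetric] power_mult_distrib)
  finally show "norm (A *v v) \<le> norm A * norm v" by (rule power2_le_imp_le) simp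
qed

text \<open>By the triangle inequality the spectral norm is 1-Lipschitz for the Euclidean norm of
  the entries. Continuity is wanted here for the sake of measurability.\<close>

lemma continuous_spectral_norm: "continuous_on UNIV (spectral_norm :: real ^ 'n ^ 'm \<Rightarrow> real)"
proof -
  have d: "\<bar>spectral_norm A - spectral_norm B\<bar> \<le> norm (A - B)" for A B :: "real ^ 'n ^ 'm"
    using spectral_norm_triangle[of "A - B" B] spectral_norm_triangle[of "B - A" A]
      spectral_norm_le_norm[of "A - B"] spectral_norm_le_norm[of "B - A"]
    by (simp add: norm_minus_commute[of B A])
  show ?thesis
    unfolding continuous_on_iff dist_norm using d by (metis le_less_trans real_norm_def)
qed

lemma borel_measurable_spectral_norm [measurable]:
  "A \<in> borel_measurable M \<Longrightarrow> (\<lambda>x. spectral_norm (A x)) \<in> borel_measurable M"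
  by (rule borel_measurable_continuous_on[OF continuous_spectral_norm])

lemma borel_measurable_matrix_vector [measurable]:
  fixes A :: "'a \<Rightarrow> real ^ 'n ^ 'm"
  assumes "A \<in> borel_measurable M" "v \<in> borel_measurable M"
  shows "(\<lambda>x. A x *v v x) \<in> borel_measurable M"
proof -
  have "continuous_on UNIV (\<lambda>(A :: real ^ 'n ^ 'm, v). A *v v)"
    unfolding matrix_vector_mult_def split_def by (intro continuous_intros continuous_on_vec_lambda)
  from borel_measurable_continuous_Pair[OF assms, of "\<lambda>A v. A *v v"] this
  show ?thesis by (simp add: split_def)
qed



section \<open>Approximation by polynomials in \<open>tanh\<close>\<close>

lemma DERIV_compare:
  fixes f g :: "real \<Rightarrow> real"
  assumes "0 \<le> t" "\<And>x. 0 \<le> x \<Longrightarrow> x \<le> t \<Longrightarrow> (f has_real_derivative f' x) (at x)"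
    and "\<And>x. 0 \<le> x \<Longrightarrow> x \<le> t \<Longrightarrow> (g has_real_derivative g' x) (at x)"
    and "\<And>x. 0 \<le> x \<Longrightarrow> x \<le> t \<Longrightarrow> f' x \<le> g' x" and "f 0 = g 0"
  shows "f t \<le> g t"
proof -
  have "g 0 - f 0 \<le> g t - f t"
  proof (rule DERIV_nonneg_imp_nondecreasing[OF assms(1)])
    fix x assume x: "0 \<le> x" "x \<le> t"
    show "\<exists>y. ((\<lambda>x. g x - f x) has_real_derivative y) (at x) \<and> 0 \<le> y"
      using DERIV_diff[OF assms(3)[OF x] assms(2)[OF x]] assms(4)[OF x] by (intro exI[of _ "g' x - f' x"]) simp
  qed
  then show ?thesis using assms(5) by simp
qed

text \<open>In the variable y = tanh t, the derivative of P(tanh t) is P'(y) (1 - y^2), so P' should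
  approximate w(artanh y) / (1 - y^2). As \<open>w\<close> vanishes for large arguments, this
  quotient is continuous up to y = -1 and y = 1. The error keeps the factor 1 - tanh^2, which is
  integrable on the line, so P itself can be controlled later.\<close>

lemma polynomial_tanh_approximation:
  fixes w :: "real \<Rightarrow> real"
  assumes w: "continuous_on UNIV w" and R: "0 < R" "\<And>t. R \<le> \<bar>t\<bar> \<Longrightarrow> w t = 0" and e: "0 < e"
  obtains P where "\<And>t. \<bar>poly (pderiv P * [:1, 0, -1:]) (tanh t) - w t\<bar> \<le> e * (1 - (tanh t)\<^sup>2)" "poly P 0 = c"
proof -
  define k where "k y = (if \<bar>y\<bar> < 1 then w (artanh y) / (1 - y\<^sup>2) else 0)" for y :: real
  have artanh_mono: "R \<le> \<bar>artanh y\<bar>" if "tanh R < \<bar>y\<bar>" "\<bar>y\<bar> < 1" for y :: real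
  proof -
    have "y = tanh (artanh y)" 
    proof -
      have "exp (- (2 * artanh y)) = (1 - y) / (1 + y)"
        using that by (simp add: artanh_def exp_minus)
      then have "tanh (artanh y) = (1 - (1 - y) / (1 + y)) / (1 + (1 - y) / (1 + y))"
        by (simp add: tanh_real_altdef)
      also have "\<dots> = y"
      proof -
        have "1 + y \<noteq> 0" using that by auto
        then have "1 - (1 - y) / (1 + y) = 2 * y / (1 + y)" "1 + (1 - y) / (1 + y) = 2 / (1 + y)"
          by (simp_all add: field_simps)
        then show ?thesis using \<open>1 + y \<noteq> 0\<close> by simp
      qed
      finally show ?thesis by simp
    qed
    then have "\<bar>y\<bar> = tanh \<bar>artanh y\<bar>" by (metis tanh_real_abs)
    then have "tanh R < tanh \<bar>artanh y\<bar>" using that(1) by (simp only:)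
    then have "R < \<bar>artanh y\<bar>" by (simp only: tanh_real_less_iff)
    then show ?thesis by simp
  qed
  have "continuous_on ({-1<..<1} \<union> {y. tanh R < \<bar>y\<bar>}) k"
  proof (rule continuous_on_open_Un)
    have sq: "1 - y\<^sup>2 \<noteq> 0" if "y \<in> {-1<..<1}" for y :: real
      using that abs_square_less_1[of y] by auto
    have "continuous_on {-1<..<1} (\<lambda>y. w (artanh y) / (1 - y\<^sup>2))"
      using sq by (intro continuous_on_divide continuous_on_compose2[OF w] continuous_intros) auto
    then show "continuous_on {-1<..<1} k" by (rule continuous_on_eq) (auto simp: k_def)
    have "continuous_on {y. tanh R < \<bar>y\<bar>} (\<lambda>y. 0::real)" by simp
    then show "continuous_on {y. tanh R < \<bar>y\<bar>} k"
      by (rule continuous_on_eq) (auto simp: k_def artanh_mono R(2))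
    show "open {y::real. tanh R < \<bar>y\<bar>}" by (intro open_Collect_less continuous_intros)
  qed simp
  then have "continuous_on {-1..1} k"
    by (rule continuous_on_subset) (use tanh_real_lt_1[of R] in auto)
  then obtain p where p: "real_polynomial_function p" "\<And>y. y \<in> {-1..1} \<Longrightarrow> \<bar>k y - p y\<bar> < e"
    using Stone_Weierstrass_real_polynomial_function[of "{-1..1}" k e] e by auto
  then obtain a n where a: "p = (\<lambda>x. \<Sum>i\<le>n. a i * x ^ i)" by (auto simp: real_polynomial_function_iff_sum)
  \<comment> \<open>An antiderivative of the Weierstrass polynomial; since tanh 0 = 0, the constant
    term is the prescribed value at t = 0.\<close>
  define P where "P = (\<Sum>i\<le>n. monom (a i / real (Suc i)) (Suc i)) + [:c:]"
  have pderiv_sum: "pderiv (\<Sum>i\<in>A. q i) = (\<Sum>i\<in>A. pderiv (q i))" for A :: "nat set" and q :: "nat \<Rightarrow> real poly"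
    by (induction A rule: infinite_finite_induct) (auto simp: pderiv_add)
  have dP: "pderiv P = (\<Sum>i\<le>n. monom (a i) i)"
    by (simp add: P_def pderiv_add pderiv_sum pderiv_monom pderiv_pCons)
  have dPp: "poly (pderiv P) y = p y" for y by (simp add: dP a poly_sum poly_monom)
  show ?thesis
  proof (rule that[of P])
    show "poly P 0 = c" by (simp add: P_def poly_sum poly_monom)
    fix t :: real
    have t: "\<bar>tanh t\<bar> < 1" using tanh_real_bounds[of t] by auto
    then have sq: "0 < 1 - (tanh t)\<^sup>2" using abs_square_less_1[of "tanh t"] by simp
    have "w t = k (tanh t) * (1 - (tanh t)\<^sup>2)" using t sq by (simp add: k_def artanh_tanh_real)
    then have "poly (pderiv P * [:1, 0, -1:]) (tanh t) - w t = (p (tanh t) - k (tanh t)) * (1 - (tanh t)\<^sup>2)"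
      by (simp add: dPp algebra_simps power2_eq_square)
    also have "\<bar>\<dots>\<bar> \<le> e * (1 - (tanh t)\<^sup>2)"
    proof -
      have "tanh t \<in> {-1..1}" using t by (auto simp: abs_less_iff)
      then have "\<bar>p (tanh t) - k (tanh t)\<bar> \<le> e" using p(2)[of "tanh t"] by (simp add: abs_minus_commute)
      then show ?thesis unfolding abs_mult using sq e by (intro mult_mono) auto
    qed
    finally show "\<bar>poly (pderiv P * [:1, 0, -1:]) (tanh t) - w t\<bar> \<le> e * (1 - (tanh t)\<^sup>2)" .
  qed
qed

text \<open>\<open>h'\<close> is multiplied by a trapezoid equal to 1 up to \<open>Suc n\<close> and
  to 0 beyond twice that, and the product is approximated in the previous sense. Since 1 - tanh^2 is
  the derivative of tanh, errors in the derivative integrate to at most \<open>1 / Suc n\<close> on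
  the whole half line. The last two bounds are the majorants for dominated convergence.\<close>

lemma tanh_polynomial_sequence:
  fixes h h' :: "real \<Rightarrow> real"
  assumes der: "\<And>t. 0 \<le> t \<Longrightarrow> (h has_real_derivative h' t) (at t)"
    and cont: "continuous_on {0..} h'" and bd: "\<And>t. 0 \<le> t \<Longrightarrow> 0 \<le> h' t" "\<And>t. 0 \<le> t \<Longrightarrow> h' t \<le> K"
  obtains P :: "nat \<Rightarrow> real poly" where
    "\<And>t. 0 \<le> t \<Longrightarrow> (\<lambda>n. poly (P n) (tanh t)) \<longlonglongrightarrow> h t"
    "\<And>t. 0 \<le> t \<Longrightarrow> (\<lambda>n. poly (pderiv (P n) * [:1, 0, -1:]) (tanh t)) \<longlonglongrightarrow> h' t"
    "\<And>n t. 0 \<le> t \<Longrightarrow> \<bar>poly (P n) (tanh t)\<bar> \<le> 1 + \<bar>h 0\<bar> + \<bar>h t\<bar>"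
    "\<And>n t. 0 \<le> t \<Longrightarrow> \<bar>poly (pderiv (P n) * [:1, 0, -1:]) (tanh t)\<bar> \<le> K + 1"
proof -
  define w where "w n t = h' (max 0 t) * max 0 (min 1 (2 - \<bar>t\<bar> / real (Suc n)))" for n t
  have contw: "continuous_on UNIV (w n)" for n
    unfolding w_def
    by (intro continuous_intros continuous_on_compose2[OF cont]) auto
  have w_bd: "0 \<le> w n t" "w n t \<le> h' t" if "0 \<le> t" for n t
    using that bd[OF that] by (auto simp: w_def intro: mult_left_le)
  have w_eq: "w n t = h' t" if "0 \<le> t" "t \<le> real (Suc n)" for n t
  proof -
    have "t / real (Suc n) \<le> 1" using that by (simp add: divide_simps)
    then have "max 0 (min 1 (2 - \<bar>t\<bar> / real (Suc n))) = 1" using that by simp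
    then show ?thesis using that by (simp add: w_def)
  qed
  have w_zero: "w n t = 0" if "2 * real (Suc n) \<le> \<bar>t\<bar>" for n t
  proof -
    have "2 \<le> \<bar>t\<bar> / real (Suc n)" using that by (simp add: pos_le_divide_eq)
    then show ?thesis by (simp add: w_def)
  qed
  have "\<exists>P. (\<forall>t. \<bar>poly (pderiv P * [:1, 0, -1:]) (tanh t) - w n t\<bar> \<le> (1 / real (Suc n)) * (1 - (tanh t)\<^sup>2)) \<and> poly P 0 = h 0" for n
    by (rule polynomial_tanh_approximation[OF contw[of n], of "2 * real (Suc n)" "1 / real (Suc n)" "h 0"])
      (use w_zero in auto)
  then obtain P where P: "\<And>n t. \<bar>poly (pderiv (P n) * [:1, 0, -1:]) (tanh t) - w n t\<bar> \<le> (1 / real (Suc n)) * (1 - (tanh t)\<^sup>2)"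
    "\<And>n. poly (P n) 0 = h 0" by metis
  have sq: "0 \<le> 1 - (tanh t)\<^sup>2" "1 - (tanh t)\<^sup>2 \<le> 1" for t :: real
    using tanh_real_bounds[of t] abs_square_le_1[of "tanh t"] by auto
  have P1: "\<bar>poly (pderiv (P n) * [:1, 0, -1:]) (tanh t) - w n t\<bar> \<le> 1 / real (Suc n)" for n t
    using order_trans[OF P(1) mult_left_le[OF sq(2)]] by simp
  have H: "\<exists>H. (\<forall>t. (H has_real_derivative w n t) (at t)) \<and> H 0 = h 0" for n
  proof -
    obtain F where F: "\<And>t. (F has_real_derivative w n t) (at t)" "F 0 = 0"
      using continuous_antiderivative[OF contw[of n]] by blast
    have "((\<lambda>t. F t + h 0) has_real_derivative w n t) (at t)" for t
      using DERIV_add[OF F(1)[of t] DERIV_const[of "h 0"]] by simp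
    then show ?thesis using F(2) by (intro exI[of _ "\<lambda>t. F t + h 0"]) simp
  qed
  then obtain H where H: "\<And>n t. (H n has_real_derivative w n t) (at t)" "\<And>n. H n 0 = h 0" by metis
  have PH: "\<bar>poly (P n) (tanh t) - H n t\<bar> \<le> 1 / real (Suc n)" if t: "0 \<le> t" for n t
  proof -
    define e where "e = 1 / real (Suc n)"
    have e: "0 \<le> e" by (simp add: e_def)
    have T: "((\<lambda>t. e * poly [:0, 1:] (tanh t)) has_real_derivative e * poly (pderiv [:0, 1:] * [:1, 0, -1:]) (tanh x)) (at x)" for x
      by (rule DERIV_cmult[OF poly_tanh_deriv])
    have "poly (P n) (tanh t) - H n t \<le> e * poly [:0, 1:] (tanh t)"
    proof (rule DERIV_compare[OF t DERIV_diff[OF poly_tanh_deriv H(1)] T])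
      fix x :: real
      show "poly (pderiv (P n) * [:1, 0, -1:]) (tanh x) - w n x \<le> e * poly (pderiv [:0, 1:] * [:1, 0, -1:]) (tanh x)"
        using P(1)[of n x, folded e_def] by (simp add: pderiv_pCons power2_eq_square)
    qed (simp add: P H)
    moreover have "H n t - poly (P n) (tanh t) \<le> e * poly [:0, 1:] (tanh t)"
    proof (rule DERIV_compare[OF t DERIV_diff[OF H(1) poly_tanh_deriv] T])
      fix x :: real
      show "w n x - poly (pderiv (P n) * [:1, 0, -1:]) (tanh x) \<le> e * poly (pderiv [:0, 1:] * [:1, 0, -1:]) (tanh x)"
        using P(1)[of n x, folded e_def] by (simp add: pderiv_pCons power2_eq_square)
    qed (simp add: P H)
    moreover have "e * poly [:0, 1:] (tanh t) \<le> e * 1"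
      using e tanh_real_bounds[of t] by (intro mult_left_mono) auto
    ultimately show ?thesis unfolding e_def[symmetric] by linarith
  qed
  \<comment> \<open>From 0 <= \<open>w n\<close> <= \<open>h'\<close> the antiderivative stays
    between \<open>h 0\<close> and \<open>h\<close>, which gives a majorant independent of
    \<open>n\<close>.\<close>
  have Hle: "h 0 \<le> H n t" "H n t \<le> h t" if t: "0 \<le> t" for n t
  proof -
    show "H n t \<le> h t" by (rule DERIV_compare[OF t H(1) der w_bd(2) H(2)])
    have "(\<lambda>_. h 0) t \<le> H n t" by (rule DERIV_compare[OF t DERIV_const H(1) w_bd(1)]) (simp_all add: H(2))
    then show "h 0 \<le> H n t" .
  qed
  have Heq: "H n t = h t" if t: "0 \<le> t" "t \<le> real (Suc n)" for n t
  proof (rule antisym[OF Hle(2)[OF t(1)]])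
    show "h t \<le> H n t" by (rule DERIV_compare[OF t(1) der H(1)]) (use w_eq t in \<open>auto simp: H\<close>)
  qed
  have inv0: "(\<lambda>n. 1 / real (Suc n)) \<longlonglongrightarrow> 0" using LIMSEQ_inverse_real_of_nat by (simp add: inverse_eq_divide)
  have large: "eventually (\<lambda>n. t \<le> real (Suc n)) sequentially" for t
  proof -
    obtain N :: nat where "t \<le> real N" using real_arch_simple by blast
    then show ?thesis by (intro eventually_sequentiallyI[of N]) simp
  qed
  show ?thesis
  proof (rule that[of P])
    fix t :: real assume t: "0 \<le> t"
    show "(\<lambda>n. poly (P n) (tanh t)) \<longlonglongrightarrow> h t"
    proof (rule LIM_zero_cancel, rule Lim_null_comparison[OF _ inv0])
      show "eventually (\<lambda>n. norm (poly (P n) (tanh t) - h t) \<le> 1 / real (Suc n)) sequentially"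
        using large[of t] by eventually_elim (use PH[OF t] Heq[OF t] in \<open>metis real_norm_def\<close>)
    qed
    show "(\<lambda>n. poly (pderiv (P n) * [:1, 0, -1:]) (tanh t)) \<longlonglongrightarrow> h' t"
    proof (rule LIM_zero_cancel, rule Lim_null_comparison[OF _ inv0])
      show "eventually (\<lambda>n. norm (poly (pderiv (P n) * [:1, 0, -1:]) (tanh t) - h' t) \<le> 1 / real (Suc n)) sequentially"
        using large[of t] by eventually_elim (use P1[of _ t] w_eq[OF t] in \<open>metis real_norm_def\<close>)
    qed
    fix n
    have n1: "1 / real (Suc n) \<le> 1" by simp
    show "\<bar>poly (P n) (tanh t)\<bar> \<le> 1 + \<bar>h 0\<bar> + \<bar>h t\<bar>"
      using PH[OF t, of n] Hle[OF t, of n] n1 by linarith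
    show "\<bar>poly (pderiv (P n) * [:1, 0, -1:]) (tanh t)\<bar> \<le> K + 1"
      using P1[of n t] w_bd[OF t, of n] bd[OF t] n1 by linarith
  qed
qed

lemma continuous_on_grad:
  assumes "smooth_closure S f" "open S"
  shows "continuous_on S (grad f)" "\<And>x. x \<in> S \<Longrightarrow> f differentiable at x"
proof -
  have "Ck_closure (Suc 0) S f" using assms(1) unfolding smooth_closure_def by (rule spec)
  then have "Ck (Suc 0) S f" by (rule Ck_closure_imp_Ck)
  then show "continuous_on S (grad f)" "\<And>x. x \<in> S \<Longrightarrow> f differentiable at x"
    by (auto simp: grad_def[abs_def] intro!: continuous_on_vec_lambda)
qed

subsection \<open>Solutions and the Caccioppoli inequality\<close>

lemma smooth_closure_bounded:
  fixes f :: "real ^ 'n \<Rightarrow> real"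
  assumes f: "smooth_closure S f" and S: "bounded S" "open S"
  obtains B where "\<And>x. x \<in> S \<Longrightarrow> \<bar>f x\<bar> \<le> B" "\<And>x. x \<in> S \<Longrightarrow> norm (grad f x) \<le> B"
proof -
  have ext: "\<exists>B. \<forall>x\<in>S. \<bar>h x\<bar> \<le> B" if ex: "\<exists>g. continuous_on (closure S) g \<and> (\<forall>x\<in>S. g x = h x)" for h :: "real ^ 'n \<Rightarrow> real"
  proof -
    obtain g where g: "continuous_on (closure S) g" "\<forall>x\<in>S. g x = h x" using ex by (elim exE conjE)
    have "bounded (g ` closure S)"
      using S(1) g(1) by (intro compact_imp_bounded compact_continuous_image) (simp_all add: compact_closure)
    then obtain B where B: "\<forall>y\<in>g ` closure S. norm y \<le> B" unfolding bounded_iff by (elim exE)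
    have "\<bar>h x\<bar> \<le> B" if "x \<in> S" for x
      using B g(2) closure_subset[of S] that by (metis imageI real_norm_def subsetD)
    then show ?thesis by blast
  qed
  have "Ck_closure (Suc 0) S f" using f unfolding smooth_closure_def by (rule spec)
  note C = this[unfolded Ck_closure.simps]
  obtain B0 where B0: "\<forall>x\<in>S. \<bar>f x\<bar> \<le> B0" using ext[OF conjunct1[OF C]] by (elim exE)
  have "\<forall>i. \<exists>B. \<forall>x\<in>S. \<bar>frechet_derivative f (at x) (axis i 1)\<bar> \<le> B"
    using C by (intro allI ext) blast
  then obtain B1 where B1: "\<And>i x. x \<in> S \<Longrightarrow> \<bar>frechet_derivative f (at x) (axis i 1)\<bar> \<le> B1 i" by metis
  show ?thesis
  proof (rule that[of "\<bar>B0\<bar> + \<bar>\<Sum>i\<in>UNIV. B1 i\<bar>"])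
    fix x assume x: "x \<in> S"
    show "\<bar>f x\<bar> \<le> \<bar>B0\<bar> + \<bar>\<Sum>i\<in>UNIV. B1 i\<bar>" using bspec[OF B0 x] by linarith
    have "norm (grad f x) \<le> (\<Sum>i\<in>UNIV. \<bar>grad f x $ i\<bar>)" by (rule norm_le_l1_cart)
    also have "\<dots> \<le> (\<Sum>i\<in>UNIV. B1 i)" using B1[OF x] by (intro sum_mono) (simp add: grad_def)
    finally show "norm (grad f x) \<le> \<bar>B0\<bar> + \<bar>\<Sum>i\<in>UNIV. B1 i\<bar>" by linarith
  qed
qed

section \<open>Cubes and their volume\<close>

lemma bounded_cube: "bounded (cube \<rho>)" by (simp add: cube_def bounded_box)

lemma cube_subset:
  assumes "\<rho> \<le> \<rho>'"
  shows "cube \<rho> \<subseteq> cube \<rho>'"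
proof
  fix x assume x: "x \<in> cube \<rho>"
  have "- \<rho>' / 2 < x $ i \<and> x $ i < \<rho>' / 2" for i
  proof -
    have "- \<rho> / 2 < x $ i \<and> x $ i < \<rho> / 2" using x by (simp add: in_cube_iff)
    then show ?thesis using assms by (simp add: field_simps)
  qed
  then show "x \<in> cube \<rho>'" by (simp add: in_cube_iff)
qed

lemma cbox_subset_cube:
  assumes "\<rho> < \<rho>'"
  shows "cbox (\<chi> i. - \<rho> / 2) (\<chi> i. \<rho> / 2) \<subseteq> cube \<rho>'"
proof
  fix x :: "real ^ 'n" assume x: "x \<in> cbox (\<chi> i. - \<rho> / 2) (\<chi> i. \<rho> / 2)"
  have "- \<rho>' / 2 < x $ i \<and> x $ i < \<rho>' / 2" for i
  proof -
    have "- \<rho> / 2 \<le> x $ i \<and> x $ i \<le> \<rho> / 2" using x by (simp add: mem_box_cart)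
    then show ?thesis using assms by (simp add: field_simps)
  qed
  then show "x \<in> cube \<rho>'" by (simp add: in_cube_iff)
qed

lemma cube_sets_borel [measurable, simp]: "cube \<rho> \<in> sets borel"
  by (rule borel_open[OF open_cube])

lemma cube_sets_lebesgue [simp]: "cube \<rho> \<in> sets lebesgue"
  unfolding cube_def by (rule fmeasurableD[OF lmeasurable_box])

lemma emeasure_cube: "0 < \<rho> \<Longrightarrow> emeasure lborel (cube \<rho> :: (real ^ 'n) set) = ennreal (\<rho> ^ CARD('n))"
proof -
  assume \<rho>: "0 < \<rho>"
  have B: "(\<Prod>b\<in>Basis. ((\<chi> i. \<rho> / 2) - (\<chi> i. - \<rho> / 2)) \<bullet> (b :: real ^ 'n)) = (\<Prod>b\<in>(Basis :: (real ^ 'n) set). \<rho>)"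
  proof (rule prod.cong[OF refl])
    fix b :: "real ^ 'n" assume "b \<in> Basis"
    then show "((\<chi> i. \<rho> / 2) - (\<chi> i. - \<rho> / 2)) \<bullet> b = \<rho>"
      by (auto simp: Basis_vec_def inner_axis)
  qed
  have "emeasure lborel (cube \<rho> :: (real ^ 'n) set) = ennreal (\<Prod>b\<in>Basis. ((\<chi> i. \<rho> / 2) - (\<chi> i. - \<rho> / 2)) \<bullet> (b :: real ^ 'n))"
    unfolding cube_def using \<rho> by (intro emeasure_lborel_box) (auto simp: Basis_vec_def inner_axis)
  then show ?thesis unfolding B by simp
qed

lemma poly_tanh_bounded: "\<exists>C. \<forall>t::real. \<bar>poly P (tanh t)\<bar> \<le> C"
proof -
  have "bounded (poly P ` {-1..1})"
    by (intro compact_imp_bounded compact_continuous_image continuous_intros) auto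
  then obtain C where C: "\<forall>y\<in>poly P ` {-1..1}. norm y \<le> C" unfolding bounded_iff by (elim exE)
  have "\<bar>poly P (tanh t)\<bar> \<le> C" for t
  proof -
    have "tanh t \<in> {-1..1}" using tanh_real_bounds[of t] by auto
    then show ?thesis using bspec[OF C imageI] by simp
  qed
  then show ?thesis by blast
qed

text \<open>A normalised form of the hypotheses of the theorem: the solution is nonnegative
  everywhere, not only almost everywhere, and the approximating smooth functions also converge
  pointwise almost everywhere. Both can be arranged by changing \<open>u\<close> on a null set and
  passing to a subsequence.\<close>

locale degenerate_solution =
  fixes a :: "real ^ 'n \<Rightarrow> real ^ 'n ^ 'n" and u :: "real ^ 'n \<Rightarrow> real" and G :: "real ^ 'n \<Rightarrow> real ^ 'n"
    and \<phi> :: "nat \<Rightarrow> real ^ 'n \<Rightarrow> real"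
  assumes a_meas [measurable]: "a \<in> borel_measurable (cube_measure 1)"
    and a_sym: "\<And>x. x \<in> cube 1 \<Longrightarrow> transpose (a x) = a x"
    and a_psd: "\<And>x v. x \<in> cube 1 \<Longrightarrow> 0 \<le> v \<bullet> (a x *v v)"
    and a_int: "(\<integral>\<^sup>+ x. ennreal (spectral_norm (a x)) \<partial>cube_measure 1) < \<infinity>"
    and u_meas [measurable]: "u \<in> borel_measurable (cube_measure 1)"
    and G_meas [measurable]: "G \<in> borel_measurable (cube_measure 1)"
    and u_nonneg: "\<And>x. 0 \<le> u x"
    and \<phi>_smooth: "\<And>k. smooth_closure (cube 1) (\<phi> k)"
    and \<phi>_AE: "AE x in cube_measure 1. (\<lambda>k. \<phi> k x) \<longlonglongrightarrow> u x"
    and \<phi>_L2: "(\<lambda>k. \<integral>\<^sup>+ x. ennreal ((\<phi> k x - u x)\<^sup>2) \<partial>cube_measure 1) \<longlonglongrightarrow> 0"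
    and \<phi>_energy: "(\<lambda>k. \<integral>\<^sup>+ x. ennreal ((grad (\<phi> k) x - G x) \<bullet> (a x *v (grad (\<phi> k) x - G x))) \<partial>cube_measure 1) \<longlonglongrightarrow> 0"
    and weak: "\<And>\<psi>. test_function (cube 1) \<psi> \<Longrightarrow> (LINT x|cube_measure 1. grad \<psi> x \<bullet> (a x *v G x)) = 0"
begin

abbreviation "\<mu> \<equiv> cube_measure 1 :: (real ^ 'n) measure"
abbreviation "N x \<equiv> spectral_norm (a x)"
abbreviation "E x \<equiv> G x \<bullet> (a x *v G x)"
abbreviation "dev k x \<equiv> (grad (\<phi> k) x - G x) \<bullet> (a x *v (grad (\<phi> k) x - G x))"

lemma cube_\<mu> [measurable]: "cube \<rho> \<inter> cube 1 \<in> sets \<mu>"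
  by (simp add: sets_restrict_space_iff sets.Int)

lemma indicator_cube_meas [measurable]: "indicator (cube \<rho>) \<in> borel_measurable \<mu>"
  by (intro measurable_restrict_space1 borel_measurable_indicator) simp

lemma finite_\<mu>: "finite_measure \<mu>"
  by (rule finite_measureI) (simp add: emeasure_restrict_space emeasure_cube)

lemma continuous_meas: "continuous_on (cube 1) f \<Longrightarrow> f \<in> borel_measurable \<mu>"
  by (rule continuous_imp_measurable_on_sets_lebesgue) simp_all

lemma grad_\<phi>_meas [measurable]: "grad (\<phi> k) \<in> borel_measurable \<mu>"
  by (rule continuous_meas[OF continuous_on_grad(1)[OF \<phi>_smooth open_cube]])

lemma \<phi>_diff: "x \<in> cube 1 \<Longrightarrow> \<phi> k differentiable at x"
  by (rule continuous_on_grad(2)[OF \<phi>_smooth open_cube])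

lemma \<phi>_cont: "continuous_on (cube 1) (\<phi> k)"
  using \<phi>_diff by (intro continuous_at_imp_continuous_on) (auto intro: differentiable_imp_continuous_within)

lemma \<phi>_meas [measurable]: "\<phi> k \<in> borel_measurable \<mu>"
  by (rule continuous_meas[OF \<phi>_cont])

lemma quadratic_add_le:
  assumes "x \<in> cube 1"
  shows "(v + w) \<bullet> (a x *v (v + w)) \<le> 2 * (v \<bullet> (a x *v v)) + 2 * (w \<bullet> (a x *v w))"
  using a_psd[OF assms, of "v - w"]
  unfolding matrix_vector_right_distrib matrix_vector_mult_diff_distrib
    inner_add_left inner_add_right inner_diff_left inner_diff_right
  by linarith

lemma dev_meas [measurable]: "dev k \<in> borel_measurable \<mu>"
  by (intro borel_measurable_inner borel_measurable_matrix_vector borel_measurable_diff grad_\<phi>_meas G_meas a_meas)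

lemma E_meas [measurable]: "E \<in> borel_measurable \<mu>"
  by (intro borel_measurable_inner borel_measurable_matrix_vector G_meas a_meas)

lemma N_meas [measurable]: "N \<in> borel_measurable \<mu>"
  by (intro borel_measurable_spectral_norm a_meas)

text \<open>A single approximant suffices: its gradient is bounded on the cube, so its energy is
  controlled by the integral of \<open>N\<close>, and its energy distance to \<open>G\<close> is
  finite.\<close>

lemma energy_finite: "(\<integral>\<^sup>+ x. ennreal (E x) \<partial>\<mu>) < \<infinity>"
proof -
  have "eventually (\<lambda>k. (\<integral>\<^sup>+ x. ennreal (dev k x) \<partial>\<mu>) < 1) sequentially"
    using order_tendstoD(2)[OF \<phi>_energy, of 1] by simp
  then obtain k where k: "(\<integral>\<^sup>+ x. ennreal (dev k x) \<partial>\<mu>) < 1" by (auto simp: eventually_sequentially)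
  obtain B where B: "\<And>x. x \<in> cube 1 \<Longrightarrow> norm (grad (\<phi> k) x) \<le> B"
  proof (rule smooth_closure_bounded[OF \<phi>_smooth[of k] bounded_cube open_cube])
    fix B assume "\<And>x. x \<in> cube 1 \<Longrightarrow> norm (grad (\<phi> k) x) \<le> B"
    then show thesis by (rule that)
  qed
  have "(\<integral>\<^sup>+ x. ennreal (E x) \<partial>\<mu>) \<le> (\<integral>\<^sup>+ x. 2 * ennreal (dev k x) + ennreal (2 * B\<^sup>2) * ennreal (N x) \<partial>\<mu>)"
  proof (rule nn_integral_mono)
    fix x assume "x \<in> space \<mu>"
    then have x: "x \<in> cube 1" by simp
    have "E x \<le> 2 * ((G x - grad (\<phi> k) x) \<bullet> (a x *v (G x - grad (\<phi> k) x))) + 2 * (grad (\<phi> k) x \<bullet> (a x *v grad (\<phi> k) x))"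
      using quadratic_add_le[OF x, of "G x - grad (\<phi> k) x" "grad (\<phi> k) x"] unfolding diff_add_cancel .
    also have "(G x - grad (\<phi> k) x) \<bullet> (a x *v (G x - grad (\<phi> k) x)) = dev k x"
      unfolding matrix_vector_mult_diff_distrib inner_diff_left inner_diff_right by linarith
    also have "grad (\<phi> k) x \<bullet> (a x *v grad (\<phi> k) x) \<le> N x * B\<^sup>2"
      by (rule order_trans[OF quadratic_form_le mult_left_mono[OF power_mono[OF B[OF x] norm_ge_zero] spectral_norm_nonneg]])
    finally have "E x \<le> 2 * dev k x + 2 * B\<^sup>2 * N x" by (simp only: mult_ac)
    then have "ennreal (E x) \<le> ennreal (2 * dev k x + 2 * B\<^sup>2 * N x)" by (rule ennreal_leI)
    also have "\<dots> = 2 * ennreal (dev k x) + ennreal (2 * B\<^sup>2) * ennreal (N x)"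
    proof -
      have "ennreal (2 * p + 2 * B\<^sup>2 * n) = 2 * ennreal p + ennreal (2 * B\<^sup>2) * ennreal n" if "0 \<le> p" "0 \<le> n" for p n
        using that by (simp add: ennreal_plus ennreal_mult)
      from this[OF a_psd[OF x] spectral_norm_nonneg] show ?thesis .
    qed
    finally show "ennreal (E x) \<le> 2 * ennreal (dev k x) + ennreal (2 * B\<^sup>2) * ennreal (N x)" .
  qed
  also have "\<dots> = 2 * (\<integral>\<^sup>+ x. ennreal (dev k x) \<partial>\<mu>) + ennreal (2 * B\<^sup>2) * (\<integral>\<^sup>+ x. ennreal (N x) \<partial>\<mu>)"
    by (subst nn_integral_add, measurable) (subst (1 2) nn_integral_cmult, measurable)
  also have "\<dots> < \<infinity>"
  proof -
    have "(\<integral>\<^sup>+ x. ennreal (dev k x) \<partial>\<mu>) < \<infinity>" using k by (rule less_trans) simp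
    then show ?thesis using a_int by (simp add: ennreal_mult_less_top)
  qed
  finally show ?thesis .
qed

lemma integrable_E: "integrable \<mu> E"
  by (rule integrableI_nonneg) (use energy_finite a_psd in \<open>auto intro!: AE_I2\<close>)

lemma integrable_N: "integrable \<mu> N"
  by (rule integrableI_nonneg) (use a_int spectral_norm_nonneg in auto)

lemma cross_term_le:
  assumes "x \<in> cube 1"
  shows "\<bar>v \<bullet> (a x *v w)\<bar> \<le> sqrt (v \<bullet> (a x *v v)) * sqrt (w \<bullet> (a x *v w))"
  using real_sqrt_le_mono[OF psd_Cauchy_Schwarz[OF a_sym a_psd, OF assms assms, of v w]]
  by (simp add: real_sqrt_mult)

text \<open>Cauchy-Schwarz in the form of \<open>a\<close>, then in the integral. This quantity is
  the error made by replacing the gradient of an approximant by \<open>G\<close> in the tested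
  equation.\<close>

lemma cross_integral_tendsto_0:
  "(\<lambda>k. \<integral>\<^sup>+ x. ennreal \<bar>(grad (\<phi> k) x - G x) \<bullet> (a x *v G x)\<bar> \<partial>\<mu>) \<longlonglongrightarrow> 0"
proof -
  define e where "e k = enn2real (\<integral>\<^sup>+ x. ennreal (dev k x) \<partial>\<mu>)" for k
  define E0 where "E0 = enn2real (\<integral>\<^sup>+ x. ennreal (E x) \<partial>\<mu>)"
  have fin: "eventually (\<lambda>k. (\<integral>\<^sup>+ x. ennreal (dev k x) \<partial>\<mu>) < 1) sequentially"
    using order_tendstoD(2)[OF \<phi>_energy, of 1] by simp
  have e0: "e \<longlonglongrightarrow> 0"
    unfolding e_def[abs_def] by (rule tendsto_enn2real) (use \<phi>_energy in simp_all)
  have bound: "eventually (\<lambda>k. (\<integral>\<^sup>+ x. ennreal \<bar>(grad (\<phi> k) x - G x) \<bullet> (a x *v G x)\<bar> \<partial>\<mu>) \<le> ennreal (e k powr (1/2) * E0 powr (1/2))) sequentially"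
  proof (rule eventually_mono[OF fin])
    fix k assume elim: "(\<integral>\<^sup>+ x. ennreal (dev k x) \<partial>\<mu>) < 1"
    have "(\<integral>\<^sup>+ x. ennreal \<bar>(grad (\<phi> k) x - G x) \<bullet> (a x *v G x)\<bar> \<partial>\<mu>) \<le> (\<integral>\<^sup>+ x. ennreal (sqrt \<bar>dev k x\<bar> * sqrt \<bar>E x\<bar>) \<partial>\<mu>)"
    proof (rule nn_integral_mono)
      fix x assume "x \<in> space \<mu>"
      then have x: "x \<in> cube 1" by simp
      show "ennreal \<bar>(grad (\<phi> k) x - G x) \<bullet> (a x *v G x)\<bar> \<le> ennreal (sqrt \<bar>dev k x\<bar> * sqrt \<bar>E x\<bar>)"
        using cross_term_le[OF x, of "grad (\<phi> k) x - G x" "G x"] a_psd[OF x] by (intro ennreal_leI) simp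
    qed
    also have "\<dots> \<le> ennreal (e k powr (1/2) * E0 powr (1/2))"
    proof (rule nn_integral_Holder_bound)
      have "(\<integral>\<^sup>+ x. ennreal (sqrt \<bar>dev k x\<bar> powr 2) \<partial>\<mu>) = (\<integral>\<^sup>+ x. ennreal (dev k x) \<partial>\<mu>)"
        by (intro nn_integral_cong) (use a_psd in auto)
      also have "\<dots> = ennreal (e k)" unfolding e_def using elim by (intro ennreal_enn2real[symmetric]) (auto intro: less_trans)
      finally show "(\<integral>\<^sup>+ x. ennreal (sqrt \<bar>dev k x\<bar> powr 2) \<partial>\<mu>) \<le> ennreal (e k)" by simp
      have "(\<integral>\<^sup>+ x. ennreal (sqrt \<bar>E x\<bar> powr 2) \<partial>\<mu>) = (\<integral>\<^sup>+ x. ennreal (E x) \<partial>\<mu>)"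
        by (intro nn_integral_cong) (use a_psd in auto)
      also have "\<dots> = ennreal E0" unfolding E0_def using energy_finite by (intro ennreal_enn2real[symmetric]) simp
      finally show "(\<integral>\<^sup>+ x. ennreal (sqrt \<bar>E x\<bar> powr 2) \<partial>\<mu>) \<le> ennreal E0" by simp
    qed (auto simp: e_def E0_def)
    finally show "(\<integral>\<^sup>+ x. ennreal \<bar>(grad (\<phi> k) x - G x) \<bullet> (a x *v G x)\<bar> \<partial>\<mu>) \<le> ennreal (e k powr (1/2) * E0 powr (1/2))" .
  qed
  have "(\<lambda>k. e k powr (1/2) * E0 powr (1/2)) \<longlonglongrightarrow> 0 powr (1/2) * E0 powr (1/2)"
    by (rule tendsto_mult[OF tendsto_powr'[OF e0 tendsto_const] tendsto_const]) (simp add: e_def)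
  then have "(\<lambda>k. ennreal (e k powr (1/2) * E0 powr (1/2))) \<longlonglongrightarrow> ennreal 0"
    by (intro tendsto_ennrealI) simp
  then have lim: "(\<lambda>k. ennreal (e k powr (1/2) * E0 powr (1/2))) \<longlonglongrightarrow> 0" by simp
  show ?thesis by (rule tendsto_sandwich[OF _ bound tendsto_const lim]) simp
qed

end

lemma (in degenerate_solution) continuous_comp_meas:
  assumes "continuous_on {0..} f"
  shows "(\<lambda>x. f (u x)) \<in> borel_measurable \<mu>"
proof -
  have "continuous_on UNIV (\<lambda>t. f (max 0 t))"
    by (rule continuous_on_compose2[OF assms]) (auto intro: continuous_intros)
  from borel_measurable_continuous_on[OF this u_meas] show ?thesis using u_nonneg by simp
qed

lemma (in degenerate_solution) flux_meas:
  assumes "v \<in> borel_measurable \<mu>"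
  shows "(\<lambda>x. v x \<bullet> (a x *v G x)) \<in> borel_measurable \<mu>"
  by (intro borel_measurable_inner borel_measurable_matrix_vector G_meas a_meas assms)

lemma (in degenerate_solution) flux_Young:
  assumes "x \<in> cube 1" "norm v \<le> M"
  shows "2 * \<bar>v \<bullet> (a x *v G x)\<bar> \<le> M\<^sup>2 * N x + E x"
proof -
  have "v \<bullet> (a x *v v) \<le> N x * (norm v)\<^sup>2" by (rule quadratic_form_le)
  also have "\<dots> \<le> N x * M\<^sup>2" using assms(2) by (intro mult_left_mono power_mono spectral_norm_nonneg) auto
  finally show ?thesis
    using psd_Young[OF a_sym a_psd, OF assms(1) assms(1), of v "G x"] by (simp only: mult.commute)
qed

lemma smooth_grad:
  assumes "\<And>k. Ck k UNIV f"
  shows "f differentiable at x" "continuous_on UNIV (grad f)"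
proof -
  have "Ck (Suc 0) UNIV f" by (rule assms)
  then show "f differentiable at x" "continuous_on UNIV (grad f)"
    by (auto simp: grad_def[abs_def] intro!: continuous_on_vec_lambda)
qed

text \<open>Formally the equation is tested with \<xi> g(u), g being the polynomial in
  \<open>tanh\<close>. The actual test function is \<xi> g(\<open>\<phi> k\<close>). Boundedness of
  g and g' gives a majorant that does not depend on \<open>k\<close>, even where the approximants
  are large.\<close>

lemma (in degenerate_solution) weak_form_tanh:
  assumes \<xi>: "\<And>k. Ck k UNIV \<xi>" and K: "compact K" "K \<subseteq> cube 1" "\<And>x. x \<notin> K \<Longrightarrow> \<xi> x = 0"
    and bd: "\<And>x. \<bar>\<xi> x\<bar> \<le> 1" "\<And>x. norm (grad \<xi> x) \<le> M"
  shows "(LINT x|\<mu>. poly P (tanh (u x)) * (grad \<xi> x \<bullet> (a x *v G x))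
      + \<xi> x * poly (pderiv P * [:1, 0, -1:]) (tanh (u x)) * E x) = 0"
proof -
  define g where "g t = poly P (tanh t)" for t :: real
  define g' where "g' t = poly (pderiv P * [:1, 0, -1:]) (tanh t)" for t :: real
  define X where "X x = grad \<xi> x \<bullet> (a x *v G x)" for x
  define cr where "cr k x = (grad (\<phi> k) x - G x) \<bullet> (a x *v G x)" for k x
  have dg: "(g has_real_derivative g' t) (at t)" for t
    unfolding g_def g'_def by (rule poly_tanh_deriv)
  obtain C where "\<forall>t::real. \<bar>poly P (tanh t)\<bar> \<le> C" using poly_tanh_bounded[of P] by (elim exE)
  then have C: "\<bar>g t\<bar> \<le> C" for t unfolding g_def by (rule spec)
  obtain C' where "\<forall>t::real. \<bar>poly (pderiv P * [:1, 0, -1:]) (tanh t)\<bar> \<le> C'"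
    using poly_tanh_bounded[of "pderiv P * [:1, 0, -1:]"] by (elim exE)
  then have C': "\<bar>g' t\<bar> \<le> C'" for t unfolding g'_def by (rule spec)
  have C0: "0 \<le> C" "0 \<le> C'" using order_trans[OF abs_ge_zero C] order_trans[OF abs_ge_zero C'] by blast+
  have g_cont: "continuous_on UNIV g" "continuous_on UNIV g'"
    using Ck_poly_tanh[of 0 P] Ck_poly_tanh[of 0 "pderiv P * [:1, 0, -1:]"] by (simp_all add: g_def[abs_def] g'_def[abs_def])
  have \<xi>_cont: "continuous_on UNIV \<xi>" using \<xi>[of 0] by simp
  have grad\<xi>_meas: "grad \<xi> \<in> borel_measurable \<mu>"
    by (rule continuous_meas[OF continuous_on_subset[OF smooth_grad(2)[OF \<xi>]]]) simp
  have \<xi>_meas [measurable]: "\<xi> \<in> borel_measurable \<mu>"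
    by (rule continuous_meas[OF continuous_on_subset[OF \<xi>_cont]]) simp
  have X_meas [measurable]: "X \<in> borel_measurable \<mu>"
    unfolding X_def by (rule flux_meas[OF grad\<xi>_meas])
  have cr_meas [measurable]: "cr k \<in> borel_measurable \<mu>" for k
    unfolding cr_def by (rule flux_meas) (intro borel_measurable_diff grad_\<phi>_meas G_meas)
  have [measurable]: "(\<lambda>x. g (\<phi> k x)) \<in> borel_measurable \<mu>" "(\<lambda>x. g' (\<phi> k x)) \<in> borel_measurable \<mu>"
    "(\<lambda>x. g (u x)) \<in> borel_measurable \<mu>" "(\<lambda>x. g' (u x)) \<in> borel_measurable \<mu>" for k
    using borel_measurable_continuous_on[OF g_cont(1) \<phi>_meas] borel_measurable_continuous_on[OF g_cont(2) \<phi>_meas]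
      borel_measurable_continuous_on[OF g_cont(1) u_meas] borel_measurable_continuous_on[OF g_cont(2) u_meas] by this+
  \<comment> \<open>The gradient of \<open>\<phi> k\<close> is written as \<open>G\<close> plus a
    difference. \<open>A k\<close> collects the part with \<open>G\<close> and converges by
    domination to \<open>A'\<close>; \<open>T k\<close>, the part with the difference, vanishes in
    the limit by \<open>cross_integral_tendsto_0\<close>.\<close>
  define A where "A k x = g (\<phi> k x) * X x + \<xi> x * g' (\<phi> k x) * E x" for k x
  define A' where "A' x = g (u x) * X x + \<xi> x * g' (u x) * E x" for x
  define T where "T k x = \<xi> x * g' (\<phi> k x) * cr k x" for k x
  have A_meas [measurable]: "A k \<in> borel_measurable \<mu>" "A' \<in> borel_measurable \<mu>" "T k \<in> borel_measurable \<mu>" for k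
    unfolding A_def A'_def T_def
    by (intro borel_measurable_add borel_measurable_times X_meas \<xi>_meas E_meas cr_meas; measurable)+
  define D where "D x = C * (M\<^sup>2 * N x + E x) + C' * E x" for x
  have D_int: "integrable \<mu> D"
    unfolding D_def by (intro Bochner_Integration.integrable_add Bochner_Integration.integrable_mult_right integrable_N integrable_E)
  have A_le: "\<bar>A k x\<bar> \<le> D x" if x: "x \<in> cube 1" for k x
  proof -
    have E0: "0 \<le> E x" by (rule a_psd[OF x])
    have "\<bar>X x\<bar> \<le> M\<^sup>2 * N x + E x"
      using flux_Young[OF x bd(2)[of x]] unfolding X_def by linarith
    then have "\<bar>g (\<phi> k x) * X x\<bar> \<le> C * (M\<^sup>2 * N x + E x)"
      unfolding abs_mult using C C0 by (intro mult_mono) auto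
    moreover have "\<bar>\<xi> x * g' (\<phi> k x)\<bar> \<le> 1 * C'"
      unfolding abs_mult using C' bd(1) C0 by (intro mult_mono) auto
    then have "\<bar>\<xi> x * g' (\<phi> k x) * E x\<bar> \<le> C' * E x"
      unfolding abs_mult[of "\<xi> x * g' (\<phi> k x)"] using E0 by (intro mult_mono) auto
    ultimately show ?thesis unfolding A_def D_def by linarith
  qed
  have lim: "(\<lambda>k. LINT x|\<mu>. A k x) \<longlonglongrightarrow> (LINT x|\<mu>. A' x)" and A_int: "integrable \<mu> (A k)" for k
  proof -
    have AE: "AE x in \<mu>. (\<lambda>k. A k x) \<longlonglongrightarrow> A' x"
      using \<phi>_AE
    proof (rule eventually_mono)
      fix x assume l: "(\<lambda>k. \<phi> k x) \<longlonglongrightarrow> u x"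
      have "(\<lambda>k. g (\<phi> k x)) \<longlonglongrightarrow> g (u x)" "(\<lambda>k. g' (\<phi> k x)) \<longlonglongrightarrow> g' (u x)"
        using continuous_on_tendsto_compose[OF g_cont(1) l] continuous_on_tendsto_compose[OF g_cont(2) l] by auto
      then show "(\<lambda>k. A k x) \<longlonglongrightarrow> A' x" unfolding A_def A'_def by (intro tendsto_intros)
    qed
    show "(\<lambda>k. LINT x|\<mu>. A k x) \<longlonglongrightarrow> (LINT x|\<mu>. A' x)"
      by (rule integral_dominated_convergence[OF A_meas(2) A_meas(1) D_int AE]) (auto intro!: AE_I2 A_le)
    show "integrable \<mu> (A k)"
      by (rule Bochner_Integration.integrable_bound[OF D_int A_meas(1)])
        (auto intro!: AE_I2 order_trans[OF A_le] abs_ge_self)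
  qed
  have zero: "(LINT x|\<mu>. A k x + T k x) = 0" for k
  proof -
    define \<psi> where "\<psi> = (\<lambda>x. if x \<in> cube 1 then \<xi> x * g (\<phi> k x) else 0)"
    have "test_function (cube 1) \<psi>"
      unfolding \<psi>_def
    proof (rule test_functionI[OF open_cube K(1,2)])
      fix j
      have "Ck j (cube 1) (\<phi> k)"
        using \<phi>_smooth[of k] unfolding smooth_closure_def by (intro Ck_closure_imp_Ck) (rule spec)
      then have "Ck j (cube 1) (\<lambda>x. g (\<phi> k x))" unfolding g_def by (rule Ck_compose[OF open_cube Ck_poly_tanh])
      then show "Ck j (cube 1) (\<lambda>x. \<xi> x * g (\<phi> k x))"
        by (intro Ck_mult open_cube Ck_subset[OF \<xi>]) simp_all
    qed (simp add: K(3))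
    from weak[OF this] have "(LINT x|\<mu>. grad \<psi> x \<bullet> (a x *v G x)) = 0" .
    moreover have "(LINT x|\<mu>. grad \<psi> x \<bullet> (a x *v G x)) = (LINT x|\<mu>. A k x + T k x)"
    proof (rule Bochner_Integration.integral_cong[OF refl])
      fix x assume "x \<in> space \<mu>"
      then have x: "x \<in> cube 1" by simp
      have "((\<lambda>x. g (\<phi> k x)) has_derivative (\<lambda>v. (grad (\<phi> k) x \<bullet> v) * g' (\<phi> k x))) (at x)"
        by (rule DERIV_compose_FDERIV[OF dg grad_works[OF \<phi>_diff[OF x]]])
      from has_derivative_mult[OF grad_works[OF smooth_grad(1)[OF \<xi>, of x]] this]
      have "((\<lambda>x. \<xi> x * g (\<phi> k x)) has_derivative
          (\<lambda>v. (g (\<phi> k x) *\<^sub>R grad \<xi> x + (\<xi> x * g' (\<phi> k x)) *\<^sub>R grad (\<phi> k) x) \<bullet> v)) (at x)"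
        by (rule has_derivative_eq_rhs) (simp add: fun_eq_iff inner_add_left algebra_simps)
      then have "(\<psi> has_derivative
          (\<lambda>v. (g (\<phi> k x) *\<^sub>R grad \<xi> x + (\<xi> x * g' (\<phi> k x)) *\<^sub>R grad (\<phi> k) x) \<bullet> v)) (at x)"
        by (rule has_derivative_transform_within_open[OF _ open_cube x]) (simp add: \<psi>_def)
      then have "grad \<psi> x = g (\<phi> k x) *\<^sub>R grad \<xi> x + (\<xi> x * g' (\<phi> k x)) *\<^sub>R grad (\<phi> k) x" by (rule grad_eqI)
      then show "grad \<psi> x \<bullet> (a x *v G x) = A k x + T k x"
        by (simp add: A_def T_def X_def cr_def inner_add_left inner_diff_left algebra_simps)
    qed
    ultimately show ?thesis by simp
  qed
  have T_le: "\<bar>T k x\<bar> \<le> C' * \<bar>cr k x\<bar>" for k x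
  proof -
    have "\<bar>\<xi> x * g' (\<phi> k x)\<bar> \<le> 1 * C'"
      unfolding abs_mult using C' bd(1) C0 by (intro mult_mono) auto
    then show ?thesis unfolding T_def abs_mult[of "\<xi> x * g' (\<phi> k x)"] by (intro mult_right_mono) auto
  qed
  define c where "c k = (\<integral>\<^sup>+ x. ennreal \<bar>cr k x\<bar> \<partial>\<mu>)" for k
  have c0: "c \<longlonglongrightarrow> 0" using cross_integral_tendsto_0 by (simp only: c_def[abs_def] cr_def)
  have TA: "eventually (\<lambda>k. norm (LINT x|\<mu>. A k x) \<le> C' * enn2real (c k)) sequentially"
  proof (rule eventually_mono)
    show "eventually (\<lambda>k. c k < 1) sequentially" using order_tendstoD(2)[OF c0, of 1] by simp
    fix k assume ck: "c k < 1"
    have ckfin: "c k < top" using ck by (rule less_trans) simp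
    have Tb: "(\<integral>\<^sup>+ x. ennreal (norm (T k x)) \<partial>\<mu>) \<le> ennreal C' * c k"
    proof -
      have "(\<integral>\<^sup>+ x. ennreal (norm (T k x)) \<partial>\<mu>) \<le> (\<integral>\<^sup>+ x. ennreal C' * ennreal \<bar>cr k x\<bar> \<partial>\<mu>)"
        using T_le C0 by (intro nn_integral_mono) (simp add: ennreal_mult[symmetric] ennreal_leI)
      also have "\<dots> = ennreal C' * c k" unfolding c_def by (rule nn_integral_cmult) measurable
      finally show ?thesis .
    qed
    have T_int: "integrable \<mu> (T k)"
      by (rule integrableI_bounded[OF A_meas(3)])
        (rule le_less_trans[OF Tb], simp add: ennreal_mult_less_top ckfin)
    have "ennreal (norm (LINT x|\<mu>. T k x)) \<le> ennreal C' * c k"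
      by (rule order_trans[OF integral_norm_bound_ennreal[OF T_int] Tb])
    also have "\<dots> = ennreal (C' * enn2real (c k))"
      using ckfin C0 by (simp add: ennreal_mult)
    finally have "norm (LINT x|\<mu>. T k x) \<le> C' * enn2real (c k)" using C0 by (subst (asm) ennreal_le_iff) simp_all
    moreover have "(LINT x|\<mu>. A k x) + (LINT x|\<mu>. T k x) = 0"
      using zero[of k] Bochner_Integration.integral_add[OF A_int T_int] by simp
    ultimately show "norm (LINT x|\<mu>. A k x) \<le> C' * enn2real (c k)"
      by (simp add: eq_neg_iff_add_eq_0[symmetric])
  qed
  have "(\<lambda>k. C' * enn2real (c k)) \<longlonglongrightarrow> C' * 0"
    by (intro tendsto_mult tendsto_const tendsto_enn2real) (use c0 in simp_all)
  then have "(\<lambda>k. C' * enn2real (c k)) \<longlonglongrightarrow> 0" by simp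
  from Lim_null_comparison[OF TA this] have "(\<lambda>k. LINT x|\<mu>. A k x) \<longlonglongrightarrow> 0" .
  from LIMSEQ_unique[OF lim this] show ?thesis by (simp add: A'_def g_def g'_def X_def)
qed

text \<open>The test function is \<eta>^2 h(u) with h' the square of f', so the good term is exactly
  the energy of f(u). The hypothesis on \<open>b\<close> lets the term with the gradient of the
  cutoff be absorbed: \<open>b\<close> is a multiple of f for powers and the constant 1 for the
  logarithm.\<close>

lemma (in degenerate_solution) caccioppoli:
  fixes \<eta> :: "real ^ 'n \<Rightarrow> real"
  assumes \<eta>: "\<And>k. Ck k UNIV \<eta>" "\<And>x. 0 \<le> \<eta> x" "\<And>x. \<eta> x \<le> 1" "\<And>x. x \<in> cube \<rho> \<Longrightarrow> \<eta> x = 1"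
      "\<And>x. x \<notin> cube \<rho>' \<Longrightarrow> \<eta> x = 0" "\<And>x. norm (grad \<eta> x) \<le> M" and \<rho>': "\<rho>' < 1"
    and h: "\<And>t. 0 \<le> t \<Longrightarrow> (h has_real_derivative (f' t)\<^sup>2) (at t)" "continuous_on {0..} f'" "\<And>t. 0 \<le> t \<Longrightarrow> \<bar>f' t\<bar> \<le> K"
    and b: "\<And>t. 0 \<le> t \<Longrightarrow> \<bar>h t\<bar> \<le> b t * \<bar>f' t\<bar>" "\<And>t. 0 \<le> t \<Longrightarrow> 0 \<le> b t" "continuous_on {0..} b"
    and J: "(\<integral>\<^sup>+ x. ennreal ((b (u x))\<^sup>2 * N x) * indicator (cube \<rho>') x \<partial>\<mu>) \<le> ennreal J" "0 \<le> J"
  shows "(\<integral>\<^sup>+ x. ennreal ((f' (u x))\<^sup>2 * E x) * indicator (cube \<rho>) x \<partial>\<mu>) \<le> ennreal (4 * M\<^sup>2 * J)"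
proof -
  define \<xi> where "\<xi> x = \<eta> x * \<eta> x" for x
  have K0: "0 \<le> K" using order_trans[OF abs_ge_zero h(3)[of 0]] by simp
  have M0: "0 \<le> M" using order_trans[OF norm_ge_zero \<eta>(6)] .
  have h': "0 \<le> (f' t)\<^sup>2" "(f' t)\<^sup>2 \<le> K\<^sup>2" if "0 \<le> t" for t
    using power_mono[OF h(3)[OF that], of 2] by simp_all
  have f'2: "continuous_on {0..} (\<lambda>t. (f' t)\<^sup>2)" by (intro continuous_on_power h)
  obtain P where P: "\<And>t. 0 \<le> t \<Longrightarrow> (\<lambda>n. poly (P n) (tanh t)) \<longlonglongrightarrow> h t"
    "\<And>t. 0 \<le> t \<Longrightarrow> (\<lambda>n. poly (pderiv (P n) * [:1, 0, -1:]) (tanh t)) \<longlonglongrightarrow> (f' t)\<^sup>2"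
    "\<And>n t. 0 \<le> t \<Longrightarrow> \<bar>poly (P n) (tanh t)\<bar> \<le> 1 + \<bar>h 0\<bar> + \<bar>h t\<bar>"
    "\<And>n t. 0 \<le> t \<Longrightarrow> \<bar>poly (pderiv (P n) * [:1, 0, -1:]) (tanh t)\<bar> \<le> K\<^sup>2 + 1"
  proof (rule tanh_polynomial_sequence[OF h(1) f'2 h'])
    fix P :: "nat \<Rightarrow> real poly"
    assume "\<And>t. 0 \<le> t \<Longrightarrow> (\<lambda>n. poly (P n) (tanh t)) \<longlonglongrightarrow> h t"
      "\<And>t. 0 \<le> t \<Longrightarrow> (\<lambda>n. poly (pderiv (P n) * [:1, 0, -1:]) (tanh t)) \<longlonglongrightarrow> (f' t)\<^sup>2"
      "\<And>n t. 0 \<le> t \<Longrightarrow> \<bar>poly (P n) (tanh t)\<bar> \<le> 1 + \<bar>h 0\<bar> + \<bar>h t\<bar>"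
      "\<And>n t. 0 \<le> t \<Longrightarrow> \<bar>poly (pderiv (P n) * [:1, 0, -1:]) (tanh t)\<bar> \<le> K\<^sup>2 + 1"
    then show thesis by (rule that)
  qed
  have grad\<xi>: "grad \<xi> x = (2 * \<eta> x) *\<^sub>R grad \<eta> x" for x
  proof (rule grad_eqI)
    have d: "(\<eta> has_derivative (\<lambda>v. grad \<eta> x \<bullet> v)) (at x)" by (rule grad_works[OF smooth_grad(1)[OF \<eta>(1)]])
    show "(\<xi> has_derivative (\<lambda>v. ((2 * \<eta> x) *\<^sub>R grad \<eta> x) \<bullet> v)) (at x)"
      unfolding \<xi>_def by (rule has_derivative_eq_rhs[OF has_derivative_mult[OF d d]]) (simp add: fun_eq_iff)
  qed
  define Kset :: "(real ^ 'n) set" where "Kset = cbox (\<chi> i. - \<rho>' / 2) (\<chi> i. \<rho>' / 2)"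
  have Kset: "compact Kset" "Kset \<subseteq> cube 1" "cube \<rho>' \<subseteq> Kset"
  proof -
    show "compact Kset" unfolding Kset_def by (rule compact_cbox)
    show "cube \<rho>' \<subseteq> Kset" unfolding Kset_def cube_def by (rule box_subset_cbox)
    show "Kset \<subseteq> cube 1" unfolding Kset_def by (rule cbox_subset_cube[OF \<rho>'])
  qed
  define X where "X x = grad \<eta> x \<bullet> (a x *v G x)" for x
  have W: "(LINT x|\<mu>. poly (P n) (tanh (u x)) * (2 * \<eta> x * X x)
      + \<xi> x * poly (pderiv (P n) * [:1, 0, -1:]) (tanh (u x)) * E x) = 0" for n
  proof -
    have "(LINT x|\<mu>. poly (P n) (tanh (u x)) * (grad \<xi> x \<bullet> (a x *v G x))
      + \<xi> x * poly (pderiv (P n) * [:1, 0, -1:]) (tanh (u x)) * E x) = 0"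
    proof (rule weak_form_tanh[OF _ Kset(1,2), where M="2 * M"])
      show "Ck k UNIV \<xi>" for k unfolding \<xi>_def by (intro Ck_mult open_UNIV \<eta>(1))
      show "\<xi> x = 0" if "x \<notin> Kset" for x
      proof -
        have "\<eta> x = 0" using that Kset(3) by (intro \<eta>(5)) blast
        then show ?thesis by (simp add: \<xi>_def)
      qed
      show "\<bar>\<xi> x\<bar> \<le> 1" for x using mult_le_one[OF \<eta>(3) \<eta>(2) \<eta>(3), of x x] \<eta>(2)[of x] by (simp add: \<xi>_def)
      show "norm (grad \<xi> x) \<le> 2 * M" for x
      proof -
        have "\<eta> x * norm (grad \<eta> x) \<le> 1 * M" by (rule mult_mono[OF \<eta>(3) \<eta>(6)]) simp_all
        then show ?thesis using \<eta>(2)[of x] by (simp add: grad\<xi>)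
      qed
    qed
    then show ?thesis by (simp add: grad\<xi> X_def)
  qed
  have grad\<eta>_meas: "grad \<eta> \<in> borel_measurable \<mu>"
    by (rule continuous_meas[OF continuous_on_subset[OF smooth_grad(2)[OF \<eta>(1)]]]) simp
  have \<eta>_meas [measurable]: "\<eta> \<in> borel_measurable \<mu>"
    by (rule continuous_meas[OF continuous_on_subset[OF Ck_imp_continuous[OF \<eta>(1)[of 0]]]]) simp
  have \<xi>_meas [measurable]: "\<xi> \<in> borel_measurable \<mu>" unfolding \<xi>_def by (intro borel_measurable_times \<eta>_meas)
  have X_meas [measurable]: "X \<in> borel_measurable \<mu>" unfolding X_def by (rule flux_meas[OF grad\<eta>_meas])
  have h_cont: "continuous_on {0..} h"
    by (rule continuous_at_imp_continuous_on) (use h(1) in \<open>auto intro: DERIV_isCont\<close>)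
  have hu_meas [measurable]: "(\<lambda>x. h (u x)) \<in> borel_measurable \<mu>" by (rule continuous_comp_meas[OF h_cont])
  have f'u_meas [measurable]: "(\<lambda>x. (f' (u x))\<^sup>2) \<in> borel_measurable \<mu>" by (rule continuous_comp_meas[OF f'2])
  have bu_meas [measurable]: "(\<lambda>x. b (u x)) \<in> borel_measurable \<mu>" by (rule continuous_comp_meas[OF b(3)])
  have poly_meas: "(\<lambda>x. poly Q (tanh (u x))) \<in> borel_measurable \<mu>" for Q
    using Ck_poly_tanh[of 0 Q] by (intro borel_measurable_continuous_on[OF _ u_meas]) simp
  define B where "B x = (b (u x))\<^sup>2 * N x * indicator (cube \<rho>') x" for x
  have B_meas [measurable]: "B \<in> borel_measurable \<mu>" 
    unfolding B_def by (intro borel_measurable_times borel_measurable_power bu_meas N_meas indicator_cube_meas)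
  have B0: "0 \<le> B x" for x by (simp add: B_def spectral_norm_nonneg)
  have B_nn: "(\<integral>\<^sup>+ x. ennreal (B x) \<partial>\<mu>) \<le> ennreal J"
  proof -
    have "ennreal (B x) = ennreal ((b (u x))\<^sup>2 * N x) * indicator (cube \<rho>') x" for x
      by (simp add: B_def indicator_def)
    then have "(\<integral>\<^sup>+ x. ennreal (B x) \<partial>\<mu>) = (\<integral>\<^sup>+ x. ennreal ((b (u x))\<^sup>2 * N x) * indicator (cube \<rho>') x \<partial>\<mu>)"
      by (intro nn_integral_cong)
    then show ?thesis using J(1) by (rule ord_eq_le_trans)
  qed
  have B_int: "integrable \<mu> B"
    by (rule integrableI_nonneg[OF B_meas]) (use B0 le_less_trans[OF B_nn] in auto)
  have B_le: "(LINT x|\<mu>. B x) \<le> J"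
  proof -
    have "ennreal (LINT x|\<mu>. B x) \<le> ennreal J"
      using B_nn by (subst (asm) nn_integral_eq_integral[OF B_int]) (use B0 in auto)
    then show ?thesis using J(2) by simp
  qed
  \<comment> \<open>One integrable majorant for all n. The approximants of h are at most
    \<open>1 + \<bar>h 0\<bar> + \<bar>h (u x)\<bar>\<close>, whose square is expanded with the
    factor 3, and h^2 N is at most K^2 b^2 N on the support of the cutoff, which is integrable by
    the hypothesis on \<open>J\<close>.\<close>
  define D where "D x = M\<^sup>2 * (3 * (1 + (h 0)\<^sup>2) * N x + 3 * K\<^sup>2 * B x) + E x + (K\<^sup>2 + 1) * E x" for x
  have D_int: "integrable \<mu> D"
    unfolding D_def
    by (intro Bochner_Integration.integrable_add Bochner_Integration.integrable_mult_right integrable_N integrable_E B_int)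
  define F1 where "F1 x = \<xi> x * (f' (u x))\<^sup>2 * E x" for x
  define F2 where "F2 x = h (u x) * (2 * \<eta> x * X x)" for x
  have \<xi>01: "0 \<le> \<xi> x" "\<xi> x \<le> 1" for x using \<eta>(2,3)[of x] by (auto simp: \<xi>_def mult_le_one)
  have flux_bound: "\<bar>y * (2 * \<eta> x * X x)\<bar> \<le> M\<^sup>2 * (3 * (1 + (h 0)\<^sup>2) * N x + 3 * K\<^sup>2 * B x) + E x"
    if x: "x \<in> cube 1" and y: "\<bar>y\<bar> \<le> 1 + \<bar>h 0\<bar> + \<bar>h (u x)\<bar>" for x y
  proof (cases "x \<in> cube \<rho>'")
    case False
    have "0 \<le> M\<^sup>2 * (3 * (1 + (h 0)\<^sup>2) * N x + 3 * K\<^sup>2 * B x) + E x"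
      by (intro add_nonneg_nonneg mult_nonneg_nonneg zero_le_power2 spectral_norm_nonneg B0 a_psd[OF x]) simp_all
    then show ?thesis by (simp only: \<eta>(5)[OF False] mult_zero_right mult_zero_left abs_zero)
  next
    case True
    define H where "H = 1 + \<bar>h 0\<bar> + \<bar>h (u x)\<bar>"
    have H0: "0 \<le> H" by (simp add: H_def)
    have "\<bar>y * (2 * \<eta> x * X x)\<bar> = (\<bar>y\<bar> * \<eta> x) * (2 * \<bar>X x\<bar>)" using \<eta>(2)[of x] by (simp add: abs_mult)
    also have "\<dots> \<le> (H * 1) * (2 * \<bar>X x\<bar>)"
      using y \<eta>(2,3)[of x] H0 unfolding H_def[symmetric] by (intro mult_right_mono mult_mono) auto
    also have "\<dots> = 2 * \<bar>(H *\<^sub>R grad \<eta> x) \<bullet> (a x *v G x)\<bar>" using H0 by (simp add: X_def abs_mult)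
    also have "\<dots> \<le> (H * M)\<^sup>2 * N x + E x"
      by (rule flux_Young[OF x]) (use H0 \<eta>(6)[of x] in \<open>simp add: mult_left_mono\<close>)
    finally have le: "\<bar>y * (2 * \<eta> x * X x)\<bar> \<le> (H * M)\<^sup>2 * N x + E x" .
    have H2: "H\<^sup>2 \<le> 3 * (1 + (h 0)\<^sup>2) + 3 * (h (u x))\<^sup>2"
    proof -
      have "(p + q + r)\<^sup>2 \<le> 3 * (p\<^sup>2 + q\<^sup>2) + 3 * r\<^sup>2" for p q r :: real
      proof -
        have "3 * (p\<^sup>2 + q\<^sup>2) + 3 * r\<^sup>2 - (p + q + r)\<^sup>2 = (p - q)\<^sup>2 + (p - r)\<^sup>2 + (q - r)\<^sup>2"
          by (simp add: power2_eq_square algebra_simps)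
        moreover have "0 \<le> (p - q)\<^sup>2 + (p - r)\<^sup>2 + (q - r)\<^sup>2" by simp
        ultimately show ?thesis by linarith
      qed
      from this[of 1 "\<bar>h 0\<bar>" "\<bar>h (u x)\<bar>"] show ?thesis by (simp add: H_def)
    qed
    have gen: "(H * M)\<^sup>2 * n + e \<le> M\<^sup>2 * (c * n + 3 * (z * n)) + e" if "H\<^sup>2 \<le> c + 3 * z" "0 \<le> n" for n e c z :: real
    proof -
      have "H\<^sup>2 * (M\<^sup>2 * n) \<le> (c + 3 * z) * (M\<^sup>2 * n)" using that by (intro mult_right_mono) simp_all
      then show ?thesis by (simp add: power_mult_distrib algebra_simps)
    qed
    note le
    also have "(H * M)\<^sup>2 * N x + E x \<le> M\<^sup>2 * (3 * (1 + (h 0)\<^sup>2) * N x + 3 * ((h (u x))\<^sup>2 * N x)) + E x"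
      by (rule gen[OF H2 spectral_norm_nonneg])
    also have "\<dots> \<le> M\<^sup>2 * (3 * (1 + (h 0)\<^sup>2) * N x + 3 * K\<^sup>2 * B x) + E x"
    proof -
      have "\<bar>h (u x)\<bar> \<le> b (u x) * K"
        by (rule order_trans[OF b(1)[OF u_nonneg] mult_left_mono[OF h(3)[OF u_nonneg] b(2)[OF u_nonneg]]])
      then have "(h (u x))\<^sup>2 \<le> (b (u x) * K)\<^sup>2" using power_mono[of "\<bar>h (u x)\<bar>" "b (u x) * K" 2] by simp
      then have "(h (u x))\<^sup>2 * N x \<le> (b (u x) * K)\<^sup>2 * N x" by (intro mult_right_mono spectral_norm_nonneg)
      also have "\<dots> = K\<^sup>2 * B x" using True by (simp add: B_def power_mult_distrib)
      finally have "3 * ((h (u x))\<^sup>2 * N x) \<le> 3 * K\<^sup>2 * B x" by simp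
      then show ?thesis by (intro add_right_mono mult_left_mono add_left_mono zero_le_power2)
    qed
    finally show ?thesis .
  qed
  have E0: "0 \<le> E x" if "x \<in> cube 1" for x by (rule a_psd[OF that])
  have dom: "\<bar>y * (2 * \<eta> x * X x) + \<xi> x * z * E x\<bar> \<le> D x"
    if x: "x \<in> cube 1" and y: "\<bar>y\<bar> \<le> 1 + \<bar>h 0\<bar> + \<bar>h (u x)\<bar>" and z: "\<bar>z\<bar> \<le> K\<^sup>2 + 1" for x y z
  proof -
    have "\<bar>\<xi> x * z\<bar> \<le> 1 * (K\<^sup>2 + 1)" unfolding abs_mult using \<xi>01[of x] z by (intro mult_mono) auto
    then have "\<bar>\<xi> x * z * E x\<bar> \<le> (K\<^sup>2 + 1) * E x"
      unfolding abs_mult[of "\<xi> x * z"] using E0[OF x] by (intro mult_mono) auto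
    then show ?thesis using flux_bound[OF x y] unfolding D_def by linarith
  qed
  have F12_meas [measurable]: "F1 \<in> borel_measurable \<mu>" "F2 \<in> borel_measurable \<mu>"
    unfolding F1_def F2_def
    by (intro borel_measurable_times \<xi>_meas E_meas f'u_meas hu_meas X_meas \<eta>_meas borel_measurable_const)+
  have D_abs: "D x \<le> \<bar>D x\<bar>" for x by (rule abs_ge_self)
  have F1_int: "integrable \<mu> F1"
  proof (rule Bochner_Integration.integrable_bound[OF D_int F12_meas(1)], rule AE_I2)
    fix x assume "x \<in> space \<mu>"
    then have x: "x \<in> cube 1" by simp
    have "\<bar>F1 x\<bar> \<le> D x" using dom[OF x, of 0 "(f' (u x))\<^sup>2"] h'(2)[OF u_nonneg, of x] by (simp add: F1_def)
    then show "norm (F1 x) \<le> norm (D x)" using D_abs[of x] by simp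
  qed
  have F2_int: "integrable \<mu> F2"
  proof (rule Bochner_Integration.integrable_bound[OF D_int F12_meas(2)], rule AE_I2)
    fix x assume "x \<in> space \<mu>"
    then have x: "x \<in> cube 1" by simp
    have "\<bar>F2 x\<bar> \<le> D x" using dom[OF x, of "h (u x)" 0] by (simp add: F2_def)
    then show "norm (F2 x) \<le> norm (D x)" using D_abs[of x] by simp
  qed
  have "(\<lambda>n. LINT x|\<mu>. poly (P n) (tanh (u x)) * (2 * \<eta> x * X x)
      + \<xi> x * poly (pderiv (P n) * [:1, 0, -1:]) (tanh (u x)) * E x) \<longlonglongrightarrow> (LINT x|\<mu>. F2 x + F1 x)"
  proof (rule integral_dominated_convergence[OF _ _ D_int])
    show "(\<lambda>x. F2 x + F1 x) \<in> borel_measurable \<mu>" by measurable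
    show "(\<lambda>x. poly (P n) (tanh (u x)) * (2 * \<eta> x * X x)
      + \<xi> x * poly (pderiv (P n) * [:1, 0, -1:]) (tanh (u x)) * E x) \<in> borel_measurable \<mu>" for n
      by (intro borel_measurable_add borel_measurable_times \<xi>_meas E_meas poly_meas X_meas \<eta>_meas borel_measurable_const)
    show "AE x in \<mu>. (\<lambda>n. poly (P n) (tanh (u x)) * (2 * \<eta> x * X x)
      + \<xi> x * poly (pderiv (P n) * [:1, 0, -1:]) (tanh (u x)) * E x) \<longlonglongrightarrow> F2 x + F1 x"
      unfolding F1_def F2_def by (intro AE_I2 tendsto_intros P u_nonneg)
    show "AE x in \<mu>. norm (poly (P n) (tanh (u x)) * (2 * \<eta> x * X x)
      + \<xi> x * poly (pderiv (P n) * [:1, 0, -1:]) (tanh (u x)) * E x) \<le> D x" for n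
      unfolding real_norm_def by (rule AE_I2, rule dom[OF _ P(3)[OF u_nonneg] P(4)[OF u_nonneg]]) simp
  qed
  then have "(LINT x|\<mu>. F2 x + F1 x) = 0" unfolding W by (simp add: LIMSEQ_const_iff)
  then have sum0: "(LINT x|\<mu>. F2 x) + (LINT x|\<mu>. F1 x) = 0"
    using Bochner_Integration.integral_add[OF F2_int F1_int] by simp
  \<comment> \<open>Cauchy-Schwarz followed by Young with weights 1/2 and 2. The first share is half
    of the good term and can be subtracted because \<open>F1\<close> is integrable, which doubles
    the constant 2 to 4.\<close>
  have F2_le: "- F2 x \<le> 1 / 2 * F1 x + 2 * M\<^sup>2 * B x" if x: "x \<in> cube 1" for x
  proof (cases "x \<in> cube \<rho>'")
    case False
    then show ?thesis using \<eta>(5) B0[of x] by (simp add: F1_def F2_def \<xi>_def)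
  next
    case True
    define p where "p = \<eta> x * (\<bar>f' (u x)\<bar> * sqrt (E x))"
    define q where "q = b (u x) * (M * sqrt (N x))"
    have b0: "0 \<le> b (u x)" by (rule b(2)[OF u_nonneg])
    have "\<bar>X x\<bar> \<le> sqrt (grad \<eta> x \<bullet> (a x *v grad \<eta> x)) * sqrt (E x)"
      unfolding X_def by (rule cross_term_le[OF x])
    also have "\<dots> \<le> (M * sqrt (N x)) * sqrt (E x)"
    proof (rule mult_right_mono)
      have "grad \<eta> x \<bullet> (a x *v grad \<eta> x) \<le> N x * M\<^sup>2"
        by (rule order_trans[OF quadratic_form_le mult_left_mono[OF power_mono[OF \<eta>(6) norm_ge_zero] spectral_norm_nonneg]])
      then have "sqrt (grad \<eta> x \<bullet> (a x *v grad \<eta> x)) \<le> sqrt (N x * M\<^sup>2)" by (rule real_sqrt_le_mono)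
      then show "sqrt (grad \<eta> x \<bullet> (a x *v grad \<eta> x)) \<le> M * sqrt (N x)" using M0 by (simp add: real_sqrt_mult mult.commute)
    qed (simp add: E0[OF x])
    finally have X_le: "\<bar>X x\<bar> \<le> (M * sqrt (N x)) * sqrt (E x)" .
    have "- F2 x \<le> \<bar>h (u x)\<bar> * (2 * \<eta> x * \<bar>X x\<bar>)"
      using \<eta>(2)[of x] abs_ge_minus_self[of "F2 x"] by (simp add: F2_def abs_mult)
    also have "\<dots> \<le> (b (u x) * \<bar>f' (u x)\<bar>) * (2 * \<eta> x * ((M * sqrt (N x)) * sqrt (E x)))"
      using b(1)[OF u_nonneg] X_le \<eta>(2)[of x] b0 by (intro mult_mono mult_left_mono) auto
    also have "\<dots> = 2 * (p * q)" by (simp add: p_def q_def)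
    also have "\<dots> \<le> 1 / 2 * p\<^sup>2 + 2 * q\<^sup>2"
    proof -
      have "0 \<le> (p - 2 * q)\<^sup>2" by simp
      then show ?thesis by (simp add: power2_eq_square algebra_simps)
    qed
    also have "p\<^sup>2 = F1 x"
      unfolding p_def power_mult_distrib real_sqrt_pow2[OF E0[OF x]] F1_def \<xi>_def power2_abs
      by (simp add: power2_eq_square)
    also have "q\<^sup>2 = M\<^sup>2 * B x"
      using True by (simp add: q_def B_def power_mult_distrib spectral_norm_nonneg)
    finally show ?thesis by simp
  qed
  have "- (LINT x|\<mu>. F2 x) = (LINT x|\<mu>. - F2 x)" by simp
  also have "\<dots> \<le> (LINT x|\<mu>. 1 / 2 * F1 x + 2 * M\<^sup>2 * B x)"
  proof (rule integral_mono)
    show "integrable \<mu> (\<lambda>x. - F2 x)" using F2_int by simp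
    show "integrable \<mu> (\<lambda>x. 1 / 2 * F1 x + 2 * M\<^sup>2 * B x)"
      by (intro Bochner_Integration.integrable_add Bochner_Integration.integrable_mult_right F1_int B_int)
    show "- F2 x \<le> 1 / 2 * F1 x + 2 * M\<^sup>2 * B x" if "x \<in> space \<mu>" for x
      by (rule F2_le) (use that in simp)
  qed
  also have "\<dots> = (LINT x|\<mu>. 1 / 2 * F1 x) + (LINT x|\<mu>. 2 * M\<^sup>2 * B x)"
    by (intro Bochner_Integration.integral_add Bochner_Integration.integrable_mult_right F1_int B_int)
  also have "\<dots> = 1 / 2 * (LINT x|\<mu>. F1 x) + 2 * M\<^sup>2 * (LINT x|\<mu>. B x)" by simp
  also have "\<dots> \<le> 1 / 2 * (LINT x|\<mu>. F1 x) + 2 * M\<^sup>2 * J"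
    using B_le by (intro add_left_mono mult_left_mono) auto
  finally have F1_le: "(LINT x|\<mu>. F1 x) \<le> 4 * M\<^sup>2 * J" using sum0 by simp
  have "(\<integral>\<^sup>+ x. ennreal ((f' (u x))\<^sup>2 * E x) * indicator (cube \<rho>) x \<partial>\<mu>) \<le> (\<integral>\<^sup>+ x. ennreal (F1 x) \<partial>\<mu>)"
  proof (rule nn_integral_mono)
    fix x
    show "ennreal ((f' (u x))\<^sup>2 * E x) * indicator (cube \<rho>) x \<le> ennreal (F1 x)"
    proof (cases "x \<in> cube \<rho>")
      case True
      then have "\<eta> x = 1" by (rule \<eta>(4))
      then have "\<xi> x = 1" by (simp add: \<xi>_def)
      then show ?thesis using True by (simp add: F1_def)
    qed simp
  qed
  also have "\<dots> = ennreal (LINT x|\<mu>. F1 x)"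
    by (rule nn_integral_eq_integral[OF F1_int], rule AE_I2) (simp add: F1_def E0 \<xi>01)
  also have "\<dots> \<le> ennreal (4 * M\<^sup>2 * J)" by (rule ennreal_leI[OF F1_le])
  finally show ?thesis .
qed

subsection \<open>Poincare-Sobolev inequality with weights\<close>

text \<open>Fatou's lemma with bounds that themselves converge and that need to hold only
  eventually, since the early approximants may be at infinite distance from the solution.\<close>

lemma nn_integral_le_limit:
  assumes [measurable]: "\<And>k. f k \<in> borel_measurable M"
    and AE: "AE x in M. (\<lambda>k. f k x) \<longlonglongrightarrow> (g x :: ennreal)"
    and le: "eventually (\<lambda>k. (\<integral>\<^sup>+ x. f k x \<partial>M) \<le> c k) sequentially" and c: "c \<longlonglongrightarrow> d"
  shows "(\<integral>\<^sup>+ x. g x \<partial>M) \<le> d"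
proof -
  have "(\<integral>\<^sup>+ x. g x \<partial>M) = (\<integral>\<^sup>+ x. liminf (\<lambda>k. f k x) \<partial>M)"
    by (rule nn_integral_cong_AE, rule eventually_mono[OF AE]) (simp add: lim_imp_Liminf)
  also have "\<dots> \<le> liminf (\<lambda>k. \<integral>\<^sup>+ x. f k x \<partial>M)" by (rule nn_integral_liminf) measurable
  also have "\<dots> \<le> liminf c" by (rule Liminf_mono[OF le])
  also have "\<dots> = d" using c by (simp add: lim_imp_Liminf)
  finally show ?thesis .
qed

text \<open>The Poincare-Sobolev inequality is about \<open>lborel\<close>, the solution about
  Lebesgue measure restricted to the unit cube; the indicator makes the two integrals
  comparable.\<close>

lemma nn_integral_cube_measure:
  assumes "\<rho> \<le> 1"
  shows "(\<integral>\<^sup>+ x. F x * indicator (cube \<rho>) x \<partial>cube_measure 1) = (\<integral>\<^sup>+ x. F x * indicator (cube \<rho>) x \<partial>lborel)"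
proof -
  have "(\<integral>\<^sup>+ x. F x * indicator (cube \<rho>) x \<partial>cube_measure 1)
      = (\<integral>\<^sup>+ x. F x * indicator (cube \<rho>) x * indicator (cube 1) x \<partial>lebesgue)"
    by (rule nn_integral_restrict_space) simp
  also have "\<dots> = (\<integral>\<^sup>+ x. F x * indicator (cube \<rho>) x \<partial>lebesgue)"
    using cube_subset[OF assms] by (intro nn_integral_cong) (auto simp: indicator_def)
  also have "\<dots> = (\<integral>\<^sup>+ x. F x * indicator (cube \<rho>) x \<partial>lborel)" by (rule nn_integral_completion)
  finally show ?thesis .
qed

lemma set_integral_cube_measure:
  fixes w :: "real ^ 'n \<Rightarrow> real"
  assumes "\<rho> \<le> 1" "(\<lambda>x. indicator (cube \<rho>) x *\<^sub>R w x) \<in> borel_measurable borel"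
  shows "(LINT x:cube \<rho>|lborel. w x) = (LINT x|cube_measure 1. w x * indicator (cube \<rho>) x)"
proof -
  have "(LINT x|cube_measure 1. w x * indicator (cube \<rho>) x)
      = (LINT x|lebesgue. indicator (cube 1) x *\<^sub>R (w x * indicator (cube \<rho>) x))"
    by (rule integral_restrict_space) simp
  also have "\<dots> = (LINT x|lebesgue. indicator (cube \<rho>) x *\<^sub>R w x)"
    using cube_subset[OF assms(1)] by (intro Bochner_Integration.integral_cong) (auto simp: indicator_def)
  also have "\<dots> = (LINT x|lborel. indicator (cube \<rho>) x *\<^sub>R w x)"
    by (rule integral_completion) (use assms(2) in simp)
  finally show ?thesis by (simp add: set_lebesgue_integral_def)
qed

lemma cube_diameter:
  fixes x y :: "real ^ 'n"
  assumes "x \<in> cube \<rho>" "y \<in> cube \<rho>" "\<rho> \<le> 1"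
  shows "norm (y - x) \<le> real CARD('n)"
proof -
  have "norm (y - x) \<le> (\<Sum>i\<in>UNIV. \<bar>(y - x) $ i\<bar>)" by (rule norm_le_l1_cart)
  also have "\<dots> \<le> (\<Sum>i\<in>(UNIV :: 'n set). 1)"
  proof (rule sum_mono)
    fix i :: 'n
    have "- 1 / 2 < x $ i \<and> x $ i < 1 / 2" "- 1 / 2 < y $ i \<and> y $ i < 1 / 2"
      using subsetD[OF cube_subset[OF assms(3)] assms(1)] subsetD[OF cube_subset[OF assms(3)] assms(2)]
      by (simp_all add: in_cube_iff)
    then have "- 1 < 2 * x $ i" "2 * x $ i < 1" "- 1 < 2 * y $ i" "2 * y $ i < 1" by simp_all
    then show "\<bar>(y - x) $ i\<bar> \<le> 1" unfolding abs_le_iff vector_minus_component by linarith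
  qed
  finally show ?thesis by simp
qed

text \<open>The factor of \<open>poincare_sobolev\<close> for a cube of side \<open>\<rho>\<close>
  at most 1, with the crude diameter bound \<open>CARD('n)\<close>. The exponent of the gradient is
  present only through \<open>\<sigma>\<close>.\<close>

definition poincare_const :: "'n::finite itself \<Rightarrow> real \<Rightarrow> real \<Rightarrow> real \<Rightarrow> real" where
  "poincare_const _ r \<sigma> \<rho> = 2 ^ CARD('n) * (real CARD('n) / \<rho> ^ CARD('n)) powr r * (1 / (1 - \<sigma>)) powr r"

context degenerate_solution
begin

lemma deviation_L1: "(\<lambda>k. \<integral>\<^sup>+ x. ennreal \<bar>\<phi> k x - u x\<bar> \<partial>\<mu>) \<longlonglongrightarrow> 0"
proof -
  define e where "e k = enn2real (\<integral>\<^sup>+ x. ennreal ((\<phi> k x - u x)\<^sup>2) \<partial>\<mu>)" for k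
  have e0: "e \<longlonglongrightarrow> 0" unfolding e_def[abs_def] by (rule tendsto_enn2real) (use \<phi>_L2 in simp_all)
  have diff_meas: "(\<lambda>x. \<bar>\<phi> k x - u x\<bar>) \<in> borel_measurable \<mu>" for k
    by (intro borel_measurable_abs borel_measurable_diff \<phi>_meas u_meas)
  have bound: "eventually (\<lambda>k. (\<integral>\<^sup>+ x. ennreal \<bar>\<phi> k x - u x\<bar> \<partial>\<mu>) \<le> ennreal (e k powr (1/2) * 1 powr (1/2))) sequentially"
  proof (rule eventually_mono)
    show "eventually (\<lambda>k. (\<integral>\<^sup>+ x. ennreal ((\<phi> k x - u x)\<^sup>2) \<partial>\<mu>) < 1) sequentially"
      using order_tendstoD(2)[OF \<phi>_L2, of 1] by simp
    fix k assume k: "(\<integral>\<^sup>+ x. ennreal ((\<phi> k x - u x)\<^sup>2) \<partial>\<mu>) < 1"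
    have "(\<integral>\<^sup>+ x. ennreal (\<bar>\<phi> k x - u x\<bar> * 1) \<partial>\<mu>) \<le> ennreal (e k powr (1/2) * 1 powr (1/2))"
    proof (rule nn_integral_Holder_bound[OF diff_meas])
      have "(\<integral>\<^sup>+ x. ennreal (\<bar>\<phi> k x - u x\<bar> powr 2) \<partial>\<mu>) = (\<integral>\<^sup>+ x. ennreal ((\<phi> k x - u x)\<^sup>2) \<partial>\<mu>)"
        by (intro nn_integral_cong) simp
      also have "\<dots> = ennreal (e k)" unfolding e_def using k by (intro ennreal_enn2real[symmetric]) (auto intro: less_trans)
      finally show "(\<integral>\<^sup>+ x. ennreal (\<bar>\<phi> k x - u x\<bar> powr 2) \<partial>\<mu>) \<le> ennreal (e k)" by simp
      show "(\<integral>\<^sup>+ x. ennreal (1 powr 2) \<partial>\<mu>) \<le> ennreal 1"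
        by (simp add: emeasure_restrict_space emeasure_cube)
    qed (simp_all add: e_def)
    then show "(\<integral>\<^sup>+ x. ennreal \<bar>\<phi> k x - u x\<bar> \<partial>\<mu>) \<le> ennreal (e k powr (1/2) * 1 powr (1/2))" by simp
  qed
  have "(\<lambda>k. e k powr (1/2) * 1 powr (1/2)) \<longlonglongrightarrow> 0 powr (1/2) * 1 powr (1/2)"
    by (rule tendsto_mult[OF tendsto_powr'[OF e0 tendsto_const] tendsto_const]) (simp add: e_def)
  then have "(\<lambda>k. ennreal (e k powr (1/2) * 1 powr (1/2))) \<longlonglongrightarrow> ennreal 0" by (intro tendsto_ennrealI) simp
  then have lim: "(\<lambda>k. ennreal (e k powr (1/2) * 1 powr (1/2))) \<longlonglongrightarrow> 0" by simp
  show ?thesis by (rule tendsto_sandwich[OF _ bound tendsto_const lim]) simp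
qed

lemma continuous_cube_integrable:
  fixes w :: "real ^ 'n \<Rightarrow> real"
  assumes "continuous_on (cube 1) w" "\<rho> < 1"
  shows "set_integrable lborel (cube \<rho>) w"
proof -
  define Kset :: "(real ^ 'n) set" where "Kset = cbox (\<chi> i. - \<rho> / 2) (\<chi> i. \<rho> / 2)"
  have sub: "Kset \<subseteq> cube 1" unfolding Kset_def by (rule cbox_subset_cube[OF assms(2)])
  have "compact Kset" unfolding Kset_def by (rule compact_cbox)
  then have "set_integrable lborel Kset w"
    unfolding set_integrable_def by (rule borel_integrable_compact) (rule continuous_on_subset[OF assms(1) sub])
  then show ?thesis
    by (rule set_integrable_subset) (simp_all add: Kset_def cube_def box_subset_cbox)
qed

lemma L2_u: "(\<integral>\<^sup>+ x. ennreal ((u x)\<^sup>2) \<partial>\<mu>) < \<infinity>"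
proof -
  have "eventually (\<lambda>k. (\<integral>\<^sup>+ x. ennreal ((\<phi> k x - u x)\<^sup>2) \<partial>\<mu>) < 1) sequentially"
    using order_tendstoD(2)[OF \<phi>_L2, of 1] by simp
  then obtain k where k: "(\<integral>\<^sup>+ x. ennreal ((\<phi> k x - u x)\<^sup>2) \<partial>\<mu>) < 1" by (auto simp: eventually_sequentially)
  obtain B where B: "\<And>x. x \<in> cube 1 \<Longrightarrow> \<bar>\<phi> k x\<bar> \<le> B"
  proof (rule smooth_closure_bounded[OF \<phi>_smooth[of k] bounded_cube open_cube])
    fix B assume "\<And>x. x \<in> cube 1 \<Longrightarrow> \<bar>\<phi> k x\<bar> \<le> B"
    then show thesis by (rule that)
  qed
  have meas: "(\<lambda>x. ennreal ((\<phi> k x - u x)\<^sup>2)) \<in> borel_measurable \<mu>"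
    by (intro measurable_compose[OF _ measurable_ennreal] borel_measurable_power borel_measurable_diff \<phi>_meas u_meas)
  have "(\<integral>\<^sup>+ x. ennreal ((u x)\<^sup>2) \<partial>\<mu>) \<le> (\<integral>\<^sup>+ x. 2 * ennreal ((\<phi> k x - u x)\<^sup>2) + ennreal (2 * B\<^sup>2) \<partial>\<mu>)"
  proof (rule nn_integral_mono)
    fix x assume "x \<in> space \<mu>"
    then have x: "x \<in> cube 1" by simp
    have "(\<phi> k x)\<^sup>2 \<le> B\<^sup>2" using power_mono[OF B[OF x], of 2] by simp
    moreover have "(u x)\<^sup>2 \<le> 2 * (\<phi> k x - u x)\<^sup>2 + 2 * (\<phi> k x)\<^sup>2"
      using zero_le_power2[of "2 * \<phi> k x - u x"] by (simp add: power2_eq_square algebra_simps)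
    ultimately have "(u x)\<^sup>2 \<le> 2 * (\<phi> k x - u x)\<^sup>2 + 2 * B\<^sup>2" by linarith
    then have "ennreal ((u x)\<^sup>2) \<le> ennreal (2 * (\<phi> k x - u x)\<^sup>2 + 2 * B\<^sup>2)" by (rule ennreal_leI)
    also have "\<dots> = 2 * ennreal ((\<phi> k x - u x)\<^sup>2) + ennreal (2 * B\<^sup>2)" by (simp add: ennreal_plus ennreal_mult)
    finally show "ennreal ((u x)\<^sup>2) \<le> 2 * ennreal ((\<phi> k x - u x)\<^sup>2) + ennreal (2 * B\<^sup>2)" .
  qed
  also have "\<dots> = 2 * (\<integral>\<^sup>+ x. ennreal ((\<phi> k x - u x)\<^sup>2) \<partial>\<mu>) + ennreal (2 * B\<^sup>2)"
    using meas by (simp add: nn_integral_add nn_integral_cmult emeasure_restrict_space emeasure_cube)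
  also have "\<dots> < \<infinity>"
  proof -
    have "(\<integral>\<^sup>+ x. ennreal ((\<phi> k x - u x)\<^sup>2) \<partial>\<mu>) < \<infinity>" using k by (rule less_trans) simp
    then show ?thesis by (simp add: ennreal_mult_less_top)
  qed
  finally show ?thesis .
qed

lemma lipschitz_integrable:
  assumes f: "continuous_on {0..} f" "\<And>t. 0 \<le> t \<Longrightarrow> \<bar>f t\<bar> \<le> A + K * t"
  shows "integrable \<mu> (\<lambda>x. f (u x))"
proof (rule Bochner_Integration.integrable_bound)
  interpret finite_measure \<mu> by (rule finite_\<mu>)
  have "integrable \<mu> (\<lambda>x. (u x)\<^sup>2)"
    by (rule integrableI_nonneg) (use L2_u in \<open>auto intro: borel_measurable_power\<close>)
  then show "integrable \<mu> (\<lambda>x. \<bar>A\<bar> + \<bar>K\<bar> * (1 + (u x)\<^sup>2))"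
    by (intro Bochner_Integration.integrable_add Bochner_Integration.integrable_mult_right integrable_const)
  show "(\<lambda>x. f (u x)) \<in> borel_measurable \<mu>" by (rule continuous_comp_meas[OF f(1)])
  show "AE x in \<mu>. norm (f (u x)) \<le> norm (\<bar>A\<bar> + \<bar>K\<bar> * (1 + (u x)\<^sup>2))"
  proof (rule AE_I2)
    fix x
    have "u x \<le> 1 + (u x)\<^sup>2" using zero_le_power2[of "u x - 1"] u_nonneg[of x] by (simp add: power2_eq_square algebra_simps)
    then have "\<bar>K\<bar> * u x \<le> \<bar>K\<bar> * (1 + (u x)\<^sup>2)" by (intro mult_left_mono) simp_all
    moreover have "K * u x \<le> \<bar>K\<bar> * u x" by (intro mult_right_mono u_nonneg) simp
    moreover have "A \<le> \<bar>A\<bar>" by simp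
    ultimately have "\<bar>f (u x)\<bar> \<le> \<bar>A\<bar> + \<bar>K\<bar> * (1 + (u x)\<^sup>2)" using f(2)[OF u_nonneg, of x] by linarith
    then show "norm (f (u x)) \<le> norm (\<bar>A\<bar> + \<bar>K\<bar> * (1 + (u x)\<^sup>2))" unfolding real_norm_def by linarith
  qed
qed

end

text \<open>The functions of interest live on the half line, but the approximants of a nonnegative
  solution may be negative. Freezing the derivative to the left of 0 extends f linearly and
  preserves the bound of its derivative.\<close>

lemma half_line_extension:
  fixes f f' :: "real \<Rightarrow> real"
  assumes f: "\<And>t. 0 \<le> t \<Longrightarrow> (f has_real_derivative f' t) (at t)" and cont: "continuous_on {0..} f'"
  obtains F where "\<And>t. (F has_real_derivative f' (max 0 t)) (at t)" "\<And>t. 0 \<le> t \<Longrightarrow> F t = f t"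
    "continuous_on UNIV (\<lambda>t. f' (max 0 t))"
proof -
  have c: "continuous_on UNIV (\<lambda>t. f' (max 0 t))"
    by (rule continuous_on_compose2[OF cont]) (auto intro: continuous_intros)
  show thesis
  proof (rule continuous_antiderivative[OF c])
    fix H assume H: "\<And>t. (H has_real_derivative f' (max 0 t)) (at t)" "H 0 = 0"
    have d: "((\<lambda>t. H t + f 0) has_real_derivative f' (max 0 t)) (at t)" for t
      using DERIV_add[OF H(1)[of t] DERIV_const[of "f 0"]] by simp
    have "H t + f 0 = f t" if t: "0 \<le> t" for t
    proof (rule antisym)
      show "H t + f 0 \<le> f t" by (rule DERIV_compare[OF t d f]) (simp_all add: H(2))
      show "f t \<le> H t + f 0" by (rule DERIV_compare[OF t f d]) (simp_all add: H(2))
    qed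
    then show thesis by (rule that[OF d _ c])
  qed
qed

text \<open>The s-th power of a gradient is at most the power s/2 of the norm of the inverse matrix
  times the power s/2 of the energy density. Hoelder with exponents 2 / (2 - s) and 2 / s asks for
  exactly L^q integrability of the inverse when s = 2 q / (q + 1). The inequality holds for the
  compositions with the approximants and passes to the limit by Fatou.\<close>

lemma (in degenerate_solution) weighted_poincare_sobolev:
  fixes q r s \<sigma> \<rho> B D K :: real
  assumes \<rho>: "0 < \<rho>" "\<rho> < 1" and q: "1 < q" "s = 2 * q / (q + 1)" and r: "s < r"
    and \<sigma>: "\<sigma> = real CARD('n) * (1 / s - 1 / r)" "\<sigma> < 1"
    and inv: "AE x in \<mu>. invertible (a x)" "(\<lambda>x. matrix_inv (a x)) \<in> borel_measurable \<mu>"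
    and B: "(\<integral>\<^sup>+ x. ennreal (spectral_norm (matrix_inv (a x)) powr q) \<partial>\<mu>) \<le> ennreal (B powr q)" "0 \<le> B"
    and f: "\<And>t. 0 \<le> t \<Longrightarrow> (f has_real_derivative f' t) (at t)" "continuous_on {0..} f'" "\<And>t. 0 \<le> t \<Longrightarrow> \<bar>f' t\<bar> \<le> K"
    and D: "(\<integral>\<^sup>+ x. ennreal ((f' (u x))\<^sup>2 * E x) * indicator (cube \<rho>) x \<partial>\<mu>) \<le> ennreal D" "0 \<le> D"
  shows "(\<integral>\<^sup>+ x. ennreal (\<bar>f (u x) - (LINT x|\<mu>. f (u x) * indicator (cube \<rho>) x) / \<rho> ^ CARD('n)\<bar> powr r) * indicator (cube \<rho>) x \<partial>\<mu>)
     \<le> ennreal (poincare_const TYPE('n) r \<sigma> \<rho> * (2 * B * D) powr (r / 2))"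
proof -
  interpret finite_measure \<mu> by (rule finite_\<mu>)
  define Ni where "Ni x = spectral_norm (matrix_inv (a x))" for x
  have Ni_meas [measurable]: "Ni \<in> borel_measurable \<mu>"
    unfolding Ni_def by (rule borel_measurable_spectral_norm[OF inv(2)])
  have Ni0: "0 \<le> Ni x" for x by (simp add: Ni_def spectral_norm_nonneg)
  have s: "1 < s" "s < 2" unfolding q(2) using q(1) by (simp_all add: pos_less_divide_eq pos_divide_less_eq)
  have K0: "0 \<le> K" using order_trans[OF abs_ge_zero f(3)[of 0]] by simp
  obtain F where F: "\<And>t. (F has_real_derivative f' (max 0 t)) (at t)" "\<And>t. 0 \<le> t \<Longrightarrow> F t = f t"
    "continuous_on UNIV (\<lambda>t. f' (max 0 t))"
  proof (rule half_line_extension[OF f(1,2)])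
    fix F assume "\<And>t. (F has_real_derivative f' (max 0 t)) (at t)" "\<And>t. 0 \<le> t \<Longrightarrow> F t = f t"
      "continuous_on UNIV (\<lambda>t. f' (max 0 t))"
    then show thesis by (rule that)
  qed
  define F' where "F' t = f' (max 0 t)" for t
  have F'_cont: "continuous_on UNIV F'" using F(3) by (simp only: F'_def[abs_def])
  have F': "(F has_real_derivative F' t) (at t)" for t unfolding F'_def by (rule F(1))
  have F'_le: "\<bar>F' t\<bar> \<le> K" for t unfolding F'_def by (rule f(3)) simp
  have F'_u: "F' (u x) = f' (u x)" for x using u_nonneg[of x] by (simp add: F'_def)
  have F_u: "F (u x) = f (u x)" for x using u_nonneg[of x] by (rule F(2))
  have F_cont: "continuous_on UNIV F" using F' by (intro continuous_at_imp_continuous_on ballI DERIV_isCont)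
  have F_lip: "\<bar>F x - F y\<bar> \<le> K * \<bar>x - y\<bar>" for x y
    using field_differentiable_bound[of UNIV F F' K x y] F' F'_le by (simp add: has_field_derivative_at_within)
  have Fu_meas: "(\<lambda>x. F (u x)) \<in> borel_measurable \<mu>" "(\<lambda>x. (F' (u x))\<^sup>2) \<in> borel_measurable \<mu>"
    and F\<phi>_meas: "(\<lambda>x. F (\<phi> k x)) \<in> borel_measurable \<mu>" "(\<lambda>x. (F' (\<phi> k x))\<^sup>2) \<in> borel_measurable \<mu>" for k
    by (intro borel_measurable_power borel_measurable_continuous_on[OF F_cont] borel_measurable_continuous_on[OF F'_cont] u_meas \<phi>_meas)+
  note ind_meas = indicator_cube_meas[of \<rho>]
  define w where "w k x = F (\<phi> k x)" for k x
  define g where "g k x = \<bar>F' (\<phi> k x)\<bar> * norm (grad (\<phi> k) x)" for k x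
  define qq where "qq k x = (F' (\<phi> k x))\<^sup>2 * (grad (\<phi> k) x \<bullet> (a x *v grad (\<phi> k) x))" for k x
  have sub: "x \<in> cube 1" if "x \<in> cube \<rho>" for x
    using subsetD[OF cube_subset[of \<rho> 1] that] \<rho> by simp
  have w_cont: "continuous_on (cube 1) (w k)" for k
    unfolding w_def by (rule continuous_on_compose2[OF F_cont \<phi>_cont]) simp
  have g_cont: "continuous_on (cube 1) (g k)" for k
    unfolding g_def
    by (intro continuous_on_mult continuous_on_norm continuous_on_rabs continuous_on_grad(1)[OF \<phi>_smooth open_cube]
        continuous_on_compose2[OF F'_cont \<phi>_cont] subset_UNIV)
  have dw: "(w k has_derivative (\<lambda>v. (grad (\<phi> k) z \<bullet> v) * F' (\<phi> k z))) (at z)" if "z \<in> cube 1" for k z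
    unfolding w_def by (rule DERIV_compose_FDERIV[OF F' grad_works[OF \<phi>_diff[OF that]]])
  have dw_le: "\<bar>(grad (\<phi> k) z \<bullet> v) * F' (\<phi> k z)\<bar> \<le> g k z * norm v" for k z v
  proof -
    have "\<bar>grad (\<phi> k) z \<bullet> v\<bar> * \<bar>F' (\<phi> k z)\<bar> \<le> (norm (grad (\<phi> k) z) * norm v) * \<bar>F' (\<phi> k z)\<bar>"
      by (intro mult_right_mono Cauchy_Schwarz_ineq2) simp
    then show ?thesis by (simp add: g_def abs_mult mult_ac)
  qed
  have qq0: "0 \<le> qq k x" if "x \<in> cube 1" for k x
    unfolding qq_def using a_psd[OF that] by (intro mult_nonneg_nonneg) simp_all
  have qq_meas: "qq k \<in> borel_measurable \<mu>" for k
    unfolding qq_def by (intro borel_measurable_times F\<phi>_meas borel_measurable_inner borel_measurable_matrix_vector grad_\<phi>_meas a_meas)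
  have g_le: "AE x in \<mu>. g k x powr s \<le> Ni x powr (s / 2) * qq k x powr (s / 2)" for k
  proof (rule AE_mp[OF inv(1)], rule AE_I2, rule impI)
    fix x assume "x \<in> space \<mu>" and i: "invertible (a x)"
    then have x: "x \<in> cube 1" by simp
    have "(norm (grad (\<phi> k) x))\<^sup>2 \<le> Ni x * (grad (\<phi> k) x \<bullet> (a x *v grad (\<phi> k) x))"
      unfolding Ni_def by (rule quadratic_form_inverse_ge[OF a_sym[OF x] a_psd[OF x] i])
    then have "(F' (\<phi> k x))\<^sup>2 * (norm (grad (\<phi> k) x))\<^sup>2 \<le> (F' (\<phi> k x))\<^sup>2 * (Ni x * (grad (\<phi> k) x \<bullet> (a x *v grad (\<phi> k) x)))"
      by (intro mult_left_mono) simp_all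
    then have "(g k x)\<^sup>2 \<le> Ni x * qq k x" by (simp add: g_def qq_def power_mult_distrib mult_ac)
    then have "((g k x)\<^sup>2) powr (s / 2) \<le> (Ni x * qq k x) powr (s / 2)" using s by (intro powr_mono2) simp_all
    moreover have "((g k x)\<^sup>2) powr (s / 2) = g k x powr s"
    proof -
      have "0 \<le> g k x" by (simp add: g_def)
      then have "(g k x)\<^sup>2 = g k x powr 2" by simp
      then show ?thesis by (simp only: powr_powr) simp
    qed
    ultimately show "g k x powr s \<le> Ni x powr (s / 2) * qq k x powr (s / 2)"
      using Ni0[of x] qq0[OF x, of k] by (simp add: powr_mult)
  qed
  define \<epsilon> where "\<epsilon> k = enn2real (\<integral>\<^sup>+ x. ennreal (dev k x) \<partial>\<mu>)" for k
  have \<epsilon>0: "\<epsilon> \<longlonglongrightarrow> 0" unfolding \<epsilon>_def[abs_def] by (rule tendsto_enn2real) (use \<phi>_energy in simp_all)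
  define e where "e k x = (F' (\<phi> k x))\<^sup>2 * E x * indicator (cube \<rho>) x" for k x
  define e' where "e' x = (F' (u x))\<^sup>2 * E x * indicator (cube \<rho>) x" for x
  have e_meas: "e k \<in> borel_measurable \<mu>" "e' \<in> borel_measurable \<mu>" for k
    unfolding e_def e'_def by (intro borel_measurable_times F\<phi>_meas Fu_meas E_meas ind_meas)+
  have KE_int: "integrable \<mu> (\<lambda>x. K\<^sup>2 * E x)" by (intro Bochner_Integration.integrable_mult_right integrable_E)
  have F'_sq: "(F' t)\<^sup>2 \<le> K\<^sup>2" for t using power_mono[OF F'_le[of t], of 2] by simp
  have e_le: "norm (e k x) \<le> K\<^sup>2 * E x" "0 \<le> e k x" "norm (e' x) \<le> K\<^sup>2 * E x" "0 \<le> e' x" if "x \<in> cube 1" for k x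
  proof -
    have E0: "0 \<le> E x" by (rule a_psd[OF that])
    have *: "0 \<le> (F' t)\<^sup>2 * E x * indicator (cube \<rho>) x" "(F' t)\<^sup>2 * E x * indicator (cube \<rho>) x \<le> K\<^sup>2 * E x" for t
      using mult_right_mono[OF F'_sq E0, of t] E0 by (auto simp: indicator_def)
    show "norm (e k x) \<le> K\<^sup>2 * E x" "0 \<le> e k x" "norm (e' x) \<le> K\<^sup>2 * E x" "0 \<le> e' x"
      unfolding e_def e'_def real_norm_def abs_of_nonneg[OF *(1)] by (rule * )+
  qed
  define c where "c k = (LINT x|\<mu>. e k x)" for k
  have e_int: "integrable \<mu> (e k)" for k
    by (rule Bochner_Integration.integrable_bound[OF KE_int e_meas(1)], rule AE_I2)
      (use e_le in \<open>auto intro: order_trans[OF _ abs_ge_self]\<close>)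
  have c0: "0 \<le> c k" for k unfolding c_def by (rule integral_nonneg_AE, rule AE_I2) (use e_le in auto)
  have c_lim: "c \<longlonglongrightarrow> (LINT x|\<mu>. e' x)"
    unfolding c_def
  proof (rule integral_dominated_convergence[OF e_meas(2) e_meas(1) KE_int])
    show "AE x in \<mu>. (\<lambda>k. e k x) \<longlonglongrightarrow> e' x"
      using \<phi>_AE
    proof (rule eventually_mono)
      fix x assume l: "(\<lambda>k. \<phi> k x) \<longlonglongrightarrow> u x"
      have "(\<lambda>k. F' (\<phi> k x)) \<longlonglongrightarrow> F' (u x)" using continuous_on_tendsto_compose[OF F'_cont l] by simp
      then show "(\<lambda>k. e k x) \<longlonglongrightarrow> e' x" unfolding e_def e'_def by (intro tendsto_mult tendsto_power tendsto_const)
    qed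
    show "AE x in \<mu>. norm (e k x) \<le> K\<^sup>2 * E x" for k by (rule AE_I2) (use e_le in auto)
  qed
  define c' where "c' = (LINT x|\<mu>. e' x)"
  have e'_int: "integrable \<mu> e'"
    by (rule Bochner_Integration.integrable_bound[OF KE_int e_meas(2)], rule AE_I2)
      (use e_le in \<open>auto intro: order_trans[OF _ abs_ge_self]\<close>)
  have c'0: "0 \<le> c'" unfolding c'_def by (rule integral_nonneg_AE, rule AE_I2) (use e_le in auto)
  have c'_le: "c' \<le> D"
  proof -
    have "ennreal c' = (\<integral>\<^sup>+ x. ennreal (e' x) \<partial>\<mu>)"
      unfolding c'_def by (rule nn_integral_eq_integral[symmetric, OF e'_int], rule AE_I2) (use e_le in auto)
    also have "\<dots> = (\<integral>\<^sup>+ x. ennreal ((f' (u x))\<^sup>2 * E x) * indicator (cube \<rho>) x \<partial>\<mu>)"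
      by (intro nn_integral_cong) (simp add: e'_def F'_u indicator_def)
    finally have "ennreal c' \<le> ennreal D" using D(1) by (rule ord_eq_le_trans)
    then show ?thesis using D(2) by simp
  qed
  \<comment> \<open>The energy of F(\<open>\<phi> k\<close>) is split into the contributions of
    \<open>G\<close> and of the difference, at the price of a factor 2. The latter tends to 0; the
    factor stays in front of the former and appears in the conclusion.\<close>
  define Dk where "Dk k = 2 * K\<^sup>2 * \<epsilon> k + 2 * c k" for k
  have Dk0: "0 \<le> Dk k" for k using c0[of k] by (simp add: Dk_def \<epsilon>_def)
  have Dk_lim: "Dk \<longlonglongrightarrow> 2 * K\<^sup>2 * 0 + 2 * c'"
    unfolding Dk_def[abs_def] by (intro tendsto_intros \<epsilon>0 c_lim[folded c'_def])
  have fin: "eventually (\<lambda>k. (\<integral>\<^sup>+ x. ennreal (dev k x) \<partial>\<mu>) < 1) sequentially"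
    using order_tendstoD(2)[OF \<phi>_energy, of 1] by simp
  have qq_int: "(\<integral>\<^sup>+ x. ennreal (qq k x) * indicator (cube \<rho>) x \<partial>\<mu>) \<le> ennreal (Dk k)"
    if k: "(\<integral>\<^sup>+ x. ennreal (dev k x) \<partial>\<mu>) < 1" for k
  proof -
    have dev_eq: "(\<integral>\<^sup>+ x. ennreal (dev k x) \<partial>\<mu>) = ennreal (\<epsilon> k)"
      unfolding \<epsilon>_def by (rule ennreal_enn2real[symmetric]) (rule less_trans[OF k], simp)
    have "(\<integral>\<^sup>+ x. ennreal (qq k x) * indicator (cube \<rho>) x \<partial>\<mu>)
        \<le> (\<integral>\<^sup>+ x. ennreal (2 * K\<^sup>2) * ennreal (dev k x) + 2 * ennreal (e k x) \<partial>\<mu>)"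
    proof (rule nn_integral_mono)
      fix x assume "x \<in> space \<mu>"
      then have x: "x \<in> cube 1" by simp
      show "ennreal (qq k x) * indicator (cube \<rho>) x \<le> ennreal (2 * K\<^sup>2) * ennreal (dev k x) + 2 * ennreal (e k x)"
      proof (cases "x \<in> cube \<rho>")
        case True
        have "grad (\<phi> k) x \<bullet> (a x *v grad (\<phi> k) x) \<le> 2 * dev k x + 2 * E x"
          using quadratic_add_le[OF x, of "grad (\<phi> k) x - G x" "G x"] unfolding diff_add_cancel .
        then have "qq k x \<le> (F' (\<phi> k x))\<^sup>2 * (2 * dev k x + 2 * E x)"
          unfolding qq_def by (rule mult_left_mono) simp
        also have "\<dots> = (F' (\<phi> k x))\<^sup>2 * (2 * dev k x) + 2 * e k x" using True by (simp add: e_def distrib_left)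
        also have "\<dots> \<le> K\<^sup>2 * (2 * dev k x) + 2 * e k x"
          by (intro add_right_mono mult_right_mono F'_sq mult_nonneg_nonneg a_psd[OF x]) simp
        finally have "ennreal (qq k x) \<le> ennreal (K\<^sup>2 * (2 * dev k x) + 2 * e k x)" by (rule ennreal_leI)
        also have "\<dots> = ennreal (2 * K\<^sup>2) * ennreal (dev k x) + 2 * ennreal (e k x)"
        proof -
          have "ennreal (K\<^sup>2 * (2 * y) + 2 * z) = ennreal (2 * K\<^sup>2) * ennreal y + 2 * ennreal z" if "0 \<le> y" "0 \<le> z" for y z
            using that by (simp add: ennreal_plus ennreal_mult mult_ac)
          from this[OF a_psd[OF x] e_le(2)[OF x]] show ?thesis .
        qed
        finally show ?thesis using True by simp
      qed simp
    qed
    also have "\<dots> = ennreal (2 * K\<^sup>2) * (\<integral>\<^sup>+ x. ennreal (dev k x) \<partial>\<mu>) + 2 * (\<integral>\<^sup>+ x. ennreal (e k x) \<partial>\<mu>)"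
    proof -
      have m1: "(\<lambda>x. ennreal (dev k x)) \<in> borel_measurable \<mu>" by (rule measurable_compose[OF dev_meas measurable_ennreal])
      have m2: "(\<lambda>x. ennreal (e k x)) \<in> borel_measurable \<mu>" by (rule measurable_compose[OF e_meas(1) measurable_ennreal])
      show ?thesis
        by (subst nn_integral_add) (use m1 m2 in \<open>simp_all add: nn_integral_cmult\<close>)
    qed
    also have "(\<integral>\<^sup>+ x. ennreal (e k x) \<partial>\<mu>) = ennreal (c k)"
      unfolding c_def by (rule nn_integral_eq_integral[OF e_int], rule AE_I2) (use e_le in auto)
    also have "ennreal (2 * K\<^sup>2) * (\<integral>\<^sup>+ x. ennreal (dev k x) \<partial>\<mu>) + 2 * ennreal (c k) = ennreal (Dk k)"
    proof -
      have "0 \<le> \<epsilon> k" by (simp add: \<epsilon>_def)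
      then show ?thesis unfolding dev_eq Dk_def using c0[of k] by (simp add: ennreal_plus ennreal_mult)
    qed
    finally show ?thesis .
  qed
  have gs_int: "(\<integral>\<^sup>+ x. ennreal (g k x powr s) * indicator (cube \<rho>) x \<partial>\<mu>) \<le> ennreal ((B * Dk k) powr (s / 2))"
    if k: "(\<integral>\<^sup>+ x. ennreal (dev k x) \<partial>\<mu>) < 1" for k
  proof -
    have "(\<integral>\<^sup>+ x. ennreal (g k x powr s) * indicator (cube \<rho>) x \<partial>\<mu>)
      \<le> (\<integral>\<^sup>+ x. ennreal (Ni x powr (s / 2) * (qq k x powr (s / 2) * indicator (cube \<rho>) x)) \<partial>\<mu>)"
    proof (rule nn_integral_mono_AE, rule eventually_mono[OF g_le[of k]])
      fix x assume "g k x powr s \<le> Ni x powr (s / 2) * qq k x powr (s / 2)"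
      then show "ennreal (g k x powr s) * indicator (cube \<rho>) x \<le> ennreal (Ni x powr (s / 2) * (qq k x powr (s / 2) * indicator (cube \<rho>) x))"
        by (cases "x \<in> cube \<rho>") (simp_all add: ennreal_leI)
    qed
    also have "\<dots> \<le> ennreal ((B powr q) powr (1 / (2 / (2 - s))) * (Dk k) powr (1 / (2 / s)))"
    proof (rule nn_integral_Holder_bound)
      show "(\<lambda>x. Ni x powr (s / 2)) \<in> borel_measurable \<mu>" by (intro powr_real_measurable Ni_meas borel_measurable_const)
      show "(\<lambda>x. qq k x powr (s / 2) * indicator (cube \<rho>) x) \<in> borel_measurable \<mu>"
        by (intro borel_measurable_times powr_real_measurable qq_meas borel_measurable_const ind_meas)
      show "1 < 2 / (2 - s)" "1 / (2 / (2 - s)) + 1 / (2 / s) = 1" using s by (simp_all add: field_simps)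
      have exq: "s / 2 * (2 / (2 - s)) = q"
      proof -
        have "2 - s = 2 / (q + 1)" using q by (simp add: field_simps)
        then have "s / 2 * (2 / (2 - s)) = s * (q + 1) / 2" by simp
        then show ?thesis using q by simp
      qed
      have "(\<integral>\<^sup>+ x. ennreal ((Ni x powr (s / 2)) powr (2 / (2 - s))) \<partial>\<mu>) = (\<integral>\<^sup>+ x. ennreal (Ni x powr q) \<partial>\<mu>)"
        unfolding powr_powr exq ..
      then show "(\<integral>\<^sup>+ x. ennreal ((Ni x powr (s / 2)) powr (2 / (2 - s))) \<partial>\<mu>) \<le> ennreal (B powr q)"
        using B(1) by (simp add: Ni_def)
      have "(\<integral>\<^sup>+ x. ennreal ((qq k x powr (s / 2) * indicator (cube \<rho>) x) powr (2 / s)) \<partial>\<mu>)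
        = (\<integral>\<^sup>+ x. ennreal (qq k x) * indicator (cube \<rho>) x \<partial>\<mu>)"
      proof (rule nn_integral_cong)
        fix x assume "x \<in> space \<mu>"
        then have "0 \<le> qq k x" by (intro qq0) simp
        then show "ennreal ((qq k x powr (s / 2) * indicator (cube \<rho>) x) powr (2 / s)) = ennreal (qq k x) * indicator (cube \<rho>) x"
          using s by (cases "x \<in> cube \<rho>") (simp_all add: powr_powr)
      qed
      then show "(\<integral>\<^sup>+ x. ennreal ((qq k x powr (s / 2) * indicator (cube \<rho>) x) powr (2 / s)) \<partial>\<mu>) \<le> ennreal (Dk k)"
        using qq_int[OF k] by simp
    qed (simp_all add: Dk0)
    also have "(B powr q) powr (1 / (2 / (2 - s))) * (Dk k) powr (1 / (2 / s)) = (B * Dk k) powr (s / 2)"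
    proof -
      have "q * (1 / (2 / (2 - s))) = s / 2" using q by (simp add: field_simps)
      then show ?thesis using B(2) Dk0[of k] by (simp add: powr_powr powr_mult)
    qed
    finally show ?thesis .
  qed
  define C where "C = poincare_const TYPE('n) r \<sigma> \<rho>"
  define m where "m k = (LINT x|\<mu>. w k x * indicator (cube \<rho>) x) / \<rho> ^ CARD('n)" for k
  have PS: "(\<integral>\<^sup>+ x. ennreal (\<bar>w k x - m k\<bar> powr r) * indicator (cube \<rho>) x \<partial>\<mu>) \<le> ennreal (C * (B * Dk k) powr (r / 2))"
    if k: "(\<integral>\<^sup>+ x. ennreal (dev k x) \<partial>\<mu>) < 1" for k
  proof -
    have si: "set_integrable lborel (cube \<rho>) (w k)" by (rule continuous_cube_integrable[OF w_cont \<rho>(2)])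
    have m_eq: "m k = (LINT y:cube \<rho>|lborel. w k y) / \<rho> ^ CARD('n)"
      unfolding m_def using si \<rho>(2)
      by (subst set_integral_cube_measure) (simp_all add: set_integrable_def borel_measurable_integrable)
    have "(\<integral>\<^sup>+ x. ennreal (\<bar>w k x - m k\<bar> powr r) * indicator (cube \<rho>) x \<partial>lborel)
        \<le> ennreal (2 ^ DIM(real ^ 'n) * (real CARD('n) / \<rho> ^ CARD('n)) powr r * (1 / (1 - \<sigma>)) powr r * ((B * Dk k) powr (s / 2)) powr (r / s))"
      unfolding m_eq
    proof (rule poincare_sobolev[OF open_cube _ emeasure_cube[OF \<rho>(1)]])
      show "convex (cube \<rho> :: (real ^ 'n) set)" unfolding cube_def by (rule convex_box)
      show "0 < \<rho> ^ CARD('n)" "\<rho> ^ CARD('n) \<le> 1" using \<rho> by (simp_all add: power_le_one)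
      show "norm (y - x) \<le> real CARD('n)" if "x \<in> cube \<rho>" "y \<in> cube \<rho>" for x y :: "real ^ 'n"
        by (rule cube_diameter[OF that]) (use \<rho> in simp)
      show "(w k has_derivative (\<lambda>v. (grad (\<phi> k) z \<bullet> v) * F' (\<phi> k z))) (at z)" if "z \<in> cube \<rho>" for z
        by (rule dw[OF sub[OF that]])
      show "\<bar>(grad (\<phi> k) z \<bullet> v) * F' (\<phi> k z)\<bar> \<le> g k z * norm v" for z v by (rule dw_le)
      show "continuous_on (cube \<rho>) (g k)" by (rule continuous_on_subset[OF g_cont]) (use sub in blast)
      show "0 \<le> g k z" for z by (simp add: g_def)
      show "\<sigma> = real DIM(real ^ 'n) * (1 / s - 1 / r)" using \<sigma>(1) by simp
      show "(\<integral>\<^sup>+ z. ennreal (g k z powr s) * indicator (cube \<rho>) z \<partial>lborel) \<le> ennreal ((B * Dk k) powr (s / 2))"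
        using gs_int[OF k] \<rho>(2) by (subst nn_integral_cube_measure[symmetric]) simp_all
    qed (use s r \<sigma>(2) si in simp_all)
    also have "((B * Dk k) powr (s / 2)) powr (r / s) = (B * Dk k) powr (r / 2)" using s by (simp add: powr_powr)
    finally show ?thesis
      using \<rho>(2) by (subst nn_integral_cube_measure) (simp_all add: C_def poincare_const_def)
  qed
  define m' where "m' = (LINT x|\<mu>. f (u x) * indicator (cube \<rho>) x) / \<rho> ^ CARD('n)"
  \<comment> \<open>The means converge because the extension of f is Lipschitz and the approximants
    converge in L^1.\<close>
  have m_lim: "m \<longlonglongrightarrow> m'"
  proof -
    have f_cont: "continuous_on {0..} f"
      by (rule continuous_at_imp_continuous_on) (use f(1) in \<open>auto intro: DERIV_isCont\<close>)
    have fu_int: "integrable \<mu> (\<lambda>x. f (u x) * indicator (cube \<rho>) x)"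
    proof (rule Bochner_Integration.integrable_bound[of _ "\<lambda>x. f (u x)"])
      show "integrable \<mu> (\<lambda>x. f (u x))"
      proof (rule lipschitz_integrable[OF f_cont])
        fix t :: real assume t: "0 \<le> t"
        show "\<bar>f t\<bar> \<le> \<bar>f 0\<bar> + K * t" using F_lip[of t 0] t F(2)[OF t] F(2)[of 0] by simp
      qed
      show "(\<lambda>x. f (u x) * indicator (cube \<rho>) x) \<in> borel_measurable \<mu>"
        by (intro borel_measurable_times continuous_comp_meas[OF f_cont] ind_meas)
    qed (auto simp: indicator_def)
    have w_int: "integrable \<mu> (\<lambda>x. w k x * indicator (cube \<rho>) x)" for k
    proof -
      have bdd: "bounded (w k ` cbox (\<chi> i. - \<rho> / 2) (\<chi> i. \<rho> / 2))"
      proof (intro compact_imp_bounded compact_continuous_image compact_cbox, rule continuous_on_subset[OF w_cont])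
        show "cbox (\<chi> i. - \<rho> / 2) (\<chi> i. \<rho> / 2) \<subseteq> (cube 1 :: (real ^ 'n) set)"
          by (rule cbox_subset_cube[OF \<rho>(2)])
      qed
      then obtain Bw where Bw: "\<forall>y\<in>w k ` cbox (\<chi> i. - \<rho> / 2) (\<chi> i. \<rho> / 2). norm y \<le> Bw" unfolding bounded_iff by (elim exE)
      show ?thesis
      proof (rule integrable_const_bound[of _ "\<bar>Bw\<bar>"], rule AE_I2)
        fix x
        show "norm (w k x * indicator (cube \<rho>) x) \<le> \<bar>Bw\<bar>"
        proof (cases "x \<in> cube \<rho>")
          case True
          then have "x \<in> cbox (\<chi> i. - \<rho> / 2) (\<chi> i. \<rho> / 2)" using box_subset_cbox unfolding cube_def by blast
          then show ?thesis using bspec[OF Bw imageI] True by force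
        qed simp
        show "(\<lambda>x. w k x * indicator (cube \<rho>) x) \<in> borel_measurable \<mu>"
          unfolding w_def by (intro borel_measurable_times F\<phi>_meas ind_meas)
      qed
    qed
    have "(\<lambda>k. LINT x|\<mu>. w k x * indicator (cube \<rho>) x) \<longlonglongrightarrow> (LINT x|\<mu>. f (u x) * indicator (cube \<rho>) x)"
    proof (rule tendsto_L1_int[OF w_int fu_int])
      have "(\<lambda>k. ennreal K * (\<integral>\<^sup>+ x. ennreal \<bar>\<phi> k x - u x\<bar> \<partial>\<mu>)) \<longlonglongrightarrow> ennreal K * 0"
        by (rule ennreal_tendsto_cmult[OF _ deviation_L1]) simp
      then have lim: "(\<lambda>k. ennreal K * (\<integral>\<^sup>+ x. ennreal \<bar>\<phi> k x - u x\<bar> \<partial>\<mu>)) \<longlonglongrightarrow> 0" by simp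
      show "(\<lambda>k. \<integral>\<^sup>+ x. ennreal (norm (w k x * indicator (cube \<rho>) x - f (u x) * indicator (cube \<rho>) x)) \<partial>\<mu>) \<longlonglongrightarrow> 0"
      proof (rule tendsto_sandwich[OF _ _ tendsto_const lim])
        show "\<forall>\<^sub>F k in sequentially. (\<integral>\<^sup>+ x. ennreal (norm (w k x * indicator (cube \<rho>) x - f (u x) * indicator (cube \<rho>) x)) \<partial>\<mu>)
          \<le> ennreal K * (\<integral>\<^sup>+ x. ennreal \<bar>\<phi> k x - u x\<bar> \<partial>\<mu>)"
        proof (rule always_eventually, rule allI)
          fix k
          have dm: "(\<lambda>x. ennreal \<bar>\<phi> k x - u x\<bar>) \<in> borel_measurable \<mu>"
            by (intro measurable_compose[OF _ measurable_ennreal] borel_measurable_abs borel_measurable_diff \<phi>_meas u_meas)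
          have "(\<integral>\<^sup>+ x. ennreal (norm (w k x * indicator (cube \<rho>) x - f (u x) * indicator (cube \<rho>) x)) \<partial>\<mu>)
            \<le> (\<integral>\<^sup>+ x. ennreal K * ennreal \<bar>\<phi> k x - u x\<bar> \<partial>\<mu>)"
          proof (rule nn_integral_mono)
            fix x
            have "\<bar>w k x - f (u x)\<bar> \<le> K * \<bar>\<phi> k x - u x\<bar>" unfolding w_def F_u[symmetric] by (rule F_lip)
            then have "norm (w k x * indicator (cube \<rho>) x - f (u x) * indicator (cube \<rho>) x) \<le> K * \<bar>\<phi> k x - u x\<bar>"
              using K0 by (cases "x \<in> cube \<rho>") simp_all
            then show "ennreal (norm (w k x * indicator (cube \<rho>) x - f (u x) * indicator (cube \<rho>) x)) \<le> ennreal K * ennreal \<bar>\<phi> k x - u x\<bar>"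
              using K0 by (simp only: ennreal_mult[symmetric] abs_ge_zero ennreal_leI)
          qed
          also have "\<dots> = ennreal K * (\<integral>\<^sup>+ x. ennreal \<bar>\<phi> k x - u x\<bar> \<partial>\<mu>)" by (rule nn_integral_cmult[OF dm])
          finally show "(\<integral>\<^sup>+ x. ennreal (norm (w k x * indicator (cube \<rho>) x - f (u x) * indicator (cube \<rho>) x)) \<partial>\<mu>)
            \<le> ennreal K * (\<integral>\<^sup>+ x. ennreal \<bar>\<phi> k x - u x\<bar> \<partial>\<mu>)" .
        qed
      qed simp
    qed
    then show ?thesis unfolding m_def m'_def by (intro tendsto_divide tendsto_const) (use \<rho> in simp_all)
  qed
  have r0: "0 < r" using s r by simp
  have "(\<integral>\<^sup>+ x. ennreal (\<bar>f (u x) - m'\<bar> powr r) * indicator (cube \<rho>) x \<partial>\<mu>) \<le> ennreal (C * (B * (2 * K\<^sup>2 * 0 + 2 * c')) powr (r / 2))"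
  proof (rule nn_integral_le_limit)
    show "(\<lambda>x. ennreal (\<bar>w k x - m k\<bar> powr r) * indicator (cube \<rho>) x) \<in> borel_measurable \<mu>" for k
      unfolding w_def
    proof -
      have [measurable]: "(\<lambda>x. F (\<phi> k x)) \<in> borel_measurable \<mu>" by (rule F\<phi>_meas)
      have [measurable]: "(indicator (cube \<rho>) :: real ^ 'n \<Rightarrow> ennreal) \<in> borel_measurable \<mu>"
        by (intro measurable_restrict_space1 borel_measurable_indicator) simp
      show "(\<lambda>x. ennreal (\<bar>F (\<phi> k x) - m k\<bar> powr r) * indicator (cube \<rho>) x) \<in> borel_measurable \<mu>"
        by measurable
    qed
    show "eventually (\<lambda>k. (\<integral>\<^sup>+ x. ennreal (\<bar>w k x - m k\<bar> powr r) * indicator (cube \<rho>) x \<partial>\<mu>) \<le> ennreal (C * (B * Dk k) powr (r / 2))) sequentially"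
      by (rule eventually_mono[OF fin PS])
    show "(\<lambda>k. ennreal (C * (B * Dk k) powr (r / 2))) \<longlonglongrightarrow> ennreal (C * (B * (2 * K\<^sup>2 * 0 + 2 * c')) powr (r / 2))"
      by (intro tendsto_ennrealI tendsto_mult tendsto_const tendsto_powr' Dk_lim) (use B(2) Dk0 r0 in simp)
    show "AE x in \<mu>. (\<lambda>k. ennreal (\<bar>w k x - m k\<bar> powr r) * indicator (cube \<rho>) x) \<longlonglongrightarrow> ennreal (\<bar>f (u x) - m'\<bar> powr r) * indicator (cube \<rho>) x"
      using \<phi>_AE
    proof (rule eventually_mono)
      fix x assume l: "(\<lambda>k. \<phi> k x) \<longlonglongrightarrow> u x"
      have "(\<lambda>k. w k x) \<longlonglongrightarrow> f (u x)" unfolding w_def F_u[symmetric] using continuous_on_tendsto_compose[OF F_cont l] by simp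
      then have "(\<lambda>k. \<bar>w k x - m k\<bar>) \<longlonglongrightarrow> \<bar>f (u x) - m'\<bar>" by (intro tendsto_rabs tendsto_diff m_lim)
      then have "(\<lambda>k. \<bar>w k x - m k\<bar> powr r) \<longlonglongrightarrow> \<bar>f (u x) - m'\<bar> powr r"
        by (rule tendsto_powr'[OF _ tendsto_const]) (use r0 in simp)
      then have "(\<lambda>k. ennreal (\<bar>w k x - m k\<bar> powr r)) \<longlonglongrightarrow> ennreal (\<bar>f (u x) - m'\<bar> powr r)" by (rule tendsto_ennrealI)
      then show "(\<lambda>k. ennreal (\<bar>w k x - m k\<bar> powr r) * indicator (cube \<rho>) x) \<longlonglongrightarrow> ennreal (\<bar>f (u x) - m'\<bar> powr r) * indicator (cube \<rho>) x"
        by (cases "x \<in> cube \<rho>") simp_all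
    qed
  qed
  also have "\<dots> \<le> ennreal (C * (2 * B * D) powr (r / 2))"
  proof (intro ennreal_leI mult_left_mono powr_mono2)
    have "B * (2 * c') \<le> B * (2 * D)" using c'_le B(2) by (intro mult_left_mono) simp_all
    then show "B * (2 * K\<^sup>2 * 0 + 2 * c') \<le> 2 * B * D" by simp
    show "0 \<le> C" by (simp add: C_def poincare_const_def)
  qed (use r0 B(2) c'0 in simp_all)
  finally show ?thesis unfolding m'_def C_def .
qed

subsection \<open>Reverse Hoelder inequalities for powers of the solution\<close>

lemma abs_sum_powr_le:
  fixes x y r :: real
  assumes "0 \<le> r"
  shows "\<bar>x + y\<bar> powr r \<le> 2 powr r * (\<bar>x\<bar> powr r + \<bar>y\<bar> powr r)"
proof -
  have "\<bar>x + y\<bar> powr r \<le> (2 * max \<bar>x\<bar> \<bar>y\<bar>) powr r" by (rule powr_mono2[OF assms]) auto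
  also have "\<dots> = 2 powr r * max \<bar>x\<bar> \<bar>y\<bar> powr r" by (simp add: powr_mult)
  also have "\<dots> \<le> 2 powr r * (\<bar>x\<bar> powr r + \<bar>y\<bar> powr r)" by (intro mult_left_mono) (auto simp: max_def)
  finally show ?thesis .
qed

text \<open>Here \<open>p\<close> and \<open>q\<close> are finite and exceed 1, and \<open>A\<close>
  and \<open>B\<close> enter through bounds of integrals only, so norms for infinite exponents are
  covered as well. The exponent \<open>r\<close> has to exceed the integrability that Caccioppoli
  consumes and to stay within what the Sobolev inequality delivers. The cutoff constant
  \<open>L\<close> is a parameter, so that it can be fixed before the coefficient field.\<close>

locale weighted_solution = degenerate_solution a u G \<phi>
    for a :: "real ^ 'n \<Rightarrow> real ^ 'n ^ 'n" and u G \<phi> +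
  fixes p q r A B L :: real
  assumes p: "1 < p" and q: "1 < q" and r: "2 * p / (p - 1) < r"
    and subcritical: "real CARD('n) * ((q + 1) / (2 * q) - 1 / r) < 1"
    and A: "0 < A" "(\<integral>\<^sup>+ x. ennreal (spectral_norm (a x) powr p) \<partial>cube_measure 1) \<le> ennreal (A powr p)"
    and B: "0 < B" "(\<integral>\<^sup>+ x. ennreal (spectral_norm (matrix_inv (a x)) powr q) \<partial>cube_measure 1) \<le> ennreal (B powr q)"
    and inv: "AE x in cube_measure 1. invertible (a x)" "(\<lambda>x. matrix_inv (a x)) \<in> borel_measurable (cube_measure 1)"
    and L: "0 < L" "\<And>\<rho> \<rho>'. \<rho> < \<rho>' \<Longrightarrow> \<exists>\<eta> :: real ^ 'n \<Rightarrow> real.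
     (\<forall>k. Ck k UNIV \<eta>) \<and> (\<forall>x. 0 \<le> \<eta> x \<and> \<eta> x \<le> 1) \<and> (\<forall>x\<in>cube \<rho>. \<eta> x = 1) \<and> (\<forall>x. x \<notin> cube \<rho>' \<longrightarrow> \<eta> x = 0) \<and>
     (\<forall>x. norm (grad \<eta> x) \<le> L / (\<rho>' - \<rho>))"
begin

text \<open>Twice the conjugate exponent of \<open>p\<close>: the power in which f(u) has to be
  integrable so that the square of f(u) pairs with a weight in L^p.\<close>

definition m where "m = 2 * p / (p - 1)"
text \<open>The loss d (1/s - 1/r) for the gradient exponent s = 2 q / (q + 1).\<close>

definition \<sigma> where "\<sigma> = real CARD('n) * ((q + 1) / (2 * q) - 1 / r)"

lemma m: "2 < m" "m < r"
  using p r unfolding m_def by (simp_all add: pos_less_divide_eq)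

lemma r1: "1 < r" using m by linarith

lemma poincare:
  assumes \<rho>: "0 < \<rho>" "\<rho> < 1"
    and f: "\<And>t. 0 \<le> t \<Longrightarrow> (f has_real_derivative f' t) (at t)" "continuous_on {0..} f'" "\<And>t. 0 \<le> t \<Longrightarrow> \<bar>f' t\<bar> \<le> K"
    and D: "(\<integral>\<^sup>+ x. ennreal ((f' (u x))\<^sup>2 * E x) * indicator (cube \<rho>) x \<partial>\<mu>) \<le> ennreal D" "0 \<le> D"
  shows "(\<integral>\<^sup>+ x. ennreal (\<bar>f (u x) - (LINT x|\<mu>. f (u x) * indicator (cube \<rho>) x) / \<rho> ^ CARD('n)\<bar> powr r) * indicator (cube \<rho>) x \<partial>\<mu>)
     \<le> ennreal (poincare_const TYPE('n) r \<sigma> \<rho> * (2 * B * D) powr (r / 2))"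
proof (rule weighted_poincare_sobolev[OF \<rho> q refl _ _ _ inv B(2) _ f D])
  have "2 * q / (q + 1) < 2" using q by (simp add: pos_divide_less_eq)
  then show "2 * q / (q + 1) < r" using m by linarith
  show "\<sigma> = real CARD('n) * (1 / (2 * q / (q + 1)) - 1 / r)" unfolding \<sigma>_def by simp
  show "\<sigma> < 1" using subcritical unfolding \<sigma>_def .
qed (use B in simp)

lemma weight_Holder:
  assumes b: "continuous_on {0..} b" "\<And>t. 0 \<le> t \<Longrightarrow> 0 \<le> b t"
    and I: "(\<integral>\<^sup>+ x. ennreal (b (u x) powr m) * indicator (cube \<rho>) x \<partial>\<mu>) \<le> ennreal I" "0 \<le> I"
  shows "(\<integral>\<^sup>+ x. ennreal ((b (u x))\<^sup>2 * N x) * indicator (cube \<rho>) x \<partial>\<mu>) \<le> ennreal (A * I powr (2 / m))"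
proof -
  have bu: "(\<lambda>x. b (u x)) \<in> borel_measurable \<mu>" by (rule continuous_comp_meas[OF b(1)])
  have b0: "0 \<le> b (u x)" for x by (rule b(2)[OF u_nonneg])
  have "(\<integral>\<^sup>+ x. ennreal ((b (u x))\<^sup>2 * N x) * indicator (cube \<rho>) x \<partial>\<mu>)
      = (\<integral>\<^sup>+ x. ennreal (N x * ((b (u x))\<^sup>2 * indicator (cube \<rho>) x)) \<partial>\<mu>)"
    by (intro nn_integral_cong) (simp add: indicator_def mult.commute)
  also have "\<dots> \<le> ennreal ((A powr p) powr (1 / p) * I powr (1 / (p / (p - 1))))"
  proof (rule nn_integral_Holder_bound[OF N_meas])
    show "(\<lambda>x. (b (u x))\<^sup>2 * indicator (cube \<rho>) x) \<in> borel_measurable \<mu>"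
      by (intro borel_measurable_times borel_measurable_power bu indicator_cube_meas)
    show "1 / p + 1 / (p / (p - 1)) = 1" using p by (simp add: field_simps)
    have "(\<integral>\<^sup>+ x. ennreal (((b (u x))\<^sup>2 * indicator (cube \<rho>) x) powr (p / (p - 1))) \<partial>\<mu>)
      = (\<integral>\<^sup>+ x. ennreal (b (u x) powr m) * indicator (cube \<rho>) x \<partial>\<mu>)"
    proof (rule nn_integral_cong)
      fix x
      have "(b (u x))\<^sup>2 = b (u x) powr 2" using b0[of x] by simp
      then have "((b (u x))\<^sup>2) powr (p / (p - 1)) = b (u x) powr m" by (simp only: powr_powr m_def) simp
      then show "ennreal (((b (u x))\<^sup>2 * indicator (cube \<rho>) x) powr (p / (p - 1))) = ennreal (b (u x) powr m) * indicator (cube \<rho>) x"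
        by (cases "x \<in> cube \<rho>") simp_all
    qed
    then show "(\<integral>\<^sup>+ x. ennreal (((b (u x))\<^sup>2 * indicator (cube \<rho>) x) powr (p / (p - 1))) \<partial>\<mu>) \<le> ennreal I"
      using I(1) by simp
  qed (use p A I spectral_norm_nonneg in simp_all)
  also have "(A powr p) powr (1 / p) * I powr (1 / (p / (p - 1))) = A * I powr (2 / m)"
  proof -
    have "2 / m = 1 / (p / (p - 1))" using p by (simp add: m_def divide_simps)
    then show ?thesis using p A by (simp only: powr_powr) simp
  qed
  finally show ?thesis .
qed

text \<open>On a cube of volume at most 1, Hoelder with the constant function 1 bounds L^1 by L^k.
  It is used both to restore the mean removed by the Poincare inequality and for the oscillation of
  the logarithm.\<close>

lemma mean_le:
  assumes b: "continuous_on {0..} b" "\<And>t. 0 \<le> t \<Longrightarrow> 0 \<le> b t" and \<rho>: "0 < \<rho>" "\<rho> < 1" and k: "1 < k"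
    and I: "(\<integral>\<^sup>+ x. ennreal (b (u x) powr k) * indicator (cube \<rho>) x \<partial>\<mu>) \<le> ennreal I" "0 \<le> I"
  shows "(\<integral>\<^sup>+ x. ennreal (b (u x)) * indicator (cube \<rho>) x \<partial>\<mu>) \<le> ennreal (I powr (1 / k))"
    and "\<bar>(LINT x|\<mu>. b (u x) * indicator (cube \<rho>) x) / \<rho> ^ CARD('n)\<bar> \<le> I powr (1 / k) / \<rho> ^ CARD('n)"
proof -
  have bu: "(\<lambda>x. b (u x)) \<in> borel_measurable \<mu>" by (rule continuous_comp_meas[OF b(1)])
  have b0: "0 \<le> b (u x)" for x by (rule b(2)[OF u_nonneg])
  have vol: "\<rho> ^ CARD('n) \<le> 1" using \<rho> by (simp add: power_le_one)
  have "(\<integral>\<^sup>+ x. ennreal ((b (u x) * indicator (cube \<rho>) x) * 1) \<partial>\<mu>)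
    \<le> ennreal (I powr (1 / k) * 1 powr (1 / (k / (k - 1))))"
  proof (rule nn_integral_Holder_bound)
    show "(\<lambda>x. b (u x) * indicator (cube \<rho>) x) \<in> borel_measurable \<mu>" by (intro borel_measurable_times bu indicator_cube_meas)
    show "1 / k + 1 / (k / (k - 1)) = 1" using k by (simp add: field_simps)
    have "(\<integral>\<^sup>+ x. ennreal ((b (u x) * indicator (cube \<rho>) x) powr k) \<partial>\<mu>) = (\<integral>\<^sup>+ x. ennreal (b (u x) powr k) * indicator (cube \<rho>) x \<partial>\<mu>)"
      by (intro nn_integral_cong) (simp add: indicator_def)
    then show "(\<integral>\<^sup>+ x. ennreal ((b (u x) * indicator (cube \<rho>) x) powr k) \<partial>\<mu>) \<le> ennreal I" using I(1) by simp
    show "(\<integral>\<^sup>+ x. ennreal (1 powr (k / (k - 1))) \<partial>\<mu>) \<le> ennreal 1" by (simp add: emeasure_restrict_space emeasure_cube)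
  qed (use k I b0 in simp_all)
  also have "(\<integral>\<^sup>+ x. ennreal ((b (u x) * indicator (cube \<rho>) x) * 1) \<partial>\<mu>) = (\<integral>\<^sup>+ x. ennreal (b (u x) * indicator (cube \<rho>) x) \<partial>\<mu>)"
    by simp
  finally have le: "(\<integral>\<^sup>+ x. ennreal (b (u x) * indicator (cube \<rho>) x) \<partial>\<mu>) \<le> ennreal (I powr (1 / k))" by simp
  have eq: "(\<integral>\<^sup>+ x. ennreal (b (u x)) * indicator (cube \<rho>) x \<partial>\<mu>) = (\<integral>\<^sup>+ x. ennreal (b (u x) * indicator (cube \<rho>) x) \<partial>\<mu>)"
    by (intro nn_integral_cong) (simp add: indicator_def)
  show "(\<integral>\<^sup>+ x. ennreal (b (u x)) * indicator (cube \<rho>) x \<partial>\<mu>) \<le> ennreal (I powr (1 / k))" unfolding eq by (rule le)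
  have int: "integrable \<mu> (\<lambda>x. b (u x) * indicator (cube \<rho>) x)"
    by (rule integrableI_nonneg)
      (use le_less_trans[OF le] b0 in \<open>auto intro!: borel_measurable_times bu indicator_cube_meas\<close>)
  have "ennreal (LINT x|\<mu>. b (u x) * indicator (cube \<rho>) x) = (\<integral>\<^sup>+ x. ennreal (b (u x) * indicator (cube \<rho>) x) \<partial>\<mu>)"
    by (rule nn_integral_eq_integral[symmetric, OF int]) (use b0 in simp)
  then have "ennreal (LINT x|\<mu>. b (u x) * indicator (cube \<rho>) x) \<le> ennreal (I powr (1 / k))" using le by simp
  then have "(LINT x|\<mu>. b (u x) * indicator (cube \<rho>) x) \<le> I powr (1 / k)" by simp
  moreover have "0 \<le> (LINT x|\<mu>. b (u x) * indicator (cube \<rho>) x)" by (rule integral_nonneg_AE) (use b0 in simp)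
  ultimately show "\<bar>(LINT x|\<mu>. b (u x) * indicator (cube \<rho>) x) / \<rho> ^ CARD('n)\<bar> \<le> I powr (1 / k) / \<rho> ^ CARD('n)"
    using \<rho> by (simp add: divide_right_mono)
qed

text \<open>The first summand is Caccioppoli inside Poincare-Sobolev, with \<open>c\<close>
  proportional to the exponent of the power; the second restores the mean and does not see the
  weights. The 8 is 2 from the Poincare inequality times 4 from Caccioppoli, and the outer 4 comes
  from twice adding r-th powers.\<close>

definition gain where
  "gain c \<rho> \<rho>' = 4 * (poincare_const TYPE('n) r \<sigma> \<rho> powr (1 / r) * (sqrt (8 * (A * B)) * (L / (\<rho>' - \<rho>)) * c) + 1 / \<rho> ^ CARD('n))"

text \<open>Caccioppoli with \<open>b\<close> equal to \<open>c\<close> times f, followed by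
  Poincare-Sobolev on the smaller cube, where the cutoff is 1. Every term that sees the weights thus
  carries the factor \<open>c\<close>.\<close>

lemma power_step:
  assumes \<rho>: "0 < \<rho>" "\<rho> < \<rho>'" "\<rho>' < 1" and c: "0 \<le> c"
    and f: "\<And>t. 0 \<le> t \<Longrightarrow> (f has_real_derivative f' t) (at t)" "continuous_on {0..} f'" "\<And>t. 0 \<le> t \<Longrightarrow> \<bar>f' t\<bar> \<le> K"
      "\<And>t. 0 \<le> t \<Longrightarrow> 0 \<le> f t"
    and h: "\<And>t. 0 \<le> t \<Longrightarrow> (h has_real_derivative (f' t)\<^sup>2) (at t)" "\<And>t. 0 \<le> t \<Longrightarrow> \<bar>h t\<bar> \<le> c * f t * \<bar>f' t\<bar>"
    and I: "(\<integral>\<^sup>+ x. ennreal (f (u x) powr m) * indicator (cube \<rho>') x \<partial>\<mu>) \<le> ennreal I" "0 \<le> I"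
  shows "(\<integral>\<^sup>+ x. ennreal (f (u x) powr r) * indicator (cube \<rho>) x \<partial>\<mu>) \<le> ennreal (gain c \<rho> \<rho>' powr r * I powr (r / m))"
proof -
  have \<rho>1: "\<rho> < 1" using \<rho> by simp
  define M where "M = L / (\<rho>' - \<rho>)"
  have M0: "0 < M" using L(1) \<rho> by (simp add: M_def)
  have f_cont: "continuous_on {0..} f"
    by (rule continuous_at_imp_continuous_on) (use f(1) in \<open>auto intro: DERIV_isCont\<close>)
  obtain \<eta> :: "real ^ 'n \<Rightarrow> real" where \<eta>: "\<forall>k. Ck k UNIV \<eta>" "\<forall>x. 0 \<le> \<eta> x \<and> \<eta> x \<le> 1" "\<forall>x\<in>cube \<rho>. \<eta> x = 1"
    "\<forall>x. x \<notin> cube \<rho>' \<longrightarrow> \<eta> x = 0" "\<forall>x. norm (grad \<eta> x) \<le> L / (\<rho>' - \<rho>)"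
    using L(2)[OF \<rho>(2)] by (elim exE conjE)
  have D: "(\<integral>\<^sup>+ x. ennreal ((f' (u x))\<^sup>2 * E x) * indicator (cube \<rho>) x \<partial>\<mu>) \<le> ennreal (4 * M\<^sup>2 * (c\<^sup>2 * (A * I powr (2 / m))))"
  proof (rule caccioppoli[where \<eta>=\<eta> and h=h and b="\<lambda>t. c * f t" and K=K and \<rho>'=\<rho>'])
    show "(\<integral>\<^sup>+ x. ennreal ((c * f (u x))\<^sup>2 * N x) * indicator (cube \<rho>') x \<partial>\<mu>) \<le> ennreal (c\<^sup>2 * (A * I powr (2 / m)))"
    proof -
      have "(\<integral>\<^sup>+ x. ennreal ((c * f (u x))\<^sup>2 * N x) * indicator (cube \<rho>') x \<partial>\<mu>)
        = (\<integral>\<^sup>+ x. ennreal (c\<^sup>2) * ennreal ((f (u x))\<^sup>2 * N x * indicator (cube \<rho>') x) \<partial>\<mu>)"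
        by (intro nn_integral_cong) (simp add: indicator_def ennreal_mult[symmetric] spectral_norm_nonneg power_mult_distrib mult_ac)
      also have "\<dots> = ennreal (c\<^sup>2) * (\<integral>\<^sup>+ x. ennreal ((f (u x))\<^sup>2 * N x * indicator (cube \<rho>') x) \<partial>\<mu>)"
        by (rule nn_integral_cmult, rule measurable_compose[OF _ measurable_ennreal])
          (intro borel_measurable_times borel_measurable_power continuous_comp_meas[OF f_cont] N_meas indicator_cube_meas)
      also have "(\<integral>\<^sup>+ x. ennreal ((f (u x))\<^sup>2 * N x * indicator (cube \<rho>') x) \<partial>\<mu>)
         = (\<integral>\<^sup>+ x. ennreal ((f (u x))\<^sup>2 * N x) * indicator (cube \<rho>') x \<partial>\<mu>)"
        by (intro nn_integral_cong) (simp add: indicator_def)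
      also have "ennreal (c\<^sup>2) * \<dots> \<le> ennreal (c\<^sup>2) * ennreal (A * I powr (2 / m))"
        by (rule mult_left_mono[OF weight_Holder[OF f_cont f(4) I] zero_le])
      also have "\<dots> = ennreal (c\<^sup>2 * (A * I powr (2 / m)))" using A by (simp add: ennreal_mult)
      finally show ?thesis .
    qed
    show "continuous_on {0..} (\<lambda>t. c * f t)" by (intro continuous_on_mult continuous_on_const f_cont)
    show "0 \<le> c * f t" if "0 \<le> t" for t using f(4)[OF that] c by simp
    show "0 \<le> c\<^sup>2 * (A * I powr (2 / m))" using A by simp
  qed (use \<eta> f h \<rho> in \<open>simp_all add: M_def\<close>)
  define mn where "mn = (LINT x|\<mu>. f (u x) * indicator (cube \<rho>) x) / \<rho> ^ CARD('n)"
  define C where "C = poincare_const TYPE('n) r \<sigma> \<rho>"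
  have C0: "0 \<le> C" by (simp add: C_def poincare_const_def)
  have PS: "(\<integral>\<^sup>+ x. ennreal (\<bar>f (u x) - mn\<bar> powr r) * indicator (cube \<rho>) x \<partial>\<mu>)
     \<le> ennreal (C * (2 * B * (4 * M\<^sup>2 * (c\<^sup>2 * (A * I powr (2 / m))))) powr (r / 2))"
    unfolding mn_def C_def by (rule poincare[OF \<rho>(1) \<rho>1 f(1,2,3) D]) (use A in simp_all)
  define X where "X = C powr (1 / r) * (sqrt (8 * (A * B)) * M * c)"
  define Y where "Y = 1 / \<rho> ^ CARD('n)"
  have X0: "0 \<le> X" using C0 A B M0 c by (simp add: X_def)
  have Y0: "0 < Y" using \<rho> by (simp add: Y_def)
  have CX: "C * (2 * B * (4 * M\<^sup>2 * (c\<^sup>2 * (A * I powr (2 / m))))) powr (r / 2) = X powr r * I powr (r / m)"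
  proof -
    have "2 * B * (4 * M\<^sup>2 * (c\<^sup>2 * (A * I powr (2 / m)))) = (sqrt (8 * (A * B)) * M * c)\<^sup>2 * I powr (2 / m)"
      using A B by (simp add: power_mult_distrib)
    also have "\<dots> powr (r / 2) = ((sqrt (8 * (A * B)) * M * c)\<^sup>2) powr (r / 2) * (I powr (2 / m)) powr (r / 2)"
      by (rule powr_mult)
    also have "((sqrt (8 * (A * B)) * M * c)\<^sup>2) powr (r / 2) = (sqrt (8 * (A * B)) * M * c) powr r"
    proof -
      have "(sqrt (8 * (A * B)) * M * c)\<^sup>2 = (sqrt (8 * (A * B)) * M * c) powr 2"
        using A B M0 c by simp
      then show ?thesis by (simp only: powr_powr) simp
    qed
    also have "(I powr (2 / m)) powr (r / 2) = I powr (r / m)" by (simp add: powr_powr)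
    finally have "C * (2 * B * (4 * M\<^sup>2 * (c\<^sup>2 * (A * I powr (2 / m))))) powr (r / 2) = C * (sqrt (8 * (A * B)) * M * c) powr r * I powr (r / m)"
      by simp
    also have "C * (sqrt (8 * (A * B)) * M * c) powr r = X powr r"
    proof -
      have "(C powr (1 / r)) powr r = C" using r1 C0 by (simp add: powr_powr)
      moreover have "X powr r = (C powr (1 / r)) powr r * (sqrt (8 * (A * B)) * M * c) powr r"
        unfolding X_def by (rule powr_mult)
      ultimately show ?thesis by simp
    qed
    finally show ?thesis .
  qed
  have mn_le: "\<bar>mn\<bar> \<le> I powr (1 / m) * Y"
  proof -
    have "(\<integral>\<^sup>+ x. ennreal (f (u x) powr m) * indicator (cube \<rho>) x \<partial>\<mu>) \<le> (\<integral>\<^sup>+ x. ennreal (f (u x) powr m) * indicator (cube \<rho>') x \<partial>\<mu>)"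
      using cube_subset[OF less_imp_le[OF \<rho>(2)]] by (intro nn_integral_mono mult_left_mono) (auto simp: indicator_def)
    then have "(\<integral>\<^sup>+ x. ennreal (f (u x) powr m) * indicator (cube \<rho>) x \<partial>\<mu>) \<le> ennreal I" using I(1) by (rule order_trans)
    from mean_le(2)[OF f_cont f(4) \<rho>(1) \<rho>1 _ this I(2)] m show ?thesis by (simp add: mn_def Y_def)
  qed
  have mnr: "\<bar>mn\<bar> powr r \<le> I powr (r / m) * Y powr r"
  proof -
    have "\<bar>mn\<bar> powr r \<le> (I powr (1 / m) * Y) powr r" by (rule powr_mono2[OF _ _ mn_le]) (use r1 in simp_all)
    also have "\<dots> = I powr (r / m) * Y powr r" using Y0 by (simp add: powr_mult powr_powr)
    finally show ?thesis .
  qed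
  have fu_meas: "(\<lambda>x. f (u x)) \<in> borel_measurable \<mu>" by (rule continuous_comp_meas[OF f_cont])
  have ind_meas: "(indicator (cube \<rho>) :: real ^ 'n \<Rightarrow> ennreal) \<in> borel_measurable \<mu>"
    by (intro measurable_restrict_space1 borel_measurable_indicator) simp
  have meas1: "(\<lambda>x. ennreal (\<bar>f (u x) - mn\<bar> powr r) * indicator (cube \<rho>) x) \<in> borel_measurable \<mu>"
    using fu_meas ind_meas by measurable
  have meas2: "(\<lambda>x. ennreal (\<bar>mn\<bar> powr r) * indicator (cube \<rho>) x) \<in> borel_measurable \<mu>"
    using ind_meas by measurable
  have "(\<integral>\<^sup>+ x. ennreal (f (u x) powr r) * indicator (cube \<rho>) x \<partial>\<mu>)
    \<le> (\<integral>\<^sup>+ x. ennreal (2 powr r) * (ennreal (\<bar>f (u x) - mn\<bar> powr r) * indicator (cube \<rho>) x + ennreal (\<bar>mn\<bar> powr r) * indicator (cube \<rho>) x) \<partial>\<mu>)"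
  proof (rule nn_integral_mono)
    fix x
    have "f (u x) powr r \<le> 2 powr r * (\<bar>f (u x) - mn\<bar> powr r + \<bar>mn\<bar> powr r)"
      using abs_sum_powr_le[of r "f (u x) - mn" mn] r1 f(4)[OF u_nonneg, of x] by simp
    then have "ennreal (f (u x) powr r) \<le> ennreal (2 powr r * (\<bar>f (u x) - mn\<bar> powr r + \<bar>mn\<bar> powr r))" by (rule ennreal_leI)
    also have "\<dots> = ennreal (2 powr r) * (ennreal (\<bar>f (u x) - mn\<bar> powr r) + ennreal (\<bar>mn\<bar> powr r))"
      by (simp add: ennreal_mult ennreal_plus)
    finally show "ennreal (f (u x) powr r) * indicator (cube \<rho>) x
      \<le> ennreal (2 powr r) * (ennreal (\<bar>f (u x) - mn\<bar> powr r) * indicator (cube \<rho>) x + ennreal (\<bar>mn\<bar> powr r) * indicator (cube \<rho>) x)"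
      by (cases "x \<in> cube \<rho>") simp_all
  qed
  also have "\<dots> = ennreal (2 powr r) * ((\<integral>\<^sup>+ x. ennreal (\<bar>f (u x) - mn\<bar> powr r) * indicator (cube \<rho>) x \<partial>\<mu>)
      + (\<integral>\<^sup>+ x. ennreal (\<bar>mn\<bar> powr r) * indicator (cube \<rho>) x \<partial>\<mu>))"
    using meas1 meas2 by (subst nn_integral_cmult) (simp_all add: nn_integral_add)
  also have "\<dots> \<le> ennreal (2 powr r) * (ennreal (X powr r * I powr (r / m)) + ennreal (I powr (r / m) * Y powr r))"
  proof (intro mult_left_mono add_mono)
    show "(\<integral>\<^sup>+ x. ennreal (\<bar>f (u x) - mn\<bar> powr r) * indicator (cube \<rho>) x \<partial>\<mu>) \<le> ennreal (X powr r * I powr (r / m))"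
      using PS unfolding CX .
    have "(\<integral>\<^sup>+ x. ennreal (\<bar>mn\<bar> powr r) * indicator (cube \<rho>) x \<partial>\<mu>) \<le> (\<integral>\<^sup>+ x. ennreal (\<bar>mn\<bar> powr r) \<partial>\<mu>)"
      by (intro nn_integral_mono) (simp add: indicator_def)
    also have "\<dots> = ennreal (\<bar>mn\<bar> powr r)" by (simp add: emeasure_restrict_space emeasure_cube)
    also have "\<dots> \<le> ennreal (I powr (r / m) * Y powr r)" by (rule ennreal_leI[OF mnr])
    finally show "(\<integral>\<^sup>+ x. ennreal (\<bar>mn\<bar> powr r) * indicator (cube \<rho>) x \<partial>\<mu>) \<le> ennreal (I powr (r / m) * Y powr r)" .
  qed simp
  also have "\<dots> = ennreal (2 powr r * (X powr r * I powr (r / m) + I powr (r / m) * Y powr r))"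
    using Y0 X0 by (simp add: ennreal_mult[symmetric] ennreal_plus[symmetric] del: ennreal_plus)
  also have "\<dots> \<le> ennreal (gain c \<rho> \<rho>' powr r * I powr (r / m))"
  proof (rule ennreal_leI)
    \<comment> \<open>Each power is at most that of the sum; the factor 2 is absorbed as
      \<open>2 powr r\<close>, which accounts for the second 2 in \<open>gain\<close>.\<close>
    have "X powr r + Y powr r \<le> (X + Y) powr r + (X + Y) powr r"
      using X0 Y0 r1 by (intro add_mono powr_mono2) simp_all
    also have "\<dots> = 2 powr 1 * (X + Y) powr r" by simp
    also have "\<dots> \<le> 2 powr r * (X + Y) powr r" using r1 by (intro mult_right_mono powr_mono) simp_all
    finally have "2 powr r * (X powr r + Y powr r) \<le> 2 powr r * (2 powr r * (X + Y) powr r)"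
      by (intro mult_left_mono) simp_all
    also have "\<dots> = (2 * (2 * (X + Y))) powr r" by (simp only: powr_mult)
    also have "2 * (2 * (X + Y)) = gain c \<rho> \<rho>'" by (simp add: gain_def X_def Y_def C_def M_def)
    finally have "2 powr r * (X powr r + Y powr r) * I powr (r / m) \<le> gain c \<rho> \<rho>' powr r * I powr (r / m)"
      by (intro mult_right_mono) simp_all
    then show "2 powr r * (X powr r * I powr (r / m) + I powr (r / m) * Y powr r) \<le> gain c \<rho> \<rho>' powr r * I powr (r / m)"
      by (simp add: algebra_simps)
  qed
  finally show ?thesis .
qed

end

context weighted_solution
begin

lemma shifted_powr_deriv:
  assumes "0 < \<delta>" "0 \<le> t"
  shows "((\<lambda>t. (t + \<delta>) powr \<beta>) has_real_derivative \<beta> * (t + \<delta>) powr (\<beta> - 1)) (at t)"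
proof -
  have d: "((\<lambda>t. t + \<delta>) has_real_derivative 1) (at t)" by (auto intro!: derivative_eq_intros)
  have "((\<lambda>z. z powr \<beta>) has_real_derivative \<beta> * (t + \<delta>) powr (\<beta> - 1)) (at (t + \<delta>))"
    by (rule has_real_derivative_powr) (use assms in simp)
  from DERIV_chain2[OF this d] show ?thesis by simp
qed

lemma shifted_powr_cont: "0 < \<delta> \<Longrightarrow> continuous_on {0..} (\<lambda>t. c * (t + \<delta>) powr \<beta>)" for \<delta> :: real
  by (intro continuous_intros) auto

text \<open>For \<beta> <= 1, including negative values, the derivative of the shifted power is
  bounded on the half line by its value at 0, so \<open>power_step\<close> applies as it stands. The
  primitive of its square is a power with exponent 2 \<beta> - 1, and dividing by this number is
  where the distance \<open>c0\<close> from \<beta> = 1/2 is needed.\<close>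

lemma power_step_small:
  assumes \<rho>: "0 < \<rho>" "\<rho> < \<rho>'" "\<rho>' < 1" and \<delta>: "0 < \<delta>" and c0: "0 < c0" "c0 \<le> \<bar>2 * \<beta> - 1\<bar>" and \<beta>: "\<beta> \<le> 1"
    and I: "(\<integral>\<^sup>+ x. ennreal ((u x + \<delta>) powr (m * \<beta>)) * indicator (cube \<rho>') x \<partial>\<mu>) \<le> ennreal I" "0 \<le> I"
  shows "(\<integral>\<^sup>+ x. ennreal ((u x + \<delta>) powr (r * \<beta>)) * indicator (cube \<rho>) x \<partial>\<mu>) \<le> ennreal (gain (\<bar>\<beta>\<bar> / c0) \<rho> \<rho>' powr r * I powr (r / m))"
proof -
  have pp: "((u x + \<delta>) powr \<beta>) powr k = (u x + \<delta>) powr (k * \<beta>)" for x k by (simp add: powr_powr mult.commute)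
  have b1: "2 * \<beta> - 1 \<noteq> 0" using c0 by auto
  have "(\<integral>\<^sup>+ x. ennreal (((u x + \<delta>) powr \<beta>) powr r) * indicator (cube \<rho>) x \<partial>\<mu>) \<le> ennreal (gain (\<bar>\<beta>\<bar> / c0) \<rho> \<rho>' powr r * I powr (r / m))"
  proof (rule power_step[where f="\<lambda>t. (t + \<delta>) powr \<beta>" and f'="\<lambda>t. \<beta> * (t + \<delta>) powr (\<beta> - 1)" and K="\<bar>\<beta>\<bar> * \<delta> powr (\<beta> - 1)"
        and h="\<lambda>t. \<beta>\<^sup>2 / (2 * \<beta> - 1) * (t + \<delta>) powr (2 * \<beta> - 1)", OF \<rho>])
    show "0 \<le> \<bar>\<beta>\<bar> / c0" using c0 by simp
    show "(\<integral>\<^sup>+ x. ennreal (((u x + \<delta>) powr \<beta>) powr m) * indicator (cube \<rho>') x \<partial>\<mu>) \<le> ennreal I" unfolding pp by (rule I(1))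
    show "continuous_on {0..} (\<lambda>t. \<beta> * (t + \<delta>) powr (\<beta> - 1))" by (rule shifted_powr_cont[OF \<delta>])
    fix t :: real assume t: "0 \<le> t"
    show "((\<lambda>t. (t + \<delta>) powr \<beta>) has_real_derivative \<beta> * (t + \<delta>) powr (\<beta> - 1)) (at t)" by (rule shifted_powr_deriv[OF \<delta> t])
    show "\<bar>\<beta> * (t + \<delta>) powr (\<beta> - 1)\<bar> \<le> \<bar>\<beta>\<bar> * \<delta> powr (\<beta> - 1)"
      unfolding abs_mult using \<beta> \<delta> t by (intro mult_left_mono) (auto intro: powr_mono2')
    have sq: "(\<beta> * (t + \<delta>) powr (\<beta> - 1))\<^sup>2 = \<beta>\<^sup>2 * (t + \<delta>) powr (2 * \<beta> - 2)"
    proof -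
      have "((t + \<delta>) powr (\<beta> - 1))\<^sup>2 = ((t + \<delta>) powr (\<beta> - 1)) powr 2" by simp
      also have "\<dots> = (t + \<delta>) powr (2 * \<beta> - 2)" by (simp only: powr_powr) (simp add: algebra_simps)
      finally show ?thesis by (simp add: power_mult_distrib)
    qed
    have "((\<lambda>t. \<beta>\<^sup>2 / (2 * \<beta> - 1) * (t + \<delta>) powr (2 * \<beta> - 1)) has_real_derivative
        \<beta>\<^sup>2 / (2 * \<beta> - 1) * ((2 * \<beta> - 1) * (t + \<delta>) powr (2 * \<beta> - 1 - 1))) (at t)"
      by (rule DERIV_cmult[OF shifted_powr_deriv[OF \<delta> t]])
    moreover have "\<beta>\<^sup>2 / (2 * \<beta> - 1) * ((2 * \<beta> - 1) * (t + \<delta>) powr (2 * \<beta> - 1 - 1)) = \<beta>\<^sup>2 * (t + \<delta>) powr (2 * \<beta> - 2)"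
      using b1 by simp
    ultimately show "((\<lambda>t. \<beta>\<^sup>2 / (2 * \<beta> - 1) * (t + \<delta>) powr (2 * \<beta> - 1)) has_real_derivative (\<beta> * (t + \<delta>) powr (\<beta> - 1))\<^sup>2) (at t)"
      unfolding sq by simp
    have "\<bar>\<beta>\<^sup>2 / (2 * \<beta> - 1) * (t + \<delta>) powr (2 * \<beta> - 1)\<bar> = \<beta>\<^sup>2 / \<bar>2 * \<beta> - 1\<bar> * (t + \<delta>) powr (2 * \<beta> - 1)"
      by (simp add: abs_mult)
    also have "\<dots> \<le> \<beta>\<^sup>2 / c0 * (t + \<delta>) powr (2 * \<beta> - 1)"
      using c0 by (intro mult_right_mono divide_left_mono) (auto intro!: mult_pos_pos)
    also have "\<beta>\<^sup>2 / c0 * (t + \<delta>) powr (2 * \<beta> - 1) = \<beta>\<^sup>2 / c0 * ((t + \<delta>) powr \<beta> * (t + \<delta>) powr (\<beta> - 1))"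
      by (simp add: powr_add[symmetric])
    also have "\<dots> = \<bar>\<beta>\<bar> / c0 * (t + \<delta>) powr \<beta> * \<bar>\<beta> * (t + \<delta>) powr (\<beta> - 1)\<bar>"
      by (simp add: abs_mult power2_eq_square)
    finally show "\<bar>\<beta>\<^sup>2 / (2 * \<beta> - 1) * (t + \<delta>) powr (2 * \<beta> - 1)\<bar> \<le> \<bar>\<beta>\<bar> / c0 * (t + \<delta>) powr \<beta> * \<bar>\<beta> * (t + \<delta>) powr (\<beta> - 1)\<bar>" .
  qed (use I(2) in simp_all)
  then show ?thesis unfolding pp .
qed

text \<open>For \<beta> > 1 the derivative of the power is unbounded, so it is frozen once the
  argument reaches \<open>Suc n\<close>. The primitive of its square is taken from 0, where nothing
  degenerates, and Fatou removes the truncation.\<close>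

lemma power_step_large:
  assumes \<rho>: "0 < \<rho>" "\<rho> < \<rho>'" "\<rho>' < 1" and \<delta>: "0 < \<delta>" and c0: "0 < c0" "c0 \<le> 1" and \<beta>: "1 < \<beta>"
    and I: "(\<integral>\<^sup>+ x. ennreal ((u x + \<delta>) powr (m * \<beta>)) * indicator (cube \<rho>') x \<partial>\<mu>) \<le> ennreal I" "0 \<le> I"
  shows "(\<integral>\<^sup>+ x. ennreal ((u x + \<delta>) powr (r * \<beta>)) * indicator (cube \<rho>) x \<partial>\<mu>) \<le> ennreal (gain (\<bar>\<beta>\<bar> / c0) \<rho> \<rho>' powr r * I powr (r / m))"
proof -
  have pp: "((u x + \<delta>) powr \<beta>) powr k = (u x + \<delta>) powr (k * \<beta>)" for x k by (simp add: powr_powr mult.commute)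
  have c1: "1 \<le> \<bar>\<beta>\<bar> / c0" using c0 \<beta> by (simp add: pos_le_divide_eq)
  define f' where "f' n t = \<beta> * (min (max 0 t + \<delta>) (real (Suc n))) powr (\<beta> - 1)" for n t
  have base_pos: "0 < min (max 0 t + \<delta>) (real (Suc n))" for n and t :: real using \<delta> by simp
  have f'_cont: "continuous_on UNIV (f' n)" for n
    unfolding f'_def by (intro continuous_intros) (use base_pos in \<open>auto simp: less_imp_neq[symmetric]\<close>)
  have f'0: "0 \<le> f' n t" for n t unfolding f'_def using \<beta> by simp
  have f'_mono: "f' n s \<le> f' n t" if "s \<le> t" for n s t
    unfolding f'_def using \<beta> \<delta> that by (intro mult_left_mono powr_mono2) auto
  have f'_le: "f' n t \<le> \<beta> * real (Suc n) powr (\<beta> - 1)" for n t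
    unfolding f'_def using \<beta> \<delta> by (intro mult_left_mono powr_mono2) auto
  have f'_le2: "f' n t \<le> \<beta> * (t + \<delta>) powr (\<beta> - 1)" if "0 \<le> t" for n t
    unfolding f'_def using \<beta> \<delta> that by (intro mult_left_mono powr_mono2) auto
  have f'_eq: "f' n t = \<beta> * (t + \<delta>) powr (\<beta> - 1)" if "0 \<le> t" "t + \<delta> \<le> real (Suc n)" for n t
    unfolding f'_def using that by simp
  have "\<exists>F. (\<forall>t. (F has_real_derivative f' n t) (at t)) \<and> F 0 = 0" for n
    using continuous_antiderivative[OF f'_cont[of n]] by blast
  then obtain F where F: "\<And>n t. (F n has_real_derivative f' n t) (at t)" "\<And>n. F n 0 = 0" by metis
  have f'2_cont: "continuous_on UNIV (\<lambda>t. (f' n t)\<^sup>2)" for n by (intro continuous_on_power f'_cont)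
  have "\<exists>F. (\<forall>t. (F has_real_derivative (f' n t)\<^sup>2) (at t)) \<and> F 0 = 0" for n
    using continuous_antiderivative[OF f'2_cont[of n]] by blast
  then obtain H where H: "\<And>n t. (H n has_real_derivative (f' n t)\<^sup>2) (at t)" "\<And>n. H n 0 = 0" by metis
  define f where "f n t = F n t + \<delta> powr \<beta>" for n t
  have f: "(f n has_real_derivative f' n t) (at t)" for n t
    unfolding f_def using DERIV_add[OF F(1)[of n t] DERIV_const[of "\<delta> powr \<beta>"]] by simp
  have F0: "0 \<le> F n t" if t: "0 \<le> t" for n t
  proof -
    have "(\<lambda>_. 0) t \<le> F n t" by (rule DERIV_compare[OF t DERIV_const F(1) f'0]) (simp add: F(2))
    then show ?thesis .
  qed
  have f0: "0 \<le> f n t" if "0 \<le> t" for n t using F0[OF that] by (simp add: f_def)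
  have f_le: "f n t \<le> (t + \<delta>) powr \<beta>" if t: "0 \<le> t" for n t
    by (rule DERIV_compare[OF t f shifted_powr_deriv[OF \<delta>] f'_le2]) (simp_all add: f_def F(2))
  have f_eq: "f n t = (t + \<delta>) powr \<beta>" if t: "0 \<le> t" "t + \<delta> \<le> real (Suc n)" for n t
  proof (rule antisym[OF f_le[OF t(1)]])
    show "(t + \<delta>) powr \<beta> \<le> f n t"
      by (rule DERIV_compare[OF t(1) shifted_powr_deriv[OF \<delta>] f]) (use t in \<open>simp_all add: f'_eq f_def F(2)\<close>)
  qed
  \<comment> \<open>As \<open>f'\<close> is nondecreasing, the integral of \<open>f'\<^sup>2\<close> is at most \<open>f'\<close> times the integral of \<open>f'\<close>.\<close>
  have H_le: "\<bar>H n t\<bar> \<le> \<bar>\<beta>\<bar> / c0 * f n t * \<bar>f' n t\<bar>" if t: "0 \<le> t" for n t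
  proof -
    have "(\<lambda>_. 0) t \<le> H n t" by (rule DERIV_compare[OF t DERIV_const H(1)]) (simp_all add: H(2))
    moreover have "H n t \<le> f' n t * F n t"
    proof (rule DERIV_compare[OF t H(1) DERIV_cmult[OF F(1)]])
      fix x assume "x \<le> t"
      then show "(f' n x)\<^sup>2 \<le> f' n t * f' n x"
        unfolding power2_eq_square by (intro mult_right_mono f'_mono f'0)
    qed (simp add: H(2) F(2))
    moreover have "f' n t * F n t \<le> f' n t * f n t" by (intro mult_left_mono f'0) (simp add: f_def)
    moreover have "1 * (f' n t * f n t) \<le> \<bar>\<beta>\<bar> / c0 * (f' n t * f n t)"
      by (rule mult_right_mono[OF c1]) (intro mult_nonneg_nonneg f'0 f0 t)
    ultimately show ?thesis using f'0[of n t] by (simp add: mult_ac)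
  qed
  have step: "(\<integral>\<^sup>+ x. ennreal (f n (u x) powr r) * indicator (cube \<rho>) x \<partial>\<mu>) \<le> ennreal (gain (\<bar>\<beta>\<bar> / c0) \<rho> \<rho>' powr r * I powr (r / m))" for n
  proof (rule power_step[where f="f n" and f'="f' n" and h="H n" and K="\<beta> * real (Suc n) powr (\<beta> - 1)", OF \<rho>])
    show "continuous_on {0..} (f' n)" by (rule continuous_on_subset[OF f'_cont]) simp
    show "0 \<le> \<bar>\<beta>\<bar> / c0" using c0 by simp
    show "\<bar>f' n t\<bar> \<le> \<beta> * real (Suc n) powr (\<beta> - 1)" for t using f'0[of n t] f'_le[of n t] by simp
    have "(\<integral>\<^sup>+ x. ennreal (f n (u x) powr m) * indicator (cube \<rho>') x \<partial>\<mu>)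
      \<le> (\<integral>\<^sup>+ x. ennreal ((u x + \<delta>) powr (m * \<beta>)) * indicator (cube \<rho>') x \<partial>\<mu>)"
    proof (intro nn_integral_mono mult_right_mono ennreal_leI)
      fix x
      have "f n (u x) powr m \<le> ((u x + \<delta>) powr \<beta>) powr m"
        by (rule powr_mono2[OF _ f0[OF u_nonneg] f_le[OF u_nonneg]]) (use m in simp)
      then show "f n (u x) powr m \<le> (u x + \<delta>) powr (m * \<beta>)" unfolding pp .
    qed simp
    then show "(\<integral>\<^sup>+ x. ennreal (f n (u x) powr m) * indicator (cube \<rho>') x \<partial>\<mu>) \<le> ennreal I" using I(1) by (rule order_trans)
  qed (use f f0 H H_le I(2) in simp_all)
  have fu_meas: "(\<lambda>x. f n (u x)) \<in> borel_measurable \<mu>" for n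
    by (rule continuous_comp_meas, rule continuous_at_imp_continuous_on) (use f in \<open>auto intro: DERIV_isCont\<close>)
  show ?thesis
  proof (rule nn_integral_le_limit[OF _ _ always_eventually[OF allI[OF step]] tendsto_const])
    fix n
    have [measurable]: "(\<lambda>x. f n (u x)) \<in> borel_measurable \<mu>" by (rule fu_meas)
    have [measurable]: "(indicator (cube \<rho>) :: real ^ 'n \<Rightarrow> ennreal) \<in> borel_measurable \<mu>"
      by (intro measurable_restrict_space1 borel_measurable_indicator) simp
    show "(\<lambda>x. ennreal (f n (u x) powr r) * indicator (cube \<rho>) x) \<in> borel_measurable \<mu>" by measurable
  next
    show "AE x in \<mu>. (\<lambda>n. ennreal (f n (u x) powr r) * indicator (cube \<rho>) x) \<longlonglongrightarrow> ennreal ((u x + \<delta>) powr (r * \<beta>)) * indicator (cube \<rho>) x"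
    proof (rule AE_I2)
      fix x
      obtain n0 :: nat where n0: "u x + \<delta> \<le> real n0" using real_arch_simple by blast
      have "eventually (\<lambda>n. ennreal ((u x + \<delta>) powr (r * \<beta>)) * indicator (cube \<rho>) x = ennreal (f n (u x) powr r) * indicator (cube \<rho>) x) sequentially"
      proof (rule eventually_sequentiallyI[of n0])
        fix n assume "n0 \<le> n"
        then have "u x + \<delta> \<le> real (Suc n)" using n0 by simp
        from f_eq[OF u_nonneg this] show "ennreal ((u x + \<delta>) powr (r * \<beta>)) * indicator (cube \<rho>) x = ennreal (f n (u x) powr r) * indicator (cube \<rho>) x"
          by (simp only: pp)
      qed
      from Lim_transform_eventually[OF tendsto_const this]
      show "(\<lambda>n. ennreal (f n (u x) powr r) * indicator (cube \<rho>) x) \<longlonglongrightarrow> ennreal ((u x + \<delta>) powr (r * \<beta>)) * indicator (cube \<rho>) x" .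
    qed
  qed
qed

lemma reverse_Holder_power:
  assumes \<rho>: "0 < \<rho>" "\<rho> < \<rho>'" "\<rho>' < 1" and \<delta>: "0 < \<delta>" and c0: "0 < c0" "c0 \<le> 1" "c0 \<le> \<bar>2 * \<beta> - 1\<bar>"
    and I: "(\<integral>\<^sup>+ x. ennreal ((u x + \<delta>) powr (m * \<beta>)) * indicator (cube \<rho>') x \<partial>\<mu>) \<le> ennreal I" "0 \<le> I"
  shows "(\<integral>\<^sup>+ x. ennreal ((u x + \<delta>) powr (r * \<beta>)) * indicator (cube \<rho>) x \<partial>\<mu>) \<le> ennreal (gain (\<bar>\<beta>\<bar> / c0) \<rho> \<rho>' powr r * I powr (r / m))"
  using power_step_small[OF \<rho> \<delta> c0(1,3) _ I] power_step_large[OF \<rho> \<delta> c0(1,2) _ I] by (cases "\<beta> \<le> 1") auto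

text \<open>For the logarithm, f' = 1 / (t + \<delta>), and the primitive of its square is -f'.
  Hence \<open>b\<close> is 1 and the right-hand side contains the weight but not the solution,
  which makes the bound independent of \<delta>.\<close>

lemma log_estimate:
  assumes \<delta>: "0 < \<delta>"
  defines "m0 \<equiv> (LINT x|\<mu>. ln (u x + \<delta>) * indicator (cube (1 / 2)) x) / (1 / 2) ^ CARD('n)"
  shows "(\<integral>\<^sup>+ x. ennreal (\<bar>ln (u x + \<delta>) - m0\<bar> powr r) * indicator (cube (1 / 2)) x \<partial>\<mu>)
    \<le> ennreal (poincare_const TYPE('n) r \<sigma> (1 / 2) * (128 * L\<^sup>2 * (A * B)) powr (r / 2))"
proof -
  obtain \<eta> :: "real ^ 'n \<Rightarrow> real" where \<eta>: "\<forall>k. Ck k UNIV \<eta>" "\<forall>x. 0 \<le> \<eta> x \<and> \<eta> x \<le> 1" "\<forall>x\<in>cube (1 / 2). \<eta> x = 1"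
    "\<forall>x. x \<notin> cube (3 / 4) \<longrightarrow> \<eta> x = 0" "\<forall>x. norm (grad \<eta> x) \<le> L / (3 / 4 - 1 / 2)"
    using L(2)[of "1 / 2" "3 / 4"] by auto
  have cont: "continuous_on {0..} (\<lambda>t. 1 / (t + \<delta>))" using \<delta> by (intro continuous_intros) auto
  have N_int: "(\<integral>\<^sup>+ x. ennreal (N x) \<partial>\<mu>) \<le> ennreal A"
  proof -
    have "(\<integral>\<^sup>+ x. ennreal (N x * 1) \<partial>\<mu>) \<le> ennreal ((A powr p) powr (1 / p) * 1 powr (1 / (p / (p - 1))))"
    proof (rule nn_integral_Holder_bound[OF N_meas])
      show "1 / p + 1 / (p / (p - 1)) = 1" using p by (simp add: field_simps)
      show "(\<integral>\<^sup>+ x. ennreal (1 powr (p / (p - 1))) \<partial>\<mu>) \<le> ennreal 1" by (simp add: emeasure_restrict_space emeasure_cube)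
    qed (use p A spectral_norm_nonneg in simp_all)
    then show ?thesis using p A by (simp add: powr_powr)
  qed
  have D: "(\<integral>\<^sup>+ x. ennreal ((1 / (u x + \<delta>))\<^sup>2 * E x) * indicator (cube (1 / 2)) x \<partial>\<mu>) \<le> ennreal (4 * (4 * L)\<^sup>2 * A)"
  proof (rule caccioppoli[where \<eta>=\<eta> and \<rho>'="3 / 4" and h="\<lambda>t. - (1 / (t + \<delta>))" and b="\<lambda>_. 1" and K="1 / \<delta>"])
    show "(\<integral>\<^sup>+ x. ennreal (1\<^sup>2 * N x) * indicator (cube (3 / 4)) x \<partial>\<mu>) \<le> ennreal A"
    proof (rule order_trans[OF _ N_int], rule nn_integral_mono)
      show "ennreal (1\<^sup>2 * N x) * indicator (cube (3 / 4)) x \<le> ennreal (N x)" for x by (simp add: indicator_def)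
    qed
    fix t :: real assume t: "0 \<le> t"
    show "((\<lambda>t. - (1 / (t + \<delta>))) has_real_derivative (1 / (t + \<delta>))\<^sup>2) (at t)"
      using t \<delta> by (auto intro!: derivative_eq_intros simp: power2_eq_square)
    show "\<bar>1 / (t + \<delta>)\<bar> \<le> 1 / \<delta>" using t \<delta> by (simp add: frac_le)
    show "\<bar>- (1 / (t + \<delta>))\<bar> \<le> 1 * \<bar>1 / (t + \<delta>)\<bar>" by simp
  qed (use \<eta> cont A in \<open>auto simp: mult.commute\<close>)
  have "(\<integral>\<^sup>+ x. ennreal (\<bar>ln (u x + \<delta>) - (LINT x|\<mu>. ln (u x + \<delta>) * indicator (cube (1 / 2)) x) / (1 / 2) ^ CARD('n)\<bar> powr r) * indicator (cube (1 / 2)) x \<partial>\<mu>)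
    \<le> ennreal (poincare_const TYPE('n) r \<sigma> (1 / 2) * (2 * B * (4 * (4 * L)\<^sup>2 * A)) powr (r / 2))"
  proof (rule poincare[where f'="\<lambda>t. 1 / (t + \<delta>)" and K="1 / \<delta>"])
    fix t :: real assume t: "0 \<le> t"
    show "((\<lambda>t. ln (t + \<delta>)) has_real_derivative 1 / (t + \<delta>)) (at t)"
      using t \<delta> by (auto intro!: derivative_eq_intros)
    show "\<bar>1 / (t + \<delta>)\<bar> \<le> 1 / \<delta>" using t \<delta> by (simp add: frac_le)
  qed (use cont D A in simp_all)
  \<comment> \<open>The radii 1/2 and 3/4 give a cutoff gradient of at most 4 L; the constant is 2
    times 4 times 16.\<close>
  moreover have eq: "2 * B * (4 * (4 * L)\<^sup>2 * A) = 128 * L\<^sup>2 * (A * B)" by (simp add: power_mult_distrib)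
  ultimately show ?thesis unfolding m0_def by (simp only:)
qed

end

subsection \<open>The Harnack inequality\<close>

text \<open>\<open>gain\<close> in the worst case, with radius 1/8 and the distance 1 - 1 / sqrt
  (r/m) from the degenerate exponent. The weights have disappeared: the logarithm is divided by the
  square root of \<open>A * B\<close>, which cancels this factor in \<open>gain\<close>.\<close>

definition moser_factor :: "'n::finite itself \<Rightarrow> real \<Rightarrow> real \<Rightarrow> real \<Rightarrow> real \<Rightarrow> real" where
  "moser_factor _ m r \<sigma> L =
    4 * (poincare_const TYPE('n) r \<sigma> (1 / 8) powr (1 / r) * (sqrt 8 * L / (m * (1 - 1 / sqrt (r / m)))) + 8 ^ CARD('n))"

text \<open>The L^1 bound of the scaled logarithm on the cube of side 1/2, raised to at least 1 as
  the crossover requires.\<close>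

definition log_bound :: "'n::finite itself \<Rightarrow> real \<Rightarrow> real \<Rightarrow> real \<Rightarrow> real" where
  "log_bound _ r \<sigma> L = max 1 (poincare_const TYPE('n) r \<sigma> (1 / 2) powr (1 / r) * (sqrt 128 * L))"

text \<open>The final level of the crossover between the cubes of sides 1/2 and 1/8. Its arguments
  do not include the norms of the coefficient field, the solution or \<delta>.\<close>

definition harnack_exponent :: "'n::finite itself \<Rightarrow> real \<Rightarrow> real \<Rightarrow> real \<Rightarrow> real \<Rightarrow> real" where
  "harnack_exponent _ m r \<sigma> L = crossover_bound m (r / m) (moser_factor TYPE('n) m r \<sigma> L) (log_bound TYPE('n) r \<sigma> L)
     ((1 / 2 - 1 / 8) / 2 * (1 - contraction_ratio m (r / m)))"

lemma poincare_const_mono: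
  assumes "0 < \<rho>" "\<rho> \<le> \<rho>'" "0 \<le> r"
  shows "poincare_const TYPE('n::finite) r \<sigma> \<rho>' \<le> poincare_const TYPE('n) r \<sigma> \<rho>"
  unfolding poincare_const_def
  using assms by (intro mult_right_mono mult_left_mono powr_mono2 divide_left_mono power_mono) auto

lemma geometric_scale_dense:
  fixes \<tau> \<gamma> :: real
  assumes "1 < \<gamma>" "0 < \<tau>" "0 < y"
  shows "\<exists>t\<in>range (\<lambda>j::int. \<tau> * \<gamma> powr real_of_int j). y \<le> t \<and> t \<le> \<gamma> * y"
proof -
  define z where "z = log \<gamma> (y / \<tau>)"
  have y: "y = \<tau> * \<gamma> powr z" using assms by (simp add: z_def)
  have "\<gamma> powr z \<le> \<gamma> powr real_of_int \<lceil>z\<rceil>" using assms by (intro powr_mono) auto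
  moreover have "\<gamma> powr real_of_int \<lceil>z\<rceil> \<le> \<gamma> powr (z + 1)" using assms by (intro powr_mono) linarith+
  moreover have "\<gamma> powr (z + 1) = \<gamma> * \<gamma> powr z" using assms by (simp add: powr_add)
  ultimately have "y \<le> \<tau> * \<gamma> powr real_of_int \<lceil>z\<rceil>" "\<tau> * \<gamma> powr real_of_int \<lceil>z\<rceil> \<le> \<gamma> * y"
    using assms(2) unfolding y by (simp_all add: mult.left_commute)
  then show ?thesis by blast
qed

text \<open>These numbers are the powers of \<gamma> with half-integer exponents. They sit half-way,
  on a logarithmic scale, between the integer powers, one of which is 1, so none comes closer to 1
  than \<gamma>^(-1/2).\<close>

lemma sqrt_scale_gap:
  fixes \<gamma> :: real and j :: int
  assumes "1 < \<gamma>"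
  shows "1 - 1 / sqrt \<gamma> \<le> \<bar>sqrt \<gamma> * \<gamma> powr real_of_int j - 1\<bar>"
proof -
  have s: "1 < sqrt \<gamma>" "sqrt \<gamma> * sqrt \<gamma> = \<gamma>" using assms by simp_all
  show ?thesis
  proof (cases "0 \<le> j")
    case True
    then have "1 \<le> \<gamma> powr real_of_int j" using assms by (simp add: ge_one_powr_ge_zero)
    then have "sqrt \<gamma> * 1 \<le> sqrt \<gamma> * \<gamma> powr real_of_int j" using s by (intro mult_left_mono) simp_all
    moreover have "1 - 1 / sqrt \<gamma> \<le> sqrt \<gamma> - 1"
    proof -
      have "0 \<le> (sqrt \<gamma> - 1) * (sqrt \<gamma> - 1)" by simp
      then have "2 * sqrt \<gamma> \<le> sqrt \<gamma> * sqrt \<gamma> + 1" by (simp add: algebra_simps)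
      then show ?thesis using s(1) by (simp add: field_simps)
    qed
    ultimately show ?thesis by linarith
  next
    case False
    then have "real_of_int j \<le> -1" by simp
    then have "\<gamma> powr real_of_int j \<le> \<gamma> powr (-1)" using assms by (intro powr_mono) simp_all
    also have "\<dots> = 1 / \<gamma>" using assms by (simp add: powr_minus_divide)
    finally have "sqrt \<gamma> * \<gamma> powr real_of_int j \<le> sqrt \<gamma> * (1 / \<gamma>)" using s by (intro mult_left_mono) simp_all
    also have "sqrt \<gamma> * (1 / \<gamma>) = 1 / sqrt \<gamma>" using s assms by (simp add: field_simps)
    finally show ?thesis by linarith
  qed
qed

context weighted_solution
begin

text \<open>The sign \<open>e\<close> selects the upper or the lower bound: positive powers of u +
  \<delta> for 1, negative ones for -1. Both are instances of the same crossover with the same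
  centre \<open>m0\<close>, which is what allows supremum and infimum to be compared
  afterwards.\<close>

lemma one_sided_log_bound:
  assumes \<delta>: "0 < \<delta>" and e: "e = 1 \<or> e = (-1::real)"
  defines "m0 \<equiv> (LINT x|\<mu>. ln (u x + \<delta>) * indicator (cube (1 / 2)) x) / (1 / 2) ^ CARD('n)"
  shows "AE x in \<mu>. x \<in> cube (1 / 8) \<longrightarrow> e * (ln (u x + \<delta>) - m0) \<le> sqrt (A * B) * harnack_exponent TYPE('n) m r \<sigma> L"
proof -
  \<comment> \<open>With this scale an exponent \<open>t\<close> for \<open>V\<close> is the
    exponent \<open>\<theta> * t\<close> for the solution, and the product of
    \<open>sqrt (A * B)\<close> and \<open>\<theta>\<close> in \<open>gain\<close> is 1.\<close>
  define \<theta> where "\<theta> = 1 / sqrt (A * B)"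
  have \<theta>: "0 < \<theta>" "sqrt (A * B) * \<theta> = 1" using A B by (simp_all add: \<theta>_def)
  define V where "V x = e * \<theta> * (ln (u x + \<delta>) - m0)" for x
  define \<gamma> where "\<gamma> = r / m"
  have \<gamma>: "1 < \<gamma>" "m * \<gamma> = r" using m by (simp_all add: \<gamma>_def)
  define c0 where "c0 = 1 - 1 / sqrt \<gamma>"
  have c0: "0 < c0" "c0 \<le> 1" using \<gamma>(1) by (simp_all add: c0_def)
  \<comment> \<open>With this scale, the numbers \<open>2 * \<beta>\<close> met in the iteration lie in \<open>sqrt \<gamma> * \<gamma> powr j\<close> up to sign
    and stay away from the value \<open>1\<close>, where the Caccioppoli inequality degenerates.\<close>
  define \<tau> where "\<tau> = m * sqrt \<gamma> / (2 * \<theta>)"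
  have \<tau>: "0 < \<tau>" using m \<gamma> \<theta> by (simp add: \<tau>_def)
  define T where "T = range (\<lambda>j::int. \<tau> * \<gamma> powr real_of_int j)"
  define K where "K = moser_factor TYPE('n) m r \<sigma> L"
  \<comment> \<open>The intersection makes these sets measurable for the restricted measure for
    every radius.\<close>
  define S where "S \<rho> = cube \<rho> \<inter> (cube 1 :: (real ^ 'n) set)" for \<rho> :: real
  have PC0: "0 \<le> poincare_const TYPE('n) r \<sigma> \<rho>" if "0 < \<rho>" for \<rho>
    using that by (simp add: poincare_const_def)
  have K1: "1 \<le> K"
  proof -
    have "(1::real) \<le> 8 ^ CARD('n)" by simp
    moreover have "0 \<le> poincare_const TYPE('n) r \<sigma> (1 / 8) powr (1 / r) * (sqrt 8 * L / (m * c0))"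
      using L m c0 by (intro mult_nonneg_nonneg divide_nonneg_nonneg) simp_all
    moreover have "1 \<le> 4 * (z + y)" if "1 \<le> y" "0 \<le> z" for y z :: real using that by simp
    ultimately show ?thesis unfolding K_def moser_factor_def c0_def[unfolded \<gamma>_def, symmetric] by blast
  qed
  have ln_cont: "continuous_on {0..} (\<lambda>t. ln (t + \<delta>))" using \<delta> by (intro continuous_intros) auto
  have V_meas: "V \<in> borel_measurable \<mu>"
    unfolding V_def by (intro borel_measurable_times borel_measurable_diff borel_measurable_const continuous_comp_meas[OF ln_cont])
  have ind: "indicator (S \<rho>) x = (indicator (cube \<rho>) x :: ennreal)" if "x \<in> space \<mu>" for \<rho> x
    using that by (simp add: S_def indicator_def)
  have exp_V: "exp (t * V x) = exp (- (e * \<theta> * t * m0)) * (u x + \<delta>) powr (e * \<theta> * t)" for t x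
  proof -
    have "0 < u x + \<delta>" using u_nonneg[of x] \<delta> by simp
    then show ?thesis by (simp add: V_def powr_def exp_add[symmetric] algebra_simps)
  qed
  have v_meas: "(\<lambda>x. ennreal ((u x + \<delta>) powr k)) \<in> borel_measurable \<mu>" for k
    by (intro measurable_compose[OF _ measurable_ennreal] powr_real_measurable borel_measurable_add u_meas borel_measurable_const)
  have ind_meas: "(indicator (cube \<rho>) :: real ^ 'n \<Rightarrow> ennreal) \<in> borel_measurable \<mu>" for \<rho>
    by (intro measurable_restrict_space1 borel_measurable_indicator) simp
  have exp_int: "(\<integral>\<^sup>+ x. ennreal (exp (t * V x)) * indicator (S \<rho>) x \<partial>\<mu>)
     = ennreal (exp (- (e * \<theta> * t * m0))) * (\<integral>\<^sup>+ x. ennreal ((u x + \<delta>) powr (e * \<theta> * t)) * indicator (cube \<rho>) x \<partial>\<mu>)" for t \<rho>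
  proof -
    have "(\<integral>\<^sup>+ x. ennreal (exp (t * V x)) * indicator (S \<rho>) x \<partial>\<mu>)
       = (\<integral>\<^sup>+ x. ennreal (exp (- (e * \<theta> * t * m0))) * (ennreal ((u x + \<delta>) powr (e * \<theta> * t)) * indicator (cube \<rho>) x) \<partial>\<mu>)"
      by (intro nn_integral_cong) (simp add: ind exp_V ennreal_mult mult.assoc)
    also have "\<dots> = ennreal (exp (- (e * \<theta> * t * m0))) * (\<integral>\<^sup>+ x. ennreal ((u x + \<delta>) powr (e * \<theta> * t)) * indicator (cube \<rho>) x \<partial>\<mu>)"
      by (rule nn_integral_cmult) (intro borel_measurable_times_ennreal v_meas ind_meas)
    finally show ?thesis .
  qed
  have gain_le: "gain (\<theta> * t / m / c0) \<rho> \<rho>' \<le> K * (1 + t) / (\<rho>' - \<rho>)"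
    if t: "0 < t" and \<rho>: "1 / 8 \<le> \<rho>" "\<rho> < \<rho>'" "\<rho>' \<le> 1 / 2" for t \<rho> \<rho>'
  proof -
    define d where "d = \<rho>' - \<rho>"
    have d: "0 < d" "d \<le> 1" using \<rho> by (simp_all add: d_def)
    define P where "P = poincare_const TYPE('n) r \<sigma> (1 / 8) powr (1 / r)"
    define Z where "Z = sqrt 8 * L / (m * c0)"
    have Z0: "0 \<le> Z" using L m c0 by (simp add: Z_def)
    have P1: "poincare_const TYPE('n) r \<sigma> \<rho> powr (1 / r) \<le> P"
      unfolding P_def using \<rho> r1 by (intro powr_mono2 poincare_const_mono PC0) simp_all
    have Zeq: "sqrt (8 * (A * B)) * (L / d) * (\<theta> * t / m / c0) = Z * t / d"
    proof -
      have "sqrt (8 * (A * B)) * (L / d) * (\<theta> * t / m / c0) = sqrt 8 * (sqrt (A * B) * \<theta>) * L * t / (d * m * c0)"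
        by (simp add: real_sqrt_mult mult_ac)
      then show ?thesis unfolding \<theta>(2) by (simp add: Z_def mult_ac)
    qed
    have Zt0: "0 \<le> Z * t / d" using Z0 t d by simp
    have 1: "poincare_const TYPE('n) r \<sigma> \<rho> powr (1 / r) * (sqrt (8 * (A * B)) * (L / d) * (\<theta> * t / m / c0)) \<le> P * (Z * t / d)"
      unfolding Zeq by (rule mult_right_mono[OF P1 Zt0])
    have "1 / \<rho> ^ CARD('n) \<le> 8 ^ CARD('n)"
    proof -
      have "(1 / \<rho>) ^ CARD('n) \<le> 8 ^ CARD('n)" using \<rho> by (intro power_mono) (simp_all add: field_simps)
      then show ?thesis by (simp add: power_one_over)
    qed
    also have "\<dots> \<le> 8 ^ CARD('n) / d" using d by (simp add: pos_le_divide_eq mult_left_le)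
    finally have 2: "1 / \<rho> ^ CARD('n) \<le> 8 ^ CARD('n) / d" .
    have "gain (\<theta> * t / m / c0) \<rho> \<rho>' \<le> 4 * (P * (Z * t / d) + 8 ^ CARD('n) / d)"
      unfolding gain_def d_def[symmetric] using 1 2 by (intro mult_left_mono add_mono) simp_all
    also have "\<dots> = 4 * (P * Z * t + 8 ^ CARD('n)) / d" by (simp add: add_divide_distrib)
    also have "\<dots> \<le> K * (1 + t) / d"
    proof (rule divide_right_mono)
      have K: "K = 4 * (P * Z + 8 ^ CARD('n))" unfolding K_def moser_factor_def P_def Z_def c0_def \<gamma>_def ..
      have "0 \<le> P * Z" "0 \<le> t * 8 ^ CARD('n)" using Z0 t by (simp_all add: P_def)
      then show "4 * (P * Z * t + 8 ^ CARD('n)) \<le> K * (1 + t)" unfolding K by (simp add: algebra_simps)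
    qed (use d in simp)
    finally show ?thesis by (simp add: d_def)
  qed
  \<comment> \<open>For negative powers the doubled exponent is negative and is at distance at least
    1 from 1; the choice of \<open>\<tau>\<close> matters for positive powers.\<close>
  have gap: "c0 \<le> \<bar>2 * (e * \<theta> * t / m) - 1\<bar>" if tT: "t \<in> T" for t
  proof -
    obtain j :: int where t: "t = \<tau> * \<gamma> powr real_of_int j" using tT by (auto simp: T_def)
    have eq: "2 * (\<theta> * t / m) = sqrt \<gamma> * \<gamma> powr real_of_int j" using m \<theta> by (simp add: t \<tau>_def)
    show ?thesis
    proof (cases "e = 1")
      case True
      have "c0 \<le> \<bar>sqrt \<gamma> * \<gamma> powr real_of_int j - 1\<bar>" unfolding c0_def by (rule sqrt_scale_gap[OF \<gamma>(1)])
      then show ?thesis using True eq by simp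
    next
      case False
      then have "2 * (e * \<theta> * t / m) = - (sqrt \<gamma> * \<gamma> powr real_of_int j)" using e eq by simp
      moreover have "0 \<le> sqrt \<gamma> * \<gamma> powr real_of_int j" using \<gamma> by simp
      ultimately show ?thesis using c0 by linarith
    qed
  qed
  interpret R: reverse_Holder_family \<mu> S V T \<gamma> m K "1 / 8" "1 / 2"
  proof
    show "V \<in> borel_measurable \<mu>" by (rule V_meas)
    show "S \<rho> \<in> sets \<mu>" for \<rho> unfolding S_def by (rule cube_\<mu>)
    show "S \<rho> \<subseteq> S \<rho>'" if "\<rho> \<le> \<rho>'" for \<rho> \<rho>' using cube_subset[OF that] by (auto simp: S_def)
    have "emeasure \<mu> (S (1 / 2)) \<le> emeasure \<mu> (space \<mu>)" by (rule emeasure_space)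
    also have "\<dots> = 1" by (simp add: emeasure_restrict_space emeasure_cube)
    finally show "emeasure \<mu> (S (1 / 2)) \<le> 1" .
    show "1 < \<gamma>" "0 < m" "1 \<le> K" using \<gamma> m K1 by simp_all
    show "0 < t" if "t \<in> T" for t using that \<tau> \<gamma> by (auto simp: T_def)
    show "\<gamma> * t \<in> T" if tT: "t \<in> T" for t
    proof -
      obtain j :: int where t: "t = \<tau> * \<gamma> powr real_of_int j" using tT by (auto simp: T_def)
      have "\<gamma> * t = \<tau> * \<gamma> powr real_of_int (j + 1)" using \<gamma> by (simp add: t powr_add)
      then show ?thesis unfolding T_def by blast
    qed
    show "\<exists>t\<in>T. y \<le> t \<and> t \<le> \<gamma> * y" if "0 < y" for y
      unfolding T_def by (rule geometric_scale_dense[OF \<gamma>(1) \<tau> that])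
    fix t \<rho> \<rho>' J
    assume tT: "t \<in> T" and \<rho>: "1 / 8 \<le> \<rho>" "\<rho> < \<rho>'" "\<rho>' \<le> 1 / 2" and J: "0 \<le> J"
      "(\<integral>\<^sup>+ x. ennreal (exp (t * V x)) * indicator (S \<rho>') x \<partial>\<mu>) \<le> ennreal J"
    have t0: "0 < t" using tT \<tau> \<gamma> by (auto simp: T_def)
    define \<beta> where "\<beta> = e * \<theta> * t / m"
    \<comment> \<open>The factor produced by the centring \<open>m0\<close>. The reverse Hoelder
      inequality is homogeneous, so it cancels at the end and the constants do not depend on
      \<open>m0\<close>.\<close>
    define k where "k = exp (e * \<theta> * t * m0)"
    have k0: "0 < k" "exp (- (e * \<theta> * t * m0)) = 1 / k" by (simp_all add: k_def exp_minus divide_inverse)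
    have m\<beta>: "m * \<beta> = e * \<theta> * t" using m by (simp add: \<beta>_def)
    have r\<beta>: "r * \<beta> = e * \<theta> * (\<gamma> * t)" unfolding \<gamma>(2)[symmetric] using m by (simp add: \<beta>_def)
    have I: "(\<integral>\<^sup>+ x. ennreal ((u x + \<delta>) powr (m * \<beta>)) * indicator (cube \<rho>') x \<partial>\<mu>) \<le> ennreal (k * J)"
    proof -
      have "ennreal k * (ennreal (1 / k) * (\<integral>\<^sup>+ x. ennreal ((u x + \<delta>) powr (m * \<beta>)) * indicator (cube \<rho>') x \<partial>\<mu>))
         \<le> ennreal k * ennreal J"
        using J(2) unfolding exp_int k0(2) m\<beta> by (rule mult_left_mono) simp
      then show ?thesis using k0(1) J(1) by (simp add: mult.assoc[symmetric] ennreal_mult[symmetric])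
    qed
    have \<beta>_abs: "\<bar>\<beta>\<bar> / c0 = \<theta> * t / m / c0" using e \<theta> t0 m by (auto simp: \<beta>_def abs_mult)
    have "(\<integral>\<^sup>+ x. ennreal ((u x + \<delta>) powr (r * \<beta>)) * indicator (cube \<rho>) x \<partial>\<mu>)
        \<le> ennreal (gain (\<bar>\<beta>\<bar> / c0) \<rho> \<rho>' powr r * (k * J) powr (r / m))"
    proof (rule reverse_Holder_power[OF _ \<rho>(2) _ \<delta> c0 _ I])
      show "c0 \<le> \<bar>2 * \<beta> - 1\<bar>" unfolding \<beta>_def by (rule gap[OF tT])
    qed (use \<rho> k0 J in simp_all)
    also have "\<dots> \<le> ennreal ((K * (1 + t) / (\<rho>' - \<rho>)) powr r * (k * J) powr \<gamma>)"
    proof (intro ennreal_leI)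
      have "0 \<le> gain (\<theta> * t / m / c0) \<rho> \<rho>'"
        unfolding gain_def using \<rho> t0 \<theta> m c0 L A B by (intro mult_nonneg_nonneg add_nonneg_nonneg divide_nonneg_nonneg) simp_all
      then have "gain (\<theta> * t / m / c0) \<rho> \<rho>' powr r \<le> (K * (1 + t) / (\<rho>' - \<rho>)) powr r"
        using gain_le[OF t0 \<rho>] r1 by (intro powr_mono2) simp_all
      then show "gain (\<bar>\<beta>\<bar> / c0) \<rho> \<rho>' powr r * (k * J) powr (r / m) \<le> (K * (1 + t) / (\<rho>' - \<rho>)) powr r * (k * J) powr \<gamma>"
        unfolding \<beta>_abs \<gamma>_def by (rule mult_right_mono) simp
    qed
    finally have le: "(\<integral>\<^sup>+ x. ennreal ((u x + \<delta>) powr (e * \<theta> * (\<gamma> * t))) * indicator (cube \<rho>) x \<partial>\<mu>)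
        \<le> ennreal ((K * (1 + t) / (\<rho>' - \<rho>)) powr r * (k * J) powr \<gamma>)" unfolding r\<beta> .
    have "(\<integral>\<^sup>+ x. ennreal (exp (\<gamma> * t * V x)) * indicator (S \<rho>) x \<partial>\<mu>)
       \<le> ennreal (exp (- (e * \<theta> * (\<gamma> * t) * m0))) * ennreal ((K * (1 + t) / (\<rho>' - \<rho>)) powr r * (k * J) powr \<gamma>)"
      unfolding exp_int by (rule mult_left_mono[OF le]) simp
    also have "\<dots> = ennreal (exp (- (e * \<theta> * (\<gamma> * t) * m0)) * ((K * (1 + t) / (\<rho>' - \<rho>)) powr r * (k * J) powr \<gamma>))"
      by (simp add: ennreal_mult)
    also have "exp (- (e * \<theta> * (\<gamma> * t) * m0)) * ((K * (1 + t) / (\<rho>' - \<rho>)) powr r * (k * J) powr \<gamma>)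
       = ((K * (1 + t) / (\<rho>' - \<rho>)) powr m * J) powr \<gamma>"
    proof -
      have k\<gamma>: "k powr \<gamma> * exp (- (e * \<theta> * (\<gamma> * t) * m0)) = 1"
        by (simp add: k_def powr_def exp_add[symmetric] algebra_simps)
      have "exp (- (e * \<theta> * (\<gamma> * t) * m0)) * ((K * (1 + t) / (\<rho>' - \<rho>)) powr r * (k * J) powr \<gamma>)
        = (k powr \<gamma> * exp (- (e * \<theta> * (\<gamma> * t) * m0))) * ((K * (1 + t) / (\<rho>' - \<rho>)) powr r * J powr \<gamma>)"
        by (simp only: powr_mult mult_ac)
      also have "\<dots> = ((K * (1 + t) / (\<rho>' - \<rho>)) powr m) powr \<gamma> * J powr \<gamma>" unfolding k\<gamma> powr_powr \<gamma>(2) by simp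
      finally show ?thesis by (simp only: powr_mult)
    qed
    finally show "(\<integral>\<^sup>+ x. ennreal (exp (\<gamma> * t * V x)) * indicator (S \<rho>) x \<partial>\<mu>)
       \<le> ennreal (((K * (1 + t) / (\<rho>' - \<rho>)) powr m * J) powr \<gamma>)" .
  qed simp_all
  define D0 where "D0 = poincare_const TYPE('n) r \<sigma> (1 / 2) powr (1 / r) * (sqrt 128 * L)"
  have D00: "0 \<le> D0" using L by (simp add: D0_def)
  have V_L1: "(\<integral>\<^sup>+ x. ennreal \<bar>V x\<bar> * indicator (cube (1 / 2)) x \<partial>\<mu>) \<le> ennreal D0"
  proof -
    define b where "b t = \<bar>ln (t + \<delta>) - m0\<bar>" for t
    have b_cont: "continuous_on {0..} b" unfolding b_def by (intro continuous_on_rabs continuous_on_diff ln_cont continuous_on_const)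
    have "(\<integral>\<^sup>+ x. ennreal (b (u x)) * indicator (cube (1 / 2)) x \<partial>\<mu>)
      \<le> ennreal ((poincare_const TYPE('n) r \<sigma> (1 / 2) * (128 * L\<^sup>2 * (A * B)) powr (r / 2)) powr (1 / r))"
    proof (rule mean_le(1)[OF b_cont])
      show "(\<integral>\<^sup>+ x. ennreal (b (u x) powr r) * indicator (cube (1 / 2)) x \<partial>\<mu>)
        \<le> ennreal (poincare_const TYPE('n) r \<sigma> (1 / 2) * (128 * L\<^sup>2 * (A * B)) powr (r / 2))"
        unfolding b_def m0_def by (rule log_estimate[OF \<delta>])
    qed (use r1 PC0[of "1 / 2"] in \<open>simp_all add: b_def\<close>)
    also have "(poincare_const TYPE('n) r \<sigma> (1 / 2) * (128 * L\<^sup>2 * (A * B)) powr (r / 2)) powr (1 / r)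
       = poincare_const TYPE('n) r \<sigma> (1 / 2) powr (1 / r) * (sqrt 128 * L * sqrt (A * B))"
    proof -
      have "((128 * L\<^sup>2 * (A * B)) powr (r / 2)) powr (1 / r) = (128 * L\<^sup>2 * (A * B)) powr (1 / 2)" using r1 by (simp add: powr_powr)
      also have "\<dots> = sqrt (128 * L\<^sup>2 * (A * B))" using A B by (intro powr_half_sqrt) simp
      also have "\<dots> = sqrt 128 * L * sqrt (A * B)" using L by (simp add: real_sqrt_mult)
      finally show ?thesis by (simp only: powr_mult)
    qed
    finally have le: "(\<integral>\<^sup>+ x. ennreal (b (u x)) * indicator (cube (1 / 2)) x \<partial>\<mu>) \<le> ennreal (D0 * sqrt (A * B))"
      by (simp add: D0_def mult_ac)
    have "(\<integral>\<^sup>+ x. ennreal \<bar>V x\<bar> * indicator (cube (1 / 2)) x \<partial>\<mu>) = (\<integral>\<^sup>+ x. ennreal \<theta> * (ennreal (b (u x)) * indicator (cube (1 / 2)) x) \<partial>\<mu>)"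
    proof (rule nn_integral_cong)
      fix x
      have "\<bar>V x\<bar> = \<theta> * b (u x)" using e \<theta> by (auto simp: V_def b_def abs_mult)
      then show "ennreal \<bar>V x\<bar> * indicator (cube (1 / 2)) x = ennreal \<theta> * (ennreal (b (u x)) * indicator (cube (1 / 2)) x)"
        using \<theta> by (simp add: ennreal_mult b_def mult.assoc)
    qed
    also have "\<dots> = ennreal \<theta> * (\<integral>\<^sup>+ x. ennreal (b (u x)) * indicator (cube (1 / 2)) x \<partial>\<mu>)"
      by (rule nn_integral_cmult)
        (intro borel_measurable_times_ennreal ind_meas measurable_compose[OF continuous_comp_meas[OF b_cont] measurable_ennreal])
    also have "\<dots> \<le> ennreal \<theta> * ennreal (D0 * sqrt (A * B))" by (rule mult_left_mono[OF le zero_le])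
    also have "\<dots> = ennreal (D0 * (sqrt (A * B) * \<theta>))" using \<theta> D00 A B by (simp add: ennreal_mult[symmetric] mult_ac)
    finally show ?thesis unfolding \<theta>(2) by simp
  qed
  define D where "D = log_bound TYPE('n) r \<sigma> L"
  have D_eq: "D = max 1 D0" by (simp add: D_def log_bound_def D0_def)
  \<comment> \<open>Chebyshev turns the L^1 bound into the weak bound that the crossover
    uses.\<close>
  have tail: "emeasure \<mu> {x \<in> S (1 / 2). s < V x} \<le> ennreal (D / s)" if s: "0 < s" for s
  proof -
    define X where "X = {x \<in> S (1 / 2). s < V x}"
    have X_eq: "X = {x \<in> space \<mu>. x \<in> S (1 / 2) \<and> s < V x}" by (auto simp: X_def S_def)
    have X_sets: "X \<in> sets \<mu>"
      unfolding X_eq using V_meas R.S_meas[of "1 / 2"] by measurable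
    have "ennreal s * emeasure \<mu> X = (\<integral>\<^sup>+ x. ennreal s * indicator X x \<partial>\<mu>)" using X_sets by (simp add: nn_integral_cmult)
    also have "\<dots> \<le> (\<integral>\<^sup>+ x. ennreal \<bar>V x\<bar> * indicator (cube (1 / 2)) x \<partial>\<mu>)"
      by (intro nn_integral_mono) (auto simp: X_def S_def indicator_def intro!: ennreal_leI)
    also have "\<dots> \<le> ennreal D0" by (rule V_L1)
    also have "\<dots> \<le> ennreal D" by (rule ennreal_leI) (simp add: D_eq)
    finally have "ennreal (1 / s) * (ennreal s * emeasure \<mu> X) \<le> ennreal (1 / s) * ennreal D" by (rule mult_left_mono) simp
    then show ?thesis using s D_eq by (simp add: mult.assoc[symmetric] ennreal_mult[symmetric] X_def)
  qed
  \<comment> \<open>The qualitative start needs one integrable power. Only u in L^2 is known, so the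
    exponent for the solution is kept at or below 1; negative powers are bounded thanks to
    \<delta>.\<close>
  obtain t where t: "t \<in> T" "t \<le> 1" "\<theta> * t \<le> 1"
  proof -
    define y where "y = min 1 (1 / \<theta>) / \<gamma>"
    have y: "0 < y" using \<theta> \<gamma> by (simp add: y_def)
    obtain t where t: "t \<in> T" "t \<le> \<gamma> * y" using R.T_dense[OF y] by blast
    have "\<gamma> * y = min 1 (1 / \<theta>)" using \<gamma> by (simp add: y_def)
    then have "t \<le> 1" "t \<le> 1 / \<theta>" using t(2) by simp_all
    then have "\<theta> * t \<le> 1" using \<theta> by (simp add: field_simps)
    then show thesis using t \<open>t \<le> 1\<close> by (intro that[of t])
  qed
  have t0: "0 < t" by (rule R.T_pos[OF t(1)])
  have fin: "(\<integral>\<^sup>+ x. ennreal (exp (t * V x)) * indicator (S (1 / 2)) x \<partial>\<mu>) < \<infinity>"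
  proof -
    have bound: "(u x + \<delta>) powr (e * \<theta> * t) \<le> (1 + \<delta> powr (- (\<theta> * t)) + \<delta>) + u x" for x
    proof (cases "e = 1")
      case True
      have "(u x + \<delta>) powr (\<theta> * t) \<le> (1 + u x + \<delta>) powr (\<theta> * t)" using u_nonneg[of x] \<delta> \<theta> t0 by (intro powr_mono2) simp_all
      also have "\<dots> \<le> (1 + u x + \<delta>) powr 1" using u_nonneg[of x] \<delta> t(3) by (intro powr_mono) simp_all
      also have "\<dots> = 1 + u x + \<delta>" using u_nonneg[of x] \<delta> by simp
      also have "\<dots> \<le> (1 + \<delta> powr (- (\<theta> * t)) + \<delta>) + u x" by simp
      finally show ?thesis using True by simp
    next
      case False
      then have "(u x + \<delta>) powr (e * \<theta> * t) = (u x + \<delta>) powr (- (\<theta> * t))" using e by simp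
      also have "\<dots> \<le> \<delta> powr (- (\<theta> * t))" using u_nonneg[of x] \<delta> \<theta> t0 by (intro powr_mono2') simp_all
      also have "\<dots> \<le> (1 + \<delta> powr (- (\<theta> * t)) + \<delta>) + u x" using u_nonneg[of x] \<delta> by simp
      finally show ?thesis .
    qed
    have u_int: "integrable \<mu> (\<lambda>x. (1 + \<delta> powr (- (\<theta> * t)) + \<delta>) + u x)"
      by (rule lipschitz_integrable[of "\<lambda>t'. (1 + \<delta> powr (- (\<theta> * t)) + \<delta>) + t'" "1 + \<delta> powr (- (\<theta> * t)) + \<delta>" 1])
        (use \<delta> in \<open>auto intro!: continuous_intros simp: abs_of_nonneg\<close>)
    have "(\<integral>\<^sup>+ x. ennreal ((u x + \<delta>) powr (e * \<theta> * t)) * indicator (cube (1 / 2)) x \<partial>\<mu>)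
      \<le> (\<integral>\<^sup>+ x. ennreal ((1 + \<delta> powr (- (\<theta> * t)) + \<delta>) + u x) \<partial>\<mu>)"
      by (intro nn_integral_mono) (auto simp: indicator_def intro!: ennreal_leI bound)
    also have "\<dots> = ennreal (LINT x|\<mu>. (1 + \<delta> powr (- (\<theta> * t)) + \<delta>) + u x)"
      by (rule nn_integral_eq_integral[OF u_int], rule AE_I2) (use \<delta> u_nonneg in \<open>auto intro!: add_nonneg_nonneg\<close>)
    also have "\<dots> < \<infinity>" by simp
    finally show ?thesis unfolding exp_int by (simp add: ennreal_mult_less_top)
  qed
  have "AE x in \<mu>. x \<in> S (1 / 8) \<longrightarrow> V x \<le> crossover_bound m \<gamma> K D ((1 / 2 - 1 / 8) / 2 * (1 - contraction_ratio m \<gamma>))"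
    by (rule R.bombieri_giusti[OF _ tail t(1,2) fin]) (simp add: D_eq)
  then have ae: "AE x in \<mu>. x \<in> S (1 / 8) \<longrightarrow> V x \<le> harnack_exponent TYPE('n) m r \<sigma> L"
    by (simp add: harnack_exponent_def \<gamma>_def K_def D_def)
  show ?thesis
  proof (rule eventually_mono[OF ae], rule impI)
    fix x assume H: "x \<in> S (1 / 8) \<longrightarrow> V x \<le> harnack_exponent TYPE('n) m r \<sigma> L" and x: "x \<in> cube (1 / 8)"
    have "x \<in> S (1 / 8)" using subsetD[OF cube_subset[of "1 / 8" 1] x] x by (simp add: S_def)
    then have "V x \<le> harnack_exponent TYPE('n) m r \<sigma> L" using H by blast
    then have "sqrt (A * B) * V x \<le> sqrt (A * B) * harnack_exponent TYPE('n) m r \<sigma> L" using A B by (intro mult_left_mono) simp_all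
    moreover have "sqrt (A * B) * V x = (sqrt (A * B) * \<theta>) * (e * (ln (u x + \<delta>) - m0))" by (simp add: V_def mult_ac)
    ultimately show "e * (ln (u x + \<delta>) - m0) \<le> sqrt (A * B) * harnack_exponent TYPE('n) m r \<sigma> L" unfolding \<theta>(2) by simp
  qed
qed

end

section \<open>From the hypotheses of the theorem to finite exponents and a normalised
  solution\<close>

lemma Lp_norm_bound:
  assumes [measurable]: "f \<in> borel_measurable M" and M: "emeasure M (space M) \<le> 1"
    and P: "0 < P" "p = ennreal P \<or> p = \<infinity>" and fin: "Lp_norm p M f < \<infinity>"
  shows "(\<integral>\<^sup>+ x. ennreal (\<bar>f x\<bar> powr P) \<partial>M) \<le> ennreal (enn2real (Lp_norm p M f) powr P)"
proof (cases "p = \<infinity>")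
  case True
  define S where "S = enn2real (Lp_norm p M f)"
  have S: "ennreal S = esssup M (\<lambda>x. ennreal \<bar>f x\<bar>)"
    using fin True by (simp add: S_def Lp_norm_def)
  \<comment> \<open>On a space of measure at most 1, an essential bound controls the L^P norm for
    every finite exponent.\<close>
  have "AE x in M. ennreal \<bar>f x\<bar> \<le> ennreal S" unfolding S by (rule esssup_AE)
  then have "(\<integral>\<^sup>+ x. ennreal (\<bar>f x\<bar> powr P) \<partial>M) \<le> (\<integral>\<^sup>+ x. ennreal (S powr P) \<partial>M)"
  proof (intro nn_integral_mono_AE, elim eventually_mono)
    fix x assume "ennreal \<bar>f x\<bar> \<le> ennreal S"
    then have "\<bar>f x\<bar> \<le> S" by (simp add: S_def)
    then show "ennreal (\<bar>f x\<bar> powr P) \<le> ennreal (S powr P)" using P by (intro ennreal_leI powr_mono2) auto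
  qed
  also have "\<dots> = ennreal (S powr P) * emeasure M (space M)" by simp
  also have "\<dots> \<le> ennreal (S powr P) * 1" by (rule mult_left_mono[OF M]) simp
  finally show ?thesis by (simp add: S_def)
next
  case False
  then have p: "p = ennreal P" "enn2real p = P" using P by auto
  define I where "I = (\<integral>\<^sup>+ x. ennreal (\<bar>f x\<bar> powr P) \<partial>M)"
  have N: "Lp_norm p M f = (if I = \<infinity> then \<infinity> else ennreal (enn2real I powr (1 / P)))"
    using False by (simp only: Lp_norm_def if_False p(2) Let_def I_def)
  have "I \<noteq> \<infinity>" using fin N by (auto split: if_splits)
  then have "ennreal (enn2real (Lp_norm p M f) powr P) = I"
    using P by (simp add: N powr_powr less_top)
  then show ?thesis by (simp add: I_def)
qed

lemma spectral_norm_product_ge_1: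
  fixes A :: "real ^ 'n ^ 'n"
  assumes "transpose A = A" "\<And>v. 0 \<le> v \<bullet> (A *v v)" "invertible A"
  shows "1 \<le> spectral_norm (matrix_inv A) * spectral_norm A"
proof -
  define v :: "real ^ 'n" where "v = axis undefined 1"
  have v: "norm v = 1" by (simp add: v_def)
  have "(norm v)\<^sup>2 \<le> spectral_norm (matrix_inv A) * (v \<bullet> (A *v v))" by (rule quadratic_form_inverse_ge[OF assms])
  also have "\<dots> \<le> spectral_norm (matrix_inv A) * (spectral_norm A * (norm v)\<^sup>2)"
    by (intro mult_left_mono quadratic_form_le spectral_norm_nonneg)
  finally show ?thesis by (simp add: v)
qed

text \<open>Almost everywhere the norms of a matrix and of its inverse have product at least 1, so
  neither field can vanish almost everywhere. Positivity is what permits division by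
  \<open>sqrt (A * B)\<close>.\<close>

lemma (in degenerate_solution) norms_pos:
  assumes inv: "AE x in \<mu>. invertible (a x)" and M: "(\<lambda>x. matrix_inv (a x)) \<in> borel_measurable \<mu>"
    and A: "(\<integral>\<^sup>+ x. ennreal (N x powr p) \<partial>\<mu>) \<le> ennreal (A powr p)" "0 \<le> A"
    and B: "(\<integral>\<^sup>+ x. ennreal (spectral_norm (matrix_inv (a x)) powr q) \<partial>\<mu>) \<le> ennreal (B powr q)" "0 \<le> B"
  shows "0 < A" "0 < B"
proof -
  have ge: "AE x in \<mu>. 1 \<le> spectral_norm (matrix_inv (a x)) * N x"
  proof (rule AE_mp[OF inv], rule AE_I2, rule impI)
    fix x assume "x \<in> space \<mu>" "invertible (a x)"
    then show "1 \<le> spectral_norm (matrix_inv (a x)) * N x"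
      using a_sym[of x] a_psd[of x] by (intro spectral_norm_product_ge_1) simp_all
  qed
  have space1: "emeasure \<mu> (space \<mu>) = 1" by (simp add: emeasure_restrict_space emeasure_cube)
  have no: False if "AE x in \<mu>. N x = 0 \<or> spectral_norm (matrix_inv (a x)) = 0"
  proof -
    have "AE x in \<mu>. False" using ge that by eventually_elim auto
    then have "emeasure \<mu> (space \<mu>) = 0" by (simp add: AE_iff_measurable[of "space \<mu>"])
    then show False using space1 by simp
  qed
  show "0 < A"
  proof (rule ccontr)
    assume "\<not> 0 < A"
    then have "(\<integral>\<^sup>+ x. ennreal (N x powr p) \<partial>\<mu>) = 0" using A by simp
    moreover have "(\<lambda>x. ennreal (N x powr p)) \<in> borel_measurable \<mu>"
      by (intro measurable_compose[OF _ measurable_ennreal] powr_real_measurable N_meas borel_measurable_const)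
    ultimately have "AE x in \<mu>. ennreal (N x powr p) = 0" by (simp add: nn_integral_0_iff_AE)
    then have "AE x in \<mu>. N x = 0 \<or> spectral_norm (matrix_inv (a x)) = 0"
      by (rule eventually_mono) (simp add: ennreal_eq_0_iff)
    then show False by (rule no)
  qed
  show "0 < B"
  proof (rule ccontr)
    assume "\<not> 0 < B"
    then have "(\<integral>\<^sup>+ x. ennreal (spectral_norm (matrix_inv (a x)) powr q) \<partial>\<mu>) = 0" using B by simp
    moreover have "(\<lambda>x. ennreal (spectral_norm (matrix_inv (a x)) powr q)) \<in> borel_measurable \<mu>"
      by (intro measurable_compose[OF _ measurable_ennreal] powr_real_measurable borel_measurable_spectral_norm M borel_measurable_const)
    ultimately have "AE x in \<mu>. ennreal (spectral_norm (matrix_inv (a x)) powr q) = 0" by (simp add: nn_integral_0_iff_AE)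
    then have "AE x in \<mu>. N x = 0 \<or> spectral_norm (matrix_inv (a x)) = 0"
      by (rule eventually_mono) (simp add: ennreal_eq_0_iff)
    then show False by (rule no)
  qed
qed

text \<open>The logarithm deviates from the same number \<open>m0\<close> by at most H in both
  directions, hence the factor 2 H. The function u' is the given one, equal to u almost everywhere;
  since u' enters without shift, \<delta> has to be removed.\<close>

lemma (in weighted_solution) harnack:
  assumes u': "AE x in cube_measure 1. u x = u' x" "u' \<in> borel_measurable (cube_measure 1)"
  shows "esssup (cube_measure (1 / 8)) (\<lambda>x. ereal (u' x))
    \<le> ereal (exp (2 * (sqrt (A * B) * harnack_exponent TYPE('n) m r \<sigma> L))) * essinf (cube_measure (1 / 8)) (\<lambda>x. ereal (u' x))"
proof -
  define H where "H = sqrt (A * B) * harnack_exponent TYPE('n) m r \<sigma> L"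
  define M where "M = (cube_measure (1 / 8) :: (real ^ 'n) measure)"
  define i where "i = essinf M (\<lambda>x. ereal (u' x))"
  have sub: "(cube (1 / 8) :: (real ^ 'n) set) \<subseteq> cube 1" by (rule cube_subset) simp
  have u'_meas: "u' \<in> borel_measurable M"
    unfolding M_def by (rule measurable_restrict_mono[OF u'(2) sub])
  \<comment> \<open>The witness is \<open>exp (m0 - H)\<close>. It depends on \<delta> through
    \<open>m0\<close>, so it is eliminated between the two bounds before \<delta> tends to
    0.\<close>
  have bounds: "\<exists>c. esssup M (\<lambda>x. ereal (u' x)) \<le> ereal (exp (2 * H) * c - \<delta>) \<and> ereal (c - \<delta>) \<le> i" if \<delta>: "0 < \<delta>" for \<delta>
  proof -
    define m0 where "m0 = (LINT x|\<mu>. ln (u x + \<delta>) * indicator (cube (1 / 2)) x) / (1 / 2) ^ CARD('n)"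
    have "AE x in \<mu>. x \<in> cube (1 / 8) \<longrightarrow> 1 * (ln (u x + \<delta>) - m0) \<le> H"
      unfolding H_def m0_def by (rule one_sided_log_bound[OF \<delta>]) simp
    moreover have "AE x in \<mu>. x \<in> cube (1 / 8) \<longrightarrow> (-1) * (ln (u x + \<delta>) - m0) \<le> H"
      unfolding H_def m0_def by (rule one_sided_log_bound[OF \<delta>]) simp
    ultimately have "AE x in \<mu>. x \<in> cube (1 / 8) \<longrightarrow> exp (m0 - H) - \<delta> \<le> u' x \<and> u' x \<le> exp (m0 + H) - \<delta>"
      using u'(1)
    proof eventually_elim
      case (elim x)
      have eq: "exp (ln (u x + \<delta>)) = u x + \<delta>" using u_nonneg[of x] \<delta> by simp
      show ?case
      proof
        assume x: "x \<in> cube (1 / 8)"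
        have "exp (m0 - H) \<le> exp (ln (u x + \<delta>))" "exp (ln (u x + \<delta>)) \<le> exp (m0 + H)"
        proof -
          have "1 * (ln (u x + \<delta>) - m0) \<le> H" "(-1) * (ln (u x + \<delta>) - m0) \<le> H" using elim x by blast+
          then show "exp (m0 - H) \<le> exp (ln (u x + \<delta>))" "exp (ln (u x + \<delta>)) \<le> exp (m0 + H)"
            unfolding exp_le_cancel_iff by simp_all
        qed
        then have "exp (m0 - H) \<le> u' x + \<delta>" "u' x + \<delta> \<le> exp (m0 + H)"
          unfolding eq using elim(3) by simp_all
        then show "exp (m0 - H) - \<delta> \<le> u' x \<and> u' x \<le> exp (m0 + H) - \<delta>" by linarith
      qed
    qed
    then have "AE x in lebesgue. x \<in> cube 1 \<longrightarrow> x \<in> cube (1 / 8) \<longrightarrow> exp (m0 - H) - \<delta> \<le> u' x \<and> u' x \<le> exp (m0 + H) - \<delta>"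
      by (subst (asm) AE_restrict_space_iff) simp_all
    then have ae: "AE x in M. exp (m0 - H) - \<delta> \<le> u' x \<and> u' x \<le> exp (m0 + H) - \<delta>"
      unfolding M_def using sub by (subst AE_restrict_space_iff) (auto elim!: eventually_mono)
    have "esssup M (\<lambda>x. ereal (u' x)) \<le> ereal (exp (m0 + H) - \<delta>)"
      by (rule esssup_I) (use u'_meas ae in \<open>auto elim!: eventually_mono\<close>)
    moreover have "esssup M (\<lambda>x. - ereal (u' x)) \<le> - ereal (exp (m0 - H) - \<delta>)"
      by (rule esssup_I) (use u'_meas ae in \<open>auto elim!: eventually_mono\<close>)
    then have "- (- ereal (exp (m0 - H) - \<delta>)) \<le> i" unfolding i_def essinf_def by (simp only: ereal_minus_le_minus)
    then have "ereal (exp (m0 - H) - \<delta>) \<le> i" by (simp only: ereal_uminus_uminus)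
    moreover have "exp (m0 + H) = exp (2 * H) * exp (m0 - H)" by (simp add: exp_add[symmetric])
    ultimately show ?thesis by auto
  qed
  have "esssup M (\<lambda>x. ereal (u' x)) \<le> ereal (exp (2 * H)) * i"
  proof (cases i)
    case (real i')
    have "esssup M (\<lambda>x. ereal (u' x)) \<le> ereal (exp (2 * H) * i')"
    proof (rule ereal_le_epsilon2)
      fix \<epsilon> :: real assume \<epsilon>: "0 < \<epsilon>"
      \<comment> \<open>The shift in the infimum is multiplied by \<open>exp (2 * H)\<close>, which
        this choice turns into \<open>\<epsilon>\<close>.\<close>
      define \<delta> where "\<delta> = \<epsilon> / exp (2 * H)"
      have \<delta>: "0 < \<delta>" using \<epsilon> by (simp add: \<delta>_def)
      obtain c where c: "esssup M (\<lambda>x. ereal (u' x)) \<le> ereal (exp (2 * H) * c - \<delta>)" "ereal (c - \<delta>) \<le> i" using bounds[OF \<delta>] by blast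
      have "exp (2 * H) * c \<le> exp (2 * H) * (i' + \<delta>)" using c(2) real by (intro mult_left_mono) simp_all
      also have "\<dots> = exp (2 * H) * i' + \<epsilon>" by (simp add: \<delta>_def distrib_left)
      finally have "exp (2 * H) * c - \<delta> \<le> exp (2 * H) * i' + \<epsilon>" using \<delta> by simp
      then have "ereal (exp (2 * H) * c - \<delta>) \<le> ereal (exp (2 * H) * i' + \<epsilon>)" by simp
      with c(1) have "esssup M (\<lambda>x. ereal (u' x)) \<le> ereal (exp (2 * H) * i' + \<epsilon>)" by (rule order_trans)
      then show "esssup M (\<lambda>x. ereal (u' x)) \<le> ereal (exp (2 * H) * i') + ereal \<epsilon>" by simp
    qed
    then show ?thesis using real by simp
  next
    case PInf
    then show ?thesis by simp
  next
    case MInf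
    then show ?thesis using bounds[of 1] by auto
  qed
  then show ?thesis by (simp add: H_def i_def M_def)
qed

text \<open>The strict inequality between the exponents leaves the slack \<open>g\<close>, enough to
  trade an infinite exponent for a finite one. In \<open>ennreal\<close> the reciprocal of infinity
  is 0, and 2 + 1/g exceeds both 1 and 1/g.\<close>

lemma finite_exponent:
  fixes p :: ennreal and g :: real
  assumes "1 \<le> p" "1 / p < 1" "0 < g"
  obtains P where "1 < P" "p = ennreal P \<or> p = \<infinity>" "1 / P \<le> enn2real (1 / p) + g"
proof (cases "p = \<infinity>")
  case True
  show ?thesis
  proof (rule that[of "2 + 1 / g"])
    have "1 / (2 + 1 / g) \<le> 1 / (1 / g)" using assms(3) by (intro divide_left_mono) (simp_all add: add_pos_pos)
    then show "1 / (2 + 1 / g) \<le> enn2real (1 / p) + g" by (simp add: add_increasing)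
    have "0 < 1 / g" using assms(3) by simp
    then show "1 < 2 + 1 / g" by linarith
  qed (use True in simp)
next
  case False
  then obtain P where P: "p = ennreal P" "0 \<le> P" by (cases p) auto
  have "1 \<le> P" using assms(1) P by (simp add: one_ennreal_def[symmetric] ennreal_1[symmetric] del: ennreal_1)
  then have inv: "1 / p = ennreal (1 / P)" using P by (simp add: divide_ennreal[symmetric] del: ennreal_1 flip: ennreal_1)
  have "1 < P"
  proof (rule ccontr)
    assume "\<not> 1 < P"
    then have "P = 1" using \<open>1 \<le> P\<close> by simp
    then show False using assms(2) inv by simp
  qed
  then show ?thesis using that[of P] P inv assms(3) by simp
qed

text \<open>Convergence in L^2 gives pointwise convergence along a subsequence, which inherits the
  two integral limits.\<close>

lemma H1a_approximation:
  fixes a :: "real ^ 'n \<Rightarrow> real ^ 'n ^ 'n"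
  assumes H: "in_H1a a u G"
  obtains \<phi> where "\<And>k. smooth_closure (cube 1) (\<phi> k)" "AE x in cube_measure 1. (\<lambda>k. \<phi> k x) \<longlonglongrightarrow> u x"
    "(\<lambda>k. \<integral>\<^sup>+ x. ennreal ((\<phi> k x - u x)\<^sup>2) \<partial>cube_measure 1) \<longlonglongrightarrow> 0"
    "(\<lambda>k. \<integral>\<^sup>+ x. ennreal ((grad (\<phi> k) x - G x) \<bullet> (a x *v (grad (\<phi> k) x - G x))) \<partial>cube_measure 1) \<longlonglongrightarrow> 0"
proof -
  obtain \<phi> :: "nat \<Rightarrow> real ^ 'n \<Rightarrow> real" where \<phi>: "\<And>k. smooth_closure (cube 1) (\<phi> k)"
    "(\<lambda>k. H1a_norm_sq a (\<lambda>x. \<phi> k x - u x) (\<lambda>x. grad (\<phi> k) x - G x)) \<longlonglongrightarrow> 0"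
    using H unfolding in_H1a_def by blast
  have u: "u \<in> borel_measurable (cube_measure 1)" using H unfolding in_H1a_def by blast
  have L2: "(\<lambda>k. \<integral>\<^sup>+ x. ennreal ((\<phi> k x - u x)\<^sup>2) \<partial>cube_measure 1) \<longlonglongrightarrow> 0"
    by (rule tendsto_sandwich[OF _ _ tendsto_const \<phi>(2)]) (simp_all add: H1a_norm_sq_def)
  have En: "(\<lambda>k. \<integral>\<^sup>+ x. ennreal ((grad (\<phi> k) x - G x) \<bullet> (a x *v (grad (\<phi> k) x - G x))) \<partial>cube_measure 1) \<longlonglongrightarrow> 0"
    by (rule tendsto_sandwich[OF _ _ tendsto_const \<phi>(2)]) (simp_all add: H1a_norm_sq_def)
  have "eventually (\<lambda>k. (\<integral>\<^sup>+ x. ennreal ((\<phi> k x - u x)\<^sup>2) \<partial>cube_measure 1) < 1) sequentially"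
    using order_tendstoD(2)[OF L2, of 1] by simp
  then obtain k0 where k0: "\<And>k. k0 \<le> k \<Longrightarrow> (\<integral>\<^sup>+ x. ennreal ((\<phi> k x - u x)\<^sup>2) \<partial>cube_measure 1) < 1"
    by (auto simp: eventually_sequentially)
  \<comment> \<open>The shift by \<open>k0\<close> discards the approximants whose distance to u may
    be infinite.\<close>
  define w where "w k x = (\<phi> (k + k0) x - u x)\<^sup>2" for k x
  have \<phi>_meas: "\<phi> k \<in> borel_measurable (cube_measure 1)" for k
  proof (rule continuous_imp_measurable_on_sets_lebesgue)
    show "continuous_on (cube 1) (\<phi> k)"
      using continuous_on_grad(2)[OF \<phi>(1) open_cube]
      by (intro continuous_at_imp_continuous_on) (auto intro: differentiable_imp_continuous_within)
  qed simp
  have w_meas: "w k \<in> borel_measurable (cube_measure 1)" for k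
    unfolding w_def by (intro borel_measurable_power borel_measurable_diff \<phi>_meas u)
  have w_int: "integrable (cube_measure 1) (w k)" for k
  proof (rule integrableI_nonneg[OF w_meas])
    have "(\<integral>\<^sup>+ x. ennreal (w k x) \<partial>cube_measure 1) < 1" unfolding w_def by (rule k0) simp
    then show "(\<integral>\<^sup>+ x. ennreal (w k x) \<partial>cube_measure 1) < \<infinity>" by (rule less_trans) simp
  qed (simp add: w_def)
  have "(\<lambda>k. LINT x|cube_measure 1. norm (w k x)) \<longlonglongrightarrow> 0"
  proof -
    have "(LINT x|cube_measure 1. norm (w k x)) = enn2real (\<integral>\<^sup>+ x. ennreal ((\<phi> (k + k0) x - u x)\<^sup>2) \<partial>cube_measure 1)" for k
      using w_meas[of k] by (subst integral_eq_nn_integral) (simp_all add: w_def[abs_def])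
    moreover have "(\<lambda>k. enn2real (\<integral>\<^sup>+ x. ennreal ((\<phi> (k + k0) x - u x)\<^sup>2) \<partial>cube_measure 1)) \<longlonglongrightarrow> 0"
      by (rule tendsto_enn2real) (use LIMSEQ_ignore_initial_segment[OF L2, of k0] in simp_all)
    ultimately show ?thesis by simp
  qed
  from tendsto_L1_AE_subseq[OF w_int this] obtain r where r: "strict_mono r" "AE x in cube_measure 1. (\<lambda>k. w (r k) x) \<longlonglongrightarrow> 0" by blast
  define s where "s k = r k + k0" for k
  have s: "strict_mono s" using r(1) by (simp add: s_def strict_mono_def)
  show ?thesis
  proof (rule that[of "\<lambda>k. \<phi> (s k)"])
    show "smooth_closure (cube 1) (\<phi> (s k))" for k by (rule \<phi>(1))
    show "(\<lambda>k. \<integral>\<^sup>+ x. ennreal ((\<phi> (s k) x - u x)\<^sup>2) \<partial>cube_measure 1) \<longlonglongrightarrow> 0"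
      using LIMSEQ_subseq_LIMSEQ[OF L2 s] by (simp add: o_def)
    show "(\<lambda>k. \<integral>\<^sup>+ x. ennreal ((grad (\<phi> (s k)) x - G x) \<bullet> (a x *v (grad (\<phi> (s k)) x - G x))) \<partial>cube_measure 1) \<longlonglongrightarrow> 0"
      using LIMSEQ_subseq_LIMSEQ[OF En s] by (simp add: o_def)
    show "AE x in cube_measure 1. (\<lambda>k. \<phi> (s k) x) \<longlonglongrightarrow> u x"
      using r(2)
    proof (rule eventually_mono)
      fix x assume "(\<lambda>k. w (r k) x) \<longlonglongrightarrow> 0"
      then have "(\<lambda>k. sqrt (w (r k) x)) \<longlonglongrightarrow> sqrt 0" by (rule tendsto_real_sqrt)
      then have "(\<lambda>k. \<bar>\<phi> (s k) x - u x\<bar>) \<longlonglongrightarrow> 0" by (simp add: w_def s_def)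
      then have "(\<lambda>k. \<phi> (s k) x - u x) \<longlonglongrightarrow> 0" by (rule tendsto_rabs_zero_cancel)
      then show "(\<lambda>k. \<phi> (s k) x) \<longlonglongrightarrow> u x" by (rule LIM_zero_cancel)
    qed
  qed
qed

text \<open>In terms of 1/r the two requirements are an upper bound \<open>U\<close> and a lower
  bound \<open>l\<close>, and \<open>l < U\<close> is the hypothesis on the exponents rewritten.
  Taking \<open>max l 0\<close> in the midpoint keeps 1/r positive.\<close>

lemma integrability_exponent_exists:
  fixes P Q d :: real
  assumes "1 < P" "1 < Q" "0 < d" "1 / P + 1 / Q < 2 / d"
  obtains r where "2 * P / (P - 1) < r" "d * ((Q + 1) / (2 * Q) - 1 / r) < 1"
proof -
  define U where "U = (P - 1) / (2 * P)"
  define l where "l = (Q + 1) / (2 * Q) - 1 / d"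
  define z where "z = (max l 0 + U) / 2"
  have U: "0 < U" using assms by (simp add: U_def)
  have U2: "2 * U = 1 - 1 / P" using assms by (simp add: U_def field_simps)
  have l2: "2 * l = 1 + 1 / Q - 2 / d" using assms by (simp add: l_def field_simps)
  have "l < U" if "2 * U = 1 - i" "2 * l = 1 + j - k" "i + j < k" for i j k using that by linarith
  from this[OF U2 l2 assms(4)] have "l < U" .
  then have z: "0 < z" "z < U" "l < z" using U by (auto simp: z_def max_def)
  show ?thesis
  proof (rule that[of "1 / z"])
    have "1 / U < 1 / z" using z by (intro divide_strict_left_mono) simp_all
    then show "2 * P / (P - 1) < 1 / z" by (simp add: U_def)
    have "d * ((Q + 1) / (2 * Q) - z) < d * (1 / d)"
      using z(3) assms(3) unfolding l_def by (intro mult_strict_left_mono) simp_all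
    then show "d * ((Q + 1) / (2 * Q) - 1 / (1 / z)) < 1" using assms(3) by simp
  qed
qed

theorem mainTheorem3:
  fixes p q :: ennreal
  assumes "CARD('n::finite) \<ge> 2"
    and "1 \<le> p" and "1 \<le> q"
    and "1 / p + 1 / q < 2 / of_nat CARD('n)"
  shows "\<exists>C :: real. \<forall>(a :: real ^ 'n \<Rightarrow> real ^ 'n ^ 'n) (u :: real ^ 'n \<Rightarrow> real).
    coefficient_field a \<longrightarrow>
    matrix_in_Lp p (cube_measure 1) a \<longrightarrow>
    matrix_in_Lp q (cube_measure 1) (\<lambda>x. matrix_inv (a x)) \<longrightarrow>
    weak_solution a u \<longrightarrow>
    (AE x in cube_measure 1. 0 \<le> u x) \<longrightarrow>
    esssup (cube_measure (1 / 8)) (\<lambda>x. ereal (u x)) \<le>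
      ereal (exp (C * sqrt (enn2real (matrix_Lp_norm p (cube_measure 1) a))
                    * sqrt (enn2real (matrix_Lp_norm q (cube_measure 1) (\<lambda>x. matrix_inv (a x))))))
      * essinf (cube_measure (1 / 8)) (\<lambda>x. ereal (u x))"
proof -
  define d where "d = real CARD('n)"
  have d: "2 \<le> d" using assms(1) by (simp add: d_def)
  have two_d: "2 / of_nat CARD('n) = ennreal (2 / d)"
  proof -
    have "ennreal 2 / ennreal d = ennreal (2 / d)" by (rule divide_ennreal) (use d in simp_all)
    then show ?thesis by (simp add: d_def ennreal_of_nat_eq_real_of_nat)
  qed
  have le1: "ennreal (2 / d) \<le> 1" using d by (simp add: ennreal_le_1)
  \<comment> \<open>This is where the dimension is used to be at least 2: since 2/d <= 1, the strict
    inequality excludes p = 1 and q = 1.\<close>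
  have lt: "1 / p < 1" "1 / q < 1"
    using assms(4) le1 unfolding two_d
    by (meson le_less_trans less_le_trans le_iff_add add_increasing add_increasing2 order_refl zero_le)+
  define x where "x = enn2real (1 / p)"
  define y where "y = enn2real (1 / q)"
  have xy: "1 / p = ennreal x" "1 / q = ennreal y" "0 \<le> x" "0 \<le> y"
    using less_trans[OF lt(1), of top] less_trans[OF lt(2), of top] by (simp_all add: x_def y_def)
  have "ennreal (x + y) < ennreal (2 / d)" using assms(4) xy unfolding two_d by (simp add: ennreal_plus)
  then have sum: "x + y < 2 / d" using xy by (simp add: ennreal_less_iff del: ennreal_plus)
  \<comment> \<open>A third of the slack: one share for each of the two exponents, the last one to
    keep the inequality strict.\<close>
  define g where "g = (2 / d - (x + y)) / 3"
  have g: "0 < g" using sum by (simp add: g_def)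
  obtain P where P: "1 < P" "p = ennreal P \<or> p = \<infinity>" "1 / P \<le> x + g"
    using finite_exponent[OF assms(2) lt(1) g] unfolding x_def by metis
  obtain Q where Q: "1 < Q" "q = ennreal Q \<or> q = \<infinity>" "1 / Q \<le> y + g"
    using finite_exponent[OF assms(3) lt(2) g] unfolding y_def by metis
  have "1 / P + 1 / Q \<le> x + y + 2 * g" using P(3) Q(3) by simp
  also have "\<dots> < x + y + 3 * g" using g by simp
  also have "\<dots> = 2 / d"
  proof -
    have "3 * g = 2 / d - (x + y)" by (simp add: g_def)
    then show ?thesis by simp
  qed
  finally have PQ: "1 / P + 1 / Q < 2 / d" .
  obtain r where r: "2 * P / (P - 1) < r" "d * ((Q + 1) / (2 * Q) - 1 / r) < 1"
    using integrability_exponent_exists[OF P(1) Q(1) _ PQ] d by auto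
  obtain L where L: "0 < L" "\<And>\<rho> \<rho>'. \<rho> < \<rho>' \<Longrightarrow> \<exists>\<eta> :: real ^ 'n \<Rightarrow> real.
     (\<forall>k. Ck k UNIV \<eta>) \<and> (\<forall>x. 0 \<le> \<eta> x \<and> \<eta> x \<le> 1) \<and> (\<forall>x\<in>cube \<rho>. \<eta> x = 1) \<and> (\<forall>x. x \<notin> cube \<rho>' \<longrightarrow> \<eta> x = 0) \<and>
     (\<forall>x. norm (grad \<eta> x) \<le> L / (\<rho>' - \<rho>))"
    using cutoff_exists[where 'n='n] by blast
  \<comment> \<open>Everything in \<open>C\<close> has been chosen from the dimension,
    \<open>p\<close> and \<open>q\<close>, before the coefficient field and the solution are
    introduced.\<close>
  define C where "C = 2 * harnack_exponent TYPE('n) (2 * P / (P - 1)) r (d * ((Q + 1) / (2 * Q) - 1 / r)) L"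
  show ?thesis
  proof (intro exI[of _ C] allI impI)
    fix a :: "real ^ 'n \<Rightarrow> real ^ 'n ^ 'n" and u :: "real ^ 'n \<Rightarrow> real"
    assume cf: "coefficient_field a" and ap: "matrix_in_Lp p (cube_measure 1) a"
      and aq: "matrix_in_Lp q (cube_measure 1) (\<lambda>x. matrix_inv (a x))"
      and ws: "weak_solution a u" and u0: "AE x in cube_measure 1. 0 \<le> u x"
    obtain G where G: "in_H1a a u G" "\<And>\<psi>. test_function (cube 1) \<psi> \<Longrightarrow> (LINT x|cube_measure 1. grad \<psi> x \<bullet> (a x *v G x)) = 0"
      using ws unfolding weak_solution_def by blast
    obtain \<phi> where \<phi>: "\<And>k. smooth_closure (cube 1) (\<phi> k)" "AE x in cube_measure 1. (\<lambda>k. \<phi> k x) \<longlonglongrightarrow> u x"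
      "(\<lambda>k. \<integral>\<^sup>+ x. ennreal ((\<phi> k x - u x)\<^sup>2) \<partial>cube_measure 1) \<longlonglongrightarrow> 0"
      "(\<lambda>k. \<integral>\<^sup>+ x. ennreal ((grad (\<phi> k) x - G x) \<bullet> (a x *v (grad (\<phi> k) x - G x))) \<partial>cube_measure 1) \<longlonglongrightarrow> 0"
      by (rule H1a_approximation[OF G(1)]) blast
    have space1: "emeasure (cube_measure 1 :: (real ^ 'n) measure) (space (cube_measure 1)) = 1"
      by (simp add: emeasure_restrict_space emeasure_cube)
    have u_meas: "u \<in> borel_measurable (cube_measure 1)" and G_meas: "G \<in> borel_measurable (cube_measure 1)"
      using G(1) unfolding in_H1a_def by blast+
    have a_meas: "a \<in> borel_measurable (cube_measure 1)" and ai_meas: "(\<lambda>x. matrix_inv (a x)) \<in> borel_measurable (cube_measure 1)"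
      and inv: "AE x in cube_measure 1. invertible (a x)"
      and sym: "\<And>x. x \<in> cube 1 \<Longrightarrow> transpose (a x) = a x" and psd: "\<And>x v. x \<in> cube 1 \<Longrightarrow> 0 \<le> v \<bullet> (a x *v v)"
      using cf unfolding coefficient_field_def matrix_in_Lp_def by blast+
    have Lp: "(\<integral>\<^sup>+ x. ennreal (spectral_norm (b x) powr k) \<partial>cube_measure 1) \<le> ennreal (enn2real (matrix_Lp_norm k' (cube_measure 1) b) powr k)"
      if "matrix_in_Lp k' (cube_measure 1) b" "0 < k" "k' = ennreal k \<or> k' = \<infinity>" for b :: "real ^ 'n \<Rightarrow> real ^ 'n ^ 'n" and k k'
    proof -
      have m: "(\<lambda>x. spectral_norm (b x)) \<in> borel_measurable (cube_measure 1)"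
        using that(1) unfolding matrix_in_Lp_def by (intro borel_measurable_spectral_norm) blast
      have "Lp_norm k' (cube_measure 1) (\<lambda>x. spectral_norm (b x)) < \<infinity>"
        using that(1) unfolding matrix_in_Lp_def matrix_Lp_norm_def by blast
      from Lp_norm_bound[OF m _ that(2,3) this] space1 show ?thesis
        by (simp add: matrix_Lp_norm_def spectral_norm_nonneg)
    qed
    \<comment> \<open>\<open>enn2real\<close> would send an infinite norm to 0; membership in L^p,
      used in \<open>Lp\<close>, rules this out.\<close>
    define A where "A = enn2real (matrix_Lp_norm p (cube_measure 1) a)"
    define B where "B = enn2real (matrix_Lp_norm q (cube_measure 1) (\<lambda>x. matrix_inv (a x)))"
    have A_le: "(\<integral>\<^sup>+ x. ennreal (spectral_norm (a x) powr P) \<partial>cube_measure 1) \<le> ennreal (A powr P)"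
      unfolding A_def by (rule Lp[OF ap _ P(2)]) (use P in simp)
    have B_le: "(\<integral>\<^sup>+ x. ennreal (spectral_norm (matrix_inv (a x)) powr Q) \<partial>cube_measure 1) \<le> ennreal (B powr Q)"
      unfolding B_def by (rule Lp[OF aq _ Q(2)]) (use Q in simp)
    have a_int: "(\<integral>\<^sup>+ x. ennreal (spectral_norm (a x)) \<partial>cube_measure 1) < \<infinity>"
    proof -
      have "matrix_in_Lp 1 (cube_measure 1) a" using cf unfolding coefficient_field_def by blast
      from Lp[OF this, of 1] have "(\<integral>\<^sup>+ x. ennreal (spectral_norm (a x)) \<partial>cube_measure 1) \<le> ennreal (enn2real (matrix_Lp_norm 1 (cube_measure 1) a))"
        by (simp add: spectral_norm_nonneg)
      then show ?thesis by (rule le_less_trans) simp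
    qed
    \<comment> \<open>A representative that is nonnegative everywhere. It differs from
      \<open>u\<close> on a null set, so gradient and approximants need not be changed.\<close>
    define v where "v x = max 0 (u x)" for x
    have uv: "AE x in cube_measure 1. v x = u x" using u0 by (rule eventually_mono) (simp add: v_def)
    interpret D: degenerate_solution a v G \<phi>
    proof
      show "v \<in> borel_measurable (cube_measure 1)" unfolding v_def by (intro borel_measurable_max borel_measurable_const u_meas)
      show "AE x in cube_measure 1. (\<lambda>k. \<phi> k x) \<longlonglongrightarrow> v x" using \<phi>(2) uv by eventually_elim simp
      have "(\<integral>\<^sup>+ x. ennreal ((\<phi> k x - v x)\<^sup>2) \<partial>cube_measure 1) = (\<integral>\<^sup>+ x. ennreal ((\<phi> k x - u x)\<^sup>2) \<partial>cube_measure 1)" for k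
        by (rule nn_integral_cong_AE) (rule eventually_mono[OF uv], simp)
      then show "(\<lambda>k. \<integral>\<^sup>+ x. ennreal ((\<phi> k x - v x)\<^sup>2) \<partial>cube_measure 1) \<longlonglongrightarrow> 0" using \<phi>(3) by simp
      show "0 \<le> v x" for x by (simp add: v_def)
    qed (use a_meas sym psd a_int G_meas \<phi> G in auto)
    have AB: "0 < A" "0 < B"
      using D.norms_pos[OF inv ai_meas A_le _ B_le] by (simp_all add: A_def B_def)
    interpret W: weighted_solution a v G \<phi> P Q r A B L
    proof
      show "real CARD('n) * ((Q + 1) / (2 * Q) - 1 / r) < 1" using r(2) by (simp add: d_def)
    qed (use P Q r AB A_le B_le inv ai_meas L in auto)
    have "esssup (cube_measure (1 / 8)) (\<lambda>x. ereal (u x))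
      \<le> ereal (exp (2 * (sqrt (A * B) * harnack_exponent TYPE('n) W.m r W.\<sigma> L))) * essinf (cube_measure (1 / 8)) (\<lambda>x. ereal (u x))"
      by (rule W.harnack[OF uv u_meas])
    moreover have "2 * (sqrt (A * B) * harnack_exponent TYPE('n) W.m r W.\<sigma> L) = C * sqrt A * sqrt B"
      by (simp add: C_def W.m_def W.\<sigma>_def d_def real_sqrt_mult)
    ultimately show "esssup (cube_measure (1 / 8)) (\<lambda>x. ereal (u x)) \<le>
      ereal (exp (C * sqrt (enn2real (matrix_Lp_norm p (cube_measure 1) a))
                    * sqrt (enn2real (matrix_Lp_norm q (cube_measure 1) (\<lambda>x. matrix_inv (a x))))))
      * essinf (cube_measure (1 / 8)) (\<lambda>x. ereal (u x))"
      by (simp only: A_def B_def)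
  qed
qed

end
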